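(* Let $k\ge2$, let $P\in\mathcal{P}^k(\sigma)=\mathcal{P}^k_{\tau_{min},\mathbf{L},f_{min},f_{max}}(\sigma)$, let $M$ be the associated submanifold, and let $X_1,\dots,X_n$ be an i.i.d. sample from $P$, $X_j=Y_j+Z_j$. Let $\hat T_j=\mathrm{im}\,\hat\pi_j$, where $(\hat\pi_j,\hat T_{2,j},\dots,\hat T_{k-1,j})$ is the local polynomial estimator at $X_j$ with bandwidth $h$ and constraint parameter $t$. Assume that $t\ge C_{k,d,\tau_{min},\mathbf{L}}\ge\sup_{2\le i\le k-1}\|T_i^*\|_{op}$. Set $$h=\Bigl(C_{d,k}\frac{f_{max}^2\log n}{f_{min}^3(n-1)}\Bigr)^{1/d}$$ for $C_{d,k}$ large enough (depending only on $d,k$), and assume that $\sigma\le h/4$. If $n$ is large enough so that $h\le h_0=\frac{\tau_{min}\wedge L_\perp^{-1}}{8}$, then with probability at least $1-\left(\frac1n\right)^{k/d}$, $$\max_{1\le j\le n}\angle\bigl(T_{Y_j}M,\hat T_j\bigr)\le C_{d,k,\tau_{min},\mathbf{L}}\sqrt{\frac{f_{max}}{f_{min}}}\,\bigl(h^{k-1}\vee\sigma h^{-1}\bigr)(1+th).$$ As a consequence, taking $t=h^{-1}$, for $n$ large enough, $$\sup_{P\in\mathcal{P}^k(\sigma)}\mathbb{E}_{P^{\otimes n}}\max_{1\le j\le n}\angle\bigl(T_{Y_j}M,\hat T_j\bigr)\le C\left(\frac{\log n}{n-1}\right)^{\frac{k-1}{d}}\left\{1\vee\sigma\left(\frac{\log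 n}{n-1}\right)^{-\frac kd}\right\},$$ where $C=C_{d,k,\tau_{min},\mathbf{L},f_{min},f_{max}}$.
   Context: $C_\alpha$ denotes a positive constant depending only on the listed parameters $\alpha$ (possibly different at each occurrence); $a\vee b=\max$, $a\wedge b=\min$. Integers $1\le d<D$. All submanifolds $M\subset\mathbb{R}^D$ are $d$-dimensional, compact, without boundary and at least $\mathcal{C}^2$. $\mathcal{B}(p,r)$ is the closed Euclidean ball, $\mathcal{B}_T(p,r)=\mathcal{B}(p,r)\cap T$; $\|\cdot\|_{op}$ is the operator norm of (multi)linear maps; $\pi_T$ is orthogonal projection onto a subspace; $\angle(U,V)=\|\pi_U-\pi_V\|_{op}$ for subspaces of the same dimension. Reach: $Med(M)=\{z\in\mathbb{R}^D:\exists p\ne q\in M,\ \|z-p\|=\|z-q\|=d(z,M)\}$, $\tau_M=\inf_{p\in M}d(p,Med(M))$. Classes: let $\tau_{min}>0$. $\mathcal{C}^2_{\tau_{min}}$ is the set of $d$-dimensional compact connected submanifolds with $\tau_M\ge\tau_{min}$. For $k\ge3$ and $\mathbf{L}=(L_\perp,L_3,\dots,L_k)$, $\mathcal{C}^k_{\tau_{min},\mathbf{L}}$ is the set of such $M$ (with $\tau_M\ge\tau_{min}$) for which every $p\in M$ admits a one-to-one $\Psi_p:\mathcal{B}_{T_pM}(0,r)\to M$, $\Psi_p(v)=p+v+\mathbf{N}_p(v)$, for some $r\ge\frac1{4L_\perp}$, with $\mathbf{N}_p$ of class $\mathcal{C}^k$, $\mathbf{N}_p(0)=0$, $d_0\mathbf{N}_p=0$,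 and for all $\|v\|\le\frac1{4L_\perp}$: $\|d_v^2\mathbf{N}_p\|_{op}\le L_\perp$, $\|d_v^i\mathbf{N}_p\|_{op}\le L_i$ ($3\le i\le k$). For $k=2$, $\mathcal{C}^2_{\tau_{min},\mathbf{L}}$ means $\mathcal{C}^2_{\tau_{min}}$, with $\Psi_p=\exp_p$ and $L_\perp=5/(4\tau_{min})$ by convention. Model: $\mathcal{P}^k_{\tau_{min},\mathbf{L},f_{min},f_{max}}$ ($0<f_{min}\le f_{max}<\infty$) is the set of distributions $P_0$ with support $M\in\mathcal{C}^k_{\tau_{min},\mathbf{L}}$ having a density $f$ with respect to the volume measure on $M$ with $f_{min}\le f\le f_{max}$ on $M$. For $0\le\sigma<\tau_{min}$, $\mathcal{P}^k_{\tau_{min},\mathbf{L},f_{min},f_{max}}(\sigma)$ is the set of laws of $X=Y+Z$ with $Y\sim P_0\in\mathcal{P}^k_{\tau_{min},\mathbf{L},f_{min},f_{max}}$, $Z\in T_YM^\perp$, $\|Z\|\le\sigma$ and $\mathbb{E}(Z|Y)=0$. Tensors $T_i^*$: for every $M\in\mathcal{C}^k_{\tau_{min},\mathbf{L}}$ and $y\in M$, with $\pi^*=\pi_{T_yM}$, there are $i$-linear maps $T_i^*$ ($2\le i\le k-1$) from $T_yM$ to $\mathbb{R}^D$ such that $y'-y=\pi^*(y'-y)+\sum_{i=2}^{k-1}T_i^*(\pi^*(y'-y)^{\otimes i})+R_k(y'-y)$ for $y'\in M\cap\mathcal{B}(y,\frac{\tau_{min}\wedge L_\perp^{-1}}4)$,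 with $\|R_k(y'-y)\|\le C\|y'-y\|^k$ and $\|T_i^*\|_{op}\le L_i'$, where $C,L_i'$ depend only on $d,k,\tau_{min},\mathbf{L}$. Here $z^{\otimes i}=(z,\dots,z)$ ($i$ times). The constant bounding $\sup_i\|T_i^*\|_{op}$ in the claim bounds it uniformly over all such $M$ and $y$. Estimator: $(\hat\pi_j,\hat T_{2,j},\dots,\hat T_{k-1,j})$ is any minimizer of $$\frac1{n-1}\sum_{l\ne j}\Bigl\|x_l-\pi(x_l)-\sum_{i=2}^{k-1}T_i(\pi(x_l)^{\otimes i})\Bigr\|^2\mathbf{1}_{\mathcal{B}(0,h)}(x_l),\qquad x_l=X_l-X_j,$$ over orthogonal projectors $\pi$ on $d$-dimensional subspaces of $\mathbb{R}^D$ and symmetric $i$-linear maps $T_i:(\mathbb{R}^D)^i\to\mathbb{R}^D$ with $\|T_i\|_{op}\le t$ (for $k=2$ the sum over $i$ is empty). *)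

theory Defs
  imports "HOL-Probability.Probability"
begin

section \<open>An ambient space containing every \<open>\<real>\<^sup>D\<close>\<close>

text \<open>
  The constants of the theorem must not depend on the ambient dimension \<open>D\<close>, so \<open>D\<close> is quantified
  inside the statement and cannot be encoded in a type.  All the spaces \<open>\<real>\<^sup>D\<close> are therefore
  realised as subspaces \<open>Rdim D\<close> of the inner product space of finitely supported real sequences,
  with the \<open>\<ell>\<^sub>2\<close> inner product.
\<close>

typedef evec = "{f :: nat \<Rightarrow> real. finite {i. f i \<noteq> 0}}"
  morphisms coord Abs_evec
  by (rule exI[of _ "\<lambda>_. 0"]) simp

setup_lifting type_definition_evec

lemma finite_coord: "finite {i. coord x i \<noteq> 0}"
  using coord[of x] by simp

instantiation evec :: real_vector
begin

lift_definition zero_evec :: evec is "\<lambda>_. 0" by simp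

lift_definition plus_evec :: "evec \<Rightarrow> evec \<Rightarrow> evec" is "\<lambda>f g i. f i + g i"
proof -
  fix f g :: "nat \<Rightarrow> real"
  assume "finite {i. f i \<noteq> 0}" "finite {i. g i \<noteq> 0}"
  then show "finite {i. f i + g i \<noteq> 0}"
    by - (rule finite_subset[of _ "{i. f i \<noteq> 0} \<union> {i. g i \<noteq> 0}"], auto)
qed

lift_definition minus_evec :: "evec \<Rightarrow> evec \<Rightarrow> evec" is "\<lambda>f g i. f i - g i"
proof -
  fix f g :: "nat \<Rightarrow> real"
  assume "finite {i. f i \<noteq> 0}" "finite {i. g i \<noteq> 0}"
  then show "finite {i. f i - g i \<noteq> 0}"
    by - (rule finite_subset[of _ "{i. f i \<noteq> 0} \<union> {i. g i \<noteq> 0}"], auto)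
qed

lift_definition uminus_evec :: "evec \<Rightarrow> evec" is "\<lambda>f i. - f i" by simp

lift_definition scaleR_evec :: "real \<Rightarrow> evec \<Rightarrow> evec" is "\<lambda>c f i. c * f i"
  by (erule finite_subset[rotated]) auto

lemma coord_simps [simp]:
  "coord 0 i = 0" "coord (x + y) i = coord x i + coord y i"
  "coord (x - y) i = coord x i - coord y i" "coord (- x) i = - coord x i"
  "coord (c *\<^sub>R x) i = c * coord x i"
  by (simp_all add: zero_evec.rep_eq plus_evec.rep_eq minus_evec.rep_eq uminus_evec.rep_eq
      scaleR_evec.rep_eq)

lemma evec_eqI: "(\<And>i. coord x i = coord y i) \<Longrightarrow> x = y"
  by (simp add: coord_inject[symmetric] fun_eq_iff)

instance
  by standard (auto intro!: evec_eqI simp: algebra_simps)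

end

instantiation evec :: real_inner
begin

definition inner_evec :: "evec \<Rightarrow> evec \<Rightarrow> real" where
  "inner_evec x y = (\<Sum>i | coord x i \<noteq> 0. coord x i * coord y i)"

definition norm_evec :: "evec \<Rightarrow> real" where
  "norm_evec x = sqrt (inner x x)"

definition dist_evec :: "evec \<Rightarrow> evec \<Rightarrow> real" where
  "dist_evec x y = norm (x - y)"

definition sgn_evec :: "evec \<Rightarrow> evec" where
  "sgn_evec x = x /\<^sub>R norm x"

definition uniformity_evec :: "(evec \<times> evec) filter" where
  "uniformity_evec = (INF e\<in>{0<..}. principal {(x, y). dist x y < e})"

definition open_evec :: "evec set \<Rightarrow> bool" where
  "open_evec U \<longleftrightarrow> (\<forall>x\<in>U. \<forall>\<^sub>F (x', y) in uniformity. x' = x \<longrightarrow> y \<in> U)"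

lemma inner_evec_superset:
  assumes "finite A" "{i. coord x i \<noteq> 0} \<subseteq> A"
  shows "inner x (y :: evec) = (\<Sum>i\<in>A. coord x i * coord y i)"
  unfolding inner_evec_def using assms by (intro sum.mono_neutral_left) auto

instance
proof
  fix x y z :: evec and r :: real
  define A where "A = {i. coord x i \<noteq> 0} \<union> {i. coord y i \<noteq> 0} \<union> {i. coord z i \<noteq> 0}"
  have fin: "finite A" unfolding A_def using finite_coord by blast
  have 1: "inner u w = (\<Sum>i\<in>A. coord u i * coord w i)"
    if "{i. coord u i \<noteq> 0} \<subseteq> A" for u w :: evec
    using fin that by (rule inner_evec_superset)
  have x: "{i. coord x i \<noteq> 0} \<subseteq> A" and y: "{i. coord y i \<noteq> 0} \<subseteq> A"
    unfolding A_def by blast+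
  have xy: "{i. coord (x + y) i \<noteq> 0} \<subseteq> A" and rx: "{i. coord (r *\<^sub>R x) i \<noteq> 0} \<subseteq> A"
    using x y by (auto, metis (mono_tags) add_cancel_right_left mem_Collect_eq subsetD)
  show "inner x y = inner y x"
    by (simp only: 1[OF x] 1[OF y] mult.commute)
  show "inner (x + y) z = inner x z + inner y z"
    by (simp only: 1[OF x] 1[OF y] 1[OF xy] coord_simps distrib_right sum.distrib)
  show "inner (r *\<^sub>R x) y = r * inner x y"
    by (simp only: 1[OF x] 1[OF rx] coord_simps sum_distrib_left mult.assoc)
  show "0 \<le> inner x x"
    by (simp only: 1[OF x]) (intro sum_nonneg zero_le_square)
  show "inner x x = 0 \<longleftrightarrow> x = 0"
  proof
    assume "inner x x = 0"
    then have "(\<Sum>i\<in>A. coord x i * coord x i) = 0"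
      by (simp only: 1[OF x])
    then have "\<forall>i\<in>A. coord x i * coord x i = 0"
      using fin by (subst (asm) sum_nonneg_eq_0_iff) auto
    then have "coord x i = coord 0 i" for i
      using x by (cases "i \<in> A") auto
    then show "x = 0" by (rule evec_eqI)
  next
    assume "x = 0"
    then show "inner x x = 0" by (simp add: inner_evec_def)
  qed
  show "norm x = sqrt (inner x x)" by (rule norm_evec_def)
  show "dist x y = norm (x - y)" by (rule dist_evec_def)
  show "sgn x = x /\<^sub>R norm x" by (rule sgn_evec_def)
  show "(uniformity :: (evec \<times> evec) filter) = (INF e\<in>{0<..}. principal {(x, y). dist x y < e})"
    by (rule uniformity_evec_def)
  show "open U \<longleftrightarrow> (\<forall>x\<in>U. \<forall>\<^sub>F (x', y) in uniformity. x' = x \<longrightarrow> y \<in> U)" for U :: "evec set"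
    by (rule open_evec_def)
qed

end

definition Rdim :: "nat \<Rightarrow> evec set" where
  "Rdim D = {x. \<forall>i\<ge>D. coord x i = 0}"

lift_definition unit_evec :: "nat \<Rightarrow> evec" is "\<lambda>j i. if i = j then 1 else 0"
  by simp

lemma coord_unit [simp]: "coord (unit_evec j) i = (if i = j then 1 else 0)"
  by transfer simp

lemma coord_sum: "coord (\<Sum>j\<in>A. f j) i = (\<Sum>j\<in>A. coord (f j) i)"
  by (induction A rule: infinite_finite_induct) auto

lemma subspace_Rdim: "subspace (Rdim D)"
  by (auto simp: subspace_def Rdim_def)

lemma inner_unit: "inner (unit_evec j) x = coord x j"
  by (subst inner_evec_superset[of "{j}"]) auto

lemma dim_Rdim: "dim (Rdim D) = D"
proof -
  have inj: "inj unit_evec"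
    by (rule injI) (metis coord_unit zero_neq_one)
  have "pairwise orthogonal (unit_evec ` {..<D})"
    by (auto simp: pairwise_def orthogonal_def inner_unit)
  moreover have "0 \<notin> unit_evec ` {..<D}"
    by (metis coord_simps(1) coord_unit image_iff zero_neq_one)
  ultimately have ind: "independent (unit_evec ` {..<D})"
    by (rule pairwise_orthogonal_independent)
  have "Rdim D \<subseteq> span (unit_evec ` {..<D})"
  proof
    fix x assume "x \<in> Rdim D"
    then have "x = (\<Sum>j<D. coord x j *\<^sub>R unit_evec j)"
      by (intro evec_eqI) (auto simp: coord_sum Rdim_def if_distrib not_less cong: if_cong)
    also have "\<dots> \<in> span (unit_evec ` {..<D})"
      by (intro span_sum span_scale span_base) auto
    finally show "x \<in> span (unit_evec ` {..<D})" .
  qed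
  moreover have "unit_evec ` {..<D} \<subseteq> Rdim D" by (auto simp: Rdim_def)
  ultimately show ?thesis
    using ind by (metis basis_card_eq_dim card_image card_lessThan inj inj_on_subset subset_UNIV)
qed

section \<open>Projections, multilinear maps, iterated derivatives\<close>

definition oproj :: "'v::real_inner set \<Rightarrow> 'v \<Rightarrow> 'v" where
  "oproj V x = (THE y. y \<in> V \<and> (\<forall>v\<in>V. inner (x - y) v = 0))"

definition angle :: "'v::real_inner set \<Rightarrow> 'v set \<Rightarrow> real" where
  "angle U V = onorm (\<lambda>x. oproj U x - oproj V x)"

text \<open>
  An \<open>i\<close>-linear map from a subspace \<open>T\<close> to a subspace \<open>E\<close> is a function on lists, of which only the
  values at lists of length \<open>i\<close> with entries in \<open>T\<close> matter; \<open>z\<^sup>\<otimes>\<^sup>i\<close> is \<^term>\<open>replicate i z\<close>.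
\<close>

definition multilinear_on :: "'v::real_vector set \<Rightarrow> 'v set \<Rightarrow> nat \<Rightarrow> ('v list \<Rightarrow> 'v) \<Rightarrow> bool" where
  "multilinear_on T E i A \<longleftrightarrow>
     (\<forall>ws\<in>lists T. length ws = i \<longrightarrow> A ws \<in> E \<and>
        (\<forall>j<i. \<forall>x\<in>T. \<forall>y\<in>T. \<forall>c.
           A (ws[j := x + y]) = A (ws[j := x]) + A (ws[j := y]) \<and>
           A (ws[j := c *\<^sub>R x]) = c *\<^sub>R A (ws[j := x])))"

definition symmetric_on :: "'v set \<Rightarrow> nat \<Rightarrow> ('v list \<Rightarrow> 'v) \<Rightarrow> bool" where
  "symmetric_on T i A \<longleftrightarrow>
     (\<forall>ws\<in>lists T. \<forall>ws'\<in>lists T. length ws = i \<longrightarrow> mset ws = mset ws' \<longrightarrow> A ws = A ws')"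

definition multi_onorm :: "'v::real_normed_vector set \<Rightarrow> nat \<Rightarrow> ('v list \<Rightarrow> 'v) \<Rightarrow> real" where
  "multi_onorm T i A =
     (SUP ws \<in> {ws \<in> lists T. length ws = i \<and> (\<forall>w\<in>set ws. norm w \<le> 1)}. norm (A ws))"

text \<open>
  \<open>iter_deriv S f [w\<^sub>1, \<dots>, w\<^sub>i] x\<close> is \<open>d\<^sup>i\<^sub>x f (w\<^sub>1, \<dots>, w\<^sub>i)\<close>, with derivatives taken within \<open>S\<close>.
  It is used for \<open>S\<close> relatively open, or a closed ball, in a finite-dimensional subspace \<open>T\<close>, and for
  directions in \<open>T\<close>; there the derivatives within \<open>S\<close> are unique.  In finite dimension,
  differentiability and continuity of the multilinear-map-valued \<open>x \<mapsto> d\<^sup>i\<^sub>x f\<close> are the same as those of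
  all its evaluations.
\<close>

fun iter_deriv :: "'v::real_normed_vector set \<Rightarrow> ('v \<Rightarrow> 'v) \<Rightarrow> 'v list \<Rightarrow> 'v \<Rightarrow> 'v" where
  "iter_deriv S f [] = f"
| "iter_deriv S f (w # ws) = (\<lambda>x. frechet_derivative (iter_deriv S f ws) (at x within S) w)"

definition Ck_on :: "nat \<Rightarrow> 'v::real_normed_vector set \<Rightarrow> 'v set \<Rightarrow> ('v \<Rightarrow> 'v) \<Rightarrow> bool" where
  "Ck_on k T S f \<longleftrightarrow>
     (\<forall>ws\<in>lists T. length ws < k \<longrightarrow> iter_deriv S f ws differentiable_on S) \<and>
     (\<forall>ws\<in>lists T. length ws \<le> k \<longrightarrow> continuous_on S (iter_deriv S f ws))"

section \<open>Submanifolds, tangent spaces, reach\<close>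

definition local_param :: "nat \<Rightarrow> evec set \<Rightarrow> evec set \<Rightarrow> (evec \<Rightarrow> evec) \<Rightarrow> bool" where
  "local_param d M U g \<longleftrightarrow>
     openin (top_of_set (Rdim d)) U \<and> openin (top_of_set M) (g ` U) \<and>
     (\<exists>g'. homeomorphism U (g ` U) g g') \<and>
     Ck_on 2 (Rdim d) U g \<and>
     (\<forall>x\<in>U. \<forall>w\<in>Rdim d. iter_deriv U g [w] x = 0 \<longrightarrow> w = 0)"

definition submanifold :: "nat \<Rightarrow> nat \<Rightarrow> evec set \<Rightarrow> bool" where
  "submanifold D d M \<longleftrightarrow> M \<subseteq> Rdim D \<and> M \<noteq> {} \<and> compact M \<and>
     (\<forall>p\<in>M. \<exists>U g. local_param d M U g \<and> p \<in> g ` U)"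

definition tangent_space :: "evec set \<Rightarrow> evec \<Rightarrow> evec set" where
  "tangent_space M p = {v. \<exists>(\<gamma> :: real \<Rightarrow> evec) e. 0 < e \<and> \<gamma> 0 = p \<and> \<gamma> ` {-e<..<e} \<subseteq> M \<and>
     \<gamma> differentiable_on {-e<..<e} \<and> (\<gamma> has_vector_derivative v) (at 0)}"

definition medial_axis :: "nat \<Rightarrow> evec set \<Rightarrow> evec set" where
  "medial_axis D M = {z \<in> Rdim D. \<exists>p\<in>M. \<exists>q\<in>M. p \<noteq> q \<and>
     norm (z - p) = infdist z M \<and> norm (z - q) = infdist z M}"

definition reach :: "nat \<Rightarrow> evec set \<Rightarrow> ereal" where
  "reach D M = (INF p\<in>M. INF z\<in>medial_axis D M. ereal (dist p z))"

text \<open>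
  The parameter \<open>L\<^sub>\<bottom>\<close> is \<open>L 2\<close> for \<open>k \<ge> 3\<close> (only \<open>L 2, \<dots>, L k\<close> are used), and \<open>5 / (4 \<tau>)\<close> by convention
  for \<open>k = 2\<close>, where \<open>L\<close> is not used at all.
\<close>

definition L_perp :: "nat \<Rightarrow> real \<Rightarrow> (nat \<Rightarrow> real) \<Rightarrow> real" where
  "L_perp k \<tau> L = (if k = 2 then 5 / (4 * \<tau>) else L 2)"

definition graph_chart :: "nat \<Rightarrow> (nat \<Rightarrow> real) \<Rightarrow> evec set \<Rightarrow> evec \<Rightarrow> real \<Rightarrow> (evec \<Rightarrow> evec) \<Rightarrow> bool" where
  "graph_chart k L M p r N \<longleftrightarrow>
     (let T = tangent_space M p; B = cball 0 r \<inter> T; \<Psi> = (\<lambda>v. p + v + N v) in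
        inj_on \<Psi> B \<and> \<Psi> ` B \<subseteq> M \<and>
        Ck_on k T B N \<and> N 0 = 0 \<and> (N has_derivative (\<lambda>_. 0)) (at 0 within B) \<and>
        (\<forall>v\<in>cball 0 (1 / (4 * L 2)) \<inter> T. \<forall>i\<in>{2..k}.
           multi_onorm T i (\<lambda>ws. iter_deriv B N ws v) \<le> L i))"

definition manifold_class :: "nat \<Rightarrow> nat \<Rightarrow> nat \<Rightarrow> real \<Rightarrow> (nat \<Rightarrow> real) \<Rightarrow> evec set set" where
  "manifold_class D d k \<tau> L = {M. submanifold D d M \<and> connected M \<and> ereal \<tau> \<le> reach D M \<and>
     (3 \<le> k \<longrightarrow> (\<forall>p\<in>M. \<exists>r N. 1 / (4 * L 2) \<le> r \<and> graph_chart k L M p r N))}"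

definition tensor_expansion ::
    "nat \<Rightarrow> real \<Rightarrow> real \<Rightarrow> evec set \<Rightarrow> evec \<Rightarrow> (nat \<Rightarrow> evec list \<Rightarrow> evec) \<Rightarrow> bool" where
  "tensor_expansion k \<rho> C M y T \<longleftrightarrow>
     (\<forall>y'\<in>M \<inter> cball y \<rho>.
        let u = oproj (tangent_space M y) (y' - y)
        in norm (y' - y - u - (\<Sum>i=2..k-1. T i (replicate i u))) \<le> C * norm (y' - y) ^ k)"

section \<open>Volume measure and statistical model\<close>

definition lebesgue_Rdim :: "nat \<Rightarrow> evec measure" where
  "lebesgue_Rdim d = distr (Pi\<^sub>M {..<d} (\<lambda>_. lborel)) borel (\<lambda>f. \<Sum>i<d. f i *\<^sub>R unit_evec i)"

definition gram_det :: "nat \<Rightarrow> (nat \<Rightarrow> evec) \<Rightarrow> real" where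
  "gram_det d v = (\<Sum>p | p permutes {..<d}. of_int (sign p) * (\<Prod>i<d. inner (v i) (v (p i))))"

text \<open>The Riemannian volume, characterised by \<open>d\<mu> = (det g\<^sub>i\<^sub>j)\<^sup>1\<^sup>/\<^sup>2 dx\<close> in every local parametrization:\<close>

definition volume_measure :: "nat \<Rightarrow> evec set \<Rightarrow> evec measure \<Rightarrow> bool" where
  "volume_measure d M \<mu> \<longleftrightarrow> sets \<mu> = sets borel \<and> emeasure \<mu> (- M) = 0 \<and>
     (\<forall>U g. local_param d M U g \<longrightarrow>
        (\<forall>A\<in>sets borel. A \<subseteq> g ` U \<longrightarrow>
           emeasure \<mu> A = (\<integral>\<^sup>+x\<in>{x \<in> U. g x \<in> A}.
             ennreal (sqrt (gram_det d (\<lambda>i. iter_deriv U g [unit_evec i] x))) \<partial>lebesgue_Rdim d)))"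

definition measure_support :: "'a::topological_space measure \<Rightarrow> 'a set" where
  "measure_support P = {x. \<forall>U. open U \<and> x \<in> U \<longrightarrow> 0 < emeasure P U}"

definition base_model ::
    "nat \<Rightarrow> nat \<Rightarrow> nat \<Rightarrow> real \<Rightarrow> (nat \<Rightarrow> real) \<Rightarrow> real \<Rightarrow> real \<Rightarrow> (evec set \<times> evec measure) set" where
  "base_model D d k \<tau> L fmin fmax = {(M, P0). M \<in> manifold_class D d k \<tau> L \<and>
     prob_space P0 \<and> sets P0 = sets borel \<and> measure_support P0 = M \<and>
     (\<exists>\<mu> f. volume_measure d M \<mu> \<and> f \<in> borel_measurable borel \<and>
        (\<forall>x\<in>M. fmin \<le> f x \<and> f x \<le> fmax) \<and> P0 = density \<mu> (\<lambda>x. ennreal (f x)))}"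

text \<open>
  \<open>Q\<close> is the joint law of \<open>(Y, Z)\<close>; the observation is \<open>X = Y + Z\<close>.  The joint law is kept because the
  conclusions are about the tangent space at \<open>Y\<close>.
\<close>

definition noisy_model ::
    "nat \<Rightarrow> nat \<Rightarrow> nat \<Rightarrow> real \<Rightarrow> (nat \<Rightarrow> real) \<Rightarrow> real \<Rightarrow> real \<Rightarrow> real \<Rightarrow>
       (evec set \<times> (evec \<times> evec) measure) set" where
  "noisy_model D d k \<tau> L fmin fmax \<sigma> = {(M, Q). prob_space Q \<and> sets Q = sets borel \<and>
     (M, distr Q borel fst) \<in> base_model D d k \<tau> L fmin fmax \<and>
     (AE (y, z) in Q. z \<in> Rdim D \<and> (\<forall>v\<in>tangent_space M y. inner z v = 0) \<and> norm z \<le> \<sigma>) \<and>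
     (\<forall>b. AE \<omega> in Q.
        real_cond_exp Q (vimage_algebra (space Q) fst borel) (\<lambda>\<omega>'. inner (snd \<omega>') b) \<omega> = 0)}"

section \<open>Local polynomial estimator\<close>

definition orth_projectors :: "nat \<Rightarrow> nat \<Rightarrow> (evec \<Rightarrow> evec) set" where
  "orth_projectors D d = {oproj V | V. subspace V \<and> V \<subseteq> Rdim D \<and> dim V = d}"

definition admissible ::
    "nat \<Rightarrow> nat \<Rightarrow> nat \<Rightarrow> real \<Rightarrow> (evec \<Rightarrow> evec) \<times> (nat \<Rightarrow> evec list \<Rightarrow> evec) \<Rightarrow> bool" where
  "admissible D d k t = (\<lambda>(\<pi>, T). \<pi> \<in> orth_projectors D d \<and>
     (\<forall>i\<in>{2..k-1}. multilinear_on (Rdim D) (Rdim D) i (T i) \<and>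
        symmetric_on (Rdim D) i (T i) \<and> multi_onorm (Rdim D) i (T i) \<le> t))"

definition local_risk ::
    "nat \<Rightarrow> nat \<Rightarrow> real \<Rightarrow> (nat \<Rightarrow> evec) \<Rightarrow> nat \<Rightarrow>
       (evec \<Rightarrow> evec) \<times> (nat \<Rightarrow> evec list \<Rightarrow> evec) \<Rightarrow> real" where
  "local_risk k n h X j = (\<lambda>(\<pi>, T).
     1 / (real n - 1) * (\<Sum>l\<in>{1..n} - {j}.
       let x = X l - X j
       in (norm (x - \<pi> x - (\<Sum>i=2..k-1. T i (replicate i (\<pi> x)))))\<^sup>2 * indicat_real (cball 0 h) x))"

definition local_poly_estimator ::
    "nat \<Rightarrow> nat \<Rightarrow> nat \<Rightarrow> nat \<Rightarrow> real \<Rightarrow> real \<Rightarrow>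
       ((nat \<Rightarrow> evec) \<Rightarrow> nat \<Rightarrow> (evec \<Rightarrow> evec) \<times> (nat \<Rightarrow> evec list \<Rightarrow> evec)) \<Rightarrow> bool" where
  "local_poly_estimator D d k n h t est \<longleftrightarrow>
     (\<forall>X. (\<forall>j\<in>{1..n}. X j \<in> Rdim D) \<longrightarrow>
        (\<forall>j\<in>{1..n}. is_arg_min (local_risk k n h X j) (admissible D d k t) (est X j)))"

definition bandwidth :: "nat \<Rightarrow> real \<Rightarrow> real \<Rightarrow> real \<Rightarrow> nat \<Rightarrow> real" where
  "bandwidth d c fmin fmax n =
     (c * (fmax\<^sup>2 * ln (real n)) / (fmin ^ 3 * (real n - 1))) powr (1 / real d)"

text \<open>A sample \<open>\<omega>\<close> is the sequence of pairs \<open>\<omega> j = (Y\<^sub>j, Z\<^sub>j)\<close>; the projectors act on the whole ambient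
  type, so the range of \<open>\<pi>\<close> is the estimated tangent space.\<close>

definition max_angle ::
    "evec set \<Rightarrow> nat \<Rightarrow> ((nat \<Rightarrow> evec) \<Rightarrow> nat \<Rightarrow> (evec \<Rightarrow> evec) \<times> (nat \<Rightarrow> evec list \<Rightarrow> evec)) \<Rightarrow>
       (nat \<Rightarrow> evec \<times> evec) \<Rightarrow> real" where
  "max_angle M n est \<omega> =
     Max ((\<lambda>j. angle (tangent_space M (fst (\<omega> j)))
                (range (fst (est (\<lambda>l. fst (\<omega> l) + snd (\<omega> l)) j)))) ` {1..n})"

text \<open>
  An arbitrary choice of minimizers need not be a measurable function of the data, and the library's
  \<^const>\<open>nn_integral\<close> is a lower integral on non-measurable functions; hence an upper expectation, which
  agrees with the integral in the measurable case.
\<close>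

definition upper_expectation :: "'a measure \<Rightarrow> ('a \<Rightarrow> ennreal) \<Rightarrow> ennreal" where
  "upper_expectation P f =
     (INF g \<in> {g \<in> borel_measurable P. \<forall>x\<in>space P. f x \<le> g x}. \<integral>\<^sup>+x. g x \<partial>P)"

lemma upper_expectation_measurable:
  assumes "f \<in> borel_measurable P"
  shows "upper_expectation P f = (\<integral>\<^sup>+x. f x \<partial>P)"
  unfolding upper_expectation_def using assms
  by (intro antisym INF_lower INF_greatest) (auto intro!: nn_integral_mono)

end

theory Submission
  imports Defs
begin

text \<open>
  The pair formed by the projection on the tangent space at \<open>Y\<^sub>j\<close> and the symmetrised tensors of the
  expansion of \<open>M\<close> is admissible, so minimality bounds the empirical squared residual of the estimator
  near \<open>X\<^sub>j\<close> by that of the true expansion, which is of order \<open>(h\<^sup>k \<or> \<sigma>)\<^sup>2\<close> per sample point.  Evaluated on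
  the polynomial graph \<open>u \<mapsto> u + \<Sum> T\<^sub>i(u\<^sup>\<otimes>\<^sup>i)\<close>, the residual of the estimator is a polynomial on the tangent
  space, of degree bounded in terms of \<open>k\<close>, whose linear part is \<open>u - \<pi> u\<close>; at the sample points it agrees
  with the actual residual up to \<open>(h\<^sup>k \<or> \<sigma>)(1 + t h)\<close>.  A polynomial keeps half of its maximum \<open>m\<close> over
  the ball of radius comparable to \<open>h\<close> on some cell of comparable radius, independently of the dimension.
  With high probability every such cell contains at least a multiple of \<open>n f\<^sub>m\<^sub>i\<^sub>n h\<^sup>d\<close> sample points, while
  the whole ball contains at most a multiple of \<open>n f\<^sub>m\<^sub>a\<^sub>x h\<^sup>d\<close>.  Hence \<open>m\<close> is at most a multiple of
  \<open>(f\<^sub>m\<^sub>a\<^sub>x / f\<^sub>m\<^sub>i\<^sub>n)\<^sup>1\<^sup>/\<^sup>2 (h\<^sup>k \<or> \<sigma>)(1 + t h)\<close>, and the linear part at most a multiple of \<open>m / h\<close>.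
\<close>

text \<open>No constant may see the ambient dimension \<open>D\<close> or the individual manifold,
  and this shapes every step. The reach is turned into Federer's inequality for normal vectors; with
  it, the turning of tangent spaces and the volume of balls are controlled at scales proportional to
  \<open>\<tau>\<close>, by bootstrapping from a tiny scale that does depend on \<open>M\<close>.
  The tensors are constructed: a graph chart expands \<open>M\<close> in its parameter
  \<open>v\<close>, but the map \<open>N\<close> may have a tangential component, so the coordinate
  of the expansion is \<open>u = v + \<pi> (N v)\<close>, and this relation has to be inverted up to
  order \<open>k\<close>. In the fit, the estimated forms are not compared with the true ones; only
  the linear part of a polynomial is read off, and the forms enter through their bound
  \<open>t\<close>. The factor \<open>1 + t * h\<close> is the Lipschitz constant of the residual,
  whose forms have degree at least two. The powers of \<open>fmax\<close> and \<open>fmin\<close> in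
  the bandwidth make \<open>n * fmin * h ^ d\<close> at least a multiple of \<open>ln n\<close>, so
  the same constant serves all densities.\<close>

unbundle inner_syntax

section \<open>Finitely spanned subspaces and orthonormal bases\<close>

text \<open>The ambient type is infinite-dimensional; compactness of balls and existence of
  projections are available on finitely spanned subspaces, so this predicate carries the finite
  dimension.\<close>

definition findim :: "'v::real_inner set \<Rightarrow> bool" where
  "findim V \<longleftrightarrow> (\<exists>B. finite B \<and> V = span B)"

definition onb :: "nat \<Rightarrow> (nat \<Rightarrow> 'v::real_inner) \<Rightarrow> 'v set \<Rightarrow> bool" where
  "onb n b V \<longleftrightarrow> (\<forall>i<n. \<forall>j<n. b i \<bullet> b j = (if i = j then 1 else 0)) \<and> V = span (b ` {..<n})"

lemma findim_subspace: "findim V \<Longrightarrow> subspace V"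
  by (auto simp: findim_def)

lemma onb_in: "onb n b V \<Longrightarrow> i < n \<Longrightarrow> b i \<in> V"
  by (auto simp: onb_def intro!: span_base)

lemma onb_norm: "onb n b V \<Longrightarrow> i < n \<Longrightarrow> norm (b i) = 1"
  by (simp add: onb_def norm_eq_sqrt_inner)

lemma onb_inner_sum:
  assumes "onb n b V" "j < n"
  shows "b j \<bullet> (\<Sum>i<n. c i *\<^sub>R b i) = c j"
proof -
  have "b j \<bullet> (\<Sum>i<n. c i *\<^sub>R b i) = (\<Sum>i<n. c i * (b j \<bullet> b i))"
    by (simp add: inner_sum_right)
  also have "\<dots> = (\<Sum>i<n. if i = j then c i else 0)"
    using assms by (intro sum.cong) (auto simp: onb_def)
  also have "\<dots> = c j" using assms by simp
  finally show ?thesis .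
qed

lemma onb_expand:
  assumes "onb n b V" "x \<in> V"
  shows "x = (\<Sum>i<n. (x \<bullet> b i) *\<^sub>R b i)"
proof -
  have inj: "inj_on b {..<n}"
    using assms by (auto simp: onb_def inj_on_def) (metis zero_neq_one)
  from assms have "x \<in> span (b ` {..<n})" by (simp add: onb_def)
  then obtain u where "x = (\<Sum>v\<in>b ` {..<n}. u v *\<^sub>R v)"
    by (auto simp: span_finite)
  then have x: "x = (\<Sum>i<n. u (b i) *\<^sub>R b i)"
    by (simp add: sum.reindex[OF inj])
  have "x \<bullet> b i = u (b i)" if "i < n" for i
    using onb_inner_sum[OF assms(1) that, of "\<lambda>i. u (b i)"] x by (metis inner_commute)
  then show ?thesis using x by (metis (no_types, lifting) lessThan_iff sum.cong)
qed

lemma onb_norm_sum: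
  assumes "onb n b V"
  shows "(norm (\<Sum>i<n. c i *\<^sub>R b i))\<^sup>2 = (\<Sum>i<n. (c i)\<^sup>2)"
proof -
  have "(norm (\<Sum>i<n. c i *\<^sub>R b i))\<^sup>2 = (\<Sum>j<n. c j *\<^sub>R b j) \<bullet> (\<Sum>i<n. c i *\<^sub>R b i)"
    by (simp add: power2_norm_eq_inner)
  also have "\<dots> = (\<Sum>j<n. c j * (b j \<bullet> (\<Sum>i<n. c i *\<^sub>R b i)))"
    by (simp add: inner_sum_left)
  also have "\<dots> = (\<Sum>j<n. (c j)\<^sup>2)"
    using onb_inner_sum[OF assms] by (intro sum.cong) (auto simp: power2_eq_square)
  finally show ?thesis .
qed

lemma onb_indep:
  assumes "onb n b V"
  shows "independent (b ` {..<n})" "card (b ` {..<n}) = n" "dim V = n"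
proof -
  have inj: "inj_on b {..<n}"
    using assms by (auto simp: onb_def inj_on_def) (metis zero_neq_one)
  show *: "independent (b ` {..<n})"
    by (rule pairwise_orthogonal_independent)
      (use assms in \<open>force simp: onb_def pairwise_def orthogonal_def\<close>)+
  show c: "card (b ` {..<n}) = n" using inj by (simp add: card_image)
  show "dim V = n" using * c assms
    by (simp add: onb_def dim_eq_card_independent)
qed

lemma findim_onb:
  assumes "findim V" shows "\<exists>b. onb (dim V) b V"
proof -
  obtain B where B: "finite B" "V = span B" using assms by (auto simp: findim_def)
  obtain C where C: "finite C" "span C = span B" "pairwise orthogonal C"
    using basis_orthogonal[OF B(1)] by blast
  \<comment> \<open>The orthogonal set \<open>C\<close> may contain the zero vector, which has to go
    before normalising.\<close>
  define C' where "C' = (\<lambda>x. x /\<^sub>R norm x) ` (C - {0})"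
  have f: "finite C'" using C by (simp add: C'_def)
  have n1: "norm x = 1" if "x \<in> C'" for x
    using that by (auto simp: C'_def) (metis left_inverse norm_eq_zero)
  have po: "pairwise orthogonal C'"
    using C(3) by (auto simp: C'_def pairwise_def orthogonal_def) 
  have sp: "span C' = V"
  proof -
    have "span C' \<subseteq> span C"
      unfolding C'_def by (intro span_minimal) (blast intro: span_scale span_base)+
    moreover have "C \<subseteq> span C'"
    proof
      fix x assume x: "x \<in> C"
      show "x \<in> span C'"
      proof (cases "x = 0")
        case False
        then have "x = norm x *\<^sub>R (x /\<^sub>R norm x)" by simp
        also have "\<dots> \<in> span C'" using x False unfolding C'_def by (intro span_scale span_base) blast
        finally show ?thesis .
      qed (simp add: span_zero)
    qed
    ultimately show ?thesis using C B span_minimal[of C "span C'"] by auto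
  qed
  obtain b where b: "bij_betw b {..<card C'} C'"
    using ex_bij_betw_nat_finite[OF f] by (auto simp: atLeast0LessThan)
  have "onb (card C') b V"
    unfolding onb_def
  proof (intro conjI allI impI)
    fix i j assume ij: "i < card C'" "j < card C'"
    then have "b i \<in> C'" "b j \<in> C'" using b by (auto simp: bij_betw_def)
    moreover have "i \<noteq> j \<Longrightarrow> b i \<noteq> b j" using ij b by (auto simp: bij_betw_def inj_on_def)
    ultimately show "b i \<bullet> b j = (if i = j then 1 else 0)"
      using po n1 by (auto simp: pairwise_def orthogonal_def dot_square_norm)
  next
    show "V = span (b ` {..<card C'})" using sp b by (simp add: bij_betw_def)
  qed
  then show ?thesis using onb_indep(3) by metis
qed

lemma onb_findim: "onb n b V \<Longrightarrow> findim V"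
  unfolding findim_def onb_def by (metis finite_imageI finite_lessThan)

lemma findim_subset:
  assumes "findim W" "subspace V" "V \<subseteq> W" shows "findim V"
proof -
  obtain B where B: "finite B" "W = span B" using assms by (auto simp: findim_def)
  obtain C where C: "C \<subseteq> V" "independent C" "V \<subseteq> span C"
    using basis_exists[of V] by metis
  have "C \<subseteq> span B" using C(1) assms(3) B(2) by blast
  then have "finite C" using independent_span_bound[OF B(1) C(2)] by blast
  moreover have "V = span C" using C assms(2) by (simp add: span_minimal subset_antisym)
  ultimately show ?thesis by (auto simp: findim_def)
qed

lemma Rdim_onb: "onb D unit_evec (Rdim D)"
  unfolding onb_def
proof (intro conjI allI impI)
  show "Rdim D = span (unit_evec ` {..<D})"
  proof
    show "Rdim D \<subseteq> span (unit_evec ` {..<D})"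
    proof
      fix x assume "x \<in> Rdim D"
      then have "x = (\<Sum>j<D. coord x j *\<^sub>R unit_evec j)"
        by (intro evec_eqI) (auto simp: coord_sum Rdim_def if_distrib not_less cong: if_cong)
      also have "\<dots> \<in> span (unit_evec ` {..<D})"
        by (intro span_sum span_scale span_base) auto
      finally show "x \<in> span (unit_evec ` {..<D})" .
    qed
    show "span (unit_evec ` {..<D}) \<subseteq> Rdim D"
      by (rule span_minimal[OF _ subspace_Rdim]) (auto simp: Rdim_def)
  qed
qed (simp add: inner_unit)

lemma findim_Rdim: "findim (Rdim D)"
  using Rdim_onb onb_findim by blast

lemma Rdim_expand: "x \<in> Rdim D \<Longrightarrow> x = (\<Sum>i<D. coord x i *\<^sub>R unit_evec i)"
  using onb_expand[OF Rdim_onb] by (metis (no_types, lifting) inner_commute inner_unit sum.cong)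

section \<open>Orthogonal projections\<close>

lemma oproj_eqI:
  assumes "subspace V" "y \<in> V" "\<And>v. v \<in> V \<Longrightarrow> (x - y) \<bullet> v = 0"
  shows "oproj V x = y"
  unfolding oproj_def
proof (rule the_equality)
  show "y \<in> V \<and> (\<forall>v\<in>V. (x - y) \<bullet> v = 0)" using assms by blast
next
  fix z assume z: "z \<in> V \<and> (\<forall>v\<in>V. (x - z) \<bullet> v = 0)"
  have "z - y \<in> V" using z assms by (simp add: subspace_diff)
  then have "(x - y) \<bullet> (z - y) = 0" "(x - z) \<bullet> (z - y) = 0" using z assms by auto
  then have "(z - y) \<bullet> (z - y) = 0" by (simp add: inner_diff_left)
  then show "z = y" by simp
qed

lemma oproj_onb:
  assumes "onb n b V"
  shows "oproj V x = (\<Sum>i<n. (x \<bullet> b i) *\<^sub>R b i)"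
proof (rule oproj_eqI)
  show sV: "subspace V" using assms by (simp add: onb_def)
  show "(\<Sum>i<n. (x \<bullet> b i) *\<^sub>R b i) \<in> V"
    using onb_in[OF assms] sV by (auto intro!: subspace_sum subspace_scale)
  fix v assume v: "v \<in> V"
  have "x \<bullet> v = (\<Sum>i<n. (v \<bullet> b i) * (x \<bullet> b i))"
    by (subst onb_expand[OF assms v]) (simp add: inner_sum_right)
  moreover have "(\<Sum>i<n. (x \<bullet> b i) *\<^sub>R b i) \<bullet> v = (\<Sum>i<n. (x \<bullet> b i) * (v \<bullet> b i))"
    by (simp add: inner_sum_left inner_commute[of v "b _"])
  ultimately show "(x - (\<Sum>i<n. (x \<bullet> b i) *\<^sub>R b i)) \<bullet> v = 0"
    by (simp add: inner_diff_left mult.commute)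
qed

lemma
  assumes "findim V"
  shows oproj_in: "oproj V x \<in> V"
    and oproj_orth: "v \<in> V \<Longrightarrow> (x - oproj V x) \<bullet> v = 0"
    and bounded_linear_oproj: "bounded_linear (oproj V)"
    and norm_oproj_le: "norm (oproj V x) \<le> norm x"
    and norm_oproj_diff_le: "norm (x - oproj V x) \<le> norm x"
    and oproj_pyth: "(norm x)\<^sup>2 = (norm (oproj V x))\<^sup>2 + (norm (x - oproj V x))\<^sup>2"
    and linear_oproj: "linear (oproj V)"
proof -
  obtain b where b: "onb (dim V) b V" using findim_onb[OF assms] by blast
  note sV = findim_subspace[OF assms]
  show *: "oproj V x \<in> V" for x
    unfolding oproj_onb[OF b] using onb_in[OF b] sV by (auto intro!: subspace_sum subspace_scale)
  show o: "(x - oproj V x) \<bullet> v = 0" if "v \<in> V" for x v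
  proof -
    have "x \<bullet> v = (\<Sum>i<dim V. (v \<bullet> b i) * (x \<bullet> b i))"
      by (subst onb_expand[OF b that]) (simp add: inner_sum_right)
    moreover have "oproj V x \<bullet> v = (\<Sum>i<dim V. (x \<bullet> b i) * (v \<bullet> b i))"
      by (simp add: oproj_onb[OF b] inner_sum_left inner_commute[of v "b _"])
    ultimately show ?thesis by (simp add: inner_diff_left mult.commute)
  qed
  show l: "linear (oproj V)"
    unfolding oproj_onb[OF b]
    by (rule linearI) (auto simp: inner_add_left algebra_simps sum.distrib scaleR_sum_right)
  have "oproj V x \<bullet> (x - oproj V x) = 0" for x using o[OF *] by (simp add: inner_commute)
  then have p: "(norm x)\<^sup>2 = (norm (oproj V x))\<^sup>2 + (norm (x - oproj V x))\<^sup>2" for x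
    by (simp add: power2_norm_eq_inner inner_diff_left inner_diff_right inner_commute algebra_simps)
  then show "(norm x)\<^sup>2 = (norm (oproj V x))\<^sup>2 + (norm (x - oproj V x))\<^sup>2" .
  have n: "norm (oproj V x) \<le> norm x" for x
    by (rule power2_le_imp_le) (use p[of x] in auto)
  then show "norm (oproj V x) \<le> norm x" .
  show "norm (x - oproj V x) \<le> norm x"
    by (rule power2_le_imp_le) (use p[of x] in auto)
  show "bounded_linear (oproj V)"
    using l n by (intro bounded_linear_intro[of _ 1]) (auto simp: linear_add linear_cmul)
qed

lemma oproj_id: "subspace V \<Longrightarrow> x \<in> V \<Longrightarrow> oproj V x = x"
  by (rule oproj_eqI) auto

lemma inner_oproj_eq: "findim V \<Longrightarrow> v \<in> V \<Longrightarrow> oproj V x \<bullet> v = x \<bullet> v"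
  using oproj_orth[of V v x] by (simp add: inner_diff_left)

lemma oproj_add: "findim V \<Longrightarrow> oproj V (x + y) = oproj V x + oproj V y"
  by (simp add: linear_add linear_oproj)
lemma oproj_diff: "findim V \<Longrightarrow> oproj V (x - y) = oproj V x - oproj V y"
  by (simp add: linear_diff linear_oproj)
lemma oproj_scale: "findim V \<Longrightarrow> oproj V (c *\<^sub>R y) = c *\<^sub>R oproj V y"
  by (simp add: linear_cmul linear_oproj)
lemma oproj_0: "findim V \<Longrightarrow> oproj V 0 = 0"
  by (simp add: linear_0 linear_oproj)

lemma oproj_best:
  assumes "findim V" "v \<in> V"
  shows "norm (x - oproj V x) \<le> norm (x - v)"
proof -
  have "x - oproj V x = (x - v) - oproj V (x - v)"
    using assms by (simp add: oproj_diff oproj_id findim_subspace)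
  then show ?thesis using norm_oproj_diff_le[OF assms(1), of "x - v"] by (simp only:)
qed

lemma range_oproj: "findim V \<Longrightarrow> range (oproj V) = V"
  by (metis (no_types, lifting) findim_subspace image_iff image_subset_iff oproj_id oproj_in
      rangeI subsetI subset_antisym)

text \<open>Coordinates in an orthonormal basis put the ball inside a continuous image of a cube;
  that image, \<open>K n R\<close>, is compact by induction on the number of coordinates.\<close>

lemma compact_findim:
  assumes "findim V" shows "compact (cball a r \<inter> V)"
proof -
  obtain b where b: "onb (dim V) b V" using findim_onb[OF assms] by blast
  define K where "K = (\<lambda>n R. {(\<Sum>i<n. c i *\<^sub>R b i) | c. \<forall>i<n. \<bar>c i\<bar> \<le> R})"
  have cK: "compact (K n R)" for n R
  proof (induction n)
    case 0
    then show ?case by (simp add: K_def)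
  next
    case (Suc n)
    have "compact ((\<lambda>(x, t). x + t *\<^sub>R b n) ` (K n R \<times> {-R..R}))"
      by (intro compact_continuous_image compact_Times Suc compact_Icc)
        (auto intro!: continuous_intros simp: case_prod_unfold)
    also have "(\<lambda>(x, t). x + t *\<^sub>R b n) ` (K n R \<times> {-R..R}) = K (Suc n) R"
    proof (intro set_eqI iffI)
      fix y assume "y \<in> (\<lambda>(x, t). x + t *\<^sub>R b n) ` (K n R \<times> {-R..R})"
      then obtain c t where ct: "\<forall>i<n. \<bar>c i\<bar> \<le> R" "\<bar>t\<bar> \<le> R" "y = (\<Sum>i<n. c i *\<^sub>R b i) + t *\<^sub>R b n"
        unfolding K_def by (clarsimp simp: abs_le_iff) (metis minus_le_iff)
      then have "y = (\<Sum>i<Suc n. (c(n := t)) i *\<^sub>R b i)" by simp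
      moreover have "\<forall>i<Suc n. \<bar>(c(n := t)) i\<bar> \<le> R" using ct by (auto simp: less_Suc_eq)
      ultimately show "y \<in> K (Suc n) R" unfolding K_def by blast
    next
      fix y assume "y \<in> K (Suc n) R"
      then obtain c where c: "\<forall>i<Suc n. \<bar>c i\<bar> \<le> R" "y = (\<Sum>i<Suc n. c i *\<^sub>R b i)"
        by (auto simp: K_def)
      then have "y = (\<lambda>(x, t). x + t *\<^sub>R b n) ((\<Sum>i<n. c i *\<^sub>R b i), c n)" by simp
      moreover have "((\<Sum>i<n. c i *\<^sub>R b i), c n) \<in> K n R \<times> {-R..R}"
        using c by (force simp: K_def abs_le_iff)
      ultimately show "y \<in> (\<lambda>(x, t). x + t *\<^sub>R b n) ` (K n R \<times> {-R..R})" by blast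
    qed
    finally show ?case .
  qed
  \<comment> \<open>Bounds the norm, hence by Cauchy-Schwarz every coordinate, of a point of
    \<open>cball a r\<close>.\<close>
  define R where "R = norm a + r"
  have "cball a r \<inter> V = cball a r \<inter> K (dim V) R"
  proof (intro set_eqI iffI IntI; elim IntE)
    fix x assume x: "x \<in> cball a r" "x \<in> V"
    have nx: "norm x \<le> R" using x norm_triangle_ineq4[of a x]
      by (simp add: R_def dist_norm) (smt (verit) norm_triangle_sub norm_minus_commute)
    show "x \<in> K (dim V) R"
      unfolding K_def using onb_expand[OF b x(2)]
    proof (intro CollectI exI conjI allI impI)
      fix i assume "i < dim V"
      then show "\<bar>x \<bullet> b i\<bar> \<le> R" using Cauchy_Schwarz_ineq2[of x "b i"] onb_norm[OF b] nx by auto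
    qed
  next
    fix x assume "x \<in> K (dim V) R"
    then show "x \<in> V" using onb_in[OF b] findim_subspace[OF assms]
      by (auto simp: K_def intro!: subspace_sum subspace_scale)
  qed
  then show ?thesis using compact_Int_closed[OF cK closed_cball] by (simp add: Int_commute)
qed

lemma closed_findim:
  assumes "findim V" shows "closed V"
proof -
  have "V = {x. oproj V x = x}"
    using assms by (auto simp: oproj_id findim_subspace) (metis oproj_in)
  moreover have "closed {x. oproj V x = x}"
    by (intro closed_Collect_eq continuous_intros linear_continuous_on bounded_linear_oproj assms)
  ultimately show ?thesis by simp
qed

section \<open>Angles between subspaces of equal dimension\<close>

text \<open>Otherwise a missed vector together with the image of a basis would give
  \<open>dim W + 1\<close> independent vectors in the span of \<open>dim W\<close> vectors.\<close>

lemma inj_dim_onto: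
  assumes "findim V" "findim W" "linear f" "f ` V \<subseteq> W" "inj_on f V" "dim V = dim W"
  shows "f ` V = W"
proof (rule ccontr)
  assume "f ` V \<noteq> W"
  then obtain w where w: "w \<in> W" "w \<notin> f ` V" using assms by blast
  obtain b where b: "onb (dim V) b V" using findim_onb[OF assms(1)] by blast
  obtain c where c: "onb (dim W) c W" using findim_onb[OF assms(2)] by blast
  let ?B = "b ` {..<dim V}"
  have sB: "span ?B = V" using b by (simp add: onb_def)
  have i: "independent (f ` ?B)"
    by (rule linear_independent_injective_image[OF assms(3)])
      (use onb_indep[OF b] assms(5) sB in auto)
  have sp: "span (f ` ?B) = f ` V" using linear_span_image[OF assms(3)] sB by metis
  have cB: "card (f ` ?B) = dim V"
    using assms(5) onb_indep[OF b] sB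
    by (metis card_image inj_on_subset span_superset)
  have fin: "finite (f ` ?B)" by simp
  have "w \<notin> f ` ?B" using w sp by (metis span_base)
  then have "card (insert w (f ` ?B)) = Suc (dim V)" using cB fin by simp
  moreover have "independent (insert w (f ` ?B))"
    using i w sp by (simp add: independent_insert)
  moreover have "insert w (f ` ?B) \<subseteq> span (c ` {..<dim W})"
    using w(1) assms(4) onb_in[OF b] c unfolding onb_def by blast
  ultimately have "Suc (dim V) \<le> card (c ` {..<dim W})"
    using independent_span_bound[of "c ` {..<dim W}" "insert w (f ` ?B)"] by auto
  then show False using onb_indep(2)[OF c] assms(6) by simp
qed

text \<open>A relative displacement below 1 leaves no kernel, and equal dimensions turn injectivity
  into surjectivity.\<close>

lemma oproj_onto:
  assumes "findim U" "findim V" "dim U = dim V" "\<theta> < 1"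
    and "\<And>u. u \<in> U \<Longrightarrow> norm (u - oproj V u) \<le> \<theta> * norm u"
  shows "oproj V ` U = V"
proof (rule inj_dim_onto)
  show "inj_on (oproj V) U"
  proof (subst linear_inj_on_iff_eq_0[OF linear_oproj[OF assms(2)] findim_subspace[OF assms(1)]], intro ballI impI)
    fix u assume u: "u \<in> U" "oproj V u = 0"
    then have "norm u * (1 - \<theta>) \<le> 0" using assms(5)[of u] by (simp add: algebra_simps)
    then show "u = 0" using assms(4) by (simp add: mult_le_0_iff)
  qed
qed (use assms oproj_in linear_oproj in auto)

lemma norm_diff_oproj2:
  assumes "findim U" "findim V"
  shows "norm (oproj U x - oproj V x) \<le> 2 * norm x"
  using norm_triangle_ineq4[of "oproj U x" "oproj V x"] norm_oproj_le[OF assms(1), of x]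
    norm_oproj_le[OF assms(2), of x] by linarith

text \<open>With equal dimensions a one-sided estimate on \<open>U\<close> controls the difference
  of the projections everywhere: the part of \<open>x\<close> orthogonal to \<open>U\<close> is
  handled by lifting its projection to some \<open>u\<close> in \<open>U\<close>.\<close>

lemma angle_le:
  assumes "findim U" "findim V" "dim U = dim V" "0 \<le> \<theta>"
    and "\<And>u. u \<in> U \<Longrightarrow> norm (u - oproj V u) \<le> \<theta> * norm u"
  shows "angle U V \<le> 4 * \<theta>"
  unfolding angle_def
proof (rule onorm_bound)
  show "0 \<le> 4 * \<theta>" using assms(4) by simp
  fix x
  show "norm (oproj U x - oproj V x) \<le> 4 * \<theta> * norm x"
  \<comment> \<open>For \<open>\<theta>\<close> at least 1/2 the trivial bound 2 suffices; this case
    is what fixes the factor 4.\<close>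
  proof (cases "\<theta> < 1/2")
    case False
    then have "2 * norm x \<le> 4 * \<theta> * norm x" by (intro mult_right_mono) auto
    with norm_diff_oproj2[OF assms(1,2)] show ?thesis by (rule order_trans)
  next
    case True
    let ?a = "oproj U x" and ?b = "x - oproj U x"
    have "oproj V ` U = V"
      by (rule oproj_onto[OF assms(1-3) _ assms(5)]) (use True in auto)
    then obtain u where u: "u \<in> U" "oproj V ?b = oproj V u"
      using oproj_in[OF assms(2), of ?b] by (metis (no_types, lifting) imageE)
    have "norm u - norm (oproj V u) \<le> \<theta> * norm u"
      using assms(5)[OF u(1)] norm_triangle_ineq2[of u "oproj V u"] by linarith
    then have nu: "norm u \<le> 2 * norm (oproj V u)"
      using mult_right_mono[of \<theta> "1/2" "norm u"] True by simp
    \<comment> \<open>Since \<open>?b\<close> is orthogonal to \<open>u\<close>, pairing it with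
      \<open>oproj V u\<close> only sees the small difference \<open>oproj V u - u\<close>.\<close>
    have "(norm (oproj V u))\<^sup>2 = oproj V u \<bullet> oproj V ?b" using u by (simp add: power2_norm_eq_inner)
    also have "\<dots> = ?b \<bullet> oproj V u"
      by (metis inner_oproj_eq[OF assms(2) oproj_in[OF assms(2)]] inner_commute)
    also have "\<dots> = ?b \<bullet> (oproj V u - u)"
      using oproj_orth[OF assms(1) u(1)] by (simp add: inner_diff_right)
    also have "\<dots> \<le> norm ?b * norm (oproj V u - u)" by (rule norm_cauchy_schwarz)
    also have "\<dots> \<le> norm ?b * (\<theta> * norm u)"
      using assms(5)[OF u(1)] by (intro mult_left_mono) (auto simp: norm_minus_commute)
    also have "\<dots> \<le> norm x * (\<theta> * (2 * norm (oproj V u)))"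
      using nu assms(4) norm_oproj_diff_le[OF assms(1)] by (intro mult_mono mult_left_mono) auto
    finally have "norm (oproj V u) * norm (oproj V u) \<le> (2 * \<theta> * norm x) * norm (oproj V u)"
      by (simp add: power2_eq_square algebra_simps)
    then have 1: "norm (oproj V u) \<le> 2 * \<theta> * norm x"
      using assms(4) by (cases "norm (oproj V u) = 0") (auto simp: mult_le_cancel_right)
    have "oproj U x - oproj V x = (?a - oproj V ?a) - oproj V ?b"
      by (simp add: oproj_diff[OF assms(2)])
    then have "norm (oproj U x - oproj V x) \<le> norm (?a - oproj V ?a) + norm (oproj V ?b)"
      by (metis norm_triangle_ineq4)
    moreover have "norm (?a - oproj V ?a) \<le> \<theta> * norm ?a" using assms(5) oproj_in[OF assms(1)] by blast
    moreover have "\<theta> * norm ?a \<le> \<theta> * norm x"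
      using norm_oproj_le[OF assms(1)] assms(4) by (intro mult_left_mono)
    moreover have "norm (oproj V ?b) \<le> 2 * (\<theta> * norm x)" using 1 u by simp
    moreover have "0 \<le> \<theta> * norm x" using assms(4) by simp
    ultimately show ?thesis by linarith
  qed
qed

lemma angle_le_2:
  assumes "findim U" "findim V" shows "angle U V \<le> 2"
  unfolding angle_def by (rule onorm_bound) (use norm_diff_oproj2[OF assms] in auto)

section \<open>Multilinear maps\<close>

lemma multilinear_on_in:
  "multilinear_on T E i A \<Longrightarrow> ws \<in> lists T \<Longrightarrow> length ws = i \<Longrightarrow> A ws \<in> E"
  by (simp add: multilinear_on_def)

lemma multilinear_on_Cons:
  assumes "multilinear_on T E (Suc i) A" "w \<in> T"
  shows "multilinear_on T E i (\<lambda>ws. A (w # ws))"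
  unfolding multilinear_on_def
proof (intro ballI impI conjI allI)
  fix ws assume ws: "ws \<in> lists T" "length ws = i"
  then have w: "w # ws \<in> lists T" "length (w # ws) = Suc i" using assms by auto
  show "A (w # ws) \<in> E" using assms w by (auto simp: multilinear_on_def)
  fix j x y c assume j: "j < i" "x \<in> T" "y \<in> T"
  show "A (w # ws[j := x + y]) = A (w # ws[j := x]) + A (w # ws[j := y])"
    and "A (w # ws[j := c *\<^sub>R x]) = c *\<^sub>R A (w # ws[j := x])"
    using assms(1)[unfolded multilinear_on_def, rule_format, OF w] j
    by (metis Suc_less_eq list_update_code(3))+
qed

lemma multilinear_on_head:
  assumes "multilinear_on T E (Suc i) A" "ws \<in> lists T" "length ws = i" "x \<in> T" "y \<in> T"
  shows "A ((x + y) # ws) = A (x # ws) + A (y # ws)" "A ((c *\<^sub>R x) # ws) = c *\<^sub>R A (x # ws)"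
proof -
  have "x # ws \<in> lists T" "length (x # ws) = Suc i" using assms by auto
  from assms(1)[unfolded multilinear_on_def, rule_format, OF this] assms(4,5)
  show "A ((x + y) # ws) = A (x # ws) + A (y # ws)" "A ((c *\<^sub>R x) # ws) = c *\<^sub>R A (x # ws)"
    by (metis list_update_code(2) zero_less_Suc)+
qed

lemma multilinear_on_head_0:
  assumes "multilinear_on T E (Suc i) A" "ws \<in> lists T" "length ws = i" "subspace T"
  shows "A (0 # ws) = 0"
  using multilinear_on_head(2)[OF assms(1-3), of 0 0 0] subspace_0[OF assms(4)] by simp

lemma multilinear_on_head_sum:
  assumes "multilinear_on T E (Suc i) A" "ws \<in> lists T" "length ws = i" "subspace T"
    and "\<And>j. j \<in> I \<Longrightarrow> f j \<in> T"
  shows "A ((\<Sum>j\<in>I. f j) # ws) = (\<Sum>j\<in>I. A (f j # ws))"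
  using assms(5)
proof (induction I rule: infinite_finite_induct)
  case (insert a I)
  then show ?case
    using multilinear_on_head(1)[OF assms(1-3), of "f a" "\<Sum>j\<in>I. f j"] assms(4)
    by (auto simp: subspace_sum)
qed (use multilinear_on_head_0[OF assms(1-4)] in auto)

text \<open>Homogeneous form of an operator norm bound. It is meaningful before any supremum is
  known to be finite, and it passes directly through composition and through fixing
  arguments.\<close>

definition mbound :: "'v::real_normed_vector set \<Rightarrow> nat \<Rightarrow> ('v list \<Rightarrow> 'v) \<Rightarrow> real \<Rightarrow> bool" where
  "mbound T i A B \<longleftrightarrow> (\<forall>ws\<in>lists T. length ws = i \<longrightarrow> norm (A ws) \<le> B * prod_list (map norm ws))"

lemma prod_list_norm_nonneg: "0 \<le> prod_list (map norm (ws :: 'v::real_normed_vector list))"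
  by (induction ws) auto

text \<open>Expanding the first argument in an orthonormal basis lowers the degree by one. The bound
  depends on the form in an uncontrolled way, so it serves finiteness only and enters no final
  constant.\<close>

lemma multilinear_on_bounded:
  assumes "findim T" "multilinear_on T E i A"
  shows "\<exists>B\<ge>0. mbound T i A B"
  using assms(2)
proof (induction i arbitrary: A)
  case 0
  show ?case by (rule exI[of _ "norm (A [])"]) (auto simp: mbound_def)
next
  case (Suc i)
  obtain b where b: "onb (dim T) b T" using findim_onb[OF assms(1)] by blast
  have "\<forall>j. \<exists>B\<ge>0. j < dim T \<longrightarrow> mbound T i (\<lambda>ws. A (b j # ws)) B"
    using Suc.IH[OF multilinear_on_Cons[OF Suc.prems onb_in[OF b]]] by (metis order_refl)
  then obtain B where B: "\<And>j. B j \<ge> 0" "\<And>j. j < dim T \<Longrightarrow> mbound T i (\<lambda>ws. A (b j # ws)) (B j)"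
    by metis
  have "mbound T (Suc i) A (\<Sum>j<dim T. B j)"
    unfolding mbound_def
  proof (intro ballI impI)
    fix ws' assume ws': "ws' \<in> lists T" "length ws' = Suc i"
    then obtain w ws where w: "ws' = w # ws" "w \<in> T" "ws \<in> lists T" "length ws = i"
      by (cases ws') auto
    let ?P = "prod_list (map norm ws)"
    have "A ws' = A ((\<Sum>j<dim T. (w \<bullet> b j) *\<^sub>R b j) # ws)" using onb_expand[OF b w(2)] w(1) by simp
    also have "\<dots> = (\<Sum>j<dim T. A (((w \<bullet> b j) *\<^sub>R b j) # ws))"
      using onb_in[OF b] findim_subspace[OF assms(1)]
      by (intro multilinear_on_head_sum[OF Suc.prems w(3,4)]) (auto simp: subspace_scale)
    also have "\<dots> = (\<Sum>j<dim T. (w \<bullet> b j) *\<^sub>R A (b j # ws))"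
      using onb_in[OF b] by (intro sum.cong multilinear_on_head(2)[OF Suc.prems w(3,4)]) auto
    also have "norm \<dots> \<le> (\<Sum>j<dim T. norm w * (B j * ?P))"
    proof (rule sum_norm_le)
      fix j assume "j \<in> {..<dim T}"
      then have j: "j < dim T" by simp
      have "\<bar>w \<bullet> b j\<bar> \<le> norm w" using Cauchy_Schwarz_ineq2[of w "b j"] onb_norm[OF b j] by simp
      moreover have "norm (A (b j # ws)) \<le> B j * ?P"
        using B(2)[OF j] w by (auto simp: mbound_def)
      ultimately show "norm ((w \<bullet> b j) *\<^sub>R A (b j # ws)) \<le> norm w * (B j * ?P)"
        by (simp add: mult_mono)
    qed
    also have "\<dots> = (\<Sum>j<dim T. B j) * prod_list (map norm ws')"
      by (simp add: w(1) sum_distrib_left sum_distrib_right algebra_simps)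
    finally show "norm (A ws') \<le> (\<Sum>j<dim T. B j) * prod_list (map norm ws')" .
  qed
  moreover have "0 \<le> (\<Sum>j<dim T. B j)" using B by (simp add: sum_nonneg)
  ultimately show ?case by blast
qed

lemma multilinear_on_map_scale:
  assumes "multilinear_on T E (length ws) A" "subspace T" "\<And>w. w \<in> set ws \<Longrightarrow> f w \<in> T"
  shows "A (map (\<lambda>w. c w *\<^sub>R f w) ws) = prod_list (map c ws) *\<^sub>R A (map f ws)"
  using assms(1,3)
proof (induction ws arbitrary: A)
  case (Cons w ws)
  have 1: "map (\<lambda>w. c w *\<^sub>R f w) ws \<in> lists T" "map f ws \<in> lists T"
    using Cons.prems assms(2) by (auto simp: subspace_scale)
  have "A (map (\<lambda>w. c w *\<^sub>R f w) (w # ws)) = c w *\<^sub>R A (f w # map (\<lambda>w. c w *\<^sub>R f w) ws)"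
    using multilinear_on_head(2)[of T E "length ws" A "map (\<lambda>w. c w *\<^sub>R f w) ws" "f w" "f w"] 1 Cons.prems
    by auto
  also have "A (f w # map (\<lambda>w. c w *\<^sub>R f w) ws) = prod_list (map c ws) *\<^sub>R A (f w # map f ws)"
    using Cons.IH[OF multilinear_on_Cons, of A "f w"] Cons.prems by auto
  finally show ?case by simp
qed simp

lemma mbound_multi_onorm:
  assumes "findim T" "multilinear_on T E i A"
  shows "mbound T i A (multi_onorm T i A)"
  unfolding mbound_def
proof (intro ballI impI)
  fix ws assume ws: "ws \<in> lists T" "length ws = i"
  note sT = findim_subspace[OF assms(1)]
  let ?S = "{ws \<in> lists T. length ws = i \<and> (\<forall>w\<in>set ws. norm w \<le> 1)}"
  have sg: "sgn w \<in> T" if "w \<in> T" for w using that sT by (simp add: sgn_div_norm subspace_scale)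
  obtain B where B: "B \<ge> 0" "mbound T i A B" using multilinear_on_bounded[OF assms] by blast
  have p1: "prod_list (map norm us) \<le> 1" if "\<forall>w\<in>set us. norm w \<le> 1" for us :: "'a list"
    using that by (induction us) (auto simp: mult_le_one prod_list_norm_nonneg)
  have bdd: "bdd_above ((\<lambda>ws. norm (A ws)) ` ?S)"
  proof (rule bdd_aboveI2)
    fix us assume us: "us \<in> ?S"
    then have "norm (A us) \<le> B * prod_list (map norm us)" using B by (auto simp: mbound_def)
    also have "\<dots> \<le> B * 1" using us B p1 by (intro mult_left_mono) auto
    finally show "norm (A us) \<le> B" by simp
  qed
  have nsg: "norm w *\<^sub>R sgn w = w" for w :: 'a
    by (cases "w = 0") (simp_all add: sgn_div_norm)
  \<comment> \<open>\<open>sgn\<close> is a unit vector or zero, so pulling out the norms covers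
    nonzero and zero entries at once.\<close>
  have "ws = map (\<lambda>w. norm w *\<^sub>R sgn w) ws"
    using nsg by (intro map_idI[symmetric])
  then have "A ws = A (map (\<lambda>w. norm w *\<^sub>R sgn w) ws)" by simp
  also have "\<dots> = prod_list (map norm ws) *\<^sub>R A (map sgn ws)"
    by (rule multilinear_on_map_scale) (use assms sT ws sg in auto)
  finally have eq: "norm (A ws) = prod_list (map norm ws) * norm (A (map sgn ws))"
    by (simp add: prod_list_norm_nonneg)
  have "norm (A (map sgn ws)) \<le> multi_onorm T i A"
    unfolding multi_onorm_def
    by (rule cSUP_upper[OF _ bdd]) (use ws sg in \<open>auto simp: norm_sgn\<close>)
  then show "norm (A ws) \<le> multi_onorm T i A * prod_list (map norm ws)"
    unfolding eq by (simp add: mult.commute[of "multi_onorm T i A"] mult_left_mono prod_list_norm_nonneg)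
qed

lemma multi_onorm_le:
  assumes "subspace T" "mbound T i A B" "0 \<le> B"
  shows "multi_onorm T i A \<le> B"
  unfolding multi_onorm_def
proof (rule cSUP_least)
  have "replicate i 0 \<in> {ws \<in> lists T. length ws = i \<and> (\<forall>w\<in>set ws. norm w \<le> 1)}"
    using subspace_0[OF assms(1)] by auto
  then show "{ws \<in> lists T. length ws = i \<and> (\<forall>w\<in>set ws. norm w \<le> 1)} \<noteq> {}" by blast
next
  fix us assume us: "us \<in> {ws \<in> lists T. length ws = i \<and> (\<forall>w\<in>set ws. norm w \<le> 1)}"
  have p1: "prod_list (map norm us) \<le> 1" if "\<forall>w\<in>set us. norm w \<le> 1" for us :: "'a list"
    using that by (induction us) (auto simp: mult_le_one prod_list_norm_nonneg)
  have "norm (A us) \<le> B * prod_list (map norm us)" using us assms by (auto simp: mbound_def)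
  also have "\<dots> \<le> B * 1" using us p1 assms by (intro mult_left_mono) auto
  finally show "norm (A us) \<le> B" by simp
qed

lemma mbound_mono: "mbound T i A B \<Longrightarrow> B \<le> C \<Longrightarrow> mbound T i A C"
  unfolding mbound_def by (meson mult_right_mono order_trans prod_list_norm_nonneg)

lemma mbound_replicate:
  "mbound T i A B \<Longrightarrow> x \<in> T \<Longrightarrow> norm (A (replicate i x)) \<le> B * norm x ^ i"
  by (auto simp: mbound_def prod_list_replicate dest!: bspec[of _ _ "replicate i x"])

lemma mbound_Cons: "mbound T (Suc i) A B \<Longrightarrow> w \<in> T \<Longrightarrow> mbound T i (\<lambda>ws. A (w # ws)) (B * norm w)"
  unfolding mbound_def
proof (intro ballI impI)
  fix ws assume "\<forall>ws\<in>lists T. length ws = Suc i \<longrightarrow> norm (A ws) \<le> B * prod_list (map norm ws)"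
    "w \<in> T" "ws \<in> lists T" "length ws = i"
  then have "norm (A (w # ws)) \<le> B * prod_list (map norm (w # ws))" by (metis Cons_in_lists_iff length_Cons)
  then show "norm (A (w # ws)) \<le> B * norm w * prod_list (map norm ws)" by (simp add: mult.assoc)
qed

text \<open>Telescoping: the arguments are exchanged one at a time, each exchange costing a factor
  \<open>norm (x - y)\<close>.\<close>

lemma mbound_lipschitz:
  assumes "multilinear_on T E i A" "mbound T i A B" "0 \<le> B" "subspace T"
    and xy: "x \<in> T" "y \<in> T" "norm x \<le> R" "norm y \<le> R"
  shows "norm (A (replicate i x) - A (replicate i y)) \<le> real i * B * R ^ (i - 1) * norm (x - y)"
  using assms(1-3)
proof (induction i arbitrary: A B)
  case (Suc i)
  have R: "0 \<le> R" using xy norm_ge_zero order_trans by blast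
  have r: "replicate i x \<in> lists T" using xy by auto
  have "A ((x - y) # replicate i x) = A (x # replicate i x) - A (y # replicate i x)"
    using multilinear_on_head[OF Suc.prems(1) r, of x "-y"] multilinear_on_head(2)[OF Suc.prems(1) r, of y y "-1"]
      xy assms(4) by (simp add: subspace_neg)
  then have "A (replicate (Suc i) x) - A (replicate (Suc i) y) =
      A ((x - y) # replicate i x) + (A (y # replicate i x) - A (y # replicate i y))" by simp
  then have "norm (A (replicate (Suc i) x) - A (replicate (Suc i) y)) \<le>
      norm (A ((x - y) # replicate i x)) + norm (A (y # replicate i x) - A (y # replicate i y))"
    by (metis norm_triangle_ineq)
  also have "norm (A ((x - y) # replicate i x)) \<le> (B * norm (x - y)) * norm x ^ i"
    using mbound_replicate[OF mbound_Cons[OF Suc.prems(2)], of "x - y" x] xy assms(4)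
    by (simp add: subspace_diff)
  also have "\<dots> \<le> (B * norm (x - y)) * R ^ i"
    using xy Suc.prems by (intro mult_left_mono power_mono) auto
  also have "norm (A (y # replicate i x) - A (y # replicate i y)) \<le>
      real i * (B * norm y) * R ^ (i - 1) * norm (x - y)"
    by (rule Suc.IH[OF multilinear_on_Cons[OF Suc.prems(1)] mbound_Cons[OF Suc.prems(2)]])
      (use xy Suc.prems in auto)
  also have "\<dots> \<le> real i * (B * R) * R ^ (i - 1) * norm (x - y)"
    using xy Suc.prems R by (intro mult_right_mono mult_left_mono) auto
  also have "\<dots> = real i * B * R ^ i * norm (x - y)" by (cases i) (auto simp: algebra_simps)
  finally show ?case by (simp add: algebra_simps)
qed simp

section \<open>Polynomials along lines\<close>

definition vpoly :: "'v::real_vector set \<Rightarrow> nat \<Rightarrow> (real \<Rightarrow> 'v) \<Rightarrow> bool" where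
  "vpoly V K f \<longleftrightarrow> (\<exists>c. (\<forall>i. c i \<in> V) \<and> (\<forall>t. f t = (\<Sum>i\<le>K. t ^ i *\<^sub>R c i)))"

lemma vpoly_mono:
  assumes "vpoly V K f" "K \<le> K'" "subspace V" shows "vpoly V K' f"
proof -
  obtain c where c: "\<forall>i. c i \<in> V" "\<forall>t. f t = (\<Sum>i\<le>K. t ^ i *\<^sub>R c i)" using assms(1) unfolding vpoly_def by blast
  let ?c = "\<lambda>i. if i \<le> K then c i else 0"
  have "(\<Sum>i\<le>K. t ^ i *\<^sub>R c i) = (\<Sum>i\<le>K'. t ^ i *\<^sub>R ?c i)" for t
    using assms(2) by (intro sum.mono_neutral_cong_left) auto
  moreover have "\<forall>i. ?c i \<in> V" using c assms by (simp add: subspace_0)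
  ultimately show ?thesis unfolding vpoly_def using c(2) by (intro exI[of _ ?c] conjI allI) simp_all
qed

lemma vpoly_add:
  assumes "vpoly V K f" "vpoly V K g" "subspace V" shows "vpoly V K (\<lambda>t. f t + g t)"
proof -
  obtain c where "\<forall>i. c i \<in> V" "\<forall>t. f t = (\<Sum>i\<le>K. t ^ i *\<^sub>R c i)"
    using assms(1) unfolding vpoly_def by blast
  moreover obtain c' where "\<forall>i. c' i \<in> V" "\<forall>t. g t = (\<Sum>i\<le>K. t ^ i *\<^sub>R c' i)"
    using assms(2) unfolding vpoly_def by blast
  ultimately have "\<forall>i. c i + c' i \<in> V" "\<forall>t. f t + g t = (\<Sum>i\<le>K. t ^ i *\<^sub>R (c i + c' i))"
    using assms(3) by (simp_all add: subspace_add scaleR_add_right sum.distrib)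
  then show ?thesis unfolding vpoly_def by (intro exI[of _ "\<lambda>i. c i + c' i"] conjI)
qed

lemma vpoly_const: "x \<in> V \<Longrightarrow> subspace V \<Longrightarrow> vpoly V K (\<lambda>_. x)"
  unfolding vpoly_def
  by (rule exI[of _ "\<lambda>i. if i = 0 then x else 0"]) (auto simp: subspace_0 if_distrib cong: if_cong)

lemma vpoly_sum:
  assumes "\<And>j. j \<in> I \<Longrightarrow> vpoly V K (f j)" "subspace V" shows "vpoly V K (\<lambda>t. \<Sum>j\<in>I. f j t)"
  using assms(1)
  by (induction I rule: infinite_finite_induct)
    (auto intro: vpoly_add vpoly_const simp: assms(2) subspace_0)

lemma vpoly_linear:
  assumes "vpoly V K f" "linear L" "L ` V \<subseteq> W" shows "vpoly W K (\<lambda>t. L (f t))"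
proof -
  obtain c where c: "\<forall>i. c i \<in> V" "\<forall>t. f t = (\<Sum>i\<le>K. t ^ i *\<^sub>R c i)" using assms(1) unfolding vpoly_def by blast
  then show ?thesis unfolding vpoly_def using assms
    by (intro exI[of _ "\<lambda>i. L (c i)"]) (auto simp: linear_sum linear_cmul)
qed

lemma vpoly_shift:
  assumes "vpoly V K f" "subspace V" shows "vpoly V (K + j) (\<lambda>t. t ^ j *\<^sub>R f t)"
proof -
  obtain c where c: "\<forall>i. c i \<in> V" "\<forall>t. f t = (\<Sum>i\<le>K. t ^ i *\<^sub>R c i)" using assms(1) unfolding vpoly_def by blast
  define c' where "c' = (\<lambda>i. if i < j then 0 else c (i - j))"
  have "t ^ j *\<^sub>R f t = (\<Sum>i\<le>K + j. t ^ i *\<^sub>R c' i)" for t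
  proof -
    have "t ^ j *\<^sub>R f t = (\<Sum>i\<le>K. t ^ (i + j) *\<^sub>R c' (i + j))"
      using c by (simp add: c'_def scaleR_sum_right power_add mult.commute)
    also have "\<dots> = (\<Sum>i\<in>{j..K + j}. t ^ i *\<^sub>R c' i)"
      by (rule sum.reindex_bij_witness[of _ "\<lambda>i. i - j" "\<lambda>i. i + j"]) auto
    also have "\<dots> = (\<Sum>i\<le>K + j. t ^ i *\<^sub>R c' i)"
      by (rule sum.mono_neutral_left) (auto simp: c'_def)
    finally show ?thesis .
  qed
  moreover have "\<forall>i. c' i \<in> V" using c assms by (simp add: c'_def subspace_0)
  ultimately show ?thesis unfolding vpoly_def by blast
qed

lemma vpoly_in: "vpoly V K f \<Longrightarrow> subspace V \<Longrightarrow> f t \<in> V"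
  by (auto simp: vpoly_def intro!: subspace_sum subspace_scale)

lemma vpoly_multilinear:
  assumes "multilinear_on V W (length fs) A" "subspace V" "subspace W"
    and "\<And>f. f \<in> set fs \<Longrightarrow> vpoly V K f"
  shows "vpoly W (length fs * K) (\<lambda>t. A (map (\<lambda>f. f t) fs))"
  using assms(1,4)
proof (induction fs arbitrary: A)
  case Nil
  then show ?case using assms(3) by (auto intro!: vpoly_const simp: multilinear_on_def)
next
  case (Cons f fs)
  obtain c where c: "\<forall>i. c i \<in> V" "\<forall>t. f t = (\<Sum>i\<le>K. t ^ i *\<^sub>R c i)"
    using Cons.prems(2)[of f] unfolding vpoly_def by auto
  have l: "map (\<lambda>f. f t) fs \<in> lists V" for t
    using Cons.prems(2) vpoly_in[OF _ assms(2)] by (auto simp: in_lists_conv_set)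
  have m: "multilinear_on V W (Suc (length fs)) A" using Cons.prems by simp
  have "A (map (\<lambda>f. f t) (f # fs)) = (\<Sum>i\<le>K. t ^ i *\<^sub>R A (c i # map (\<lambda>f. f t) fs))" for t
  proof -
    have "A (map (\<lambda>f. f t) (f # fs)) = (\<Sum>i\<le>K. A ((t ^ i *\<^sub>R c i) # map (\<lambda>f. f t) fs))"
      using multilinear_on_head_sum[OF m l[of t] _ assms(2), of "{..K}" "\<lambda>i. t ^ i *\<^sub>R c i"] c assms(2)
      by (simp add: subspace_scale)
    also have "\<dots> = (\<Sum>i\<le>K. t ^ i *\<^sub>R A (c i # map (\<lambda>f. f t) fs))"
      using c by (intro sum.cong multilinear_on_head(2)[OF m l[of t]]) auto
    finally show ?thesis .
  qed
  moreover have "vpoly W (length (f # fs) * K) (\<lambda>t. \<Sum>i\<le>K. t ^ i *\<^sub>R A (c i # map (\<lambda>f. f t) fs))"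
  proof (rule vpoly_sum)
    fix i assume i: "i \<in> {..K}"
    have "vpoly W (length fs * K) (\<lambda>t. A (c i # map (\<lambda>f. f t) fs))"
      using Cons.IH[OF multilinear_on_Cons[OF m]] c Cons.prems by auto
    from vpoly_shift[OF this assms(3), of i] i
    show "vpoly W (length (f # fs) * K) (\<lambda>t. t ^ i *\<^sub>R A (c i # map (\<lambda>f. f t) fs))"
      by (elim vpoly_mono) (auto simp: assms(3))
  qed (rule assms(3))
  ultimately show ?case by simp
qed

lemma vpoly_inner:
  assumes "vpoly V K f"
  shows "\<exists>P :: real poly. degree P \<le> K \<and> (\<forall>t. e \<bullet> f t = poly P t)"
proof -
  obtain c where c: "\<forall>t. f t = (\<Sum>i\<le>K. t ^ i *\<^sub>R c i)" using assms(1) unfolding vpoly_def by blast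
  let ?P = "\<Sum>i\<le>K. monom (e \<bullet> c i) i"
  have "degree ?P \<le> K"
    by (intro degree_sum_le) (auto intro: order_trans[OF degree_monom_le])
  moreover have "e \<bullet> f t = poly ?P t" for t
    using c by (simp add: poly_sum poly_monom inner_sum_right mult.commute)
  ultimately show ?thesis by blast
qed

section \<open>Inequalities for univariate polynomials of bounded degree\<close>

text \<open>Equivalence of norms, by induction on the degree: dividing \<open>p - p a\<close> by
  \<open>X - a\<close> lowers the degree, and the quotient is bounded on the right half of the
  interval, away from \<open>a\<close>.\<close>

lemma poly_coeff_bound:
  fixes a b :: real
  assumes "a < b"
  shows "\<exists>C\<ge>0. \<forall>p::real poly. \<forall>M. degree p \<le> K \<longrightarrow> (\<forall>t\<in>{a..b}. \<bar>poly p t\<bar> \<le> M) \<longrightarrow>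
    (\<forall>i. \<bar>coeff p i\<bar> \<le> C * M)"
  using assms
proof (induction K arbitrary: a b)
  case 0
  have "\<bar>coeff p i\<bar> \<le> 1 * M" if p: "degree p \<le> 0" "\<forall>t\<in>{a..b}. \<bar>poly p t\<bar> \<le> M" for p :: "real poly" and M i
  proof -
    obtain c where c: "p = [:c:]" using p degree_eq_zeroE by (metis le_zero_eq)
    have "\<bar>c\<bar> \<le> M" using p(2) 0 c by (auto dest!: bspec[of _ _ a])
    then show ?thesis using c by (cases i) auto
  qed
  then show ?case by (intro exI[of _ 1]) auto
next
  case (Suc K)
  define m where "m = (a + b) / 2"
  have m: "a < m" "m < b" using Suc.prems by (auto simp: m_def)
  obtain C where C: "C \<ge> 0" "\<And>p::real poly. \<And>M i. degree p \<le> K \<Longrightarrow> (\<forall>t\<in>{m..b}. \<bar>poly p t\<bar> \<le> M) \<Longrightarrow>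
    \<bar>coeff p i\<bar> \<le> C * M" using Suc.IH[OF m(2)] by blast
  \<comment> \<open>The coefficients of \<open>p\<close> are those of the quotient multiplied by
    \<open>-a\<close>, plus those shifted by one, plus \<open>poly p a\<close> at index 0; the
    quotient is bounded by \<open>2 / (m - a) * M\<close> on \<open>{m..b}\<close>.\<close>
  let ?C = "(\<bar>a\<bar> + 1) * (C * (2 / (m - a))) + 1"
  have "\<bar>coeff p i\<bar> \<le> ?C * M"
    if p: "degree p \<le> Suc K" "\<forall>t\<in>{a..b}. \<bar>poly p t\<bar> \<le> M" for p :: "real poly" and M i
  proof -
    define r where "r = synthetic_div p a"
    have pr: "p = [:-a, 1:] * r + [:poly p a:]" unfolding r_def by (rule synthetic_div_correct'[symmetric])
    have pa: "\<bar>poly p a\<bar> \<le> M" using p Suc.prems by auto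
    have dr: "degree r \<le> K" using p by (simp add: r_def degree_synthetic_div)
    have "\<bar>poly r t\<bar> \<le> 2 / (m - a) * M" if t: "t \<in> {m..b}" for t
    proof -
      have "poly p t = poly ([:-a, 1:] * r + [:poly p a:]) t" using pr by simp
      then have "(t - a) * poly r t = poly p t - poly p a" by (simp add: algebra_simps)
      moreover have "\<bar>poly p t - poly p a\<bar> \<le> 2 * M" using pa p(2)[rule_format, of t] t m by auto
      moreover have "\<bar>(t - a) * poly r t\<bar> = (t - a) * \<bar>poly r t\<bar>" using t m by (simp add: abs_mult)
      ultimately have "(t - a) * \<bar>poly r t\<bar> \<le> 2 * M" by simp
      moreover have "(m - a) * \<bar>poly r t\<bar> \<le> (t - a) * \<bar>poly r t\<bar>" using t by (intro mult_right_mono) auto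
      ultimately show ?thesis using m by (simp add: field_simps)
    qed
    then have cr: "\<bar>coeff r i\<bar> \<le> C * (2 / (m - a) * M)" for i using C(2)[OF dr] by blast
    have "coeff p i = coeff ([:-a, 1:] * r + [:poly p a:]) i" using pr by simp
    also have "\<dots> = - a * coeff r i + (case i of 0 \<Rightarrow> 0 | Suc j \<Rightarrow> coeff r j) + (if i = 0 then poly p a else 0)"
      by (cases i) auto
    also have "\<bar>\<dots>\<bar> \<le> \<bar>a\<bar> * (C * (2 / (m - a) * M)) + C * (2 / (m - a) * M) + M"
    proof -
      have "\<bar>- a * coeff r i\<bar> \<le> \<bar>a\<bar> * (C * (2 / (m - a) * M))"
        unfolding abs_mult abs_minus_cancel by (intro mult_left_mono cr abs_ge_zero)
      moreover have "0 \<le> M" using pa by linarith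
      moreover have "0 \<le> C * (2 / (m - a) * M)" using C m \<open>0 \<le> M\<close> by simp
      moreover have "\<bar>case i of 0 \<Rightarrow> 0 | Suc j \<Rightarrow> coeff r j\<bar> \<le> C * (2 / (m - a) * M)"
        using cr calculation by (cases i) auto
      moreover have "\<bar>if i = 0 then poly p a else 0\<bar> \<le> M" using pa calculation by auto
      ultimately show ?thesis by linarith
    qed
    also have "\<dots> = ?C * M" by (simp add: algebra_simps add_divide_distrib)
    finally show ?thesis .
  qed
  moreover have "0 \<le> ?C" using C m by simp
  ultimately show ?case by blast
qed

text \<open>Two consequences of the coefficient bound: growth to the doubled interval (Remez type)
  and a Lipschitz estimate at the origin (Markov type).\<close>

lemma poly_growth:
  "\<exists>\<Lambda>\<ge>1. \<forall>p::real poly. \<forall>M. degree p \<le> K \<longrightarrow> (\<forall>t\<in>{-1..1}. \<bar>poly p t\<bar> \<le> M) \<longrightarrow>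
    (\<forall>t\<in>{-2..2}. \<bar>poly p t\<bar> \<le> \<Lambda> * M) \<and> (\<forall>t\<in>{-1..1}. \<bar>poly p t - poly p 0\<bar> \<le> \<Lambda> * M * \<bar>t\<bar>)"
proof -
  obtain C where C: "C \<ge> 0" "\<And>p::real poly. \<And>M i. degree p \<le> K \<Longrightarrow> (\<forall>t\<in>{-1..1}. \<bar>poly p t\<bar> \<le> M) \<Longrightarrow>
    \<bar>coeff p i\<bar> \<le> C * M" using poly_coeff_bound[of "-1" 1 K] by force
  define \<Lambda> where "\<Lambda> = real (Suc K) * 2 ^ K * C + 1"
  have "\<Lambda> \<ge> 1" using C by (simp add: \<Lambda>_def)
  moreover have "(\<forall>t\<in>{-2..2}. \<bar>poly p t\<bar> \<le> \<Lambda> * M) \<and> (\<forall>t\<in>{-1..1}. \<bar>poly p t - poly p 0\<bar> \<le> \<Lambda> * M * \<bar>t\<bar>)"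
    if p: "degree p \<le> K" "\<forall>t\<in>{-1..1}. \<bar>poly p t\<bar> \<le> M" for p :: "real poly" and M
  proof -
    have M: "0 \<le> M" using p(2) by (auto dest!: bspec[of _ _ 0])
    have P: "poly p t = (\<Sum>i\<le>K. coeff p i * t ^ i)" for t
      unfolding poly_altdef using p(1) by (intro sum.mono_neutral_left) (auto simp: coeff_eq_0)
    have "\<bar>poly p t\<bar> \<le> \<Lambda> * M" if t: "t \<in> {-2..2}" for t
    proof -
      have "\<bar>poly p t\<bar> \<le> (\<Sum>i\<le>K. \<bar>coeff p i * t ^ i\<bar>)" unfolding P by (rule sum_abs)
      also have "\<dots> \<le> (\<Sum>i\<le>K. (C * M) * 2 ^ K)"
      proof (rule sum_mono)
        fix i assume i: "i \<in> {..K}"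
        have "\<bar>t\<bar> ^ i \<le> 2 ^ i" using t by (intro power_mono) auto
        also have "\<dots> \<le> 2 ^ K" using i by (intro power_increasing) auto
        finally show "\<bar>coeff p i * t ^ i\<bar> \<le> C * M * 2 ^ K"
          using C(2)[OF p] by (simp add: abs_mult power_abs mult_mono C M)
      qed
      also have "\<dots> \<le> \<Lambda> * M" using M by (simp add: \<Lambda>_def algebra_simps)
      finally show ?thesis .
    qed
    moreover have "\<bar>poly p t - poly p 0\<bar> \<le> \<Lambda> * M * \<bar>t\<bar>" if t: "t \<in> {-1..1}" for t
    proof -
      have "poly p t - poly p 0 = (\<Sum>i\<le>K. coeff p i * (t ^ i - 0 ^ i))"
        unfolding P by (simp add: sum_subtractf algebra_simps)
      also have "\<bar>\<dots>\<bar> \<le> (\<Sum>i\<le>K. \<bar>coeff p i * (t ^ i - 0 ^ i)\<bar>)" by (rule sum_abs)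
      also have "\<dots> \<le> (\<Sum>i\<le>K. (C * M) * \<bar>t\<bar>)"
      proof (rule sum_mono)
        fix i assume i: "i \<in> {..K}"
        have "\<bar>t ^ i - 0 ^ i\<bar> \<le> \<bar>t\<bar>"
        proof (cases i)
          case (Suc j)
          have "\<bar>t\<bar> ^ j \<le> 1" using t by (intro power_le_one) auto
          then show ?thesis using Suc mult_left_mono[of "\<bar>t\<bar> ^ j" 1 "\<bar>t\<bar>"] by (simp add: abs_mult power_abs)
        qed auto
        then show "\<bar>coeff p i * (t ^ i - 0 ^ i)\<bar> \<le> C * M * \<bar>t\<bar>"
          using C(2)[OF p] by (simp add: abs_mult mult_mono C M)
      qed
      also have "\<dots> = (real (Suc K) * C) * (M * \<bar>t\<bar>)" by simp
      also have "\<dots> \<le> \<Lambda> * (M * \<bar>t\<bar>)"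
      proof (rule mult_right_mono)
        have "real (Suc K) * C * 1 \<le> real (Suc K) * C * 2 ^ K"
          using C by (intro mult_left_mono) auto
        then show "real (Suc K) * C \<le> \<Lambda>" by (simp add: \<Lambda>_def algebra_simps)
      qed (use M in auto)
      finally show ?thesis by (simp add: algebra_simps)
    qed
    ultimately show ?thesis by blast
  qed
  ultimately show ?thesis by blast
qed

text \<open>Being polynomial is asked only along lines, so the univariate estimates apply with
  constants depending on the degree alone and not on the dimension of \<open>V\<close>.\<close>

definition linepoly :: "'v::real_vector set \<Rightarrow> nat \<Rightarrow> ('v \<Rightarrow> real) \<Rightarrow> bool" where
  "linepoly V K q \<longleftrightarrow> (\<forall>u\<in>V. \<forall>v\<in>V. \<exists>P::real poly. degree P \<le> K \<and> (\<forall>t. q (u + t *\<^sub>R v) = poly P t))"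

text \<open>Where a polynomial is almost maximal it stays large on a whole ball of comparable radius, so
  sample points falling into every cell of a fixed grid control the polynomial.\<close>

lemma linepoly_norming:
  "\<exists>\<Lambda>\<ge>1. \<forall>V (q :: 'v::real_inner \<Rightarrow> real) s B. subspace V \<longrightarrow> linepoly V K q \<longrightarrow> 0 < s \<longrightarrow>
    (\<forall>u\<in>V \<inter> cball 0 s. \<bar>q u\<bar> \<le> B) \<longrightarrow>
    (\<exists>M\<ge>0. \<exists>u0\<in>V \<inter> cball 0 s. (\<forall>u\<in>V. norm (u - u0) \<le> s / (4 * \<Lambda>\<^sup>2) \<longrightarrow> M / 2 \<le> \<bar>q u\<bar>) \<and>
      (\<forall>v\<in>V \<inter> cball 0 s. \<forall>t. \<bar>t\<bar> \<le> 1 \<longrightarrow> \<bar>q (t *\<^sub>R v) - q 0\<bar> \<le> \<Lambda> * M * \<bar>t\<bar>))"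
proof -
  obtain \<Lambda> where \<Lambda>: "\<Lambda> \<ge> 1" and gr: "\<And>p::real poly. \<And>M. degree p \<le> K \<Longrightarrow> (\<forall>t\<in>{-1..1}. \<bar>poly p t\<bar> \<le> M) \<Longrightarrow>
    (\<forall>t\<in>{-2..2}. \<bar>poly p t\<bar> \<le> \<Lambda> * M) \<and> (\<forall>t\<in>{-1..1}. \<bar>poly p t - poly p 0\<bar> \<le> \<Lambda> * M * \<bar>t\<bar>)"
    using poly_growth[of K] by blast
  show ?thesis
  proof (rule exI[of _ \<Lambda>], intro conjI allI impI)
    fix V and q :: "'v \<Rightarrow> real" and s B :: real
    assume sV: "subspace V" and lp: "linepoly V K q" and s: "0 < s" and B: "\<forall>u\<in>V \<inter> cball 0 s. \<bar>q u\<bar> \<le> B"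
    let ?S = "V \<inter> cball 0 s"
    have ne: "0 \<in> ?S" using s sV by (simp add: subspace_0)
    have bdd: "bdd_above ((\<lambda>u. \<bar>q u\<bar>) ` ?S)" using B by (intro bdd_aboveI2) auto
    define M where "M = (SUP u\<in>?S. \<bar>q u\<bar>)"
    have le: "\<bar>q u\<bar> \<le> M" if "u \<in> ?S" for u unfolding M_def by (rule cSUP_upper[OF that bdd])
    have M0: "0 \<le> M" using le[OF ne] by linarith
    \<comment> \<open>The supremum need not be attained, as \<open>V\<close> is any subspace; a
      point at 3/4 of it leaves room for an oscillation of \<open>M / 4\<close> above the claimed
      \<open>M / 2\<close>.\<close>
    obtain u0 where u0: "u0 \<in> ?S" "3 / 4 * M \<le> \<bar>q u0\<bar>"
    proof (cases "M = 0")
      case True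
      then show ?thesis using that[of 0] ne by auto
    next
      case False
      then have "3 / 4 * M < M" using M0 by simp
      then obtain u where "u \<in> ?S" "3 / 4 * M < \<bar>q u\<bar>"
        unfolding M_def using less_cSUP_iff[OF _ bdd] ne by (metis empty_iff)
      then show ?thesis using that by auto
    qed
    have poly_line: "\<exists>P::real poly. degree P \<le> K \<and> (\<forall>t. q (u + t *\<^sub>R v) = poly P t)" if "u \<in> V" "v \<in> V" for u v
      using lp that by (auto simp: linepoly_def)
    \<comment> \<open>Segments of length \<open>s\<close> starting at \<open>u0\<close> may leave
      the ball, so \<open>q\<close> is first bounded on the ball of twice the radius.\<close>
    have le2: "\<bar>q v\<bar> \<le> \<Lambda> * M" if v: "v \<in> V" "norm v \<le> 2 * s" for v
    proof -
      have hv: "(1/2) *\<^sub>R v \<in> V" using v sV by (simp add: subspace_scale)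
      obtain P :: "real poly" where P: "degree P \<le> K" "\<forall>t. q (0 + t *\<^sub>R ((1/2) *\<^sub>R v)) = poly P t"
        using poly_line[OF subspace_0[OF sV] hv] by blast
      have "\<bar>poly P t\<bar> \<le> M" if t: "t \<in> {-1..1}" for t
      proof -
        have "\<bar>t\<bar> * (norm v / 2) \<le> 1 * (norm v / 2)" using t by (intro mult_right_mono) auto
        then have "norm (0 + t *\<^sub>R ((1/2) *\<^sub>R v)) \<le> s" using v by simp
        then show ?thesis using P(2) le[of "0 + t *\<^sub>R ((1/2) *\<^sub>R v)"] hv sV
          by (metis Int_iff add_0 mem_cball_0 subspace_scale)
      qed
      then have "\<bar>poly P 2\<bar> \<le> \<Lambda> * M" using gr[OF P(1)] by force
      then show ?thesis using P(2)[rule_format, of 2] by simp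
    qed
    have lip: "\<bar>q u - q u0\<bar> \<le> M / 4" if u: "u \<in> V" "norm (u - u0) \<le> s / (4 * \<Lambda>\<^sup>2)" for u
    proof (cases "u = u0")
      case False
      define \<delta> where "\<delta> = norm (u - u0)"
      have d0: "0 < \<delta>" using False by (simp add: \<delta>_def)
      have "1 \<le> \<Lambda>\<^sup>2" using \<Lambda> by (rule one_le_power)
      then have "1 \<le> 4 * \<Lambda>\<^sup>2" by linarith
      then have "s / (4 * \<Lambda>\<^sup>2) \<le> s / 1" using s by (intro divide_left_mono) auto
      then have ds: "\<delta> \<le> s" using u by (simp add: \<delta>_def)
      \<comment> \<open>The direction is rescaled to length \<open>s\<close>. The growth estimate
        and the Lipschitz estimate each cost a factor \<open>\<Lambda>\<close>, which explains the
        radius \<open>s / (4 * \<Lambda>\<^sup>2)\<close>.\<close>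
      define v where "v = (s / \<delta>) *\<^sub>R (u - u0)"
      have v: "v \<in> V" "norm v = s" using u u0 sV d0 s by (auto simp: v_def \<delta>_def subspace_scale subspace_diff)
      obtain P :: "real poly" where P: "degree P \<le> K" "\<forall>t. q (u0 + t *\<^sub>R v) = poly P t"
        using poly_line[of u0 v] u0 v by blast
      have pb: "\<bar>poly P t\<bar> \<le> \<Lambda> * M" if t: "t \<in> {-1..1}" for t
      proof -
        have "\<bar>t\<bar> * s \<le> 1 * s" using t s by (intro mult_right_mono) auto
        then have "norm (u0 + t *\<^sub>R v) \<le> 2 * s"
          using norm_triangle_ineq[of u0 "t *\<^sub>R v"] v u0 by simp
        moreover have "u0 + t *\<^sub>R v \<in> V" using u0 v sV by (simp add: subspace_add subspace_scale)
        ultimately show ?thesis using le2 P(2) by metis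
      qed
      have "0 \<le> \<delta> / s" "\<delta> / s \<le> 1" using d0 ds s by auto
      then have ds1: "\<delta> / s \<in> {-1..1}" by simp
      have *: "\<bar>poly P (\<delta> / s) - poly P 0\<bar> \<le> \<Lambda> * (\<Lambda> * M) * \<bar>\<delta> / s\<bar>"
        using gr[OF P(1), of "\<Lambda> * M"] pb ds1 by blast
      have "q u = poly P (\<delta> / s)" using P(2)[rule_format, of "\<delta> / s"] d0 s by (simp add: v_def)
      moreover have "q u0 = poly P 0" using P(2)[rule_format, of 0] by simp
      ultimately have "\<bar>q u - q u0\<bar> \<le> \<Lambda>\<^sup>2 * M * (\<delta> / s)" using * d0 s by (simp add: power2_eq_square algebra_simps)
      also have "\<dots> \<le> \<Lambda>\<^sup>2 * M * (1 / (4 * \<Lambda>\<^sup>2))"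
        using u(2) s M0 \<Lambda> by (intro mult_left_mono) (auto simp: \<delta>_def field_simps)
      also have "\<dots> = M / 4" using \<Lambda> by (simp add: field_simps)
      finally show ?thesis .
    qed (use M0 in simp)
    show "\<exists>M\<ge>0. \<exists>u0\<in>?S. (\<forall>u\<in>V. norm (u - u0) \<le> s / (4 * \<Lambda>\<^sup>2) \<longrightarrow> M / 2 \<le> \<bar>q u\<bar>) \<and>
      (\<forall>v\<in>?S. \<forall>t. \<bar>t\<bar> \<le> 1 \<longrightarrow> \<bar>q (t *\<^sub>R v) - q 0\<bar> \<le> \<Lambda> * M * \<bar>t\<bar>)"
    proof (intro exI[of _ M] conjI bexI[of _ u0] ballI impI allI)
      show "0 \<le> M" by (rule M0)
      show "u0 \<in> ?S" by (rule u0(1))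
      fix u assume "u \<in> V" "norm (u - u0) \<le> s / (4 * \<Lambda>\<^sup>2)"
      then have "\<bar>q u - q u0\<bar> \<le> M / 4" by (rule lip)
      then show "M / 2 \<le> \<bar>q u\<bar>" using u0(2) by linarith
    next
      fix v and t :: real assume v: "v \<in> ?S" and t: "\<bar>t\<bar> \<le> 1"
      obtain P :: "real poly" where P: "degree P \<le> K" "\<forall>t. q (0 + t *\<^sub>R v) = poly P t"
        using poly_line[OF subspace_0[OF sV], of v] v by blast
      have "\<bar>poly P t\<bar> \<le> M" if t: "t \<in> {-1..1}" for t
      proof -
        have "\<bar>t\<bar> * norm v \<le> 1 * norm v" using t by (intro mult_right_mono) auto
        then have "t *\<^sub>R v \<in> ?S" using v sV by (auto simp: subspace_scale)
        then show ?thesis using P(2) le by (metis add_0)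
      qed
      then have "\<bar>poly P t - poly P 0\<bar> \<le> \<Lambda> * M * \<bar>t\<bar>" using gr[OF P(1)] t by (simp add: abs_le_iff)
      then show "\<bar>q (t *\<^sub>R v) - q 0\<bar> \<le> \<Lambda> * M * \<bar>t\<bar>"
        using P(2)[rule_format, of t] P(2)[rule_format, of 0] by simp
    qed
  qed (rule \<Lambda>)
qed

section \<open>Local parametrizations\<close>

lemma has_derivative_line:
  fixes f :: "'a::real_normed_vector \<Rightarrow> 'b::real_normed_vector"
  assumes f: "(f has_derivative F) (at (x + s *\<^sub>R w) within S)"
    and e: "0 < e" "\<And>t. \<bar>t - s\<bar> < e \<Longrightarrow> x + t *\<^sub>R w \<in> S"
  shows "((\<lambda>t. f (x + t *\<^sub>R w)) has_vector_derivative F w) (at s)"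
proof -
  let ?I = "{s - e<..<s + e}"
  have 1: "((\<lambda>t. x + t *\<^sub>R w) has_derivative (\<lambda>t. t *\<^sub>R w)) (at s within ?I)"
    by (auto intro!: derivative_eq_intros)
  have sub: "(\<lambda>t. x + t *\<^sub>R w) ` ?I \<subseteq> S" using e(2) by (auto simp: abs_less_iff)
  have "(f \<circ> (\<lambda>t. x + t *\<^sub>R w) has_derivative F \<circ> (\<lambda>t. t *\<^sub>R w)) (at s within ?I)"
    by (rule diff_chain_within[OF 1 has_derivative_subset[OF f sub]])
  moreover have "at s within ?I = at s" using e by (intro at_within_open) auto
  moreover have "F \<circ> (\<lambda>t. t *\<^sub>R w) = (\<lambda>t. t *\<^sub>R F w)"
    using has_derivative_linear[OF f] by (auto simp: fun_eq_iff linear_cmul)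
  ultimately show ?thesis by (simp add: has_vector_derivative_def o_def)
qed

lemma line_in_ball:
  fixes x :: "'a::real_normed_vector"
  assumes "subspace V" "x \<in> V" "w \<in> V" "0 < e"
  shows "\<exists>\<delta>>0. \<forall>t. \<bar>t\<bar> < \<delta> \<longrightarrow> x + t *\<^sub>R w \<in> ball x e \<inter> V"
proof (intro exI[of _ "e / (norm w + 1)"] conjI allI impI)
  have n: "0 < norm w + 1" by (simp add: add_nonneg_pos)
  show "0 < e / (norm w + 1)" using assms n by simp
  fix t :: real assume "\<bar>t\<bar> < e / (norm w + 1)"
  then have "\<bar>t\<bar> * (norm w + 1) < e" using n by (simp add: pos_less_divide_eq)
  then have "\<bar>t\<bar> * norm w < e" by (simp add: algebra_simps)
  then show "x + t *\<^sub>R w \<in> ball x e \<inter> V"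
    using assms by (auto simp: dist_norm subspace_add subspace_scale)
qed

text \<open>A derivative within a subset of \<open>V\<close> may be ambiguous in directions outside
  \<open>V\<close>; for directions inside, the restriction to lines determines it.\<close>

lemma has_derivative_unique_subspace:
  fixes f :: "'a::real_normed_vector \<Rightarrow> 'b::real_normed_vector"
  assumes "(f has_derivative F) (at x within S)" "(f has_derivative F') (at x within S)"
    and "subspace V" "x \<in> V" "0 < e" "ball x e \<inter> V \<subseteq> S" "w \<in> V"
  shows "F w = F' w"
proof -
  obtain \<delta> where d: "\<delta> > 0" "\<And>t. \<bar>t\<bar> < \<delta> \<Longrightarrow> x + t *\<^sub>R w \<in> S"
    using line_in_ball[OF assms(3,4,7,5)] assms(6) by blast
  have *: "((\<lambda>t. f (x + t *\<^sub>R w)) has_vector_derivative F w) (at 0)"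
    "((\<lambda>t. f (x + t *\<^sub>R w)) has_vector_derivative F' w) (at 0)"
    by (rule has_derivative_line[where e = \<delta> and S = S]; use assms(1,2) d in simp)+
  show ?thesis by (rule vector_derivative_unique_at[OF *])
qed

abbreviation dg :: "evec set \<Rightarrow> (evec \<Rightarrow> evec) \<Rightarrow> evec \<Rightarrow> evec \<Rightarrow> evec" where
  "dg U g x \<equiv> frechet_derivative g (at x within U)"

lemma local_param_sub: "local_param d M U g \<Longrightarrow> U \<subseteq> Rdim d"
  by (auto simp: local_param_def dest: openin_imp_subset)

lemma local_param_ball:
  "local_param d M U g \<Longrightarrow> x \<in> U \<Longrightarrow> \<exists>e>0. ball x e \<inter> Rdim d \<subseteq> U"
  by (auto simp: local_param_def openin_contains_ball)

lemma local_param_image: "local_param d M U g \<Longrightarrow> g ` U \<subseteq> M"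
  by (auto simp: local_param_def dest: openin_imp_subset)

lemma local_param_deriv:
  assumes "local_param d M U g" "x \<in> U"
  shows "(g has_derivative dg U g x) (at x within U)"
proof -
  have "[] \<in> lists (Rdim d)" "length ([]::evec list) < 2" by auto
  then have "iter_deriv U g [] differentiable_on U"
    using assms(1) unfolding local_param_def Ck_on_def by blast
  then show ?thesis using assms by (simp add: differentiable_on_def frechet_derivative_works)
qed

lemma local_param_deriv1:
  assumes "local_param d M U g" "w \<in> Rdim d"
  shows "(\<lambda>x. dg U g x w) differentiable_on U"
proof -
  have "[w] \<in> lists (Rdim d)" "length [w] < 2" using assms by auto
  then have "iter_deriv U g [w] differentiable_on U"
    using assms(1) unfolding local_param_def Ck_on_def by blast
  then show ?thesis by simp
qed

lemma local_param_inj: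
  "local_param d M U g \<Longrightarrow> x \<in> U \<Longrightarrow> w \<in> Rdim d \<Longrightarrow> dg U g x w = 0 \<Longrightarrow> w = 0"
  by (simp add: local_param_def)

lemma abs_coord_le: "\<bar>coord x i\<bar> \<le> norm x"
  using Cauchy_Schwarz_ineq2[of "unit_evec i" x] by (simp add: inner_unit norm_eq_sqrt_inner)

lemma frechet_derivative_compose_linear:
  fixes f :: "'a::real_normed_vector \<Rightarrow> 'b::real_normed_vector"
  assumes "f differentiable (at (A x) within U)" "bounded_linear A" "A ` U' \<subseteq> U" "x \<in> U'"
    and "\<And>x. x \<in> U' \<Longrightarrow> f' x = f (A x)"
    and "subspace V" "x \<in> V" "0 < e" "ball x e \<inter> V \<subseteq> U'"
  shows "f' differentiable (at x within U')"
    and "w \<in> V \<Longrightarrow> frechet_derivative f' (at x within U') w = frechet_derivative f (at (A x) within U) (A w)"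
proof -
  have 1: "(f has_derivative frechet_derivative f (at (A x) within U)) (at (A x) within A ` U')"
    using assms(1,3) has_derivative_subset unfolding frechet_derivative_works by blast
  have "(f \<circ> A has_derivative frechet_derivative f (at (A x) within U) \<circ> A) (at x within U')"
    by (rule diff_chain_within[OF bounded_linear_imp_has_derivative[OF assms(2)] 1])
  then have 2: "(f' has_derivative frechet_derivative f (at (A x) within U) \<circ> A) (at x within U')"
    by (rule has_derivative_transform[OF assms(4), rotated]) (use assms(5) in auto)
  then show 3: "f' differentiable (at x within U')" by (auto simp: differentiable_def)
  show "frechet_derivative f' (at x within U') w = frechet_derivative f (at (A x) within U) (A w)"
    if "w \<in> V"
    using has_derivative_unique_subspace[OF 3[unfolded frechet_derivative_works] 2 assms(6-9) that] by simp
qed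

text \<open>Composing with a linear automorphism of the parameter space makes the derivative at one point
  isometric, so no change of variables in the volume integral is needed.\<close>

lemma local_param_compose_linear:
  assumes lp: "local_param d M U g" and A: "bounded_linear A" "bounded_linear A'"
    and AE: "A ` Rdim d \<subseteq> Rdim d" "A' ` Rdim d \<subseteq> Rdim d"
    and inv: "\<And>x. x \<in> Rdim d \<Longrightarrow> A (A' x) = x" "\<And>x. x \<in> Rdim d \<Longrightarrow> A' (A x) = x"
    and U': "U' = Rdim d \<inter> A -` U"
  shows "local_param d M U' (g \<circ> A)"
    and "x \<in> U' \<Longrightarrow> w \<in> Rdim d \<Longrightarrow> dg U' (g \<circ> A) x w = dg U g (A x) (A w)"
proof -
  let ?E = "Rdim d" and ?h = "g \<circ> A"
  note sub = local_param_sub[OF lp]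
  have AU: "A ` U' = U"
  proof
    show "U \<subseteq> A ` U'"
    proof
      fix x assume x: "x \<in> U"
      then have xE: "x \<in> ?E" using sub by blast
      then have "A' x \<in> U'" using x inv(1) AE by (auto simp: U')
      then show "x \<in> A ` U'" using inv(1)[OF xE] by (metis imageI)
    qed
  qed (auto simp: U')
  have cA: "continuous_on S A" "continuous_on S A'" for S using A by (auto intro: linear_continuous_on)
  have oU': "openin (top_of_set ?E) U'"
    unfolding U'
  proof (rule continuous_openin_preimage[OF cA(1)])
    show "A \<in> ?E \<rightarrow> ?E" using AE by auto
    show "openin (top_of_set ?E) U" using lp by (simp add: local_param_def)
  qed
  have ball: "\<exists>e>0. ball x e \<inter> ?E \<subseteq> U'" if "x \<in> U'" for x
    using oU' that by (auto simp: openin_contains_ball)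
  have U'E: "U' \<subseteq> ?E" by (auto simp: U')
  have d1: "?h differentiable (at x within U')"
    and D1: "w \<in> ?E \<Longrightarrow> dg U' ?h x w = dg U g (A x) (A w)" if x: "x \<in> U'" for x w
  proof -
    obtain e where e: "e > 0" "ball x e \<inter> ?E \<subseteq> U'" using ball[OF x] by blast
    have "g differentiable (at (A x) within U)"
      using local_param_deriv[OF lp, of "A x"] x by (auto simp: U' differentiable_def)
    note * = frechet_derivative_compose_linear[OF this A(1) _ x, where f' = ?h, OF _ _ subspace_Rdim _ e]
    show "?h differentiable (at x within U')" using * AU x U'E by auto
    show "w \<in> ?E \<Longrightarrow> dg U' ?h x w = dg U g (A x) (A w)" using * AU x U'E by auto
  qed
  show "dg U' (g \<circ> A) x w = dg U g (A x) (A w)" if "x \<in> U'" "w \<in> Rdim d"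
    by (rule D1[OF that])
  have d2: "(\<lambda>x. dg U' ?h x w) differentiable (at x within U')"
    and D2: "w' \<in> ?E \<Longrightarrow> iter_deriv U' ?h [w', w] x = iter_deriv U g [A w', A w] (A x)"
    if x: "x \<in> U'" and w: "w \<in> ?E" for x w w'
  proof -
    obtain e where e: "e > 0" "ball x e \<inter> ?E \<subseteq> U'" using ball[OF x] by blast
    have "(\<lambda>x. dg U g x (A w)) differentiable (at (A x) within U)"
      using local_param_deriv1[OF lp, of "A w"] x w AE by (auto simp: U' differentiable_on_def)
    note * = frechet_derivative_compose_linear[OF this A(1) _ x, where f' = "\<lambda>x. dg U' ?h x w",
        OF _ _ subspace_Rdim _ e]
    show "(\<lambda>x. dg U' ?h x w) differentiable (at x within U')" using * AU x U'E D1 w by auto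
    show "w' \<in> ?E \<Longrightarrow> iter_deriv U' ?h [w', w] x = iter_deriv U g [A w', A w] (A x)"
      using * AU x U'E D1 w by auto
  qed
  have ck: "continuous_on U (iter_deriv U g ws)" if "ws \<in> lists ?E" "length ws \<le> 2" for ws
    using lp that by (auto simp: local_param_def Ck_on_def)
  have C: "Ck_on 2 ?E U' ?h"
    unfolding Ck_on_def
  proof (intro conjI ballI impI)
    fix ws assume ws: "ws \<in> lists ?E" "length ws < 2"
    then consider "ws = []" | w where "ws = [w]" "w \<in> ?E"
      by (cases ws; cases "tl ws") auto
    then show "iter_deriv U' ?h ws differentiable_on U'"
      using d1 d2 by cases (auto simp: differentiable_on_def)
  next
    fix ws assume ws: "ws \<in> lists ?E" "length ws \<le> 2"
    then have ws': "map A ws \<in> lists ?E" using AE by (auto simp: image_subset_iff)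
    have "iter_deriv U' ?h ws x = iter_deriv U g (map A ws) (A x)" if "x \<in> U'" for x
    proof -
      consider "ws = []" | w where "ws = [w]" "w \<in> ?E" | w w' where "ws = [w', w]" "w \<in> ?E" "w' \<in> ?E"
        using ws by (cases ws; cases "tl ws"; cases "tl (tl ws)") auto
      then show ?thesis using D1[OF that] D2[OF that] by cases auto
    qed
    moreover have "continuous_on U' (\<lambda>x. iter_deriv U g (map A ws) (A x))"
      by (rule continuous_on_compose2[OF ck cA(1)]) (use ws ws' AU in auto)
    ultimately show "continuous_on U' (iter_deriv U' ?h ws)"
      by (simp cong: continuous_on_cong)
  qed
  obtain g' where g': "homeomorphism U (g ` U) g g'" using lp by (auto simp: local_param_def)
  have "homeomorphism U' U A A'"
  proof (rule homeomorphismI[OF cA])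
    show "A' ` U \<subseteq> U'" using inv sub AE(2) by (auto simp: U' image_subset_iff subset_iff)
  qed (use AU inv sub U'E in auto)
  from homeomorphism_compose[OF this g']
  have hm: "homeomorphism U' (?h ` U') ?h (A' \<circ> g')" by (simp only: image_comp[symmetric] AU)
  show "local_param d M U' ?h"
    unfolding local_param_def
  proof (intro conjI ballI impI)
    show "openin (top_of_set M) (?h ` U')" using lp by (simp only: image_comp[symmetric] AU local_param_def)
    show "\<exists>g'. homeomorphism U' (?h ` U') ?h g'" using hm by blast
    fix x w assume x: "x \<in> U'" "w \<in> ?E" "iter_deriv U' ?h [w] x = 0"
    then have "dg U g (A x) (A w) = 0" using D1 by simp
    then have "A w = 0" using local_param_inj[OF lp] x AE by (auto simp: U')
    then show "w = 0" using inv(2)[OF x(2)] A(2) by (metis linear_simps(3))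
  qed (use oU' C in auto)
qed

lemma Rdim_norm: "x \<in> Rdim d \<Longrightarrow> (norm x)\<^sup>2 = (\<Sum>i<d. (coord x i)\<^sup>2)"
  using onb_norm_sum[OF Rdim_onb, of "coord x" d] Rdim_expand[of x d] by simp

lemma dim_inj_image:
  assumes "findim V" "linear f" "inj_on f V"
  shows "dim (f ` V) = dim V" "findim (f ` V)"
proof -
  obtain b where b: "onb (dim V) b V" using findim_onb[OF assms(1)] by blast
  let ?B = "b ` {..<dim V}"
  have sB: "span ?B = V" using b by (simp add: onb_def)
  have i: "independent (f ` ?B)"
    by (rule linear_independent_injective_image[OF assms(2)])
      (use onb_indep[OF b] assms(3) sB in auto)
  have sp: "span (f ` ?B) = f ` V" using linear_span_image[OF assms(2)] sB by metis
  have "card (f ` ?B) = dim V"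
    using assms(3) onb_indep[OF b] sB by (metis card_image inj_on_subset span_superset)
  then show "dim (f ` V) = dim V" using dim_eq_card_independent[OF i] sp by (metis dim_span)
  show "findim (f ` V)" unfolding findim_def using sp by (metis finite_imageI finite_lessThan)
qed

section \<open>Charts adapted to a point\<close>

text \<open>The parameter space is changed linearly so that the unit vectors go to preimages of an
  orthonormal basis of the image of the derivative; the derivative at the point is then
  isometric.\<close>

lemma chart_at:
  assumes "submanifold D d M" "p \<in> M"
  obtains U g x0 where "local_param d M U g" "x0 \<in> U" "g x0 = p"
    "\<And>w. w \<in> Rdim d \<Longrightarrow> norm (dg U g x0 w) = norm w"
proof -
  obtain U g where lp: "local_param d M U g" and "p \<in> g ` U"
    using assms unfolding submanifold_def by blast
  then obtain y0 where y0: "y0 \<in> U" "g y0 = p" by auto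
  let ?E = "Rdim d"
  define G where "G = dg U g y0"
  have bG: "bounded_linear G" unfolding G_def using local_param_deriv[OF lp y0(1)] by (rule has_derivative_bounded_linear)
  then have lG: "linear G" by (rule bounded_linear.linear)
  have inj: "inj_on G ?E"
    by (subst linear_inj_on_iff_eq_0[OF lG subspace_Rdim])
      (use local_param_inj[OF lp y0(1)] in \<open>auto simp: G_def\<close>)
  have dV: "dim (G ` ?E) = d" and fV: "findim (G ` ?E)"
    using dim_inj_image[OF findim_Rdim lG inj] dim_Rdim by auto
  obtain b where b: "onb d b (G ` ?E)" using findim_onb[OF fV] dV by auto
  have "\<exists>a. a \<in> ?E \<and> (i < d \<longrightarrow> G a = b i)" for i
    using onb_in[OF b, of i] subspace_0[OF subspace_Rdim] by (cases "i < d") auto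
  then obtain a where a: "\<And>i. a i \<in> ?E" "\<And>i. i < d \<Longrightarrow> G (a i) = b i" by metis
  define A where "A = (\<lambda>x. \<Sum>i<d. (unit_evec i \<bullet> x) *\<^sub>R a i)"
  define A' where "A' = (\<lambda>x. \<Sum>i<d. (b i \<bullet> G x) *\<^sub>R unit_evec i)"
  have bA: "bounded_linear A"
    unfolding A_def
    by (intro bounded_linear_sum bounded_linear_compose[OF bounded_linear_scaleR_left bounded_linear_inner_right])
  have bA': "bounded_linear A'"
    unfolding A'_def
    by (intro bounded_linear_sum bounded_linear_compose[OF bounded_linear_scaleR_left]
        bounded_linear_compose[OF bounded_linear_inner_right bG])
  have AE: "A ` ?E \<subseteq> ?E" unfolding A_def using a
    by (auto intro!: subspace_sum subspace_scale subspace_Rdim)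
  have AE': "A' ` ?E \<subseteq> ?E" unfolding A'_def
    using onb_in[OF Rdim_onb, of _ d] by (auto intro!: subspace_sum subspace_scale subspace_Rdim)
  have GA: "G (A x) = (\<Sum>i<d. coord x i *\<^sub>R b i)" for x
    using a by (simp add: A_def linear_sum[OF lG] linear_cmul[OF lG] inner_unit)
  have GA': "G (A (A' x)) = G x" if "x \<in> ?E" for x
  proof -
    have "coord (A' x) i = b i \<bullet> G x" if "i < d" for i
      using that unfolding A'_def by (simp add: coord_sum if_distrib cong: if_cong)
    then have "G (A (A' x)) = (\<Sum>i<d. (G x \<bullet> b i) *\<^sub>R b i)" by (simp add: GA inner_commute)
    also have "\<dots> = G x" using onb_expand[OF b, of "G x"] that by auto
    finally show ?thesis .
  qed
  have inv1: "A (A' x) = x" if "x \<in> ?E" for x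
    using inj_onD[OF inj GA'[OF that]] that AE AE' by blast
  have inv2: "A' (A x) = x" if "x \<in> ?E" for x
  proof -
    have "A' (A x) = (\<Sum>i<d. coord x i *\<^sub>R unit_evec i)"
      unfolding A'_def GA by (intro sum.cong) (auto simp: onb_inner_sum[OF b])
    then show ?thesis using Rdim_expand[OF that] by simp
  qed
  have iso: "norm (G (A w)) = norm w" if "w \<in> ?E" for w
  proof -
    have "(norm (G (A w)))\<^sup>2 = (norm w)\<^sup>2"
      by (simp add: GA onb_norm_sum[OF b] Rdim_norm[OF that])
    then show ?thesis by simp
  qed
  define U' where "U' = ?E \<inter> A -` U"
  have L: "local_param d M U' (g \<circ> A)"
    "\<And>x w. x \<in> U' \<Longrightarrow> w \<in> ?E \<Longrightarrow> dg U' (g \<circ> A) x w = dg U g (A x) (A w)"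
    by (rule local_param_compose_linear[OF lp bA bA' AE AE' _ _ U'_def]; use inv1 inv2 in auto)+
  have y0E: "y0 \<in> ?E" using y0 local_param_sub[OF lp] by auto
  have x0: "A' y0 \<in> U'" using y0 y0E inv1[OF y0E] AE' by (auto simp: U'_def)
  show thesis
  proof (rule that[OF L(1) x0])
    show "(g \<circ> A) (A' y0) = p" using inv1[OF y0E] y0 by simp
    show "norm (dg U' (g \<circ> A) (A' y0) w) = norm w" if "w \<in> Rdim d" for w
      using L(2)[OF x0 that] inv1[OF y0E] iso[OF that] by (simp add: G_def)
  qed
qed

lemma isometry_inner:
  assumes "linear G" "\<And>w. w \<in> E \<Longrightarrow> norm (G w) = norm w" "subspace E" "u \<in> E" "v \<in> E"
  shows "G u \<bullet> G v = u \<bullet> (v::'a::real_inner)"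
proof -
  have "(norm (G u + G v))\<^sup>2 = (norm (u + v))\<^sup>2"
    using assms by (metis linear_add subspace_add)
  moreover have "G u \<bullet> G u = u \<bullet> u" "G v \<bullet> G v = v \<bullet> v" using assms by (simp_all add: dot_square_norm)
  ultimately show ?thesis
    by (simp add: power2_norm_eq_inner inner_add_left inner_add_right inner_commute)
qed

lemma gram_det_orthonormal:
  assumes "\<And>i j. i < d \<Longrightarrow> j < d \<Longrightarrow> v i \<bullet> v j = (if i = j then 1 else 0)"
  shows "gram_det d v = 1"
proof -
  have fin: "finite {p. p permutes {..<d}}" by (rule finite_permutations) simp
  have z: "(\<Prod>i<d. v i \<bullet> v (p i)) = 0" if p: "p permutes {..<d}" "p \<noteq> id" for p
  proof -
    obtain i where i: "p i \<noteq> i" using p(2) by (auto simp: fun_eq_iff)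
    then have id: "i < d" using p(1) by (auto simp: permutes_def)
    then have "p i < d" using p(1) permutes_in_image by fastforce
    then have "v i \<bullet> v (p i) = 0" using assms[OF id] i by simp
    then show ?thesis using id by (intro prod_zero) auto
  qed
  have "gram_det d v = (\<Sum>p\<in>{id}. of_int (sign p) * (\<Prod>i<d. v i \<bullet> v (p i)))"
    unfolding gram_det_def
    by (intro sum.mono_neutral_right fin) (auto simp: z permutes_id)
  also have "\<dots> = 1" using assms by simp
  finally show ?thesis .
qed

text \<open>The vector \<open>c\<close> is free so that increments of the chart can be compared with
  its linearisation at the centre, by \<open>c = dg U g x0 (x - x')\<close>. The intermediate point
  is kept on the segment because the quadratic estimate needs
  \<open>norm (z - x0) \<le> norm (x - x0)\<close>.\<close>

lemma chart_mean_value: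
  assumes lp: "local_param d M U g" and B: "ball x0 \<delta> \<inter> Rdim d \<subseteq> U"
    and x: "x \<in> ball x0 \<delta> \<inter> Rdim d" "x' \<in> ball x0 \<delta> \<inter> Rdim d"
  shows "\<exists>z\<in>ball x0 \<delta> \<inter> Rdim d. z \<in> closed_segment x' x \<and>
    norm (g x - g x' - c) \<le> norm (dg U g z (x - x') - c)"
proof -
  let ?E = "Rdim d"
  define \<phi> where "\<phi> t = x' + t *\<^sub>R (x - x')" for t :: real
  have \<phi>s: "\<phi> t \<in> closed_segment x' x" if "t \<in> {0..1}" for t
  proof -
    have "\<phi> t = (1 - t) *\<^sub>R x' + t *\<^sub>R x" by (simp add: \<phi>_def algebra_simps)
    then show ?thesis using that unfolding in_segment by auto
  qed
  have "convex (ball x0 \<delta> \<inter> ?E)" by (intro convex_Int convex_ball subspace_imp_convex subspace_Rdim)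
  then have "closed_segment x' x \<subseteq> ball x0 \<delta> \<inter> ?E" using x by (intro closed_segment_subset)
  then have \<phi>b: "\<phi> t \<in> ball x0 \<delta> \<inter> ?E" if "t \<in> {0..1}" for t
    using \<phi>s[OF that] by (rule subsetD)
  have cg: "continuous_on U g" using lp unfolding local_param_def homeomorphism_def by blast
  have "continuous_on {0..1} (\<lambda>t. g (\<phi> t) - t *\<^sub>R c)"
    unfolding \<phi>_def
    by (intro continuous_intros continuous_on_compose2[OF cg]) (use \<phi>b B in \<open>auto simp: \<phi>_def\<close>)
  moreover have "((\<lambda>t. g (\<phi> t) - t *\<^sub>R c) has_derivative (\<lambda>s. s *\<^sub>R (dg U g (\<phi> t) (x - x') - c))) (at t)"
    if t: "0 < t" "t < 1" for t
  proof -
    have "((\<lambda>t. g (x' + t *\<^sub>R (x - x'))) has_vector_derivative dg U g (\<phi> t) (x - x')) (at t)"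
    proof (rule has_derivative_line[where e = "min t (1 - t)"])
      show "(g has_derivative dg U g (\<phi> t)) (at (x' + t *\<^sub>R (x - x')) within U)"
        using local_param_deriv[OF lp, of "\<phi> t"] \<phi>b[of t] t B by (auto simp: \<phi>_def)
      show "x' + s *\<^sub>R (x - x') \<in> U" if "\<bar>s - t\<bar> < min t (1 - t)" for s
        using \<phi>b[of s] that t B by (auto simp: \<phi>_def abs_less_iff)
    qed (use t in auto)
    moreover have "((\<lambda>t. t *\<^sub>R c) has_vector_derivative c) (at t)"
      unfolding has_vector_derivative_def by (auto intro!: derivative_eq_intros)
    ultimately have "((\<lambda>t. g (\<phi> t) - t *\<^sub>R c) has_vector_derivative (dg U g (\<phi> t) (x - x') - c)) (at t)"
      unfolding \<phi>_def by (rule has_vector_derivative_diff)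
    then show ?thesis by (simp add: has_vector_derivative_def)
  qed
  ultimately obtain t where t: "t \<in> {0<..<1}"
    "norm ((g (\<phi> 1) - 1 *\<^sub>R c) - (g (\<phi> 0) - 0 *\<^sub>R c)) \<le> norm ((1 - 0) *\<^sub>R (dg U g (\<phi> t) (x - x') - c))"
    using mvt_general[of 0 1 "\<lambda>t. g (\<phi> t) - t *\<^sub>R c" "\<lambda>t s. s *\<^sub>R (dg U g (\<phi> t) (x - x') - c)"] by auto
  have "norm (g x - g x' - c) \<le> norm (dg U g (\<phi> t) (x - x') - c)"
    using t by (simp add: \<phi>_def algebra_simps)
  then show ?thesis using \<phi>b[of t] \<phi>s[of t] t(1) by auto
qed

text \<open>Quantitative chart around \<open>p\<close>: the deviation 1/8 from an isometry gives
  Lipschitz factors 7/8 and 9/8, and a Gram determinant between 1/4 and 4 gives a volume density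
  between 1/2 and 2. The numbers \<open>\<delta>\<close>, \<open>\<rho>\<close>, \<open>C\<close>
  depend on the point and the chart.\<close>

definition good_chart where
  "good_chart d M p U g x0 \<delta> \<rho> C \<longleftrightarrow> local_param d M U g \<and> x0 \<in> U \<and> g x0 = p \<and> 0 < \<delta> \<and> 0 < \<rho> \<and> 0 \<le> C \<and>
     (\<forall>w\<in>Rdim d. norm (dg U g x0 w) = norm w) \<and>
     ball x0 \<delta> \<inter> Rdim d \<subseteq> U \<and>
     (\<forall>x\<in>ball x0 \<delta> \<inter> Rdim d. \<forall>w\<in>Rdim d. norm (dg U g x w - dg U g x0 w) \<le> 1/8 * norm w) \<and>
     (\<forall>x\<in>ball x0 \<delta> \<inter> Rdim d. \<forall>x'\<in>ball x0 \<delta> \<inter> Rdim d.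
        norm (g x - g x' - dg U g x0 (x - x')) \<le> 1/8 * norm (x - x')) \<and>
     (\<forall>x\<in>ball x0 \<delta> \<inter> Rdim d. norm (g x - g x0 - dg U g x0 (x - x0)) \<le> C * (norm (x - x0))\<^sup>2) \<and>
     (\<forall>x\<in>ball x0 \<delta> \<inter> Rdim d. 1/4 \<le> gram_det d (\<lambda>i. dg U g x (unit_evec i)) \<and>
        gram_det d (\<lambda>i. dg U g x (unit_evec i)) \<le> 4) \<and>
     M \<inter> ball p \<rho> \<subseteq> g ` (ball x0 \<delta> \<inter> Rdim d)"

text \<open>Differentiability of the first derivative at the single point \<open>x0\<close> bounds
  its variation by \<open>C * norm (x - x0)\<close>; the mean value inequality on segments from
  \<open>x0\<close> then gives the quadratic contact.\<close>

lemma good_chart_ex: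
  assumes "submanifold D d M" "p \<in> M"
  obtains U g x0 \<delta> \<rho> C where "good_chart d M p U g x0 \<delta> \<rho> C"
proof -
  obtain U g x0 where lp: "local_param d M U g" and x0: "x0 \<in> U" "g x0 = p"
    and iso: "\<And>w. w \<in> Rdim d \<Longrightarrow> norm (dg U g x0 w) = norm w" using chart_at[OF assms] by blast
  let ?E = "Rdim d" and ?G = "dg U g"
  have x0E: "x0 \<in> ?E" using x0 local_param_sub[OF lp] by blast
  have lG: "linear (?G x)" if "x \<in> U" for x
    using local_param_deriv[OF lp that] by (rule has_derivative_linear)
  obtain e0 where e0: "e0 > 0" "ball x0 e0 \<inter> ?E \<subseteq> U" using local_param_ball[OF lp x0(1)] by blast
  have "\<exists>K \<delta>. 0 \<le> K \<and> 0 < \<delta> \<and> (\<forall>x\<in>U. norm (x - x0) < \<delta> \<longrightarrow>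
      norm (?G x (unit_evec i) - ?G x0 (unit_evec i)) \<le> K * norm (x - x0))" if "i < d" for i
  proof -
    have "(\<lambda>x. ?G x (unit_evec i)) differentiable (at x0 within U)"
      using local_param_deriv1[OF lp onb_in[OF Rdim_onb that]] x0 by (auto simp: differentiable_on_def)
    then obtain F where F: "((\<lambda>x. ?G x (unit_evec i)) has_derivative F) (at x0 within U)"
      by (auto simp: differentiable_def)
    then have bF: "bounded_linear F" by (rule has_derivative_bounded_linear)
    obtain \<delta> where d: "\<delta> > 0" "\<And>y. y \<in> U \<Longrightarrow> norm (y - x0) < \<delta> \<Longrightarrow>
      norm (?G y (unit_evec i) - ?G x0 (unit_evec i) - F (y - x0)) \<le> 1 * norm (y - x0)"
      using F unfolding has_derivative_within_alt by (metis zero_less_one)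
    show ?thesis
    proof (rule exI[of _ "1 + onorm F"], rule exI[of _ \<delta>], intro conjI ballI impI)
      show "0 \<le> 1 + onorm F" using onorm_pos_le[OF bF] by simp
      fix x assume "x \<in> U" "norm (x - x0) < \<delta>"
      then have "norm (?G x (unit_evec i) - ?G x0 (unit_evec i) - F (x - x0)) \<le> norm (x - x0)" using d(2) by simp
      moreover have "norm (F (x - x0)) \<le> onorm F * norm (x - x0)" by (rule onorm[OF bF])
      ultimately show "norm (?G x (unit_evec i) - ?G x0 (unit_evec i)) \<le> (1 + onorm F) * norm (x - x0)"
        using norm_triangle_sub[of "?G x (unit_evec i) - ?G x0 (unit_evec i)" "F (x - x0)"]
        by (simp add: algebra_simps)
    qed (rule d(1))
  qed
  then have "\<exists>K \<delta>. \<forall>i<d. 0 \<le> K i \<and> 0 < \<delta> i \<and> (\<forall>x\<in>U. norm (x - x0) < \<delta> i \<longrightarrow>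
      norm (?G x (unit_evec i) - ?G x0 (unit_evec i)) \<le> K i * norm (x - x0))" by metis
  then obtain K \<delta>1 where K: "\<And>i. i < d \<Longrightarrow> 0 \<le> K i" "\<And>i. i < d \<Longrightarrow> 0 < \<delta>1 i"
    "\<And>i x. i < d \<Longrightarrow> x \<in> U \<Longrightarrow> norm (x - x0) < \<delta>1 i \<Longrightarrow>
      norm (?G x (unit_evec i) - ?G x0 (unit_evec i)) \<le> K i * norm (x - x0)" by metis
  define C where "C = (\<Sum>i<d. K i)"
  have C0: "0 \<le> C" using K(1) by (auto simp: C_def intro: sum_nonneg)
  define \<delta>2 where "\<delta>2 = Min (insert e0 (\<delta>1 ` {..<d}))"
  have d2: "0 < \<delta>2" "\<delta>2 \<le> e0" "\<And>i. i < d \<Longrightarrow> \<delta>2 \<le> \<delta>1 i"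
    using e0 K(2) by (auto simp: \<delta>2_def)
  have GC: "norm (?G x w - ?G x0 w) \<le> C * norm (x - x0) * norm w"
    if x: "x \<in> U" "norm (x - x0) < \<delta>2" and w: "w \<in> ?E" for x w
  proof -
    have "?G x w - ?G x0 w = (\<Sum>i<d. coord w i *\<^sub>R (?G x (unit_evec i) - ?G x0 (unit_evec i)))"
      by (subst (1 2) Rdim_expand[OF w])
        (simp add: linear_sum[OF lG] linear_cmul[OF lG] x x0 sum_subtractf scaleR_diff_right)
    also have "norm \<dots> \<le> (\<Sum>i<d. norm w * (K i * norm (x - x0)))"
    proof (rule sum_norm_le)
      fix i assume "i \<in> {..<d}"
      then have "norm (?G x (unit_evec i) - ?G x0 (unit_evec i)) \<le> K i * norm (x - x0)"
        using K(3)[of i x] x d2(3)[of i] by auto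
      then show "norm (coord w i *\<^sub>R (?G x (unit_evec i) - ?G x0 (unit_evec i))) \<le> norm w * (K i * norm (x - x0))"
        using abs_coord_le[of w i] by (simp add: mult_mono)
    qed
    also have "\<dots> = C * norm (x - x0) * norm w"
      by (simp add: C_def sum_distrib_left sum_distrib_right algebra_simps)
    finally show ?thesis .
  qed
  have "continuous_on U (\<lambda>x. ?G x (unit_evec i))" if "i < d" for i
    using local_param_deriv1[OF lp onb_in[OF Rdim_onb that]] by (rule differentiable_imp_continuous_on)
  then have "continuous_on U (\<lambda>x. gram_det d (\<lambda>i. ?G x (unit_evec i)))"
    unfolding gram_det_def
    by (intro continuous_intros) (auto dest: permutes_in_image)
  moreover have g1: "gram_det d (\<lambda>i. ?G x0 (unit_evec i)) = 1"
  proof (rule gram_det_orthonormal)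
    fix i j assume ij: "i < d" "j < d"
    have "?G x0 (unit_evec i) \<bullet> ?G x0 (unit_evec j) = unit_evec i \<bullet> unit_evec j"
      by (rule isometry_inner[OF lG[OF x0(1)] iso subspace_Rdim])
        (use ij onb_in[OF Rdim_onb] in auto)
    then show "?G x0 (unit_evec i) \<bullet> ?G x0 (unit_evec j) = (if i = j then 1 else 0)"
      by (simp add: inner_unit)
  qed
  ultimately obtain \<delta>3 where d3: "\<delta>3 > 0" "\<And>x. x \<in> U \<Longrightarrow> dist x x0 < \<delta>3 \<Longrightarrow>
      dist (gram_det d (\<lambda>i. ?G x (unit_evec i))) 1 < 1/2"
    using x0(1) unfolding continuous_on_iff by (metis half_gt_zero zero_less_one)
  \<comment> \<open>The last entry makes the variation \<open>C * norm (x - x0)\<close> of the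
    derivative at most 1/8.\<close>
  define \<delta> where "\<delta> = min \<delta>2 (min \<delta>3 (1 / (8 * (C + 1))))"
  have dd: "0 < \<delta>" "\<delta> \<le> \<delta>2" "\<delta> \<le> \<delta>3" "\<delta> \<le> 1 / (8 * (C + 1))"
    using d2 d3 C0 by (auto simp: \<delta>_def)
  let ?B = "ball x0 \<delta> \<inter> ?E"
  have BU: "?B \<subseteq> U" using dd d2 e0 by auto
  have nB: "norm (x - x0) < \<delta>" if "x \<in> ?B" for x using that by (simp add: dist_norm norm_minus_commute)
  have G8: "norm (?G x w - ?G x0 w) \<le> 1/8 * norm w" if "x \<in> ?B" "w \<in> ?E" for x w
  proof -
    have "norm (?G x w - ?G x0 w) \<le> C * norm (x - x0) * norm w"
      using GC[of x w] that BU nB[OF that(1)] dd by auto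
    also have "C * norm (x - x0) \<le> (C + 1) * (1 / (8 * (C + 1)))"
      using C0 nB[OF that(1)] dd by (intro mult_mono) auto
    also have "\<dots> = 1/8" using C0 by (simp add: field_simps)
    finally show ?thesis by (simp add: mult_right_mono)
  qed
  have x0B: "x0 \<in> ?B" using x0E dd by simp
  obtain g' where hg: "homeomorphism U (g ` U) g g'" using lp by (auto simp: local_param_def)
  have cg': "continuous_on (g ` U) g'" and g'g: "\<And>x. x \<in> U \<Longrightarrow> g' (g x) = x"
    using hg unfolding homeomorphism_def by auto
  have pU: "p \<in> g ` U" using x0 by auto
  obtain \<rho>1 where r1: "\<rho>1 > 0" "ball p \<rho>1 \<inter> M \<subseteq> g ` U"
    using lp pU by (auto simp: local_param_def openin_contains_ball)
  \<comment> \<open>Continuity of the inverse chart excludes points of \<open>M\<close> near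
    \<open>p\<close> whose parameter is far from \<open>x0\<close>.\<close>
  obtain \<rho>2 where r2: "\<rho>2 > 0" "\<And>y. y \<in> g ` U \<Longrightarrow> dist y p < \<rho>2 \<Longrightarrow> dist (g' y) (g' p) < \<delta>"
    using cg' pU dd(1) unfolding continuous_on_iff by blast
  have "M \<inter> ball p (min \<rho>1 \<rho>2) \<subseteq> g ` ?B"
  proof
    fix y assume y: "y \<in> M \<inter> ball p (min \<rho>1 \<rho>2)"
    then have "y \<in> g ` U" using r1 by auto
    then obtain x where x: "x \<in> U" "y = g x" by blast
    have "dist (g' y) (g' p) < \<delta>" using r2(2)[of y] x y by (auto simp: dist_commute)
    then have "x \<in> ?B" using x x0 g'g local_param_sub[OF lp] by (auto simp: dist_commute)
    then show "y \<in> g ` ?B" using x by blast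
  qed
  moreover have "norm (g x - g x' - ?G x0 (x - x')) \<le> 1/8 * norm (x - x')" if xx: "x \<in> ?B" "x' \<in> ?B" for x x'
  proof -
    obtain z where "z \<in> ?B" "norm (g x - g x' - ?G x0 (x - x')) \<le> norm (?G z (x - x') - ?G x0 (x - x'))"
      using chart_mean_value[OF lp BU xx] by blast
    then show ?thesis using G8[of z "x - x'"] xx subspace_diff[OF subspace_Rdim] by fastforce
  qed
  moreover have "norm (g x - g x0 - ?G x0 (x - x0)) \<le> C * (norm (x - x0))\<^sup>2" if xx: "x \<in> ?B" for x
  proof -
    obtain z where z: "z \<in> ?B" "z \<in> closed_segment x0 x"
      "norm (g x - g x0 - ?G x0 (x - x0)) \<le> norm (?G z (x - x0) - ?G x0 (x - x0))"
      using chart_mean_value[OF lp BU xx x0B] by blast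
    have "norm (?G z (x - x0) - ?G x0 (x - x0)) \<le> C * norm (z - x0) * norm (x - x0)"
      using GC[of z "x - x0"] z BU nB[OF z(1)] dd xx x0E subspace_diff[OF subspace_Rdim] by fastforce
    also have "\<dots> \<le> C * norm (x - x0) * norm (x - x0)"
      using segment_bound(1)[OF z(2)] C0 by (intro mult_right_mono mult_left_mono) auto
    finally show ?thesis using z(3) by (simp add: power2_eq_square mult.assoc)
  qed
  moreover have "1/4 \<le> gram_det d (\<lambda>i. ?G x (unit_evec i)) \<and> gram_det d (\<lambda>i. ?G x (unit_evec i)) \<le> 4"
    if "x \<in> ?B" for x
  proof -
    have "dist x x0 < \<delta>3" "x \<in> U" using that BU dd by (auto simp: dist_commute)
    from d3(2)[OF this(2,1)] show ?thesis unfolding dist_real_def by linarith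
  qed
  ultimately have "good_chart d M p U g x0 \<delta> (min \<rho>1 \<rho>2) C"
    unfolding good_chart_def using lp x0 dd(1) r1(1) r2(1) C0 iso BU G8 by (intro conjI ballI) auto
  then show thesis by (rule that)
qed

section \<open>Tangent spaces and reach\<close>

lemma good_chart_lower:
  assumes "good_chart d M p U g x0 \<delta> \<rho> C" "x \<in> ball x0 \<delta> \<inter> Rdim d" "x' \<in> ball x0 \<delta> \<inter> Rdim d"
  shows "7/8 * norm (x - x') \<le> norm (g x - g x')" "norm (g x - g x') \<le> 9/8 * norm (x - x')"
proof -
  have "x - x' \<in> Rdim d" using assms subspace_diff[OF subspace_Rdim] by auto
  then have "norm (dg U g x0 (x - x')) = norm (x - x')" using assms by (simp add: good_chart_def)
  moreover have "norm (g x - g x' - dg U g x0 (x - x')) \<le> 1/8 * norm (x - x')"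
    using assms by (simp add: good_chart_def)
  ultimately show "7/8 * norm (x - x') \<le> norm (g x - g x')" "norm (g x - g x') \<le> 9/8 * norm (x - x')"
    using norm_triangle_ineq2[of "dg U g x0 (x - x')" "g x - g x'"]
      norm_triangle_ineq2[of "g x - g x'" "dg U g x0 (x - x')"] norm_minus_commute[of "g x - g x'" "dg U g x0 (x - x')"]
    by linarith+
qed

lemma good_chart_lower_deriv:
  assumes "good_chart d M p U g x0 \<delta> \<rho> C" "x \<in> ball x0 \<delta> \<inter> Rdim d" "w \<in> Rdim d"
  shows "7/8 * norm w \<le> norm (dg U g x w)"
proof -
  have "norm (dg U g x0 w) = norm w" "norm (dg U g x w - dg U g x0 w) \<le> 1/8 * norm w"
    using assms by (simp_all add: good_chart_def)
  then show ?thesis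
    using norm_triangle_ineq2[of "dg U g x0 w" "dg U g x w"] norm_minus_commute[of "dg U g x w" "dg U g x0 w"]
    by linarith
qed

lemma has_vector_derivative_eq_0:
  fixes f :: "real \<Rightarrow> 'a::real_normed_vector"
  assumes "(f has_vector_derivative f') (at 0)"
    and "\<And>\<eta>. 0 < \<eta> \<Longrightarrow> \<exists>e>0. \<forall>t. \<bar>t\<bar> < e \<longrightarrow> norm (f t - f 0) \<le> \<eta> * \<bar>t\<bar>"
  shows "f' = 0"
proof -
  have "(f has_vector_derivative 0) (at 0)"
    unfolding has_vector_derivative_def has_derivative_at_alt using assms(2) by auto
  then show ?thesis using assms(1) vector_derivative_unique_at by blast
qed

lemma good_chart_open:
  assumes gc: "good_chart d M p U g x0 \<delta> \<rho> C" and x: "x \<in> ball x0 \<delta> \<inter> Rdim d"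
  shows "\<exists>\<rho>'>0. M \<inter> ball (g x) \<rho>' \<subseteq> g ` (ball x0 \<delta> \<inter> Rdim d)"
proof -
  let ?B = "ball x0 \<delta> \<inter> Rdim d"
  have lp: "local_param d M U g" and BU: "?B \<subseteq> U" using gc by (simp_all add: good_chart_def)
  obtain g' where hg: "homeomorphism U (g ` U) g g'" using lp by (auto simp: local_param_def)
  have "openin (top_of_set U) (U \<inter> ball x0 \<delta>)" by (rule openin_open_Int) simp
  moreover have "U \<inter> ball x0 \<delta> = ?B" using BU local_param_sub[OF lp] by blast
  ultimately have "openin (top_of_set (g ` U)) (g ` ?B)" using homeomorphism_imp_open_map[OF hg] by simp
  then have "openin (top_of_set M) (g ` ?B)"
    using openin_trans lp unfolding local_param_def by blast
  moreover have "g x \<in> g ` ?B" using x by blast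
  ultimately obtain \<rho>' where "\<rho>' > 0" "ball (g x) \<rho>' \<inter> M \<subseteq> g ` ?B"
    unfolding openin_contains_ball by blast
  then show ?thesis by (auto simp: Int_commute)
qed

text \<open>Velocities lie in the image of the derivative because a curve in \<open>M\<close>
  starting at \<open>g x\<close> runs inside the chart, with parameters at distance O(t) from
  \<open>x\<close>, so its component off that image is o(t).\<close>

lemma tangent_space_chart:
  assumes gc: "good_chart d M p U g x0 \<delta> \<rho> C" and x: "x \<in> ball x0 \<delta> \<inter> Rdim d"
  shows "tangent_space M (g x) = dg U g x ` Rdim d"
proof
  let ?B = "ball x0 \<delta> \<inter> Rdim d" and ?E = "Rdim d"
  have lp: "local_param d M U g" and BU: "?B \<subseteq> U" using gc by (simp_all add: good_chart_def)
  obtain \<epsilon> where eps: "\<epsilon> > 0" "ball x \<epsilon> \<subseteq> ball x0 \<delta>" using x openE[OF open_ball, of x x0 \<delta>] by blast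
  have xU: "x \<in> U" using x BU by blast
  note D = local_param_deriv[OF lp]
  show "dg U g x ` ?E \<subseteq> tangent_space M (g x)"
  proof
    fix v assume "v \<in> dg U g x ` ?E"
    then obtain w where w: "w \<in> ?E" "v = dg U g x w" by blast
    obtain e where e: "e > 0" "\<And>t. \<bar>t\<bar> < e \<Longrightarrow> x + t *\<^sub>R w \<in> ball x \<epsilon> \<inter> ?E"
      using line_in_ball[OF subspace_Rdim _ w(1) eps(1)] x by blast
    have inU: "x + t *\<^sub>R w \<in> U" if "\<bar>t\<bar> < e" for t using e(2)[OF that] eps BU by auto
    let ?\<gamma> = "\<lambda>t. g (x + t *\<^sub>R w)"
    have der: "(?\<gamma> has_vector_derivative dg U g (x + s *\<^sub>R w) w) (at s)" if s: "\<bar>s\<bar> < e" for s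
    proof (rule has_derivative_line[OF D[OF inU[OF s]], where e = "e - \<bar>s\<bar>"])
      show "x + t *\<^sub>R w \<in> U" if "\<bar>t - s\<bar> < e - \<bar>s\<bar>" for t using inU[of t] that by linarith
    qed (use s in auto)
    show "v \<in> tangent_space M (g x)"
      unfolding tangent_space_def
    proof (intro CollectI exI[of _ ?\<gamma>] exI[of _ e] conjI)
      show "?\<gamma> ` {-e<..<e} \<subseteq> M" using inU local_param_image[OF lp] by force
      show "?\<gamma> differentiable_on {-e<..<e}"
        unfolding differentiable_on_def
      proof
        fix s assume "s \<in> {-e<..<e}"
        then have "?\<gamma> differentiable (at s)" using der[of s] by (auto simp: abs_less_iff intro: differentiableI_vector)
        then show "?\<gamma> differentiable (at s within {-e<..<e})" by (rule differentiable_at_withinI)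
      qed
      show "(?\<gamma> has_vector_derivative v) (at 0)" using der[of 0] e w by simp
    qed (use e in auto)
  qed
  show "tangent_space M (g x) \<subseteq> dg U g x ` ?E"
  proof
    fix v assume "v \<in> tangent_space M (g x)"
    then obtain \<gamma> e where \<gamma>: "0 < e" "\<gamma> 0 = g x" "\<gamma> ` {-e<..<e} \<subseteq> M" "(\<gamma> has_vector_derivative v) (at 0)"
      unfolding tangent_space_def by blast
    let ?W = "dg U g x ` ?E"
    have lG: "linear (dg U g x)" using D[OF xU] by (rule has_derivative_linear)
    have "inj_on (dg U g x) ?E"
      by (subst linear_inj_on_iff_eq_0[OF lG subspace_Rdim]) (use local_param_inj[OF lp xU] in auto)
    then have fW: "findim ?W" using dim_inj_image[OF findim_Rdim lG] by blast
    let ?P = "\<lambda>y. y - oproj ?W y"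
    have bP: "bounded_linear ?P" by (intro bounded_linear_sub bounded_linear_ident bounded_linear_oproj fW)
    have P0: "?P (dg U g x w) = 0" if "w \<in> ?E" for w
      using that oproj_id[OF findim_subspace[OF fW]] by auto
    have derP: "((\<lambda>t. ?P (\<gamma> t)) has_vector_derivative ?P v) (at 0)"
      by (rule bounded_linear.has_vector_derivative[OF bP \<gamma>(4)])
    have "?P v = 0"
    proof (rule has_vector_derivative_eq_0[OF derP])
      fix \<eta> :: real assume \<eta>: "0 < \<eta>"
      define \<eta>' where "\<eta>' = \<eta> / (2 * (norm v + 1))"
      have nv: "0 < norm v + 1" by (simp add: add_nonneg_pos)
      have \<eta>': "\<eta>' > 0" using \<eta> nv by (simp add: \<eta>'_def)
      obtain \<delta>' where d': "\<delta>' > 0" "\<And>y. y \<in> U \<Longrightarrow> norm (y - x) < \<delta>' \<Longrightarrow>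
          norm (g y - g x - dg U g x (y - x)) \<le> \<eta>' * norm (y - x)"
        using D[OF xU] \<eta>' unfolding has_derivative_within_alt by blast
      obtain \<rho>' where r': "\<rho>' > 0" "M \<inter> ball (g x) \<rho>' \<subseteq> g ` ?B" using good_chart_open[OF gc x] by blast
      \<comment> \<open>The difference quotient with tolerance 1 already gives growth of
        \<open>\<gamma>\<close> at rate at most \<open>norm v + 1\<close>.\<close>
      obtain e1 where e1: "e1 > 0" "\<And>t. norm (t - 0) < e1 \<Longrightarrow> norm (\<gamma> t - \<gamma> 0 - (t - 0) *\<^sub>R v) \<le> 1 * norm (t - 0)"
        using \<gamma>(4) unfolding has_vector_derivative_def has_derivative_at_alt by (metis zero_less_one)
      have \<gamma>l: "norm (\<gamma> t - g x) \<le> (norm v + 1) * \<bar>t\<bar>" if "\<bar>t\<bar> < e1" for t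
        using e1(2)[of t] that norm_triangle_sub[of "\<gamma> t - g x" "t *\<^sub>R v"] \<gamma>(2) by (simp add: algebra_simps)
      define e2 where "e2 = min (min e e1) (min (\<rho>' / (norm v + 1)) (\<delta>' / (2 * (norm v + 1))))"
      show "\<exists>e>0. \<forall>t. \<bar>t\<bar> < e \<longrightarrow> norm (?P (\<gamma> t) - ?P (\<gamma> 0)) \<le> \<eta> * \<bar>t\<bar>"
      proof (rule exI[of _ e2], intro conjI allI impI)
        show "0 < e2" using \<gamma>(1) e1(1) r'(1) d'(1) nv by (simp add: e2_def)
        fix t assume t: "\<bar>t\<bar> < e2"
        then have tt: "\<bar>t\<bar> < e" "\<bar>t\<bar> < e1" "(norm v + 1) * \<bar>t\<bar> < \<rho>'" "2 * (norm v + 1) * \<bar>t\<bar> < \<delta>'"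
          using nv by (auto simp: e2_def field_simps)
        have "\<gamma> t \<in> M" using \<gamma>(3) tt(1) by (auto simp: abs_less_iff)
        moreover have "dist (g x) (\<gamma> t) < \<rho>'" using \<gamma>l[OF tt(2)] tt(3) by (simp add: dist_norm norm_minus_commute)
        ultimately obtain y where y: "y \<in> ?B" "\<gamma> t = g y" using r'(2) by auto
        have nyx: "norm (y - x) \<le> 2 * norm (\<gamma> t - g x)"
          using good_chart_lower(1)[OF gc y(1) x] norm_ge_zero[of "y - x"] unfolding y(2) by linarith
        also have "\<dots> \<le> 2 * ((norm v + 1) * \<bar>t\<bar>)" using \<gamma>l[OF tt(2)] by simp
        finally have n2: "norm (y - x) \<le> 2 * ((norm v + 1) * \<bar>t\<bar>)" .
        have "?P (\<gamma> t) - ?P (\<gamma> 0) = ?P (g y - g x - dg U g x (y - x))"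
          using P0[of "y - x"] x y \<gamma>(2) subspace_diff[OF subspace_Rdim] oproj_diff[OF fW] by auto
        also have "norm \<dots> \<le> norm (g y - g x - dg U g x (y - x))" by (rule norm_oproj_diff_le[OF fW])
        also have "\<dots> \<le> \<eta>' * norm (y - x)" using d'(2)[of y] y BU n2 tt(4) by auto
        also have "\<dots> \<le> \<eta>' * (2 * ((norm v + 1) * \<bar>t\<bar>))" using n2 \<eta>' by (intro mult_left_mono) auto
        also have "\<dots> = \<eta> * \<bar>t\<bar>"
        proof -
          have "\<eta>' * (2 * (norm v + 1)) = \<eta>" unfolding \<eta>'_def using nv by simp
          then show ?thesis by (metis mult.assoc)
        qed
        finally show "norm (?P (\<gamma> t) - ?P (\<gamma> 0)) \<le> \<eta> * \<bar>t\<bar>" .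
      qed
    qed
    then show "v \<in> ?W" using oproj_in[OF fW, of v] by simp
  qed
qed

text \<open>Pointwise facts read off a good chart. The radii and the quadratic constant depend on
  the point; they only start the arguments that give bounds in terms of
  \<open>\<tau>\<close>.\<close>

lemma
  assumes "submanifold D d M" "p \<in> M"
  shows findim_tangent: "findim (tangent_space M p)"
    and dim_tangent: "dim (tangent_space M p) = d"
    and tangent_sub: "tangent_space M p \<subseteq> Rdim D"
    and normal_quadratic: "\<exists>C\<ge>0. \<exists>\<rho>>0. \<forall>q\<in>M \<inter> ball p \<rho>.
      norm (q - p - oproj (tangent_space M p) (q - p)) \<le> C * (norm (q - p))\<^sup>2"
    and tilt_local: "\<exists>\<rho>>0. \<forall>q\<in>M \<inter> ball p \<rho>.
      (\<forall>e\<in>tangent_space M q. norm (e - oproj (tangent_space M p) e) \<le> 1/4 * norm e) \<and>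
      (\<forall>e\<in>tangent_space M p. norm (e - oproj (tangent_space M q) e) \<le> 1/4 * norm e)"
proof -
  obtain U g x0 \<delta> \<rho> C where gc: "good_chart d M p U g x0 \<delta> \<rho> C" using good_chart_ex[OF assms] by blast
  let ?B = "ball x0 \<delta> \<inter> Rdim d" and ?E = "Rdim d" and ?G = "dg U g"
  have lp: "local_param d M U g" and x0: "x0 \<in> U" "g x0 = p" and BU: "?B \<subseteq> U" and dpos: "0 < \<delta>"
    and rho: "0 < \<rho>" "M \<inter> ball p \<rho> \<subseteq> g ` ?B" and C0: "0 \<le> C"
    using gc by (simp_all add: good_chart_def)
  have x0B: "x0 \<in> ?B" using x0 dpos local_param_sub[OF lp] by auto
  have fW: "findim (?G x ` ?E) \<and> dim (?G x ` ?E) = d" if "x \<in> ?B" for x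
  proof -
    have xU: "x \<in> U" using that BU by blast
    have lG: "linear (?G x)" using local_param_deriv[OF lp xU] by (rule has_derivative_linear)
    have "inj_on (?G x) ?E"
      by (subst linear_inj_on_iff_eq_0[OF lG subspace_Rdim]) (use local_param_inj[OF lp xU] in auto)
    then show ?thesis using dim_inj_image[OF findim_Rdim lG] dim_Rdim by metis
  qed
  note T = tangent_space_chart[OF gc]
  have Tp: "tangent_space M p = ?G x0 ` ?E" using T[OF x0B] x0 by simp
  show "findim (tangent_space M p)" "dim (tangent_space M p) = d" using fW[OF x0B] Tp by simp_all
  show "tangent_space M p \<subseteq> Rdim D"
  proof
    fix v assume "v \<in> tangent_space M p"
    then obtain \<gamma> e where \<gamma>: "0 < e" "\<gamma> 0 = p" "\<gamma> ` {-e<..<e} \<subseteq> M" "(\<gamma> has_vector_derivative v) (at 0)"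
      unfolding tangent_space_def by blast
    let ?P = "\<lambda>y. y - oproj (Rdim D) y"
    have bP: "bounded_linear ?P" by (intro bounded_linear_sub bounded_linear_ident bounded_linear_oproj findim_Rdim)
    have "((\<lambda>t. ?P (\<gamma> t)) has_vector_derivative ?P v) (at 0)"
      by (rule bounded_linear.has_vector_derivative[OF bP \<gamma>(4)])
    then have "?P v = 0"
    proof (rule has_vector_derivative_eq_0)
      have MD: "M \<subseteq> Rdim D" using assms by (simp add: submanifold_def)
      have "?P (\<gamma> t) = 0" if "\<bar>t\<bar> < e" for t
      proof -
        have "\<gamma> t \<in> Rdim D" using \<gamma>(3) MD that by (auto simp: abs_less_iff image_subset_iff)
        then show ?thesis by (simp add: oproj_id subspace_Rdim)
      qed
      then show "\<exists>e>0. \<forall>t. \<bar>t\<bar> < e \<longrightarrow> norm (?P (\<gamma> t) - ?P (\<gamma> 0)) \<le> \<eta> * \<bar>t\<bar>" if "0 < \<eta>" for \<eta> :: real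
        using that \<gamma>(1) by (intro exI[of _ e]) auto
    qed
    then show "v \<in> Rdim D" using oproj_in[OF findim_Rdim, of D v] by simp
  qed
  show "\<exists>C\<ge>0. \<exists>\<rho>>0. \<forall>q\<in>M \<inter> ball p \<rho>.
      norm (q - p - oproj (tangent_space M p) (q - p)) \<le> C * (norm (q - p))\<^sup>2"
  proof (rule exI[of _ "4 * C"], intro conjI exI[of _ \<rho>] ballI)
    fix q assume "q \<in> M \<inter> ball p \<rho>"
    then obtain x where x: "x \<in> ?B" "q = g x" using rho by blast
    have "x - x0 \<in> ?E" using x x0B subspace_diff[OF subspace_Rdim] by auto
    then have "norm (q - p - oproj (tangent_space M p) (q - p)) \<le> norm (q - p - ?G x0 (x - x0))"
      using oproj_best[OF fW[OF x0B, THEN conjunct1], of "?G x0 (x - x0)" "q - p"] Tp by simp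
    also have "\<dots> \<le> C * (norm (x - x0))\<^sup>2" using gc x x0 by (auto simp: good_chart_def)
    also have "\<dots> \<le> C * (2 * norm (q - p))\<^sup>2"
    proof (intro mult_left_mono power_mono C0)
      show "norm (x - x0) \<le> 2 * norm (q - p)"
        using good_chart_lower(1)[OF gc x(1) x0B] norm_ge_zero[of "x - x0"] unfolding x(2) x0(2) by linarith
    qed auto
    finally show "norm (q - p - oproj (tangent_space M p) (q - p)) \<le> 4 * C * (norm (q - p))\<^sup>2"
      by (simp add: power_mult_distrib)
  qed (use C0 rho in auto)
  show "\<exists>\<rho>>0. \<forall>q\<in>M \<inter> ball p \<rho>.
      (\<forall>e\<in>tangent_space M q. norm (e - oproj (tangent_space M p) e) \<le> 1/4 * norm e) \<and>
      (\<forall>e\<in>tangent_space M p. norm (e - oproj (tangent_space M q) e) \<le> 1/4 * norm e)"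
  proof (intro exI[of _ \<rho>] conjI ballI rho(1))
    fix q assume "q \<in> M \<inter> ball p \<rho>"
    then obtain x where x: "x \<in> ?B" "q = g x" using rho by blast
    have Tq: "tangent_space M q = ?G x ` ?E" using T[OF x(1)] x by simp
    { fix e assume "e \<in> tangent_space M q"
      then obtain w where w: "w \<in> ?E" "e = ?G x w" using Tq by blast
      have "norm (e - oproj (tangent_space M p) e) \<le> norm (?G x w - ?G x0 w)"
        using oproj_best[OF fW[OF x0B, THEN conjunct1], of "?G x0 w" e] Tp w by simp
      also have "\<dots> \<le> 1/8 * norm w" using gc x w by (auto simp: good_chart_def)
      also have "\<dots> \<le> 1/4 * norm e" using good_chart_lower_deriv[OF gc x(1) w(1)] norm_ge_zero[of w] unfolding w(2) by linarith
      finally show "norm (e - oproj (tangent_space M p) e) \<le> 1/4 * norm e" . }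
    { fix e assume "e \<in> tangent_space M p"
      then obtain w where w: "w \<in> ?E" "e = ?G x0 w" using Tp by blast
      have "norm (e - oproj (tangent_space M q) e) \<le> norm (?G x0 w - ?G x w)"
        using oproj_best[OF fW[OF x(1), THEN conjunct1], of "?G x w" e] Tq w by simp
      also have "\<dots> \<le> 1/8 * norm w" using gc x w by (subst norm_minus_commute) (auto simp: good_chart_def)
      also have "\<dots> \<le> 1/4 * norm e" using good_chart_lower_deriv[OF gc x0B w(1)] norm_ge_zero[of w] unfolding w(2) by linarith
      finally show "norm (e - oproj (tangent_space M q) e) \<le> 1/4 * norm e" . }
  qed
qed

section \<open>Nearest points and Federer's inequality\<close>

definition mfd where
  "mfd D d \<tau> M \<longleftrightarrow> submanifold D d M \<and> 0 < \<tau> \<and> ereal \<tau> \<le> reach D M"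

definition nearest :: "evec set \<Rightarrow> evec \<Rightarrow> evec \<Rightarrow> bool" where
  "nearest M z q \<longleftrightarrow> q \<in> M \<and> (\<forall>y\<in>M. norm (z - q) \<le> norm (z - y))"

lemma nearest_ex:
  assumes "submanifold D d M" shows "\<exists>q. nearest M z q"
proof -
  have "compact M" "M \<noteq> {}" using assms by (auto simp: submanifold_def)
  then obtain q where "q \<in> M" "\<forall>y\<in>M. norm (z - q) \<le> norm (z - y)"
  proof -
    assume "compact M" "M \<noteq> {}"
    moreover have "continuous_on M (\<lambda>q. norm (z - q))" by (intro continuous_intros)
    ultimately show thesis using continuous_attains_inf[of M "\<lambda>q. norm (z - q)"] that by blast
  qed
  then show ?thesis by (auto simp: nearest_def)
qed

lemma nearest_infdist: "nearest M z q \<Longrightarrow> infdist z M = norm (z - q)"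
proof -
  assume n: "nearest M z q"
  have "infdist z M \<le> dist z q" using n by (intro infdist_le) (simp add: nearest_def)
  moreover have "dist z q \<le> infdist z M"
    using n unfolding nearest_def dist_norm[symmetric] by (subst infdist_notempty) (auto intro: cINF_greatest)
  ultimately show ?thesis by (simp add: dist_norm)
qed

lemma nearest_unique:
  assumes "mfd D d \<tau> M" "z \<in> Rdim D" "nearest M z q" "nearest M z q'" "norm (z - q) < \<tau>"
  shows "q' = q"
proof (rule ccontr)
  assume ne: "q' \<noteq> q"
  have q: "q \<in> M" "q' \<in> M" using assms by (auto simp: nearest_def)
  have "z \<in> medial_axis D M"
    unfolding medial_axis_def using assms(2) q ne nearest_infdist[OF assms(3)] nearest_infdist[OF assms(4)]
    by (metis (mono_tags, lifting) mem_Collect_eq)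
  then have "reach D M \<le> ereal (dist q z)"
    unfolding reach_def by (intro INF_lower2[OF q(1)] INF_lower)
  then have "ereal \<tau> \<le> ereal (dist q z)" using assms(1) order_trans unfolding mfd_def by blast
  then show False using assms(5) by (simp add: dist_norm norm_minus_commute)
qed

lemma nearest_normal:
  assumes "nearest M z q" "v \<in> tangent_space M q"
  shows "(z - q) \<bullet> v = 0"
proof -
  obtain \<gamma> e where \<gamma>: "0 < e" "\<gamma> 0 = q" "\<gamma> ` {-e<..<e} \<subseteq> M" "(\<gamma> has_vector_derivative v) (at 0)"
    using assms(2) unfolding tangent_space_def by blast
  let ?\<phi> = "\<lambda>t. (z - \<gamma> t) \<bullet> (z - \<gamma> t)"
  have "(?\<phi> has_derivative (\<lambda>h. (z - \<gamma> 0) \<bullet> (0 - h *\<^sub>R v) + (0 - h *\<^sub>R v) \<bullet> (z - \<gamma> 0))) (at 0)"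
    using \<gamma>(4) unfolding has_vector_derivative_def
    by (intro has_derivative_inner has_derivative_diff has_derivative_const)
  moreover have "(\<lambda>h. (z - \<gamma> 0) \<bullet> (0 - h *\<^sub>R v) + (0 - h *\<^sub>R v) \<bullet> (z - \<gamma> 0)) = times (- 2 * ((z - q) \<bullet> v))"
    by (auto simp: \<gamma>(2) fun_eq_iff inner_commute)
  ultimately have "DERIV ?\<phi> 0 :> - 2 * ((z - q) \<bullet> v)" by (simp add: has_field_derivative_def)
  moreover have "\<forall>y. \<bar>0 - y\<bar> < e \<longrightarrow> ?\<phi> 0 \<le> ?\<phi> y"
  proof (intro allI impI)
    fix y assume "\<bar>0 - y\<bar> < e"
    then have "\<gamma> y \<in> M" using \<gamma>(3) by (auto simp: abs_less_iff image_subset_iff)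
    then have "norm (z - \<gamma> 0) \<le> norm (z - \<gamma> y)" using assms(1) \<gamma>(2) by (auto simp: nearest_def)
    then show "?\<phi> 0 \<le> ?\<phi> y" by (simp add: norm_eq_sqrt_inner)
  qed
  ultimately have "- 2 * ((z - q) \<bullet> v) = 0" using DERIV_local_min \<gamma>(1) by blast
  then show ?thesis by simp
qed

text \<open>By compactness, points of \<open>M\<close> away from the unique nearest point are
  farther from \<open>z\<close> by a positive gap; moving \<open>z\<close> by less than half the gap
  cannot make one of them nearest.\<close>

lemma nearest_continuous:
  assumes "submanifold D d M" "nearest M z q" "\<And>q'. nearest M z q' \<Longrightarrow> q' = q" "0 < \<epsilon>"
  shows "\<exists>\<eta>>0. \<forall>z' q'. norm (z' - z) < \<eta> \<longrightarrow> nearest M z' q' \<longrightarrow> norm (q' - q) < \<epsilon>"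
proof (cases "M - ball q \<epsilon> = {}")
  case True
  then show ?thesis
    by (intro exI[of _ 1]) (auto simp: nearest_def dist_norm norm_minus_commute)
next
  case False
  let ?K = "M - ball q \<epsilon>"
  have "compact ?K" using assms(1) by (intro compact_diff open_ball) (simp add: submanifold_def)
  then obtain y0 where y0: "y0 \<in> ?K" "\<forall>y\<in>?K. norm (z - y0) \<le> norm (z - y)"
  proof -
    assume "compact ?K"
    moreover have "continuous_on ?K (\<lambda>q. norm (z - q))" by (intro continuous_intros)
    ultimately show thesis using False continuous_attains_inf[of ?K "\<lambda>q. norm (z - q)"] that by blast
  qed
  have "norm (z - q) < norm (z - y0)"
  proof (rule ccontr)
    assume "\<not> ?thesis"
    then have "nearest M z y0" using assms(2) y0(1) by (force simp: nearest_def)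
    then have "y0 = q" by (rule assms(3))
    then show False using y0 assms(4) by auto
  qed
  then show ?thesis
  proof (intro exI[of _ "(norm (z - y0) - norm (z - q)) / 2"] conjI allI impI)
    fix z' q' assume z': "norm (z' - z) < (norm (z - y0) - norm (z - q)) / 2" "nearest M z' q'"
    show "norm (q' - q) < \<epsilon>"
    proof (rule ccontr)
      assume "\<not> ?thesis"
      then have "q' \<in> ?K" using z'(2) by (auto simp: nearest_def dist_norm norm_minus_commute)
      then have "norm (z - y0) \<le> norm (z - q')" using y0 by blast
      moreover have "norm (z - q') \<le> norm (z' - z) + norm (z' - q')"
        using norm_triangle_ineq[of "z - z'" "z' - q'"] by (simp add: norm_minus_commute)
      moreover have "norm (z' - q') \<le> norm (z' - q)" using z'(2) assms(2) by (auto simp: nearest_def)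
      moreover have "norm (z' - q) \<le> norm (z' - z) + norm (z - q)"
        using norm_triangle_ineq[of "z' - z" "z - q"] by simp
      moreover have "2 * norm (z' - z) < norm (z - y0) - norm (z - q)" using z'(1) by simp
      ultimately show False by linarith
    qed
  qed auto
qed

text \<open>Quadratic contact: the ball of radius \<open>t\<close> resting on \<open>M\<close> at
  \<open>p\<close> avoids the nearby part of \<open>M\<close> once \<open>2 * t * C\<close> is at
  most 1, and the remaining points are at distance at least \<open>2 * t\<close> from
  \<open>p\<close>.\<close>

lemma normal_small:
  assumes "submanifold D d M" "p \<in> M" "norm v = 1" "\<And>w. w \<in> tangent_space M p \<Longrightarrow> v \<bullet> w = 0"
  shows "\<exists>t>0. \<forall>q\<in>M. t \<le> norm (p + t *\<^sub>R v - q)"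
proof -
  obtain C \<rho> where C: "0 \<le> C" "0 < \<rho>" "\<And>q. q \<in> M \<inter> ball p \<rho> \<Longrightarrow>
      norm (q - p - oproj (tangent_space M p) (q - p)) \<le> C * (norm (q - p))\<^sup>2"
    using normal_quadratic[OF assms(1,2)] by blast
  define t where "t = min (\<rho> / 2) (1 / (2 * (C + 1)))"
  have t: "0 < t" "t \<le> \<rho> / 2" "t * (2 * C) \<le> 1"
  proof -
    show "0 < t" "t \<le> \<rho> / 2" using C by (auto simp: t_def)
    have "t \<le> 1 / (2 * (C + 1))" by (simp add: t_def)
    then have "t * (2 * (C + 1)) \<le> 1" using C by (simp add: field_simps)
    then show "t * (2 * C) \<le> 1" using \<open>0 < t\<close> by (simp add: algebra_simps)
  qed
  have "t \<le> norm (p + t *\<^sub>R v - q)" if q: "q \<in> M" for q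
  proof (cases "norm (q - p) < \<rho>")
    case False
    then show ?thesis using norm_triangle_ineq2[of "q - p" "t *\<^sub>R v"] assms(3) t
      by (simp add: norm_minus_commute algebra_simps)
  next
    case True
    let ?n = "q - p - oproj (tangent_space M p) (q - p)"
    have "norm ?n \<le> C * (norm (q - p))\<^sup>2" using C(3)[of q] q True by (simp add: dist_norm norm_minus_commute)
    moreover have "v \<bullet> (q - p) = v \<bullet> ?n"
      using assms(4)[OF oproj_in[OF findim_tangent[OF assms(1,2)]]] by (simp add: inner_diff_right)
    ultimately have "v \<bullet> (q - p) \<le> C * (norm (q - p))\<^sup>2"
      using norm_cauchy_schwarz[of v ?n] assms(3) by simp
    then have "2 * t * (v \<bullet> (q - p)) \<le> 2 * t * (C * (norm (q - p))\<^sup>2)" using t by (intro mult_left_mono) auto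
    also have "\<dots> \<le> 1 * (norm (q - p))\<^sup>2"
      using mult_right_mono[OF t(3), of "(norm (q - p))\<^sup>2"] by (simp add: algebra_simps)
    finally have "t\<^sup>2 \<le> t\<^sup>2 - 2 * t * (v \<bullet> (q - p)) + (norm (q - p))\<^sup>2" by simp
    also have "\<dots> = (norm (p + t *\<^sub>R v - q))\<^sup>2"
    proof -
      have "p + t *\<^sub>R v - q = t *\<^sub>R v - (q - p)" by simp
      then have "(norm (p + t *\<^sub>R v - q))\<^sup>2 = (t *\<^sub>R v - (q - p)) \<bullet> (t *\<^sub>R v - (q - p))"
        by (simp only: power2_norm_eq_inner)
      also have "\<dots> = t * t * (v \<bullet> v) - 2 * t * (v \<bullet> (q - p)) + (q - p) \<bullet> (q - p)"
        unfolding inner_diff_left[of "t *\<^sub>R v"] inner_diff_right[of _ "t *\<^sub>R v"]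
        by (simp add: inner_commute[of "q - p" v] del: inner_diff_left inner_diff_right)
      finally show ?thesis using assms(3) by (simp add: dot_square_norm power2_eq_square)
    qed
    finally show ?thesis by (rule power2_le_imp_le) simp
  qed
  then show ?thesis using t by blast
qed

text \<open>If the ball of radius \<open>T\<close> resting on \<open>M\<close> at \<open>p\<close> misses \<open>M\<close>, then so does a slightly larger one.
  The maximiser of a tilted distance function lies on a small sphere around the centre, for otherwise
  moving away from the (unique) nearest point would increase it; equality in the triangle inequality
  then identifies the limit.\<close>

lemma normal_step:
  assumes m: "mfd D d \<tau> M" and p: "p \<in> M" and v: "v \<in> Rdim D" "norm v = 1"
    and T: "0 < T" "T < \<tau>" and ok: "\<forall>q\<in>M. T \<le> norm (p + T *\<^sub>R v - q)"
  shows "\<exists>s>0. \<forall>q\<in>M. T + s \<le> norm (p + (T + s) *\<^sub>R v - q)"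
proof -
  have sm: "submanifold D d M" and MD: "M \<subseteq> Rdim D" using m by (auto simp: mfd_def submanifold_def)
  \<comment> \<open>Keeps the distances to \<open>M\<close> met below at most \<open>T + s\<close>,
    hence below \<open>\<tau>\<close>, where nearest points are unique.\<close>
  define s where "s = (\<tau> - T) / 2"
  have s: "0 < s" "T + s < \<tau>" using T by (auto simp: s_def field_simps)
  let ?z0 = "p + T *\<^sub>R v" and ?\<delta> = "\<lambda>z. infdist z M"
  have z0D: "?z0 \<in> Rdim D" using p MD v by (auto intro: subspace_add subspace_scale subspace_Rdim)
  have "nearest M ?z0 p" using p ok T v by (auto simp: nearest_def)
  then have dz0: "?\<delta> ?z0 = T" using nearest_infdist T v by fastforce
  let ?B = "cball ?z0 s \<inter> Rdim D"
  have cB: "compact ?B" by (rule compact_findim[OF findim_Rdim])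
  have z0B: "?z0 \<in> ?B" using z0D s by auto
  \<comment> \<open>The distance to \<open>M\<close> is maximised with a penalty of slope
    \<open>1 - \<eta>\<close>. At an interior maximiser, moving away from the nearest point would
    gain almost slope 1, a contradiction.\<close>
  have claim: "\<exists>z\<in>?B. T + (1 - \<eta>) * s \<le> ?\<delta> z" if \<eta>: "0 < \<eta>" "\<eta> < 1" for \<eta>
  proof -
    obtain z where z: "z \<in> ?B" "\<forall>y\<in>?B. ?\<delta> y - (1 - \<eta>) * norm (y - ?z0) \<le> ?\<delta> z - (1 - \<eta>) * norm (z - ?z0)"
    proof -
      have "continuous_on ?B (\<lambda>z. ?\<delta> z - (1 - \<eta>) * norm (z - ?z0))" by (intro continuous_intros)
      then show thesis using continuous_attains_sup[OF cB, of "\<lambda>z. ?\<delta> z - (1 - \<eta>) * norm (z - ?z0)"] z0B that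
        by blast
    qed
    have dz: "T + (1 - \<eta>) * norm (z - ?z0) \<le> ?\<delta> z" using z(2)[rule_format, OF z0B] dz0 by simp
    have nz: "norm (z - ?z0) \<le> s" using z(1) by (simp add: dist_norm norm_minus_commute)
    have "norm (z - ?z0) = s"
    proof (rule ccontr)
      assume "norm (z - ?z0) \<noteq> s"
      then have lt: "norm (z - ?z0) < s" using nz by simp
      obtain q where q: "nearest M z q" using nearest_ex[OF sm] by blast
      define a where "a = norm (z - q)"
      have a: "a = ?\<delta> z" using nearest_infdist[OF q] by (simp add: a_def)
      have "0 \<le> (1 - \<eta>) * norm (z - ?z0)" using \<eta> by simp
      then have aT: "T \<le> a" using dz a by linarith
      have "a \<le> T + s" using infdist_triangle_abs[of z M ?z0] dz0 nz a by (simp add: dist_norm)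
      then have a\<tau>: "norm (z - q) < \<tau>" using s by (simp add: a_def)
      have uq: "q' = q" if "nearest M z q'" for q'
        using nearest_unique[OF m _ q that a\<tau>] z(1) by blast
      have "0 < \<eta> * a / 4" using \<eta> aT T by simp
      \<comment> \<open>Nearest points of perturbed centres stay so close to \<open>q\<close> that
        pushing out by \<open>e\<close> gains at least \<open>e * (1 - \<eta> / 2)\<close>.\<close>
      then obtain \<eta>' where \<eta>': "0 < \<eta>'" "\<And>z' q'. norm (z' - z) < \<eta>' \<Longrightarrow> nearest M z' q' \<Longrightarrow> norm (q' - q) < \<eta> * a / 4"
        using nearest_continuous[OF sm q uq] by blast
      define e where "e = min (\<eta>' / 2) (s - norm (z - ?z0))"
      have e: "0 < e" "e < \<eta>'" "e \<le> s - norm (z - ?z0)" using \<eta>' lt by (auto simp: e_def)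
      define u where "u = (1 / a) *\<^sub>R (z - q)"
      have u: "norm u = 1" "u \<bullet> (z - q) = a"
        using aT T by (auto simp: u_def a_def dot_square_norm power2_eq_square)
      let ?z' = "z + e *\<^sub>R u"
      obtain q' where q': "nearest M ?z' q'" using nearest_ex[OF sm] by blast
      have qq: "norm (q' - q) < \<eta> * a / 4" using \<eta>'(2)[of ?z' q'] q' e u by simp
      have qM: "q \<in> M" "q' \<in> M" using q q' by (auto simp: nearest_def)
      have "u \<in> Rdim D" unfolding u_def using z qM MD by (auto intro: subspace_scale subspace_diff subspace_Rdim)
      moreover have nz': "norm (?z' - ?z0) \<le> norm (z - ?z0) + e"
        using norm_triangle_ineq[of "z - ?z0" "e *\<^sub>R u"] u e by (simp add: algebra_simps)
      ultimately have z'B: "?z' \<in> ?B"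
        using z e by (auto simp: dist_norm norm_minus_commute[of ?z0] intro: subspace_add subspace_scale subspace_Rdim)
      have "(a + e * (1 - \<eta> / 2))\<^sup>2 \<le> (norm (?z' - q'))\<^sup>2"
      proof -
        have "u \<bullet> (q' - q) \<le> \<eta> * a / 4" using norm_cauchy_schwarz[of u "q' - q"] u qq by simp
        then have 1: "a - \<eta> * a / 4 \<le> u \<bullet> (z - q')" using u(2) by (simp add: inner_diff_right)
        have "a \<le> norm (z - q')" using q qM by (auto simp: nearest_def a_def)
        then have 2: "a\<^sup>2 \<le> (norm (z - q'))\<^sup>2" using aT T by (intro power_mono) auto
        have "(norm (?z' - q'))\<^sup>2 = (norm (z - q'))\<^sup>2 + 2 * e * (u \<bullet> (z - q')) + e\<^sup>2"
        proof -
          have "?z' - q' = (z - q') + e *\<^sub>R u" by simp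
          then have "(norm (?z' - q'))\<^sup>2 = ((z - q') + e *\<^sub>R u) \<bullet> ((z - q') + e *\<^sub>R u)" by (simp only: power2_norm_eq_inner)
          also have "\<dots> = (z - q') \<bullet> (z - q') + 2 * e * (u \<bullet> (z - q')) + e * e * (u \<bullet> u)"
            by (simp only: inner_add_left inner_add_right inner_commute[of "z - q'" u] inner_scaleR_left inner_scaleR_right) 
               (simp add: inner_commute algebra_simps)
          finally show ?thesis using u(1) by (simp add: dot_square_norm power2_eq_square)
        qed
        moreover have "2 * e * (a - \<eta> * a / 4) \<le> 2 * e * (u \<bullet> (z - q'))" using 1 e by (intro mult_left_mono) auto
        moreover have "(a + e * (1 - \<eta> / 2))\<^sup>2 \<le> a\<^sup>2 + 2 * e * (a - \<eta> * a / 4) + e\<^sup>2"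
        proof -
          have "a\<^sup>2 + 2 * e * (a - \<eta> * a / 4) + e\<^sup>2 - (a + e * (1 - \<eta> / 2))\<^sup>2 = e * \<eta> * a / 2 + e\<^sup>2 * (\<eta> * (1 - \<eta> / 4))"
            by (simp add: power2_eq_square algebra_simps)
          moreover have "0 \<le> e * \<eta> * a / 2" "0 \<le> e\<^sup>2 * (\<eta> * (1 - \<eta> / 4))" using e \<eta> aT T by auto
          ultimately show ?thesis by linarith
        qed
        ultimately show ?thesis using 2 by linarith
      qed
      then have "a + e * (1 - \<eta> / 2) \<le> norm (?z' - q')" by (rule power2_le_imp_le) simp
      then have "a + e * (1 - \<eta> / 2) \<le> ?\<delta> ?z'" using nearest_infdist[OF q'] by simp
      moreover have "?\<delta> ?z' - (1 - \<eta>) * norm (?z' - ?z0) \<le> a - (1 - \<eta>) * norm (z - ?z0)"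
        using z(2)[rule_format, OF z'B] a by simp
      moreover have "(1 - \<eta>) * norm (?z' - ?z0) \<le> (1 - \<eta>) * (norm (z - ?z0) + e)"
        using nz' \<eta> by (intro mult_left_mono) auto
      ultimately have "e * (1 - \<eta> / 2) \<le> (1 - \<eta>) * e" by (simp add: algebra_simps)
      then have "e * \<eta> \<le> 0" by (simp add: algebra_simps)
      then show False using e \<eta> by (simp add: mult_le_0_iff)
    qed
    then show ?thesis using z(1) dz by auto
  qed
  obtain z where z: "z \<in> ?B" "\<forall>y\<in>?B. ?\<delta> y \<le> ?\<delta> z"
  proof -
    have "continuous_on ?B ?\<delta>" by (intro continuous_intros)
    then show thesis using continuous_attains_sup[OF cB, of ?\<delta>] z0B that by blast
  qed
  have "T + s \<le> ?\<delta> z"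
  proof (rule field_le_epsilon)
    fix e :: real assume e: "0 < e"
    define \<eta> where "\<eta> = min (1/2) (e / s)"
    have \<eta>: "0 < \<eta>" "\<eta> < 1" "\<eta> * s \<le> e" using e s by (auto simp: \<eta>_def min_def field_simps)
    obtain y where "y \<in> ?B" "T + (1 - \<eta>) * s \<le> ?\<delta> y" using claim[OF \<eta>(1,2)] by blast
    then have "T + (1 - \<eta>) * s \<le> ?\<delta> z" using z(2) by force
    then show "T + s \<le> ?\<delta> z + e" using \<eta>(3) by (simp add: algebra_simps)
  qed
  moreover have "?\<delta> z \<le> norm (z - p)" using infdist_le[OF p] by (simp add: dist_norm)
  moreover have nz: "norm (z - ?z0) \<le> s" using z(1) by (simp add: dist_norm norm_minus_commute)
  moreover have "norm (z - p) \<le> norm (z - ?z0) + T"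
    using norm_triangle_ineq[of "z - ?z0" "T *\<^sub>R v"] v T by simp
  \<comment> \<open>The chain \<open>T + s \<le> ?\<delta> z \<le> norm (z - p) \<le> norm (z - ?z0)
    + T \<le> s + T\<close> collapses to equalities.\<close>
  ultimately have eqs: "norm (z - ?z0) = s" "norm ((z - ?z0) + T *\<^sub>R v) = norm (z - ?z0) + norm (T *\<^sub>R v)"
    "T + s \<le> ?\<delta> z" using v T by auto
  have "s *\<^sub>R (T *\<^sub>R v) = T *\<^sub>R (z - ?z0)"
    using eqs(2) unfolding norm_triangle_eq using eqs(1) v T by simp
  then have "T *\<^sub>R (s *\<^sub>R v) = T *\<^sub>R (z - ?z0)" by (simp add: mult.commute)
  then have "z - ?z0 = s *\<^sub>R v" using T by (metis less_irrefl scaleR_left_imp_eq)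
  then have "z = p + (T + s) *\<^sub>R v" by (simp add: algebra_simps)
  then have "\<forall>q\<in>M. T + s \<le> norm (p + (T + s) *\<^sub>R v - q)"
    using eqs(3) infdist_le[of _ M z] by (force simp: dist_norm)
  then show ?thesis using s by blast
qed

text \<open>Continuation in the radius: the admissible radii contain a small one, are closed under
  decrease and under suprema, and by \<open>normal_step\<close> their supremum cannot lie below
  \<open>t\<close>.\<close>

lemma normal_ball:
  assumes m: "mfd D d \<tau> M" and p: "p \<in> M" and v: "v \<in> Rdim D" "norm v = 1"
    and nv: "\<And>w. w \<in> tangent_space M p \<Longrightarrow> v \<bullet> w = 0" and t: "0 < t" "t < \<tau>" and q: "q \<in> M"
  shows "t \<le> norm (p + t *\<^sub>R v - q)"
proof -
  define ok where "ok t \<longleftrightarrow> (\<forall>q\<in>M. t \<le> norm (p + t *\<^sub>R v - q))" for t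
  have sm: "submanifold D d M" using m by (simp add: mfd_def)
  have lip: "norm (p + t *\<^sub>R v - q) \<le> norm (p + s *\<^sub>R v - q) + \<bar>t - s\<bar>" for s t q
  proof -
    have "p + t *\<^sub>R v - q = (p + s *\<^sub>R v - q) + (t - s) *\<^sub>R v" by (simp add: algebra_simps)
    then show ?thesis using norm_triangle_ineq[of "p + s *\<^sub>R v - q" "(t - s) *\<^sub>R v"] v
      by (simp only: norm_scaleR real_norm_def mult_1_right)
  qed
  have down: "ok s" if "ok t" "s \<le> t" for s t
    using that lip[of t _ s] unfolding ok_def by (smt (verit, best))
  have "ok t"
  proof (rule ccontr)
    assume nok: "\<not> ok t"
    let ?S = "{s. s \<le> t \<and> ok s}"
    obtain t0 where t0: "t0 > 0" "ok t0" using normal_small[OF sm p v(2) nv] by (auto simp: ok_def)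
    have t0t: "t0 < t" using down[OF t0(2), of t] nok by linarith
    have ne: "t0 \<in> ?S" using t0 t0t by simp
    have bdd: "bdd_above ?S" by (rule bdd_aboveI[of _ t]) simp
    define T where "T = Sup ?S"
    have T0: "t0 \<le> T" unfolding T_def using ne bdd by (rule cSup_upper)
    have Tt: "T \<le> t" unfolding T_def using ne by (intro cSup_least) auto
    have okT: "ok T"
      unfolding ok_def
    proof (rule ballI, rule field_le_epsilon)
      fix q e :: "_" assume q: "q \<in> M" and e: "0 < (e::real)"
      have "T - e / 2 < Sup ?S" using e by (simp add: T_def)
      then have "\<exists>s\<in>?S. T - e / 2 < s" using less_cSup_iff[OF _ bdd] ne by blast
      then obtain s where s: "s \<in> ?S" "T - e / 2 < s" by blast
      have "s \<le> T" unfolding T_def using s(1) bdd by (rule cSup_upper)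
      then show "T \<le> norm (p + T *\<^sub>R v - q) + e"
      proof -
        have "s \<le> norm (p + s *\<^sub>R v - q)" using s(1) q by (simp add: ok_def)
        then show ?thesis using lip[of s q T] s(2) \<open>s \<le> T\<close> by linarith
      qed
    qed
    then have "T < t" using nok Tt by (cases "T = t") auto
    have "\<exists>s>0. \<forall>q\<in>M. T + s \<le> norm (p + (T + s) *\<^sub>R v - q)"
      by (rule normal_step[OF m p v]) (use okT T0 t0 \<open>T < t\<close> t in \<open>auto simp: ok_def\<close>)
    then obtain s where s: "s > 0" "ok (T + s)" unfolding ok_def by blast
    have "ok (T + min s (t - T))" using down[OF s(2)] by simp
    then have "T + min s (t - T) \<le> T"
      unfolding T_def[symmetric] using cSup_upper[OF _ bdd, of "T + min s (t - T)"] by (simp add: T_def)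
    then show False using s \<open>T < t\<close> by simp
  qed
  then show ?thesis using q by (simp add: ok_def)
qed

text \<open>Federer's inequality. For a unit normal \<open>u\<close>, squaring
  \<open>t \<le> norm (p + t *\<^sub>R u - q)\<close> gives
  \<open>2 * t * (u \<bullet> (q - p)) \<le> (norm (q - p))\<^sup>2\<close> for every
  \<open>t\<close> below \<open>\<tau>\<close>, hence also at \<open>\<tau>\<close>.\<close>

lemma reach_normal:
  assumes m: "mfd D d \<tau> M" and p: "p \<in> M" and q: "q \<in> M" and v: "v \<in> Rdim D"
    and nv: "\<And>w. w \<in> tangent_space M p \<Longrightarrow> v \<bullet> w = 0"
  shows "v \<bullet> (q - p) \<le> norm v * ((norm (q - p))\<^sup>2 / (2 * \<tau>))"
proof (cases "v = 0")
  case False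
  have \<tau>: "0 < \<tau>" using m by (simp add: mfd_def)
  define u where "u = (1 / norm v) *\<^sub>R v"
  have u: "norm u = 1" "u \<in> Rdim D" "v = norm v *\<^sub>R u"
    using False v by (auto simp: u_def intro: subspace_scale subspace_Rdim)
  have nu: "u \<bullet> w = 0" if "w \<in> tangent_space M p" for w using nv[OF that] by (simp add: u_def)
  let ?x = "u \<bullet> (q - p)" and ?N = "(norm (q - p))\<^sup>2"
  have 1: "2 * t * ?x \<le> ?N" if t: "0 < t" "t < \<tau>" for t
  proof -
    have "t \<le> norm (p + t *\<^sub>R u - q)" by (rule normal_ball[OF m p u(2,1) nu t q])
    then have "t\<^sup>2 \<le> (norm (p + t *\<^sub>R u - q))\<^sup>2" using t by (intro power_mono) auto
    also have "\<dots> = (norm (t *\<^sub>R u - (q - p)))\<^sup>2" by (simp add: algebra_simps)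
    also have "\<dots> = (t *\<^sub>R u) \<bullet> (t *\<^sub>R u) - 2 * ((t *\<^sub>R u) \<bullet> (q - p)) + (q - p) \<bullet> (q - p)"
      unfolding power2_norm_eq_inner inner_diff_left[of "t *\<^sub>R u"] inner_diff_right[of _ "t *\<^sub>R u"]
        inner_commute[of "q - p" "t *\<^sub>R u"] by linarith
    also have "\<dots> = t\<^sup>2 - 2 * t * ?x + ?N" using u(1) by (simp add: dot_square_norm power2_eq_square)
    finally show ?thesis by simp
  qed
  have "2 * \<tau> * ?x \<le> ?N"
  proof (rule ccontr)
    assume c: "\<not> ?thesis"
    have "0 \<le> ?N" by simp
    then have "0 < \<tau> * ?x" using c by linarith
    then have x: "0 < ?x" using \<tau> by (simp add: zero_less_mult_iff)
    \<comment> \<open>Midpoint between \<open>\<tau>\<close> and the radius at which the inequality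
      would become an equality; beyond that radius it is violated.\<close>
    define t where "t = (?N / (2 * ?x) + \<tau>) / 2"
    have "?N / (2 * ?x) < \<tau>" using c x by (simp add: field_simps)
    moreover have "0 \<le> ?N / (2 * ?x)" using x by simp
    ultimately have t: "0 < t" "t < \<tau>" using \<tau> by (simp_all add: t_def)
    have "2 * t * ?x = ?N / 2 + \<tau> * ?x" using x by (simp add: t_def field_simps)
    then show False using 1[OF t] c by linarith
  qed
  then have "?x \<le> ?N / (2 * \<tau>)" using \<tau> by (simp add: field_simps)
  then have "norm v * ?x \<le> norm v * (?N / (2 * \<tau>))" by (intro mult_left_mono) auto
  then show ?thesis using u(3) by (metis inner_scaleR_left)
qed simp

text \<open>Federer's inequality with the normal component of \<open>q - p\<close> itself as normal
  vector.\<close>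

lemma reach_tangent:
  assumes m: "mfd D d \<tau> M" and p: "p \<in> M" and q: "q \<in> M"
  shows "norm (q - p - oproj (tangent_space M p) (q - p)) \<le> (norm (q - p))\<^sup>2 / (2 * \<tau>)"
proof -
  have sm: "submanifold D d M" and MD: "M \<subseteq> Rdim D" and \<tau>: "0 < \<tau>" using m by (auto simp: mfd_def submanifold_def)
  let ?T = "tangent_space M p"
  note fT = findim_tangent[OF sm p]
  let ?v = "q - p - oproj ?T (q - p)"
  have "oproj ?T (q - p) \<in> Rdim D" using oproj_in[OF fT] tangent_sub[OF sm p] by blast
  then have vD: "?v \<in> Rdim D" using p q MD by (auto intro!: subspace_diff subspace_Rdim)
  have "?v \<bullet> (q - p) \<le> norm ?v * ((norm (q - p))\<^sup>2 / (2 * \<tau>))"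
    by (rule reach_normal[OF m p q vD]) (rule oproj_orth[OF fT])
  moreover have "?v \<bullet> (q - p) = norm ?v * norm ?v"
  proof -
    have "?v \<bullet> (q - p) = ?v \<bullet> ?v + ?v \<bullet> oproj ?T (q - p)" by (subst inner_add_right[symmetric]) simp
    also have "?v \<bullet> oproj ?T (q - p) = 0" by (rule oproj_orth[OF fT oproj_in[OF fT]])
    finally show ?thesis by (simp only: dot_square_norm power2_eq_square add_0_right)
  qed
  ultimately show ?thesis
    using \<tau> by (cases "norm ?v = 0") (simp, metis mult_le_cancel_left_pos norm_ge_zero order_less_le)
qed

section \<open>Variation of tangent spaces\<close>

lemma mfd_sub: "mfd D d \<tau> M \<Longrightarrow> submanifold D d M" "mfd D d \<tau> M \<Longrightarrow> 0 < \<tau>" "mfd D d \<tau> M \<Longrightarrow> M \<subseteq> Rdim D"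
  "mfd D d \<tau> M \<Longrightarrow> compact M" "mfd D d \<tau> M \<Longrightarrow> M \<noteq> {}"
  by (auto simp: mfd_def submanifold_def)

text \<open>Asymmetric on purpose: directions at \<open>q\<close> are tested against the tangent
  space at \<open>p\<close>. In this form the bounds simply add up along chains.\<close>

definition tilt :: "evec set \<Rightarrow> evec \<Rightarrow> evec \<Rightarrow> real \<Rightarrow> bool" where
  "tilt M p q \<theta> \<longleftrightarrow> (\<forall>e\<in>tangent_space M q. norm (e - oproj (tangent_space M p) e) \<le> \<theta> * norm e)"

lemma tilt_refl: "submanifold D d M \<Longrightarrow> p \<in> M \<Longrightarrow> tilt M p p 0"
  by (simp add: tilt_def oproj_id findim_subspace[OF findim_tangent])

lemma tilt_mono: "tilt M p q a \<Longrightarrow> a \<le> b \<Longrightarrow> tilt M p q b"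
  unfolding tilt_def by (meson mult_right_mono norm_ge_zero order_trans)

lemma tilt_trans:
  assumes "submanifold D d M" "p \<in> M" "q \<in> M" "tilt M p q a" "tilt M q r b" "0 \<le> a"
  shows "tilt M p r (a + b)"
  unfolding tilt_def
proof
  let ?p = "oproj (tangent_space M p)" and ?q = "oproj (tangent_space M q)"
  note fp = findim_tangent[OF assms(1,2)] and fq = findim_tangent[OF assms(1,3)]
  fix e assume e: "e \<in> tangent_space M r"
  have "norm (e - ?p e) \<le> norm (e - ?p (?q e))" by (rule oproj_best[OF fp oproj_in[OF fp]])
  also have "\<dots> \<le> norm (e - ?q e) + norm (?q e - ?p (?q e))"
    using norm_triangle_ineq[of "e - ?q e" "?q e - ?p (?q e)"] by simp
  also have "norm (e - ?q e) \<le> b * norm e" using assms(5) e by (simp add: tilt_def)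
  also have "norm (?q e - ?p (?q e)) \<le> a * norm (?q e)"
    using assms(4) oproj_in[OF fq] by (simp add: tilt_def)
  also have "\<dots> \<le> a * norm e" using norm_oproj_le[OF fq] assms(6) by (intro mult_left_mono)
  finally show "norm (e - ?p e) \<le> (a + b) * norm e" by (simp add: algebra_simps)
qed

text \<open>With tilt below 1, every vector of the tangent space at \<open>y\<close> is the
  projection of one at \<open>p\<close>, so orthogonality to the latter space forces zero. It serves
  to exploit first order optimality conditions.\<close>

lemma tilt_orth:
  assumes "submanifold D d M" "y \<in> M" "p \<in> M" "tilt M y p \<theta>" "\<theta> < 1"
    and e: "e \<in> tangent_space M y" "\<And>v. v \<in> tangent_space M p \<Longrightarrow> e \<bullet> v = 0"
  shows "e = 0"
proof -
  note fy = findim_tangent[OF assms(1,2)] and fp = findim_tangent[OF assms(1,3)]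
  have "oproj (tangent_space M y) ` tangent_space M p = tangent_space M y"
    by (rule oproj_onto[OF fp fy _ assms(5)])
      (use assms(4) dim_tangent[OF assms(1)] assms(2,3) in \<open>auto simp: tilt_def\<close>)
  then obtain f where f: "f \<in> tangent_space M p" "e = oproj (tangent_space M y) f" using e(1) by blast
  have "e \<bullet> e = oproj (tangent_space M y) f \<bullet> e" by (simp add: f(2))
  also have "\<dots> = f \<bullet> e" by (rule inner_oproj_eq[OF fy e(1)])
  also have "\<dots> = 0" using e(2)[OF f(1)] by (simp add: inner_commute)
  finally show ?thesis by simp
qed

text \<open>Adding Federer's inequality at \<open>q\<close> towards \<open>q'\<close> and at
  \<open>q'\<close> towards \<open>q\<close> shows that the nearest point map is Lipschitz on tubes
  of radius below \<open>\<tau>\<close>.\<close>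

lemma nearest_lipschitz:
  assumes m: "mfd D d \<tau> M" and z: "z \<in> Rdim D" "z' \<in> Rdim D" "nearest M z q" "nearest M z' q'"
    and \<rho>: "norm (z - q) \<le> \<rho>" "norm (z' - q') \<le> \<rho>"
  shows "(1 - \<rho> / \<tau>) * norm (q - q') \<le> norm (z - z')"
proof -
  have q: "q \<in> M" "q' \<in> M" using z by (auto simp: nearest_def)
  have D: "z - q \<in> Rdim D" "z' - q' \<in> Rdim D" using z(1,2) q mfd_sub(3)[OF m] by (blast intro: subspace_diff subspace_Rdim)+
  let ?N = "(norm (q - q'))\<^sup>2"
  have N: "(norm (q' - q))\<^sup>2 = ?N" by (simp add: norm_minus_commute)
  have "(z - q) \<bullet> (q' - q) \<le> norm (z - q) * (?N / (2 * \<tau>))"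
    using reach_normal[OF m q D(1) nearest_normal[OF z(3)]] N by simp
  also have "\<dots> \<le> \<rho> * (?N / (2 * \<tau>))" using \<rho> mfd_sub(2)[OF m] by (intro mult_right_mono) auto
  finally have 1: "(z - q) \<bullet> (q' - q) \<le> \<rho> * (?N / (2 * \<tau>))" .
  have "(z' - q') \<bullet> (q - q') \<le> norm (z' - q') * (?N / (2 * \<tau>))"
    using reach_normal[OF m q(2,1) D(2) nearest_normal[OF z(4)]] by simp
  also have "\<dots> \<le> \<rho> * (?N / (2 * \<tau>))" using \<rho> mfd_sub(2)[OF m] by (intro mult_right_mono) auto
  finally have 2: "(z' - q') \<bullet> (q - q') \<le> \<rho> * (?N / (2 * \<tau>))" .
  have "(z - z') \<bullet> (q' - q) + ?N = (z - q) \<bullet> (q' - q) + (z' - q') \<bullet> (q - q')"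
    unfolding power2_norm_eq_inner by (simp add: inner_diff_left inner_diff_right algebra_simps inner_commute)
  with 1 2 have "(z - z') \<bullet> (q' - q) + ?N \<le> \<rho> * ?N / \<tau>" by simp
  then have "(1 - \<rho> / \<tau>) * ?N \<le> - ((z - z') \<bullet> (q' - q))" by (simp add: algebra_simps)
  also have "- ((z - z') \<bullet> (q' - q)) = (z - z') \<bullet> (q - q')" by (simp add: inner_diff_right)
  also have "\<dots> \<le> norm (z - z') * norm (q - q')" by (rule norm_cauchy_schwarz)
  finally have "((1 - \<rho> / \<tau>) * norm (q - q')) * norm (q - q') \<le> norm (z - z') * norm (q - q')"
    by (simp add: power2_eq_square algebra_simps)
  then show ?thesis by (cases "norm (q - q') = 0") (auto simp: mult_le_cancel_right)
qed

text \<open>The chain consists of the nearest points in \<open>M\<close> of a subdivision of the segment.\<close>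

lemma chain_ex:
  assumes m: "mfd D d \<tau> M" and pq: "p \<in> M" "q \<in> M" "norm (q - p) \<le> R" "R \<le> \<tau> / 4" and n: "0 < (n::nat)"
  shows "\<exists>c. c 0 = p \<and> c n = q \<and> (\<forall>i\<le>n. c i \<in> M) \<and> (\<forall>i<n. norm (c (Suc i) - c i) \<le> 8/7 * (R / n))"
proof -
  note sm = mfd_sub(1)[OF m] and \<tau> = mfd_sub(2)[OF m] and MD = mfd_sub(3)[OF m]
  define z where "z i = p + (real i / n) *\<^sub>R (q - p)" for i :: nat
  have "\<forall>i. \<exists>q. nearest M (z i) q" using nearest_ex[OF sm] by blast
  then obtain c where c: "\<And>i. nearest M (z i) (c i)" by metis
  have zD: "z i \<in> Rdim D" for i unfolding z_def
    using pq MD by (auto intro!: subspace_add subspace_diff subspace_scale subspace_Rdim)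
  have self: "x = y" if "nearest M y x" "y \<in> M" for x y using that by (force simp: nearest_def)
  have R: "0 \<le> R" using pq(3) norm_ge_zero order_trans by blast
  \<comment> \<open>One endpoint is within half the length of the segment, so all subdivision points
    lie in the tube of radius \<open>R / 2 \<le> \<tau> / 8\<close>; this is the source of the
    factor 8/7.\<close>
  have half: "norm (z i - c i) \<le> R / 2" if i: "i \<le> n" for i
  proof -
    have 1: "norm (z i - c i) \<le> norm (z i - p)" "norm (z i - c i) \<le> norm (z i - q)"
      using c[of i] pq by (auto simp: nearest_def)
    have "norm (z i - p) = (real i / n) * norm (q - p)" by (simp add: z_def)
    moreover have "z i - q = (real i / n - 1) *\<^sub>R (q - p)" by (simp add: z_def algebra_simps)
    then have "norm (z i - q) = (1 - real i / n) * norm (q - p)" using i n by (simp add: abs_if)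
    ultimately have "2 * norm (z i - c i) \<le> norm (q - p)" using 1 by (simp add: algebra_simps)
    then show ?thesis using pq by simp
  qed
  show ?thesis
  proof (intro exI[of _ c] conjI allI impI)
    show "c 0 = p" using self[of p "c 0"] c[of 0] pq by (simp add: z_def)
    show "c n = q" using self[of q "c n"] c[of n] pq n by (simp add: z_def)
    show "c i \<in> M" for i using c[of i] by (simp add: nearest_def)
    fix i assume i: "i < n"
    have "(1 - (R / 2) / \<tau>) * norm (c (Suc i) - c i) \<le> norm (z (Suc i) - z i)"
      by (rule nearest_lipschitz[OF m zD zD c c half half]) (use i in auto)
    also have "z (Suc i) - z i = (1 / n) *\<^sub>R (q - p)" by (simp add: z_def add_divide_distrib algebra_simps)
    also have "norm \<dots> \<le> R / n" using pq n by (simp add: divide_right_mono)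
    finally have 1: "(1 - (R / 2) / \<tau>) * norm (c (Suc i) - c i) \<le> R / n" .
    have "(R / 2) / \<tau> \<le> 1 / 8" using pq \<tau> by (simp add: field_simps)
    then have "7/8 * norm (c (Suc i) - c i) \<le> (1 - (R / 2) / \<tau>) * norm (c (Suc i) - c i)"
      by (intro mult_right_mono) auto
    with 1 show "norm (c (Suc i) - c i) \<le> 8/7 * (R / n)" by linarith
  qed
qed

text \<open>A point of \<open>M\<close> whose projection is as close as possible to the target must hit it, by the first
  order condition.\<close>

lemma tangent_cover:
  assumes m: "mfd D d \<tau> M" and y: "y \<in> M" and r: "0 < r" "r \<le> \<tau>"
    and H: "\<And>p. p \<in> M \<Longrightarrow> norm (p - y) \<le> r \<Longrightarrow> tilt M y p (1/2)"
    and u: "u \<in> tangent_space M y" "norm u < r / 4"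
  shows "\<exists>p\<in>M. norm (p - y) \<le> 2 * norm u \<and> oproj (tangent_space M y) (p - y) = u"
proof -
  note sm = mfd_sub(1)[OF m] and \<tau> = mfd_sub(2)[OF m]
  let ?T = "tangent_space M y"
  note fT = findim_tangent[OF sm y] and sT = findim_subspace[OF findim_tangent[OF sm y]]
  let ?\<pi> = "oproj ?T"
  let ?K = "M \<inter> cball y r"
  have "compact ?K" using mfd_sub(4)[OF m] by (simp add: compact_Int_closed)
  moreover have "continuous_on ?K (\<lambda>p. norm (?\<pi> (p - y) - u))"
    by (intro continuous_intros bounded_linear.continuous_on[OF bounded_linear_oproj[OF fT]])
  moreover have yK: "y \<in> ?K" using y r by simp
  ultimately obtain p where p: "p \<in> ?K" "\<forall>q\<in>?K. norm (?\<pi> (p - y) - u) \<le> norm (?\<pi> (q - y) - u)"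
    using continuous_attains_inf[of ?K "\<lambda>p. norm (?\<pi> (p - y) - u)"] by blast
  have pM: "p \<in> M" and npr: "norm (p - y) \<le> r" using p(1) by (auto simp: dist_norm norm_minus_commute)
  have "norm (?\<pi> (p - y) - u) \<le> norm u" using p(2)[rule_format, OF yK] by (simp add: oproj_0[OF fT])
  \<comment> \<open>By the reach the normal part is at most half of \<open>norm (p - y)\<close>,
    because \<open>norm (p - y)\<close> is at most \<open>\<tau>\<close>.\<close>
  have tri: "norm (p - y) \<le> norm (?\<pi> (p - y)) + norm (p - y) / 2"
  proof -
    have "norm (p - y) \<le> norm (?\<pi> (p - y)) + norm (p - y - ?\<pi> (p - y))"
      using norm_triangle_ineq[of "?\<pi> (p - y)" "p - y - ?\<pi> (p - y)"] by simp
    also have "norm (p - y - ?\<pi> (p - y)) \<le> (norm (p - y))\<^sup>2 / (2 * \<tau>)" by (rule reach_tangent[OF m y pM])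
    also have "\<dots> \<le> norm (p - y) / 2"
    proof -
      have "norm (p - y) * norm (p - y) \<le> norm (p - y) * \<tau>" using npr r by (intro mult_left_mono) auto
      then show ?thesis using \<tau> by (simp add: power2_eq_square field_simps)
    qed
    finally show ?thesis by simp
  qed
  have "norm (?\<pi> (p - y)) \<le> 2 * norm u"
    using \<open>norm (?\<pi> (p - y) - u) \<le> norm u\<close> norm_triangle_ineq2[of "?\<pi> (p - y)" u] by linarith
  then have lt: "norm (p - y) < r" using tri u(2) by linarith
  define e where "e = ?\<pi> (p - y) - u"
  have eT: "e \<in> ?T" unfolding e_def using oproj_in[OF fT] u(1) sT by (simp add: subspace_diff)
  have "e \<bullet> v = 0" if v: "v \<in> tangent_space M p" for v
  proof -
    obtain \<gamma> \<epsilon> where \<gamma>: "0 < \<epsilon>" "\<gamma> 0 = p" "\<gamma> ` {-\<epsilon><..<\<epsilon>} \<subseteq> M" "(\<gamma> has_vector_derivative v) (at 0)"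
      using v unfolding tangent_space_def by blast
    let ?f = "\<lambda>t. ?\<pi> (\<gamma> t - y) - u"
    have "((\<lambda>t. \<gamma> t - y) has_vector_derivative v) (at 0)"
      using has_vector_derivative_diff[OF \<gamma>(4) has_vector_derivative_const[of y]] by simp
    then have "((\<lambda>t. ?\<pi> (\<gamma> t - y)) has_vector_derivative ?\<pi> v) (at 0)"
      by (rule bounded_linear.has_vector_derivative[OF bounded_linear_oproj[OF fT]])
    then have df: "(?f has_derivative (\<lambda>h. h *\<^sub>R ?\<pi> v)) (at 0)"
      using has_vector_derivative_diff[OF _ has_vector_derivative_const[of u]]
      by (fastforce simp: has_vector_derivative_def)
    let ?\<phi> = "\<lambda>t. ?f t \<bullet> ?f t"
    have "(?\<phi> has_derivative (\<lambda>h. ?f 0 \<bullet> (h *\<^sub>R ?\<pi> v) + (h *\<^sub>R ?\<pi> v) \<bullet> ?f 0)) (at 0)"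
      by (rule has_derivative_inner[OF df df])
    moreover have "(\<lambda>h. ?f 0 \<bullet> (h *\<^sub>R ?\<pi> v) + (h *\<^sub>R ?\<pi> v) \<bullet> ?f 0) = times (2 * (e \<bullet> ?\<pi> v))"
      by (auto simp: \<gamma>(2) fun_eq_iff inner_commute e_def)
    ultimately have D: "DERIV ?\<phi> 0 :> 2 * (e \<bullet> ?\<pi> v)" by (simp add: has_field_derivative_def)
    have "(\<gamma> \<longlongrightarrow> \<gamma> 0) (at 0)"
      using has_vector_derivative_continuous[OF \<gamma>(4)] by (simp add: isCont_def)
    then have "\<forall>\<^sub>F t in at 0. dist (\<gamma> t) p < r - norm (p - y)"
      using lt \<gamma>(2) by (auto simp: tendsto_iff)
    then obtain \<epsilon>2 where e2: "0 < \<epsilon>2" "\<And>t. t \<noteq> 0 \<Longrightarrow> dist t 0 < \<epsilon>2 \<Longrightarrow> dist (\<gamma> t) p < r - norm (p - y)"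
      unfolding eventually_at by auto
    have "\<forall>t. \<bar>0 - t\<bar> < min \<epsilon> \<epsilon>2 \<longrightarrow> ?\<phi> 0 \<le> ?\<phi> t"
    proof (intro allI impI)
      fix t assume t: "\<bar>0 - t\<bar> < min \<epsilon> \<epsilon>2"
      then have gM: "\<gamma> t \<in> M" using \<gamma>(3) by (auto simp: abs_less_iff image_subset_iff)
      have "dist (\<gamma> t) p < r - norm (p - y)" using e2(2)[of t] t \<gamma>(2) lt by (cases "t = 0") auto
      then have "norm (\<gamma> t - y) \<le> r" using norm_triangle_ineq[of "\<gamma> t - p" "p - y"] by (simp add: dist_norm)
      then have "\<gamma> t \<in> ?K" using gM by (simp add: dist_norm norm_minus_commute)
      then have "norm (?f 0) \<le> norm (?f t)" using p(2) \<gamma>(2) by simp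
      then show "?\<phi> 0 \<le> ?\<phi> t" by (simp add: norm_eq_sqrt_inner)
    qed
    then have "2 * (e \<bullet> ?\<pi> v) = 0" using DERIV_local_min[OF D, of "min \<epsilon> \<epsilon>2"] \<gamma>(1) e2(1) by simp
    moreover have "e \<bullet> ?\<pi> v = e \<bullet> v" using inner_oproj_eq[OF fT eT, of v] by (simp add: inner_commute)
    ultimately show ?thesis by simp
  qed
  then have "e = 0" using tilt_orth[OF sm y pM H[OF pM npr] _ eT] by simp
  then have pu: "?\<pi> (p - y) = u" by (simp add: e_def)
  then have "norm (p - y) \<le> 2 * norm u" using tri by simp
  then show ?thesis using pM pu by blast
qed

text \<open>A coarse tilt bound at scale \<open>r\<close> improves to a linear one. The point of
  \<open>M\<close> lying over \<open>s *\<^sub>R e\<close> at \<open>q\<close> is viewed from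
  \<open>p\<close> and from \<open>q\<close>; Federer's inequality limits the normal parts in both
  views, hence the part of \<open>e\<close> normal at \<open>p\<close>.\<close>

lemma tilt_lipschitz:
  assumes m: "mfd D d \<tau> M" and r: "0 < r" "r \<le> \<tau>"
    and H: "\<And>p q. p \<in> M \<Longrightarrow> q \<in> M \<Longrightarrow> norm (p - q) \<le> r \<Longrightarrow> tilt M p q (1/2)"
    and p: "p \<in> M" and q: "q \<in> M" and pq: "norm (p - q) \<le> r / 5"
  shows "tilt M p q (7 * norm (p - q) / \<tau>)"
proof (cases "p = q")
  case True
  then show ?thesis using tilt_refl[OF mfd_sub(1)[OF m] p] by simp
next
  case False
  note sm = mfd_sub(1)[OF m] and \<tau> = mfd_sub(2)[OF m] and MD = mfd_sub(3)[OF m]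
  define s where "s = norm (p - q)"
  have s: "0 < s" "s \<le> r / 5" using False pq by (auto simp: s_def)
  let ?p = "oproj (tangent_space M p)"
  note fp = findim_tangent[OF sm p] and fq = findim_tangent[OF sm q]
  have unit: "norm (e - ?p e) \<le> 7 * s / \<tau>" if e: "e \<in> tangent_space M q" "norm e = 1" for e
  proof -
    have "s *\<^sub>R e \<in> tangent_space M q" using e fq by (simp add: findim_subspace subspace_scale)
    moreover have "norm (s *\<^sub>R e) < r / 4" using s e r by simp
    moreover have "\<And>p. p \<in> M \<Longrightarrow> norm (p - q) \<le> r \<Longrightarrow> tilt M q p (1/2)"
      using H q by (simp add: norm_minus_commute)
    ultimately obtain q' where q': "q' \<in> M" "norm (q' - q) \<le> 2 * norm (s *\<^sub>R e)"
        "oproj (tangent_space M q) (q' - q) = s *\<^sub>R e"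
      using tangent_cover[OF m q r] by blast
    have nq': "norm (q' - q) \<le> 2 * s" using q'(2) e s by simp
    define w where "w = e - ?p e"
    have wD: "w \<in> Rdim D" unfolding w_def
      using e(1) tangent_sub[OF sm q] tangent_sub[OF sm p] oproj_in[OF fp] 
      by (auto intro!: subspace_diff subspace_Rdim)
    have wn: "w \<bullet> v = 0" if "v \<in> tangent_space M p" for v
      using oproj_orth[OF fp that] by (simp add: w_def)
    have we: "w \<bullet> e = norm w * norm w"
    proof -
      have "w \<bullet> e = w \<bullet> w + w \<bullet> ?p e" unfolding inner_add_right[symmetric] by (simp add: w_def)
      then show ?thesis using wn[OF oproj_in[OF fp]] by (simp add: dot_square_norm power2_eq_square)
    qed
    have "norm (q' - p) \<le> 3 * s"
      using norm_triangle_ineq[of "q' - q" "q - p"] nq' by (simp add: s_def norm_minus_commute)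
    then have "(norm (q' - p))\<^sup>2 \<le> (3 * s)\<^sup>2" by (intro power_mono) auto
    then have "(norm (q' - p))\<^sup>2 / (2 * \<tau>) \<le> 9 * s\<^sup>2 / (2 * \<tau>)"
      using \<tau> by (intro divide_right_mono) (auto simp: power_mult_distrib)
    then have 1: "w \<bullet> (q' - p) \<le> norm w * (9 * s\<^sup>2 / (2 * \<tau>))"
      using reach_normal[OF m p q'(1) wD wn] by (meson mult_left_mono norm_ge_zero order_trans)
    have mwD: "- w \<in> Rdim D" using wD by (simp add: subspace_neg[OF subspace_Rdim])
    have 2: "- (w \<bullet> (q - p)) \<le> norm w * (s\<^sup>2 / (2 * \<tau>))"
      using reach_normal[OF m p q mwD] wn by (simp add: s_def norm_minus_commute)
    let ?b = "q' - q - s *\<^sub>R e"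
    have "norm ?b \<le> (norm (q' - q))\<^sup>2 / (2 * \<tau>)" using reach_tangent[OF m q q'(1)] q'(3) by simp
    also have "\<dots> \<le> (2 * s)\<^sup>2 / (2 * \<tau>)" using nq' \<tau> by (intro divide_right_mono power_mono) auto
    finally have "norm ?b \<le> 2 * s\<^sup>2 / \<tau>" by (simp add: power_mult_distrib)
    then have "norm w * norm ?b \<le> norm w * (2 * s\<^sup>2 / \<tau>)" by (intro mult_left_mono) auto
    then have 3: "- (w \<bullet> ?b) \<le> norm w * (2 * s\<^sup>2 / \<tau>)"
      using norm_cauchy_schwarz[of w "- ?b"] by (simp only: inner_minus_right norm_minus_cancel)
    have "s * (w \<bullet> e) = w \<bullet> (q' - p) - w \<bullet> (q - p) - w \<bullet> ?b"
      by (simp add: inner_diff_right)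
    \<comment> \<open>The displacements \<open>q' - p\<close> and \<open>q - p\<close> and the
      deviation at \<open>q\<close> contribute 9/2, 1/2 and 2, which add up to the constant
      7.\<close>
    also have "\<dots> \<le> norm w * (9 * s\<^sup>2 / (2 * \<tau>)) + norm w * (s\<^sup>2 / (2 * \<tau>)) + norm w * (2 * s\<^sup>2 / \<tau>)"
      using 1 2 3 by linarith
    also have "\<dots> = s * (norm w * (7 * s / \<tau>))" using \<tau> by (simp add: field_simps power2_eq_square)
    finally have "s * (norm w * norm w) \<le> s * (norm w * (7 * s / \<tau>))" by (simp only: we)
    then have "norm w * norm w \<le> norm w * (7 * s / \<tau>)" using mult_le_cancel_left_pos[OF s(1)] by blast
    then have "norm w \<le> 7 * s / \<tau>"
      using s \<tau> mult_le_cancel_left_pos[of "norm w" "norm w" "7 * s / \<tau>"] by (cases "w = 0") auto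
    then show ?thesis by (simp only: w_def)
  qed
  show ?thesis
    unfolding tilt_def s_def[symmetric]
  proof
    fix e assume e: "e \<in> tangent_space M q"
    show "norm (e - ?p e) \<le> 7 * s / \<tau> * norm e"
    proof (cases "e = 0")
      case False
      let ?e = "(1 / norm e) *\<^sub>R e"
      have "norm (?e - ?p ?e) \<le> 7 * s / \<tau>"
        using False e fq by (intro unit) (auto simp: findim_subspace subspace_scale)
      moreover have "?e - ?p ?e = (1 / norm e) *\<^sub>R (e - ?p e)"
        by (simp add: oproj_scale[OF fp] scaleR_diff_right)
      ultimately have "norm (e - ?p e) / norm e \<le> 7 * s / \<tau>" by simp
      then show ?thesis using False by (simp only: pos_divide_le_eq[of "norm e"] zero_less_norm_iff simp_thms)
    qed (simp add: oproj_0[OF fp])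
  qed
qed

text \<open>The bound 1/2 reproduces itself from scale \<open>r\<close> to \<open>2 * r\<close>: a
  chain of 12 steps has step length at most \<open>4/21 * r\<close>, below the \<open>r / 5\<close>
  required for the linear bound, and the accumulated tilt \<open>16 * r / \<tau>\<close> is far
  below 1/2.\<close>

lemma tilt_double:
  assumes m: "mfd D d \<tau> M" and r: "0 < r" "r \<le> \<tau> / 100"
    and H: "\<And>p q. p \<in> M \<Longrightarrow> q \<in> M \<Longrightarrow> norm (p - q) \<le> r \<Longrightarrow> tilt M p q (1/2)"
    and p: "p \<in> M" and q: "q \<in> M" and pq: "norm (p - q) \<le> 2 * r"
  shows "tilt M p q (1/2)"
proof -
  note sm = mfd_sub(1)[OF m] and \<tau> = mfd_sub(2)[OF m]
  obtain c where c: "c 0 = p" "c (12::nat) = q" "\<And>i. i \<le> 12 \<Longrightarrow> c i \<in> M"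
    "\<And>i. i < 12 \<Longrightarrow> norm (c (Suc i) - c i) \<le> 8/7 * (2 * r / real 12)"
    using chain_ex[OF m p q, of "2 * r" 12] pq r \<tau> by (auto simp: norm_minus_commute)
  have step: "tilt M (c i) (c (Suc i)) (4/3 * r / \<tau>)" if i: "i < 12" for i
  proof -
    have n: "norm (c i - c (Suc i)) \<le> 4/21 * r" using c(4)[OF i] by (simp add: norm_minus_commute)
    have "tilt M (c i) (c (Suc i)) (7 * norm (c i - c (Suc i)) / \<tau>)"
      by (rule tilt_lipschitz[OF m r(1) _ H]) (use r \<tau> c(3) i n in auto)
    moreover have "7 * norm (c i - c (Suc i)) / \<tau> \<le> 4/3 * r / \<tau>"
      using n \<tau> by (intro divide_right_mono) auto
    ultimately show ?thesis by (rule tilt_mono)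
  qed
  have "i \<le> 12 \<Longrightarrow> tilt M p (c i) (real i * (4/3 * r / \<tau>))" for i
  proof (induction i)
    case 0
    then show ?case using tilt_refl[OF sm p] c(1) by simp
  next
    case (Suc i)
    have "tilt M p (c (Suc i)) (real i * (4/3 * r / \<tau>) + 4/3 * r / \<tau>)"
      by (rule tilt_trans[OF sm p]) (use Suc c(3) step r \<tau> in auto)
    moreover have "real i * (4/3 * r / \<tau>) + 4/3 * r / \<tau> = real (Suc i) * (4/3 * r / \<tau>)"
      unfolding of_nat_Suc distrib_right by simp
    ultimately show ?case by (simp only:)
  qed
  from this[of 12] have "tilt M p q (12 * (4/3 * r / \<tau>))" using c(2) by simp
  then show ?thesis by (rule tilt_mono) (use r \<tau> in \<open>simp add: field_simps\<close>)
qed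

text \<open>Lebesgue number argument for a relation between pairs of points.\<close>

lemma compact_uniform:
  fixes K :: "'a::metric_space set"
  assumes "compact K"
    and "\<And>p. p \<in> K \<Longrightarrow> \<exists>\<rho>>0. \<forall>q\<in>K. \<forall>q'\<in>K. dist p q < \<rho> \<longrightarrow> dist p q' < \<rho> \<longrightarrow> \<Phi> q q'"
  shows "\<exists>r>0. \<forall>q\<in>K. \<forall>q'\<in>K. dist q q' < r \<longrightarrow> \<Phi> q q'"
proof -
  obtain \<rho> where \<rho>: "\<And>p. p \<in> K \<Longrightarrow> \<rho> p > 0"
    "\<And>p q q'. p \<in> K \<Longrightarrow> q \<in> K \<Longrightarrow> q' \<in> K \<Longrightarrow> dist p q < \<rho> p \<Longrightarrow> dist p q' < \<rho> p \<Longrightarrow> \<Phi> q q'"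
    using assms(2) by metis
  have "K \<subseteq> (\<Union>p\<in>K. ball p (\<rho> p / 2))" using \<rho>(1) by force
  then obtain F where F: "F \<subseteq> K" "finite F" "K \<subseteq> (\<Union>p\<in>F. ball p (\<rho> p / 2))"
    using compactE_image[OF assms(1), of K "\<lambda>p. ball p (\<rho> p / 2)"] by blast
  define r where "r = Min (insert 1 ((\<lambda>p. \<rho> p / 2) ` F))"
  have r: "0 < r" "\<And>p. p \<in> F \<Longrightarrow> r \<le> \<rho> p / 2"
  proof -
    show "0 < r" unfolding r_def using F(1,2) \<rho>(1) by (subst Min_gr_iff) auto
    show "r \<le> \<rho> p / 2" if "p \<in> F" for p unfolding r_def using F(2) that by (intro Min_le) auto
  qed
  have "\<Phi> q q'" if q: "q \<in> K" "q' \<in> K" "dist q q' < r" for q q'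
  proof -
    obtain p where p: "p \<in> F" "dist p q < \<rho> p / 2" using F(3) q(1) by auto
    then have "dist p q' < \<rho> p" using dist_triangle[of p q' q] q(3) r(2)[OF p(1)] by simp
    then show ?thesis using \<rho>(2)[of p q q'] p q F(1) zero_le_dist[of p q] by force
  qed
  then show ?thesis using r(1) by blast
qed

text \<open>Compactness gives the bound at some scale depending on \<open>M\<close>; repeated
  doubling carries it up to \<open>\<tau> / 100\<close>, which removes that dependence.\<close>

lemma tilt_half:
  assumes m: "mfd D d \<tau> M" and pq: "p \<in> M" "q \<in> M" "norm (p - q) \<le> \<tau> / 100"
  shows "tilt M p q (1/2)"
proof -
  note sm = mfd_sub(1)[OF m] and \<tau> = mfd_sub(2)[OF m]
  have "\<exists>r>0. \<forall>q\<in>M. \<forall>q'\<in>M. dist q q' < r \<longrightarrow> tilt M q q' (1/2)"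
  proof (rule compact_uniform[OF mfd_sub(4)[OF m]])
    fix p assume p: "p \<in> M"
    obtain \<rho> where \<rho>: "\<rho> > 0" "\<And>q. q \<in> M \<inter> ball p \<rho> \<Longrightarrow> tilt M p q (1/4) \<and> tilt M q p (1/4)"
      using tilt_local[OF sm p] unfolding tilt_def by blast
    have "tilt M q q' (1/2)" if "q \<in> M" "q' \<in> M" "dist p q < \<rho>" "dist p q' < \<rho>" for q q'
      using tilt_trans[OF sm that(1) p, of "1/4" q' "1/4"] \<rho>(2)[of q] \<rho>(2)[of q'] that by simp
    then show "\<exists>\<rho>>0. \<forall>q\<in>M. \<forall>q'\<in>M. dist p q < \<rho> \<longrightarrow> dist p q' < \<rho> \<longrightarrow> tilt M q q' (1/2)"
      using \<rho>(1) by blast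
  qed
  then obtain r0 where r0: "r0 > 0" "\<And>q q'. q \<in> M \<Longrightarrow> q' \<in> M \<Longrightarrow> dist q q' < r0 \<Longrightarrow> tilt M q q' (1/2)"
    by blast
  define R where "R n = min (2 ^ n * (r0 / 2)) (\<tau> / 100)" for n :: nat
  have R: "0 < R n" "R n \<le> \<tau> / 100" "R (Suc n) \<le> 2 * R n" for n
  proof -
    have *: "min (2 * a) t \<le> 2 * min a t" if "0 < t" for a t :: real using that by (auto simp: min_def)
    show "0 < R n" "R n \<le> \<tau> / 100" using r0 \<tau> by (auto simp: R_def)
    show "R (Suc n) \<le> 2 * R n" using *[of "\<tau> / 100" "2 ^ n * (r0 / 2)"] \<tau> by (simp add: R_def mult.assoc)
  qed
  have H: "p \<in> M \<Longrightarrow> q \<in> M \<Longrightarrow> norm (p - q) \<le> R n \<Longrightarrow> tilt M p q (1/2)" for n p q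
  proof (induction n arbitrary: p q)
    case 0
    then show ?case using r0 by (intro r0(2)) (auto simp: R_def dist_norm)
  next
    case (Suc n)
    show ?case by (rule tilt_double[OF m R(1) R(2) Suc.IH]) (use Suc.prems R(3)[of n] in auto)
  qed
  obtain n where "\<tau> / 100 / (r0 / 2) < 2 ^ n" using real_arch_pow[of 2 "\<tau> / 100 / (r0 / 2)"] by auto
  then have "\<tau> / 100 < 2 ^ n * (r0 / 2)" using r0(1) by (simp add: divide_less_eq)
  then have "R n = \<tau> / 100" unfolding R_def by (intro min_absorb2 less_imp_le)
  then show ?thesis using H[of p q n] pq by simp
qed

lemma tilt_le:
  assumes m: "mfd D d \<tau> M" and pq: "p \<in> M" "q \<in> M" "norm (p - q) \<le> \<tau> / 500"
  shows "tilt M p q (7 * norm (p - q) / \<tau>)"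
  by (rule tilt_lipschitz[OF m _ _ tilt_half[OF m], of "\<tau> / 100"]) (use pq mfd_sub(2)[OF m] in auto)

lemma tangent_cover':
  assumes m: "mfd D d \<tau> M" and y: "y \<in> M" and u: "u \<in> tangent_space M y" "norm u < \<tau> / 400"
  shows "\<exists>p\<in>M. norm (p - y) \<le> 2 * norm u \<and> oproj (tangent_space M y) (p - y) = u"
proof -
  have 1: "p \<in> M \<Longrightarrow> norm (p - y) \<le> \<tau> / 100 \<Longrightarrow> tilt M y p (1/2)" for p
    by (rule tilt_half[OF m y]) (auto simp: norm_minus_commute)
  show ?thesis
    by (rule tangent_cover[OF m y _ _ 1 u(1), of "\<tau> / 100"]) (use u mfd_sub(2)[OF m] in auto)
qed

text \<open>Near \<open>y\<close>, projecting \<open>M\<close> onto the tangent space at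
  \<open>y\<close> contracts distances by at most 2: the increment is almost tangent at
  \<open>q\<close> by the reach, and the tangent space at \<open>q\<close> is hardly tilted against
  the one at \<open>y\<close>.\<close>

lemma tangent_expand:
  assumes m: "mfd D d \<tau> M" and y: "y \<in> M" and p: "p \<in> M" "norm (p - y) \<le> \<tau> / 500"
    and q: "q \<in> M" "norm (q - y) \<le> \<tau> / 500"
  shows "norm (p - q) \<le> 2 * norm (oproj (tangent_space M y) (p - q))"
proof -
  note sm = mfd_sub(1)[OF m] and \<tau> = mfd_sub(2)[OF m]
  let ?y = "oproj (tangent_space M y)" and ?q = "oproj (tangent_space M q)"
  note fy = findim_tangent[OF sm y] and fq = findim_tangent[OF sm q(1)]
  define a where "a = ?q (p - q)" 
  define b where "b = p - q - a"
  have npq: "norm (p - q) \<le> \<tau> / 250"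
    using norm_triangle_ineq[of "p - y" "y - q"] p q by (simp add: norm_minus_commute)
  have "norm b \<le> (norm (p - q))\<^sup>2 / (2 * \<tau>)" using reach_tangent[OF m q(1) p(1)] by (simp add: a_def b_def)
  also have "\<dots> \<le> norm (p - q) / 500"
  proof -
    have "norm (p - q) * norm (p - q) \<le> norm (p - q) * (\<tau> / 250)" using npq by (intro mult_left_mono) auto
    then show ?thesis using \<tau> by (simp add: power2_eq_square field_simps)
  qed
  finally have nb: "norm b \<le> norm (p - q) / 500" .
  have "tilt M y q (7 * norm (y - q) / \<tau>)" by (rule tilt_le[OF m y q(1)]) (use q in \<open>simp add: norm_minus_commute\<close>)
  then have "tilt M y q (7 / 500)"
    by (rule tilt_mono) (use q \<tau> in \<open>simp add: norm_minus_commute field_simps\<close>)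
  then have na: "norm (a - ?y a) \<le> 7 / 500 * norm a" using oproj_in[OF fq] by (simp add: tilt_def a_def)
  have pq: "p - q = a + b" by (simp add: b_def)
  have "norm (p - q) \<le> norm a + norm b" using norm_triangle_ineq[of a b] pq by simp
  moreover have "norm a \<le> norm (a - ?y a) + norm (?y a)" using norm_triangle_ineq[of "a - ?y a" "?y a"] by simp
  moreover have "norm (?y a) \<le> norm (?y (p - q)) + norm (?y b)"
    using norm_triangle_ineq4[of "?y (p - q)" "?y b"] by (simp add: pq oproj_add[OF fy])
  moreover have "norm (?y b) \<le> norm b" by (rule norm_oproj_le[OF fy])
  moreover have "norm a \<le> norm (p - q)" unfolding a_def by (rule norm_oproj_le[OF fq])
  ultimately show ?thesis using na nb by linarith
qed

section \<open>Volume of balls\<close>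

lemma measurable_lebesgue_Rdim:
  "(\<lambda>f. \<Sum>i<d. f i *\<^sub>R unit_evec i) \<in> measurable (Pi\<^sub>M {..<d} (\<lambda>_. lborel)) (borel :: evec measure)"
proof -
  \<comment> \<open>Extension by zero to all indices: on full sequences the product sigma-algebra is
    the Borel algebra of the product topology, for which the linear map is continuous.\<close>
  let ?R = "\<lambda>f i. if i < d then f i else (0::real)"
  have "?R \<in> measurable (Pi\<^sub>M {..<d} (\<lambda>_. lborel)) (Pi\<^sub>M UNIV (\<lambda>_::nat. borel))"
  proof (rule measurable_PiM_single')
    fix i :: nat
    show "(\<lambda>f. ?R f i) \<in> borel_measurable (Pi\<^sub>M {..<d} (\<lambda>_. lborel))"
      by (cases "i < d") auto
  qed auto
  then have R: "?R \<in> measurable (Pi\<^sub>M {..<d} (\<lambda>_. lborel)) borel"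
    by (simp add: measurable_def sets_PiM_equal_borel space_PiM)
  have "continuous_on UNIV (\<lambda>f :: nat \<Rightarrow> real. \<Sum>i<d. f i *\<^sub>R unit_evec i)"
    by (intro continuous_intros continuous_on_product_coordinates)
  then have "(\<lambda>f :: nat \<Rightarrow> real. \<Sum>i<d. f i *\<^sub>R unit_evec i) \<in> borel_measurable borel"
    by (rule borel_measurable_continuous_onI)
  from measurable_compose[OF R this] show ?thesis by simp
qed

lemma sets_lebesgue_Rdim [simp]: "sets (lebesgue_Rdim d) = sets borel" "space (lebesgue_Rdim d) = UNIV"
  by (simp_all add: lebesgue_Rdim_def)

lemma emeasure_lebesgue_Rdim:
  "A \<in> sets borel \<Longrightarrow> emeasure (lebesgue_Rdim d) A =
    emeasure (Pi\<^sub>M {..<d} (\<lambda>_. lborel)) ((\<lambda>f. \<Sum>i<d. f i *\<^sub>R unit_evec i) -` A \<inter> space (Pi\<^sub>M {..<d} (\<lambda>_. lborel)))"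
  unfolding lebesgue_Rdim_def by (rule emeasure_distr[OF measurable_lebesgue_Rdim])

lemma emeasure_PiM_cube:
  assumes "0 \<le> s"
  shows "emeasure (Pi\<^sub>M {..<d} (\<lambda>_. lborel)) (Pi\<^sub>E {..<d} (\<lambda>i. {a i - s..a i + s})) = ennreal ((2 * s) ^ d)"
proof -
  interpret product_sigma_finite "\<lambda>_::nat. lborel :: real measure" by standard
  have "emeasure (Pi\<^sub>M {..<d} (\<lambda>_. lborel)) (Pi\<^sub>E {..<d} (\<lambda>i. {a i - s..a i + s})) =
      (\<Prod>i<d. emeasure lborel {a i - s..a i + s})"
    by (rule emeasure_PiM) auto
  also have "\<dots> = (\<Prod>i<d. ennreal (2 * s))" using assms by (intro prod.cong) auto
  also have "\<dots> = ennreal ((2 * s) ^ d)" using assms by (simp add: ennreal_power)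
  finally show ?thesis .
qed

lemma borel_cball_Rdim: "cball x r \<inter> Rdim d \<in> sets borel"
  by (intro borel_closed closed_Int closed_cball closed_findim findim_Rdim)

text \<open>Comparison with an inscribed and a circumscribed cube, of half side \<open>r / d\<close>
  and \<open>r\<close>.\<close>

lemma lebesgue_Rdim_ball:
  assumes "1 \<le> d" "x \<in> Rdim d" "0 \<le> r"
  shows "ennreal ((2 * r / d) ^ d) \<le> emeasure (lebesgue_Rdim d) (cball x r \<inter> Rdim d)"
    and "emeasure (lebesgue_Rdim d) (cball x r \<inter> Rdim d) \<le> ennreal ((2 * r) ^ d)"
proof -
  let ?\<Phi> = "\<lambda>f. \<Sum>i<d. f i *\<^sub>R unit_evec i" and ?P = "Pi\<^sub>M {..<d} (\<lambda>_. lborel :: real measure)"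
  let ?V = "?\<Phi> -` (cball x r \<inter> Rdim d) \<inter> space ?P"
  have V: "?V \<in> sets ?P" using measurable_sets[OF measurable_lebesgue_Rdim borel_cball_Rdim] by blast
  have \<Phi>d: "?\<Phi> f - x = (\<Sum>i<d. (f i - coord x i) *\<^sub>R unit_evec i)" for f
  proof -
    have "?\<Phi> f - x = ?\<Phi> f - (\<Sum>i<d. coord x i *\<^sub>R unit_evec i)"
      by (rule arg_cong[OF Rdim_expand[OF assms(2)]])
    then show ?thesis by (simp add: scaleR_diff_left sum_subtractf)
  qed
  have "Pi\<^sub>E {..<d} (\<lambda>i. {coord x i - r / d..coord x i + r / d}) \<subseteq> ?V"
  proof
    fix f assume f: "f \<in> Pi\<^sub>E {..<d} (\<lambda>i. {coord x i - r / d..coord x i + r / d})"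
    have "norm (?\<Phi> f - x) \<le> (\<Sum>i<d. r / d)"
      unfolding \<Phi>d
    proof (rule sum_norm_le)
      fix i assume "i \<in> {..<d}"
      then have "f i \<in> {coord x i - r / d..coord x i + r / d}" using f by (auto simp: PiE_def)
      then show "norm ((f i - coord x i) *\<^sub>R unit_evec i) \<le> r / d"
        using \<open>i \<in> {..<d}\<close> onb_norm[OF Rdim_onb, of i d] by auto
    qed
    then have "norm (?\<Phi> f - x) \<le> r" using assms by simp
    moreover have "?\<Phi> f \<in> Rdim d"
      using onb_in[OF Rdim_onb, of _ d] by (auto intro!: subspace_sum subspace_scale subspace_Rdim)
    moreover have "f \<in> space ?P" using f by (auto simp: space_PiM PiE_def)
    ultimately show "f \<in> ?V" by (simp add: dist_norm norm_minus_commute)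
  qed
  from emeasure_mono[OF this V] show "ennreal ((2 * r / d) ^ d) \<le> emeasure (lebesgue_Rdim d) (cball x r \<inter> Rdim d)"
    using assms emeasure_PiM_cube[of "r / d" d "coord x"] by (simp add: emeasure_lebesgue_Rdim borel_cball_Rdim)
  have sub: "?V \<subseteq> Pi\<^sub>E {..<d} (\<lambda>i. {coord x i - r..coord x i + r})"
  proof
    fix f assume f: "f \<in> ?V"
    show "f \<in> Pi\<^sub>E {..<d} (\<lambda>i. {coord x i - r..coord x i + r})"
    proof (rule PiE_I)
      fix i assume i: "i \<in> {..<d}"
      have "norm (?\<Phi> f - x) \<le> r" using f by (simp add: dist_norm norm_minus_commute)
      moreover have "coord (?\<Phi> f - x) i = f i - coord x i"
        using i by (simp add: coord_sum if_distrib cong: if_cong)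
      ultimately have "\<bar>f i - coord x i\<bar> \<le> r" using abs_coord_le[of "?\<Phi> f - x" i] by simp
      then show "f i \<in> {coord x i - r..coord x i + r}" by auto
    qed (use f in \<open>auto simp: space_PiM PiE_def extensional_def\<close>)
  qed
  have "Pi\<^sub>E {..<d} (\<lambda>i. {coord x i - r..coord x i + r}) \<in> sets ?P" by (intro sets_PiM_I_finite) auto
  from emeasure_mono[OF sub this] show "emeasure (lebesgue_Rdim d) (cball x r \<inter> Rdim d) \<le> ennreal ((2 * r) ^ d)"
    using assms emeasure_PiM_cube[of r d "coord x"] by (simp add: emeasure_lebesgue_Rdim borel_cball_Rdim)
qed

lemma volume_small_ball_local:
  assumes sm: "submanifold D d M" and vol: "volume_measure d M \<mu>" and p: "p \<in> M" and d: "1 \<le> d"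
  shows "\<exists>\<rho>>0. \<forall>q\<in>M. dist p q < \<rho> \<longrightarrow> (\<forall>r. 0 < r \<and> r < \<rho> \<longrightarrow>
    ennreal (1/2 * (r / d) ^ d) \<le> emeasure \<mu> (M \<inter> cball q r) \<and>
    emeasure \<mu> (M \<inter> cball q r) \<le> ennreal (2 * (4 * r) ^ d))"
proof -
  obtain U g x0 \<delta> \<rho>c C where gc: "good_chart d M p U g x0 \<delta> \<rho>c C" using good_chart_ex[OF sm p] by blast
  let ?B = "ball x0 \<delta> \<inter> Rdim d" and ?E = "Rdim d" and ?G = "dg U g"
  have lp: "local_param d M U g" and x0: "x0 \<in> U" "g x0 = p" and BU: "?B \<subseteq> U" and dpos: "0 < \<delta>"
    and rho: "0 < \<rho>c" "M \<inter> ball p \<rho>c \<subseteq> g ` ?B"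
    and gram: "\<And>x. x \<in> ?B \<Longrightarrow> 1/4 \<le> gram_det d (\<lambda>i. ?G x (unit_evec i)) \<and> gram_det d (\<lambda>i. ?G x (unit_evec i)) \<le> 4"
    using gc by (simp_all add: good_chart_def)
  have x0B: "x0 \<in> ?B" using x0 dpos local_param_sub[OF lp] by auto
  obtain g' where hg: "homeomorphism U (g ` U) g g'" using lp by (auto simp: local_param_def)
  have inj: "x = x'" if "x \<in> U" "x' \<in> U" "g x = g x'" for x x'
    using hg that unfolding homeomorphism_def by metis
  define w where "w x = ennreal (sqrt (gram_det d (\<lambda>i. iter_deriv U g [unit_evec i] x)))" for x
  have w: "ennreal (1/2) \<le> w x" "w x \<le> ennreal 2" if "x \<in> ?B" for x
  proof -
    have "sqrt (1/4) \<le> sqrt (gram_det d (\<lambda>i. ?G x (unit_evec i)))" using gram[OF that] by (intro real_sqrt_le_mono) simp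
    then have "1/2 \<le> sqrt (gram_det d (\<lambda>i. ?G x (unit_evec i)))" by (simp add: real_sqrt_divide)
    then show "ennreal (1/2) \<le> w x" unfolding w_def iter_deriv.simps by (rule ennreal_leI)
    have "sqrt (gram_det d (\<lambda>i. ?G x (unit_evec i))) \<le> sqrt 4" using gram[OF that] by (intro real_sqrt_le_mono) simp
    then have "sqrt (gram_det d (\<lambda>i. ?G x (unit_evec i))) \<le> 2" by simp
    then show "w x \<le> ennreal 2" unfolding w_def iter_deriv.simps by (rule ennreal_leI)
  qed
  \<comment> \<open>Small enough that balls of radius \<open>r\<close> around \<open>q\<close> stay
    in the chart and that parameters within \<open>r / 2\<close> of \<open>x\<close> stay in the
    parameter ball.\<close>
  define \<rho> where "\<rho> = min \<rho>c \<delta> / 4"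
  have \<rho>: "0 < \<rho>" "\<rho> \<le> \<rho>c / 4" "\<rho> \<le> \<delta> / 4" using rho dpos by (auto simp: \<rho>_def)
  have "ennreal (1/2 * (r / d) ^ d) \<le> emeasure \<mu> (M \<inter> cball q r) \<and> emeasure \<mu> (M \<inter> cball q r) \<le> ennreal (2 * (4 * r) ^ d)"
    if q: "q \<in> M" "dist p q < \<rho>" and r: "0 < r" "r < \<rho>" for q r
  proof -
    let ?A = "M \<inter> cball q r"
    have "q \<in> M \<inter> ball p \<rho>c" using q \<rho> by auto
    then obtain x where x: "x \<in> ?B" "q = g x" using rho by blast
    have "compact M" using sm by (simp add: submanifold_def)
    then have A: "?A \<in> sets borel" by (intro borel_closed closed_Int compact_imp_closed closed_cball)
    have "?A \<subseteq> M \<inter> ball p \<rho>c"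
    proof
      fix y assume "y \<in> ?A"
      then show "y \<in> M \<inter> ball p \<rho>c" using dist_triangle[of p y q] q r \<rho> by auto
    qed
    then have Ag: "?A \<subseteq> g ` ?B" using rho by blast
    then have AgU: "?A \<subseteq> g ` U" using BU by blast
    have eq: "emeasure \<mu> ?A = (\<integral>\<^sup>+x\<in>{x \<in> U. g x \<in> ?A}. w x \<partial>lebesgue_Rdim d)"
      using vol lp A AgU unfolding volume_measure_def w_def by blast
    have 7: "7/8 * norm (x' - x) \<le> norm (g x' - q)" "norm (g x' - q) \<le> 9/8 * norm (x' - x)" if "x' \<in> ?B" for x'
      using good_chart_lower[OF gc that x(1)] x(2) by simp_all
    have xE: "x \<in> ?E" using x by simp
    \<comment> \<open>By the factor 7/8 the parameters of the ball lie within \<open>2 * r\<close>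
      of \<open>x\<close>, and the volume density is at most 2 there.\<close>
    have up: "w x' * indicator {x \<in> U. g x \<in> ?A} x' \<le> ennreal 2 * indicator (cball x (2 * r) \<inter> ?E) x'" for x'
    proof (cases "x' \<in> U \<and> g x' \<in> ?A")
      case True
      then obtain x'' where "x'' \<in> ?B" "g x' = g x''" using Ag by blast
      then have x'B: "x' \<in> ?B" using inj[of x' x''] True BU by blast
      have "norm (g x' - q) \<le> r" using True by (simp add: dist_norm norm_minus_commute)
      then have "norm (x' - x) \<le> 2 * r" using 7(1)[OF x'B] r by linarith
      then show ?thesis using w(2)[OF x'B] x'B True by (simp add: dist_norm norm_minus_commute indicator_def)
    qed (auto simp: indicator_def)
    have "emeasure \<mu> ?A \<le> (\<integral>\<^sup>+x'. ennreal 2 * indicator (cball x (2 * r) \<inter> ?E) x' \<partial>lebesgue_Rdim d)"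
      unfolding eq by (intro nn_integral_mono up)
    also have "\<dots> = ennreal 2 * emeasure (lebesgue_Rdim d) (cball x (2 * r) \<inter> ?E)"
      by (intro nn_integral_cmult_indicator) (simp add: borel_cball_Rdim)
    also have "\<dots> \<le> ennreal 2 * ennreal ((2 * (2 * r)) ^ d)"
      using lebesgue_Rdim_ball(2)[OF d xE, of "2 * r"] r by (intro mult_left_mono) auto
    also have "\<dots> = ennreal (2 * (4 * r) ^ d)" using r by (simp add: ennreal_mult)
    finally have U: "emeasure \<mu> ?A \<le> ennreal (2 * (4 * r) ^ d)" .
    \<comment> \<open>Conversely, by the factor 9/8, parameters within \<open>r / 2\<close> of
      \<open>x\<close> are sent into the ball, with density at least 1/2.\<close>
    have lo: "ennreal (1/2) * indicator (cball x (r / 2) \<inter> ?E) x' \<le> w x' * indicator {x \<in> U. g x \<in> ?A} x'" for x'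
    proof (cases "x' \<in> cball x (r / 2) \<inter> ?E")
      case True
      then have n: "norm (x' - x) \<le> r / 2" by (simp add: dist_norm norm_minus_commute)
      have "7/8 * norm (x - x0) \<le> norm (g x - g x0)" by (rule good_chart_lower(1)[OF gc x(1) x0B])
      also have "\<dots> < \<rho>" using q x x0 by (simp add: dist_norm norm_minus_commute)
      finally have "norm (x - x0) < \<delta> / 2" using \<rho> norm_ge_zero[of "x - x0"] by linarith
      then have "norm (x' - x0) < \<delta>" using norm_triangle_ineq[of "x' - x" "x - x0"] n r \<rho> by simp
      then have x'B: "x' \<in> ?B" using True by (simp add: dist_norm norm_minus_commute)
      have "norm (g x' - q) \<le> r" using 7(2)[OF x'B] n r by linarith
      moreover have "g x' \<in> M" using x'B BU local_param_image[OF lp] by blast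
      ultimately have "x' \<in> {x \<in> U. g x \<in> ?A}" using x'B BU by (auto simp: dist_norm norm_minus_commute)
      then show ?thesis using w(1)[OF x'B] True by (simp add: indicator_def)
    qed (auto simp: indicator_def)
    have "ennreal (1/2 * (r / d) ^ d) = ennreal (1/2) * ennreal ((2 * (r / 2) / d) ^ d)"
      using r by (subst ennreal_mult[symmetric]) simp_all
    also have "\<dots> \<le> ennreal (1/2) * emeasure (lebesgue_Rdim d) (cball x (r / 2) \<inter> ?E)"
      using lebesgue_Rdim_ball(1)[OF d xE, of "r / 2"] r by (intro mult_left_mono) auto
    also have "\<dots> = (\<integral>\<^sup>+x'. ennreal (1/2) * indicator (cball x (r / 2) \<inter> ?E) x' \<partial>lebesgue_Rdim d)"
      by (intro nn_integral_cmult_indicator[symmetric]) (simp add: borel_cball_Rdim)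
    also have "\<dots> \<le> emeasure \<mu> ?A" unfolding eq by (intro nn_integral_mono lo)
    finally show ?thesis using U by blast
  qed
  then show ?thesis using \<rho>(1) by blast
qed

text \<open>A finite subcover makes the threshold radius uniform over the points of
  \<open>M\<close>, though it still depends on \<open>M\<close>.\<close>

lemma volume_small_ball:
  assumes sm: "submanifold D d M" and vol: "volume_measure d M \<mu>" and d: "1 \<le> d"
  shows "\<exists>\<rho>>0. \<forall>q\<in>M. \<forall>r. 0 < r \<and> r < \<rho> \<longrightarrow>
    ennreal (1/2 * (r / d) ^ d) \<le> emeasure \<mu> (M \<inter> cball q r) \<and>
    emeasure \<mu> (M \<inter> cball q r) \<le> ennreal (2 * (4 * r) ^ d)"
proof -
  let ?\<Phi> = "\<lambda>q r. 0 < r \<longrightarrow> ennreal (1/2 * (r / d) ^ d) \<le> emeasure \<mu> (M \<inter> cball q r) \<and>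
    emeasure \<mu> (M \<inter> cball q r) \<le> ennreal (2 * (4 * r) ^ d)"
  have cM: "compact M" using sm by (simp add: submanifold_def)
  obtain \<rho> where \<rho>: "\<And>p. p \<in> M \<Longrightarrow> \<rho> p > 0"
    "\<And>p q r. p \<in> M \<Longrightarrow> q \<in> M \<Longrightarrow> dist p q < \<rho> p \<Longrightarrow> r < \<rho> p \<Longrightarrow> ?\<Phi> q r"
    using volume_small_ball_local[OF sm vol _ d] by metis
  have "M \<subseteq> (\<Union>p\<in>M. ball p (\<rho> p))" using \<rho>(1) by force
  then obtain F where F: "F \<subseteq> M" "finite F" "M \<subseteq> (\<Union>p\<in>F. ball p (\<rho> p))"
    using compactE_image[OF cM, of M "\<lambda>p. ball p (\<rho> p)"] by blast
  define r0 where "r0 = Min (insert 1 (\<rho> ` F))"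
  have r0: "0 < r0" "\<And>p. p \<in> F \<Longrightarrow> r0 \<le> \<rho> p"
  proof -
    show "0 < r0" unfolding r0_def using F \<rho>(1) by (subst Min_gr_iff) auto
    show "r0 \<le> \<rho> p" if "p \<in> F" for p unfolding r0_def using F(2) that by (intro Min_le) auto
  qed
  have "?\<Phi> q r" if q: "q \<in> M" and r: "r < r0" for q r
  proof -
    obtain p where p: "p \<in> F" "dist p q < \<rho> p" using F(3) q by auto
    show ?thesis by (rule \<rho>(2)[of p q r]) (use p F q r r0(2)[OF p(1)] in auto)
  qed
  then show ?thesis using r0(1) by blast
qed

lemma volume_measure_sets:
  assumes "volume_measure d M \<mu>" "compact M"
  shows "M \<inter> cball q r \<in> sets \<mu>"
  using assms unfolding volume_measure_def
  by (auto intro!: borel_closed closed_Int compact_imp_closed)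

text \<open>Small balls have almost Euclidean volume; lifting a grid in the tangent space to well separated
  points of \<open>M\<close> carries the lower bound over to larger radii.\<close>

lemma volume_lower:
  assumes m: "mfd D d \<tau> M" and vol: "volume_measure d M \<mu>" and d: "1 \<le> d" and y: "y \<in> M"
    and r: "0 < r" "r < \<tau> / 100"
  shows "ennreal (1/2 * (r / (12 * d * d)) ^ d) \<le> emeasure \<mu> (M \<inter> cball y r)"
proof -
  note sm = mfd_sub(1)[OF m] and \<tau> = mfd_sub(2)[OF m] and cM = mfd_sub(4)[OF m]
  let ?T = "tangent_space M y"
  note fT = findim_tangent[OF sm y]
  obtain b where b: "onb d b ?T" using findim_onb[OF fT] dim_tangent[OF sm y] by metis
  obtain r0 where r0: "r0 > 0" "\<And>q r. q \<in> M \<Longrightarrow> 0 < r \<Longrightarrow> r < r0 \<Longrightarrow>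
      ennreal (1/2 * (r / d) ^ d) \<le> emeasure \<mu> (M \<inter> cball q r)"
    using volume_small_ball[OF sm vol d] by blast
  obtain m :: nat where m': "r / r0 < real m" using reals_Archimedean2 by blast
  have m0: "0 < m" using m' r r0 by (smt (verit) divide_pos_pos gr0I of_nat_0)
  \<comment> \<open>Mesh chosen so that the grid of \<open>m ^ d\<close> points stays within
    \<open>r / 4\<close> of the origin while balls of radius \<open>\<epsilon> / 3\<close> fall
    below the threshold \<open>r0\<close>.\<close>
  define \<epsilon> where "\<epsilon> = r / (4 * d * m)"
  have dm: "0 < real d * real m" using d m0 by simp
  have \<epsilon>: "0 < \<epsilon>" "\<epsilon> * d * m = r / 4" using r d m0 by (auto simp: \<epsilon>_def)
  have "\<epsilon> \<le> r / (4 * 1 * m)" unfolding \<epsilon>_def using r d m0 by (intro divide_left_mono mult_right_mono) auto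
  moreover have "r < r0 * m" using m' r0 by (simp add: field_simps)
  ultimately have \<epsilon>r0: "\<epsilon> / 3 < r0" "\<epsilon> \<le> r"
  proof -
    assume *: "\<epsilon> \<le> r / (4 * 1 * m)" "r < r0 * m"
    have "r / (4 * m) < r0" using * m0 r0 r by (simp add: field_simps) 
    then show "\<epsilon> / 3 < r0" using * \<epsilon> by simp
    have "r / (4 * m) \<le> r / 1" using r m0 by (intro divide_left_mono) auto
    then show "\<epsilon> \<le> r" using * by simp
  qed
  let ?F = "Pi\<^sub>E {..<d} (\<lambda>_. {..<m})"
  define u where "u f = (\<Sum>i<d. (\<epsilon> * real (f i)) *\<^sub>R b i)" for f :: "nat \<Rightarrow> nat"
  have uT: "u f \<in> ?T" for f unfolding u_def using onb_in[OF b]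
    by (auto intro!: subspace_sum subspace_scale findim_subspace fT)
  have nu: "norm (u f) \<le> r / 4" if f: "f \<in> ?F" for f
  proof -
    have "norm (u f) \<le> (\<Sum>i<d. \<epsilon> * m)"
      unfolding u_def
    proof (rule sum_norm_le)
      fix i assume i: "i \<in> {..<d}"
      then have "f i < m" using f by (auto simp: PiE_def)
      then show "norm ((\<epsilon> * real (f i)) *\<^sub>R b i) \<le> \<epsilon> * m" using onb_norm[OF b] i \<epsilon> by simp
    qed
    also have "\<dots> = r / 4" using \<epsilon> by (simp add: algebra_simps)
    finally show ?thesis .
  qed
  have "\<exists>p. f \<in> ?F \<longrightarrow> p \<in> M \<and> norm (p - y) \<le> 2 * norm (u f) \<and> oproj ?T (p - y) = u f" for f
    using tangent_cover'[OF m y uT, of f] nu[of f] r by fastforce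
  then obtain P where P: "\<And>f. f \<in> ?F \<Longrightarrow> P f \<in> M" "\<And>f. f \<in> ?F \<Longrightarrow> norm (P f - y) \<le> 2 * norm (u f)"
    "\<And>f. f \<in> ?F \<Longrightarrow> oproj ?T (P f - y) = u f" by metis
  \<comment> \<open>The projection does not increase distances, so the lifted points are at least as
    separated as the grid; balls of radius \<open>\<epsilon> / 3\<close> around them are
    disjoint.\<close>
  have sep: "\<epsilon> \<le> norm (P f - P f')" if f: "f \<in> ?F" "f' \<in> ?F" "f \<noteq> f'" for f f'
  proof -
    obtain i where i: "i < d" "f i \<noteq> f' i" using f by (metis PiE_ext lessThan_iff)
    have "b i \<bullet> u h = \<epsilon> * real (h i)" for h unfolding u_def by (rule onb_inner_sum[OF b i(1)])
    then have "b i \<bullet> (u f - u f') = \<epsilon> * (real (f i) - real (f' i))" by (simp add: inner_diff_right algebra_simps)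
    moreover have "1 \<le> \<bar>real (f i) - real (f' i)\<bar>" using i(2) by linarith
    ultimately have "\<epsilon> \<le> \<bar>b i \<bullet> (u f - u f')\<bar>" using \<epsilon> mult_left_mono[of 1 "\<bar>real (f i) - real (f' i)\<bar>" \<epsilon>]
      by (simp add: abs_mult)
    also have "\<dots> \<le> norm (u f - u f')" using Cauchy_Schwarz_ineq2[of "b i" "u f - u f'"] onb_norm[OF b i(1)] by simp
    also have "u f - u f' = oproj ?T (P f - P f')"
      using P(3)[OF f(1)] P(3)[OF f(2)] oproj_diff[OF fT, of "P f - y" "P f' - y"] by simp
    also have "norm \<dots> \<le> norm (P f - P f')" by (rule norm_oproj_le[OF fT])
    finally show ?thesis .
  qed
  let ?S = "\<lambda>f. M \<inter> cball (P f) (\<epsilon> / 3)"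
  have disj: "disjoint_family_on ?S ?F"
    unfolding disjoint_family_on_def
  proof (intro ballI impI)
    fix f f' assume f: "f \<in> ?F" "f' \<in> ?F" "f \<noteq> f'"
    show "?S f \<inter> ?S f' = {}"
    proof (rule ccontr)
      assume "?S f \<inter> ?S f' \<noteq> {}"
      then obtain z where "dist (P f) z \<le> \<epsilon> / 3" "dist (P f') z \<le> \<epsilon> / 3" by auto
      then have "dist (P f) (P f') \<le> 2 * \<epsilon> / 3" using dist_triangle2[of "P f" "P f'" z] by simp
      then show False using sep[OF f] \<epsilon> by (simp add: dist_norm)
    qed
  qed
  have finF: "finite ?F" by (intro finite_PiE) auto
  have cF: "card ?F = m ^ d" by (simp add: card_PiE)
  \<comment> \<open>The number of grid points \<open>m ^ d\<close> cancels the mesh, so neither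
    \<open>m\<close> nor the threshold survives.\<close>
  have "ennreal (1/2 * (r / (12 * d * d)) ^ d) = (\<Sum>f\<in>?F. ennreal (1/2 * ((\<epsilon> / 3) / d) ^ d))"
  proof -
    have "(\<Sum>f\<in>?F. ennreal (1/2 * ((\<epsilon> / 3) / d) ^ d)) = ennreal (real (m ^ d) * (1/2 * ((\<epsilon> / 3) / d) ^ d))"
      using \<epsilon> by (subst sum_ennreal) (simp_all add: cF)
    also have "real (m ^ d) * (1/2 * ((\<epsilon> / 3) / d) ^ d) = 1/2 * (m * ((\<epsilon> / 3) / d)) ^ d"
      by (simp only: power_mult_distrib of_nat_power mult.left_commute)
    also have "m * ((\<epsilon> / 3) / d) = r / (12 * d * d)" using m0 d by (simp add: \<epsilon>_def field_simps)
    finally show ?thesis by simp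
  qed
  also have "\<dots> \<le> (\<Sum>f\<in>?F. emeasure \<mu> (?S f))"
    by (intro sum_mono r0(2)) (use P \<epsilon> \<epsilon>r0 in auto)
  also have "\<dots> = emeasure \<mu> (\<Union>f\<in>?F. ?S f)"
    using volume_measure_sets[OF vol cM] disj finF by (intro sum_emeasure) auto
  also have "\<dots> \<le> emeasure \<mu> (M \<inter> cball y r)"
  proof (rule emeasure_mono)
    show "(\<Union>f\<in>?F. ?S f) \<subseteq> M \<inter> cball y r"
    proof
      fix z assume "z \<in> (\<Union>f\<in>?F. ?S f)"
      then obtain f where f: "f \<in> ?F" "z \<in> M" "dist (P f) z \<le> \<epsilon> / 3" by auto
      have "dist y z \<le> dist y (P f) + dist (P f) z" by (rule dist_triangle)
      also have "dist y (P f) \<le> r / 2" using P(2)[OF f(1)] nu[OF f(1)] by (simp add: dist_norm norm_minus_commute)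
      finally show "z \<in> M \<inter> cball y r" using f \<epsilon>r0 r by auto
    qed
  qed (rule volume_measure_sets[OF vol cM])
  finally show ?thesis .
qed

text \<open>Dual to the lower bound: the tangential coordinates are cut into cells, and
  \<open>tangent_expand\<close> confines the part of \<open>M\<close> over a cell to a ball of
  comparable radius. The number of cells again cancels the mesh.\<close>

lemma volume_upper:
  assumes m: "mfd D d \<tau> M" and vol: "volume_measure d M \<mu>" and d: "1 \<le> d" and y: "y \<in> M"
    and r: "0 < r" "r \<le> \<tau> / 500"
  shows "emeasure \<mu> (M \<inter> cball y r) \<le> ennreal (2 * (48 * d * r) ^ d)"
proof -
  note sm = mfd_sub(1)[OF m] and \<tau> = mfd_sub(2)[OF m] and cM = mfd_sub(4)[OF m]
  let ?T = "tangent_space M y"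
  note fT = findim_tangent[OF sm y]
  obtain b where b: "onb d b ?T" using findim_onb[OF fT] dim_tangent[OF sm y] by metis
  obtain r0 where r0: "r0 > 0" "\<And>q r. q \<in> M \<Longrightarrow> 0 < r \<Longrightarrow> r < r0 \<Longrightarrow>
      emeasure \<mu> (M \<inter> cball q r) \<le> ennreal (2 * (4 * r) ^ d)"
    using volume_small_ball[OF sm vol d] by blast
  obtain m :: nat where m': "4 * d * r / r0 < real m" using reals_Archimedean2 by blast
  have "0 < 4 * d * r / r0" using r r0 d by simp
  then have m0: "0 < m" using m' by (cases m) auto
  define \<epsilon> where "\<epsilon> = r / m"
  have \<epsilon>: "0 < \<epsilon>" "\<epsilon> * m = r" using r m0 by (auto simp: \<epsilon>_def)
  have "4 * d * r < r0 * m" using m' r0 by (simp add: field_simps)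
  then have \<epsilon>r0: "4 * d * \<epsilon> < r0" using m0 by (simp add: \<epsilon>_def field_simps)
  let ?F = "Pi\<^sub>E {..<d} (\<lambda>_. {..2 * m})"
  have finF: "finite ?F" by (intro finite_PiE) auto
  have cF: "card ?F = (2 * m + 1) ^ d" by (simp add: card_PiE)
  \<comment> \<open>Cells of half width \<open>\<epsilon>\<close> on a grid of spacing
    \<open>\<epsilon>\<close> overlap, so rounding the coordinates down always gives a valid
    index.\<close>
  define Q where "Q f = {p \<in> M \<inter> cball y r. \<forall>i<d. \<bar>b i \<bullet> (p - y) - (\<epsilon> * real (f i) - r)\<bar> \<le> \<epsilon>}" for f :: "nat \<Rightarrow> nat"
  define G where "G = {f \<in> ?F. Q f \<noteq> {}}"
  have GF: "G \<subseteq> ?F" "finite G" using finF by (auto simp: G_def)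
  have "\<exists>p. f \<in> G \<longrightarrow> p \<in> Q f" for f by (auto simp: G_def)
  then obtain P where P: "\<And>f. f \<in> G \<Longrightarrow> P f \<in> Q f" by metis
  have PM: "P f \<in> M" if "f \<in> G" for f using P[OF that] by (simp add: Q_def)
  have Qs: "Q f \<subseteq> M \<inter> cball (P f) (4 * d * \<epsilon>)" if f: "f \<in> G" for f
  proof
    fix p assume p: "p \<in> Q f"
    let ?p = "P f"
    have "norm (oproj ?T (p - ?p)) \<le> (\<Sum>i<d. 2 * \<epsilon>)"
      unfolding oproj_onb[OF b]
    proof (rule sum_norm_le)
      fix i assume i: "i \<in> {..<d}"
      have "\<bar>b i \<bullet> (p - y) - (\<epsilon> * real (f i) - r)\<bar> \<le> \<epsilon>" "\<bar>b i \<bullet> (?p - y) - (\<epsilon> * real (f i) - r)\<bar> \<le> \<epsilon>"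
        using p P[OF f] i by (auto simp: Q_def)
      moreover have "(p - ?p) \<bullet> b i = b i \<bullet> (p - y) - b i \<bullet> (?p - y)"
        by (simp add: inner_diff_right inner_diff_left inner_commute)
      ultimately have "\<bar>(p - ?p) \<bullet> b i\<bar> \<le> 2 * \<epsilon>" by linarith
      then show "norm (((p - ?p) \<bullet> b i) *\<^sub>R b i) \<le> 2 * \<epsilon>" using onb_norm[OF b] i by simp
    qed
    then have 1: "norm (oproj ?T (p - ?p)) \<le> 2 * d * \<epsilon>" by simp
    have "norm (p - ?p) \<le> 2 * norm (oproj ?T (p - ?p))"
      by (rule tangent_expand[OF m y])
        (use p P[OF f] r in \<open>auto simp: Q_def dist_norm norm_minus_commute\<close>)
    then show "p \<in> M \<inter> cball ?p (4 * d * \<epsilon>)" using 1 p by (auto simp: Q_def dist_norm norm_minus_commute)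
  qed
  have cov: "M \<inter> cball y r \<subseteq> (\<Union>f\<in>G. M \<inter> cball (P f) (4 * d * \<epsilon>))"
  proof
    fix p assume p: "p \<in> M \<inter> cball y r"
    define f where "f = restrict (\<lambda>i. nat \<lfloor>(b i \<bullet> (p - y) + r) / \<epsilon>\<rfloor>) {..<d}"
    have ci: "\<bar>b i \<bullet> (p - y)\<bar> \<le> r" if "i < d" for i
      using Cauchy_Schwarz_ineq2[of "b i" "p - y"] onb_norm[OF b that] p by (simp add: dist_norm norm_minus_commute)
    have fi: "real (f i) \<le> (b i \<bullet> (p - y) + r) / \<epsilon>" "(b i \<bullet> (p - y) + r) / \<epsilon> < real (f i) + 1" if i: "i < d" for i
    proof -
      have "0 \<le> (b i \<bullet> (p - y) + r) / \<epsilon>" using ci[OF i] \<epsilon> by (simp add: abs_le_iff)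
      then show "real (f i) \<le> (b i \<bullet> (p - y) + r) / \<epsilon>" "(b i \<bullet> (p - y) + r) / \<epsilon> < real (f i) + 1"
        using i by (auto simp: f_def)
    qed
    have "f \<in> ?F"
    proof (rule PiE_I)
      fix i assume "i \<in> {..<d}"
      then have i: "i < d" by simp
      have "(b i \<bullet> (p - y) + r) / \<epsilon> \<le> (2 * r) / \<epsilon>" using ci[OF i] \<epsilon> by (intro divide_right_mono) auto
      also have "\<dots> = 2 * m" using \<epsilon>(2)[symmetric] \<epsilon>(1) by simp
      finally show "f i \<in> {..2 * m}" using fi(1)[OF i] by simp
    qed (simp add: f_def)
    moreover have "p \<in> Q f"
    proof -
      have "\<bar>b i \<bullet> (p - y) - (\<epsilon> * real (f i) - r)\<bar> \<le> \<epsilon>" if i: "i < d" for i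
      proof -
        have "\<epsilon> * real (f i) \<le> b i \<bullet> (p - y) + r" using fi(1)[OF i] \<epsilon> by (simp add: field_simps)
        moreover have "b i \<bullet> (p - y) + r \<le> \<epsilon> * real (f i) + \<epsilon>" using fi(2)[OF i] \<epsilon> by (simp add: field_simps)
        ultimately show ?thesis by (simp add: abs_le_iff)
      qed
      then show ?thesis using p by (simp add: Q_def)
    qed
    ultimately have "f \<in> G" by (auto simp: G_def)
    then show "p \<in> (\<Union>f\<in>G. M \<inter> cball (P f) (4 * d * \<epsilon>))" using Qs \<open>p \<in> Q f\<close> by blast
  qed
  have "emeasure \<mu> (M \<inter> cball y r) \<le> emeasure \<mu> (\<Union>f\<in>G. M \<inter> cball (P f) (4 * d * \<epsilon>))"
    using volume_measure_sets[OF vol cM] GF(2) by (intro emeasure_mono cov sets.finite_UN) auto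
  also have "\<dots> \<le> (\<Sum>f\<in>G. emeasure \<mu> (M \<inter> cball (P f) (4 * d * \<epsilon>)))"
    using volume_measure_sets[OF vol cM] GF(2) by (intro emeasure_subadditive_finite) auto
  also have "\<dots> \<le> (\<Sum>f\<in>G. ennreal (2 * (4 * (4 * d * \<epsilon>)) ^ d))"
    by (intro sum_mono r0(2)) (use PM \<epsilon> \<epsilon>r0 d in auto)
  also have "\<dots> \<le> (\<Sum>f\<in>?F. ennreal (2 * (4 * (4 * d * \<epsilon>)) ^ d))"
    using GF finF by (intro sum_mono2) auto
  also have "\<dots> = ennreal (real ((2 * m + 1) ^ d) * (2 * (4 * (4 * d * \<epsilon>)) ^ d))"
    using \<epsilon> by (subst sum_ennreal) (simp_all add: cF)
  also have "real ((2 * m + 1) ^ d) * (2 * (4 * (4 * d * \<epsilon>)) ^ d) = 2 * (real (2 * m + 1) * (4 * (4 * d * \<epsilon>))) ^ d"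
    by (simp add: power_mult_distrib)
  also have "ennreal \<dots> \<le> ennreal (2 * (48 * d * r) ^ d)"
  proof (intro ennreal_leI mult_left_mono power_mono)
    have "real (2 * m + 1) * (4 * (4 * d * \<epsilon>)) \<le> (3 * real m) * (4 * (4 * d * \<epsilon>))"
      using m0 \<epsilon> by (intro mult_right_mono) auto
    also have "\<dots> = 48 * d * (\<epsilon> * m)" by simp
    finally show "real (2 * m + 1) * (4 * (4 * d * \<epsilon>)) \<le> 48 * d * r" using \<epsilon> by simp
  qed (use \<epsilon> in auto)
  finally show ?thesis by simp
qed

section \<open>Packing, covering and volume at larger radii\<close>

lemma mult_power_cancel: "0 < (x::real) \<Longrightarrow> a * x ^ d \<le> b * x ^ d \<longleftrightarrow> a \<le> b"
  by simp

definition separated :: "real \<Rightarrow> 'a::metric_space set \<Rightarrow> bool" where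
  "separated r F \<longleftrightarrow> (\<forall>x\<in>F. \<forall>y\<in>F. x \<noteq> y \<longrightarrow> r < dist x y)"

text \<open>A separated subset of largest cardinality is a net, since an uncovered point could be
  added; the a priori bound \<open>N\<close> makes a largest cardinality exist.\<close>

lemma maximal_separated:
  fixes S :: "'a::metric_space set"
  assumes "0 \<le> r" "\<And>F. finite F \<Longrightarrow> F \<subseteq> S \<Longrightarrow> separated r F \<Longrightarrow> card F \<le> N"
  shows "\<exists>F. finite F \<and> F \<subseteq> S \<and> separated r F \<and> card F \<le> N \<and> S \<subseteq> (\<Union>f\<in>F. cball f r)"
proof -
  let ?P = "\<lambda>F. finite F \<and> F \<subseteq> S \<and> separated r F"
  have "?P {}" by (simp add: separated_def)
  then have "\<exists>F. ?P F \<and> (\<forall>G. ?P G \<longrightarrow> card G \<le> card F)"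
    by (rule ex_has_greatest_nat[where b = "Suc N"]) (use assms(2) in \<open>auto simp: less_Suc_eq_le\<close>)
  then obtain F where F: "?P F" "\<And>G. ?P G \<Longrightarrow> card G \<le> card F" by blast
  have "S \<subseteq> (\<Union>f\<in>F. cball f r)"
  proof (rule ccontr)
    assume "\<not> ?thesis"
    then obtain q where q: "q \<in> S" "\<And>f. f \<in> F \<Longrightarrow> r < dist f q" by force
    have "q \<notin> F" using q(2)[of q] assms(1) by auto
    moreover have "?P (insert q F)" using F(1) q by (auto simp: separated_def dist_commute)
    ultimately show False using F(2)[of "insert q F"] F(1) by simp
  qed
  then show ?thesis using F(1) assms(2) by blast
qed

lemma packing:
  fixes F :: "'a::metric_space set" and c :: real
  assumes "finite F" "separated r F" "0 \<le> c" "\<And>f. f \<in> F \<Longrightarrow> ennreal c \<le> emeasure \<mu> (M \<inter> cball f (r / 2))"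
    "\<And>f. f \<in> F \<Longrightarrow> M \<inter> cball f (r / 2) \<in> sets \<mu>" "\<And>f. f \<in> F \<Longrightarrow> M \<inter> cball f (r / 2) \<subseteq> B" "B \<in> sets \<mu>"
  shows "ennreal (card F * c) \<le> emeasure \<mu> B"
proof -
  let ?S = "\<lambda>f. M \<inter> cball f (r / 2)"
  have disj: "disjoint_family_on ?S F"
    unfolding disjoint_family_on_def
  proof (intro ballI impI)
    fix f f' assume f: "f \<in> F" "f' \<in> F" "f \<noteq> f'"
    show "?S f \<inter> ?S f' = {}"
    proof (rule ccontr)
      assume "?S f \<inter> ?S f' \<noteq> {}"
      then obtain z where "dist f z \<le> r / 2" "dist f' z \<le> r / 2" by auto
      then have "dist f f' \<le> r" using dist_triangle2[of f f' z] by simp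
      then show False using assms(2) f unfolding separated_def by force
    qed
  qed
  have "ennreal (card F * c) = (\<Sum>f\<in>F. ennreal c)" using assms(3) by (subst sum_ennreal) simp_all
  also have "\<dots> \<le> (\<Sum>f\<in>F. emeasure \<mu> (?S f))" by (intro sum_mono assms(4))
  also have "\<dots> = emeasure \<mu> (\<Union>f\<in>F. ?S f)"
    using assms(1,5) disj by (intro sum_emeasure) auto
  also have "\<dots> \<le> emeasure \<mu> B" using assms(6,7) by (intro emeasure_mono) auto
  finally show ?thesis .
qed

text \<open>Ratio of the upper volume bound at radius \<open>3 * r\<close> to the lower one at
  \<open>r / 2\<close>: the bases are \<open>144 * d * r\<close> and
  \<open>r / (24 * d * d)\<close>, the prefactors 2 and 1/2.\<close>

definition covering_number :: "nat \<Rightarrow> nat" where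
  "covering_number d = 4 * (3456 * d ^ 3) ^ d"

lemma covering_number_step:
  assumes m: "mfd D d \<tau> M" and vol: "volume_measure d M \<mu>" and d: "1 \<le> d" and p: "p \<in> M"
    and r: "0 < r" "r \<le> \<tau> / 2000"
  shows "\<exists>F. finite F \<and> F \<subseteq> M \<and> card F \<le> covering_number d \<and> M \<inter> cball p (2 * r) \<subseteq> (\<Union>f\<in>F. cball f r)"
proof -
  note \<tau> = mfd_sub(2)[OF m] and cM = mfd_sub(4)[OF m] and sets = volume_measure_sets[OF vol mfd_sub(4)[OF m]]
  have "card F \<le> covering_number d" if F: "finite F" "F \<subseteq> M \<inter> cball p (2 * r)" "separated r F" for F
  proof -
    let ?c = "1/2 * (r / 2 / (12 * real d * real d)) ^ d"
    have "ennreal (card F * ?c) \<le> emeasure \<mu> (M \<inter> cball p (3 * r))"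
    proof (rule packing[OF F(1,3)])
      fix f assume f: "f \<in> F"
      show "ennreal ?c \<le> emeasure \<mu> (M \<inter> cball f (r / 2))"
        using volume_lower[OF m vol d, of f "r / 2"] f F r \<tau> by auto
      show "M \<inter> cball f (r / 2) \<subseteq> M \<inter> cball p (3 * r)"
      proof
        fix z assume "z \<in> M \<inter> cball f (r / 2)"
        moreover have "dist p f \<le> 2 * r" using f F by auto
        ultimately show "z \<in> M \<inter> cball p (3 * r)" using dist_triangle[of p z f] r by auto
      qed
    qed (use r sets in auto)
    also have "\<dots> \<le> ennreal (2 * (48 * real d * (3 * r)) ^ d)"
      using volume_upper[OF m vol d p, of "3 * r"] r by simp
    finally have "card F * ?c \<le> 2 * (48 * real d * (3 * r)) ^ d" using r by (simp add: ennreal_le_iff)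
    moreover have "(48 * real d * (3 * r)) ^ d = (3456 * real d ^ 3) ^ d * (r / 2 / (12 * real d * real d)) ^ d"
      unfolding power_mult_distrib[symmetric] using d by (intro arg_cong[of _ _ "\<lambda>x. x ^ d"]) (simp add: field_simps power3_eq_cube)
    ultimately have "(card F / 2) * (r / 2 / (12 * real d * real d)) ^ d \<le> (2 * (3456 * real d ^ 3) ^ d) * (r / 2 / (12 * real d * real d)) ^ d"
      by simp
    moreover have "0 < r / 2 / (12 * real d * real d)" using r d by simp
    ultimately have "card F / 2 \<le> 2 * (3456 * real d ^ 3) ^ d" using mult_power_cancel by blast
    then have "real (card F) \<le> real (covering_number d)" by (simp add: covering_number_def)
    then show ?thesis by simp
  qed
  then have "\<exists>F. finite F \<and> F \<subseteq> M \<inter> cball p (2 * r) \<and> separated r F \<and> card F \<le> covering_number d \<and>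
      M \<inter> cball p (2 * r) \<subseteq> (\<Union>f\<in>F. cball f r)"
    using r by (intro maximal_separated) auto
  then show ?thesis by blast
qed

text \<open>Extends coverings to radii beyond the range of the volume bounds: points within
  \<open>R\<close> are reached by chains of \<open>n\<close> short steps, and each step replaces
  every ball of a covering by at most \<open>covering_number d\<close> balls.\<close>

lemma covering_number_chain:
  assumes m: "mfd D d \<tau> M" and vol: "volume_measure d M \<mu>" and d: "1 \<le> d" and y: "y \<in> M"
    and r: "0 < r" "r \<le> \<tau> / 2000" and R: "R \<le> \<tau> / 4" "8/7 * (R / n) \<le> r" "0 < n"
  shows "\<exists>G. finite G \<and> G \<subseteq> M \<and> card G \<le> covering_number d ^ n \<and> M \<inter> cball y R \<subseteq> (\<Union>g\<in>G. cball g r)"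
proof -
  obtain F where F: "\<And>p. p \<in> M \<Longrightarrow> finite (F p) \<and> F p \<subseteq> M \<and> card (F p) \<le> covering_number d \<and>
      M \<inter> cball p (2 * r) \<subseteq> (\<Union>f\<in>F p. cball f r)"
    using covering_number_step[OF m vol d _ r] by metis
  let ?reach = "\<lambda>i. {q. \<exists>c. c 0 = y \<and> c i = q \<and> (\<forall>j\<le>i. c j \<in> M) \<and> (\<forall>j<i. norm (c (Suc j) - c j) \<le> r)}"
  have "\<exists>G. finite G \<and> G \<subseteq> M \<and> card G \<le> covering_number d ^ i \<and> ?reach i \<subseteq> (\<Union>g\<in>G. cball g r)" for i
  proof (induction i)
    case 0
    show ?case by (rule exI[of _ "{y}"]) (use y r in auto)
  next
    case (Suc i)
    then obtain G where G: "finite G" "G \<subseteq> M" "card G \<le> covering_number d ^ i" "?reach i \<subseteq> (\<Union>g\<in>G. cball g r)"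
      by blast
    let ?G = "\<Union>g\<in>G. F g"
    have "card ?G \<le> (\<Sum>g\<in>G. card (F g))" using G(1) by (rule card_UN_le)
    also have "\<dots> \<le> (\<Sum>g\<in>G. covering_number d)" using F G(2) by (intro sum_mono) blast
    also have "\<dots> \<le> covering_number d ^ Suc i" using mult_right_mono[OF G(3), of "covering_number d"] by (simp add: mult.commute)
    finally have "card ?G \<le> covering_number d ^ Suc i" .
    moreover have "?reach (Suc i) \<subseteq> (\<Union>g\<in>?G. cball g r)"
    proof
      fix q assume "q \<in> ?reach (Suc i)"
      then obtain c where c: "c 0 = y" "c (Suc i) = q" "\<forall>j\<le>Suc i. c j \<in> M" "\<forall>j<Suc i. norm (c (Suc j) - c j) \<le> r"
        by blast
      then have "c i \<in> ?reach i" by (intro CollectI exI[of _ c]) auto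
      then obtain g where g: "g \<in> G" "dist g (c i) \<le> r" using G(4) by auto
      have "dist (c i) q \<le> r" using c(2,4) by (auto simp: dist_norm norm_minus_commute)
      then have "q \<in> M \<inter> cball g (2 * r)" using g(2) dist_triangle[of g q "c i"] c(2,3) by auto
      then have "q \<in> (\<Union>f\<in>F g. cball f r)" using F[of g] g(1) G(2) by blast
      then show "q \<in> (\<Union>g\<in>?G. cball g r)" using g(1) by blast
    qed
    moreover have "finite ?G" using F G(1,2) by (intro finite_UN_I) auto
    moreover have "?G \<subseteq> M" using F G(2) by blast
    ultimately show ?case by (intro exI[of _ ?G] conjI)
  qed
  from this[of n] obtain G where G: "finite G" "G \<subseteq> M" "card G \<le> covering_number d ^ n" "?reach n \<subseteq> (\<Union>g\<in>G. cball g r)"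
    by blast
  have "M \<inter> cball y R \<subseteq> ?reach n"
  proof
    fix q assume q: "q \<in> M \<inter> cball y R"
    then obtain c where "c 0 = y" "c n = q" "\<forall>i\<le>n. c i \<in> M" "\<forall>i<n. norm (c (Suc i) - c i) \<le> 8/7 * (R / n)"
      using chain_ex[OF m y, of q R n] R by (auto simp: dist_norm norm_minus_commute)
    then show "q \<in> ?reach n" using R(2) by (auto intro!: exI[of _ c] elim: order_trans[rotated])
  qed
  then have "M \<inter> cball y R \<subseteq> (\<Union>g\<in>G. cball g r)" using G(4) by (rule subset_trans)
  then show ?thesis by (intro exI[of _ G] conjI G(1,2,3))
qed

text \<open>The upper bound is wanted for radii up to \<open>\<tau> / 4\<close>, far beyond
  \<open>\<tau> / 500\<close>; covering by chains bridges the gap at the price of a constant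
  depending on \<open>d\<close> only.\<close>

lemma volume_bounds:
  assumes "1 \<le> d"
  shows "\<exists>c>0. \<exists>C>0. \<forall>D \<tau> M \<mu>. mfd D d \<tau> M \<longrightarrow> volume_measure d M \<mu> \<longrightarrow>
    (\<forall>y\<in>M. \<forall>r. 0 < r \<longrightarrow> r < \<tau> / 100 \<longrightarrow> ennreal (c * r ^ d) \<le> emeasure \<mu> (M \<inter> cball y r)) \<and>
    (\<forall>y\<in>M. \<forall>h. 0 < h \<longrightarrow> h \<le> \<tau> / 8 \<longrightarrow> emeasure \<mu> (M \<inter> cball y (2 * h)) \<le> ennreal (C * h ^ d))"
proof -
  define c where "c = 1/2 * (1 / (12 * real d * real d)) ^ d"
  \<comment> \<open>With covering radius \<open>h / 250\<close> and \<open>R = 2 * h\<close>, the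
    chain steps are at most \<open>8/7 * (2 * h / 600)\<close>, just below
    \<open>h / 250\<close>.\<close>
  define n :: nat where "n = 600"
  define N where "N = real (covering_number d ^ n)"
  define C where "C = N * (2 * (48 * real d) ^ d)"
  have N0: "0 < N" using assms by (simp add: N_def covering_number_def)
  have c0: "0 < c" using assms by (simp add: c_def)
  have C0: "0 < C" using N0 assms by (simp add: C_def)
  have "ennreal (c * r ^ d) \<le> emeasure \<mu> (M \<inter> cball y r)"
    if m: "mfd D d \<tau> M" and vol: "volume_measure d M \<mu>" and y: "y \<in> M" and r: "0 < r" "r < \<tau> / 100"
    for D \<tau> M \<mu> y r
  proof -
    have "c * r ^ d = 1/2 * (r / (12 * d * d)) ^ d"
      by (simp add: c_def power_mult_distrib power_divide)
    then show ?thesis using volume_lower[OF m vol assms y r] by (simp only: of_nat_mult of_nat_numeral)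
  qed
  moreover have "emeasure \<mu> (M \<inter> cball y (2 * h)) \<le> ennreal (C * h ^ d)"
    if m: "mfd D d \<tau> M" and vol: "volume_measure d M \<mu>" and y: "y \<in> M" and h: "0 < h" "h \<le> \<tau> / 8"
    for D \<tau> M \<mu> y h
  proof -
    have r: "0 < h / 250" "h / 250 \<le> \<tau> / 2000" using h by auto
    note sets = volume_measure_sets[OF vol mfd_sub(4)[OF m]]
    obtain G where G: "finite G" "G \<subseteq> M" "card G \<le> covering_number d ^ n" "M \<inter> cball y (2 * h) \<subseteq> (\<Union>g\<in>G. cball g (h / 250))"
      using covering_number_chain[OF m vol assms y r, of "2 * h" n] h by (auto simp: n_def)
    have "M \<inter> cball y (2 * h) \<subseteq> (\<Union>g\<in>G. M \<inter> cball g (h / 250))" using G(4) by blast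
    then have "emeasure \<mu> (M \<inter> cball y (2 * h)) \<le> emeasure \<mu> (\<Union>g\<in>G. M \<inter> cball g (h / 250))"
      using sets G(1) by (intro emeasure_mono sets.finite_UN) auto
    also have "\<dots> \<le> (\<Sum>g\<in>G. emeasure \<mu> (M \<inter> cball g (h / 250)))"
      using sets G(1) by (intro emeasure_subadditive_finite) auto
    also have "\<dots> \<le> (\<Sum>g\<in>G. ennreal (2 * (48 * d * h) ^ d))"
    proof (intro sum_mono)
      fix g assume "g \<in> G"
      then have "emeasure \<mu> (M \<inter> cball g (h / 250)) \<le> ennreal (2 * (48 * d * (h / 250)) ^ d)"
        using volume_upper[OF m vol assms, of g "h / 250"] G(2) h mfd_sub(2)[OF m] by auto
      also have "\<dots> \<le> ennreal (2 * (48 * d * h) ^ d)"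
        using h by (intro ennreal_leI mult_left_mono power_mono) auto
      finally show "emeasure \<mu> (M \<inter> cball g (h / 250)) \<le> ennreal (2 * (48 * d * h) ^ d)" .
    qed
    also have "\<dots> = ennreal (card G * (2 * (48 * d * h) ^ d))" using h by (subst sum_ennreal) simp_all
    also have "\<dots> \<le> ennreal (C * h ^ d)"
    proof (rule ennreal_leI)
      have "real (card G) \<le> N" using G(3) unfolding N_def by (simp only: of_nat_le_iff)
      then have "card G * (2 * (48 * d * h) ^ d) \<le> N * (2 * (48 * d * h) ^ d)" using h by (intro mult_right_mono) auto
      also have "\<dots> = C * h ^ d" by (simp add: C_def power_mult_distrib)
      finally show "card G * (2 * (48 * d * h) ^ d) \<le> C * h ^ d" .
    qed
    finally show ?thesis .
  qed
  ultimately show ?thesis using c0 C0 by (intro exI[of _ c] exI[of _ C] conjI allI impI ballI) auto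
qed

section \<open>Concentration of counts\<close>

text \<open>Chernoff bound with a free sign of \<open>s\<close>, so that both tails follow; the
  moment generating function is estimated by \<open>1 + x \<le> exp x\<close>.\<close>

lemma exp_moment_count:
  fixes s :: real
  assumes Q: "prob_space Q" and B: "B \<in> sets Q" and I: "finite I"
  shows "emeasure (Pi\<^sub>M I (\<lambda>_. Q)) {\<omega> \<in> space (Pi\<^sub>M I (\<lambda>_. Q)). t \<le> s * (\<Sum>i\<in>I. indicator B (\<omega> i))}
    \<le> ennreal (exp (- t) * exp (card I * ((exp s - 1) * measure Q B)))"
proof -
  interpret Q: prob_space Q by (rule Q)
  interpret P: product_prob_space "\<lambda>_. Q" I by standard
  let ?P = "Pi\<^sub>M I (\<lambda>_. Q)" and ?p = "measure Q B"
  let ?u = "\<lambda>\<omega>. \<Prod>i\<in>I. ennreal (exp (s * indicator B (\<omega> i)))"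
  have meas: "(\<lambda>\<omega>. indicator B (\<omega> i) :: real) \<in> borel_measurable ?P" if "i \<in> I" for i
    using that B by measurable
  have "(\<lambda>\<omega>. ennreal (exp (s * indicator B (\<omega> i)))) \<in> borel_measurable ?P" if "i \<in> I" for i
    using meas[OF that] by measurable
  then have mu: "?u \<in> borel_measurable ?P" by (rule borel_measurable_prod_ennreal)
  have one: "(\<integral>\<^sup>+x. ennreal (exp (s * indicator B x)) \<partial>Q) \<le> ennreal (exp ((exp s - 1) * ?p))"
  proof -
    have "(\<integral>\<^sup>+x. ennreal (exp (s * indicator B x)) \<partial>Q) =
        (\<integral>\<^sup>+x. ennreal (exp s) * indicator B x + indicator (space Q - B) x \<partial>Q)"
      by (intro nn_integral_cong) (auto simp: indicator_def)
    also have "\<dots> = ennreal (exp s) * emeasure Q B + emeasure Q (space Q - B)"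
      using B by (subst nn_integral_add) (auto simp: nn_integral_cmult)
    also have "\<dots> = ennreal (exp s * ?p + (1 - ?p))"
      using Q.prob_compl[OF B] by (simp add: Q.emeasure_eq_measure ennreal_mult[symmetric] ennreal_plus[symmetric] del: ennreal_plus)
    also have "exp s * ?p + (1 - ?p) = 1 + (exp s - 1) * ?p" by (simp add: algebra_simps)
    also have "ennreal \<dots> \<le> ennreal (exp ((exp s - 1) * ?p))"
      by (intro ennreal_leI exp_ge_add_one_self)
    finally show ?thesis .
  qed
  have "{\<omega> \<in> space ?P. t \<le> s * (\<Sum>i\<in>I. indicator B (\<omega> i))} = {\<omega> \<in> space ?P. 1 \<le> ennreal (exp (- t)) * ?u \<omega>}"
  proof (intro Collect_cong conj_cong refl)
    fix \<omega>
    have "?u \<omega> = ennreal (exp (s * (\<Sum>i\<in>I. indicator B (\<omega> i))))"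
    proof -
      have "exp (s * (\<Sum>i\<in>I. indicator B (\<omega> i))) = (\<Prod>i\<in>I. exp (s * indicator B (\<omega> i)))"
        by (simp only: sum_distrib_left exp_sum[OF I])
      then show ?thesis by (simp only: prod_ennreal exp_ge_zero)
    qed
    then have "ennreal (exp (- t)) * ?u \<omega> = ennreal (exp (s * (\<Sum>i\<in>I. indicator B (\<omega> i)) - t))"
      by (simp add: ennreal_mult[symmetric] exp_add[symmetric])
    then show "(t \<le> s * (\<Sum>i\<in>I. indicator B (\<omega> i))) = (1 \<le> ennreal (exp (- t)) * ?u \<omega>)"
      by (simp add: ennreal_ge_1)
  qed
  then have "emeasure ?P {\<omega> \<in> space ?P. t \<le> s * (\<Sum>i\<in>I. indicator B (\<omega> i))} \<le>
      ennreal (exp (- t)) * (\<integral>\<^sup>+\<omega>. ?u \<omega> * indicator (space ?P) \<omega> \<partial>?P)"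
    using nn_integral_Markov_inequality[of ?u "space ?P" ?P "ennreal (exp (- t))"] mu by simp
  also have "(\<integral>\<^sup>+\<omega>. ?u \<omega> * indicator (space ?P) \<omega> \<partial>?P) = (\<integral>\<^sup>+\<omega>. ?u \<omega> \<partial>?P)"
    by (intro nn_integral_cong) simp
  also have "\<dots> = (\<Prod>i\<in>I. (\<integral>\<^sup>+x. ennreal (exp (s * indicator B x)) \<partial>Q))"
    using B I by (intro P.product_nn_integral_prod) auto
  also have "\<dots> \<le> (\<Prod>i\<in>I. ennreal (exp ((exp s - 1) * ?p)))"
    by (intro prod_mono_ennreal one)
  also have "\<dots> = ennreal (exp (card I * ((exp s - 1) * ?p)))"
    by (simp add: ennreal_power exp_of_nat_mult)
  finally show ?thesis by (simp add: ennreal_mult mult_left_mono)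
qed

text \<open>The choice \<open>s = -1\<close>: since \<open>exp (-1) \<le> 1/2\<close>, the exponent
  is at most \<open>card I * (a / 4 - a / 2)\<close>.\<close>

lemma count_lower_tail:
  fixes a :: real
  assumes Q: "prob_space Q" and B: "B \<in> sets Q" and I: "finite I" and a: "0 \<le> a" "a \<le> measure Q B"
  shows "emeasure (Pi\<^sub>M I (\<lambda>_. Q)) {\<omega> \<in> space (Pi\<^sub>M I (\<lambda>_. Q)). (\<Sum>i\<in>I. indicator B (\<omega> i)) \<le> card I * a / 4}
    \<le> ennreal (exp (- (card I * a / 4)))"
proof -
  have "(2::real) \<le> exp 1" using exp_ge_add_one_self[of 1] by simp
  then have "exp (-1) \<le> (1/2 :: real)" by (simp add: exp_minus field_simps)
  then have "(exp (-1) - 1) * measure Q B \<le> - 1/2 * measure Q B" by (intro mult_right_mono) auto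
  also have "\<dots> \<le> - 1/2 * a" using a by simp
  finally have *: "card I * ((exp (-1) - 1) * measure Q B) \<le> card I * (- 1/2 * a)" by (intro mult_left_mono) auto
  have "{\<omega> \<in> space (Pi\<^sub>M I (\<lambda>_. Q)). (\<Sum>i\<in>I. indicator B (\<omega> i)) \<le> card I * a / 4} =
      {\<omega> \<in> space (Pi\<^sub>M I (\<lambda>_. Q)). - (card I * a / 4) \<le> -1 * (\<Sum>i\<in>I. indicator B (\<omega> i))}" by auto
  also have "emeasure (Pi\<^sub>M I (\<lambda>_. Q)) \<dots> \<le>
      ennreal (exp (- (- (card I * a / 4))) * exp (card I * ((exp (-1) - 1) * measure Q B)))"
    by (rule exp_moment_count[OF Q B I])
  also have "\<dots> \<le> ennreal (exp (- (card I * a / 4)))"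
    unfolding exp_add[symmetric]
    by (intro ennreal_leI iffD2[OF exp_le_cancel_iff]) (use * in \<open>simp add: algebra_simps\<close>)
  finally show ?thesis .
qed

text \<open>The choice \<open>s = 1\<close>: since \<open>exp 1 \<le> 3\<close>, the exponent is at
  most \<open>card I * (2 * b - 3 * b)\<close>.\<close>

lemma count_upper_tail:
  fixes b :: real
  assumes Q: "prob_space Q" and B: "B \<in> sets Q" and I: "finite I" and b: "measure Q B \<le> b"
  shows "emeasure (Pi\<^sub>M I (\<lambda>_. Q)) {\<omega> \<in> space (Pi\<^sub>M I (\<lambda>_. Q)). 3 * card I * b \<le> (\<Sum>i\<in>I. indicator B (\<omega> i))}
    \<le> ennreal (exp (- (card I * b)))"
proof -
  have "(exp 1 - 1) * measure Q B \<le> 2 * measure Q B" using exp_le by (intro mult_right_mono) auto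
  also have "\<dots> \<le> 2 * b" using b by simp
  finally have *: "card I * ((exp 1 - 1) * measure Q B) \<le> card I * (2 * b)" by (intro mult_left_mono) auto
  have "{\<omega> \<in> space (Pi\<^sub>M I (\<lambda>_. Q)). 3 * card I * b \<le> (\<Sum>i\<in>I. indicator B (\<omega> i))} =
      {\<omega> \<in> space (Pi\<^sub>M I (\<lambda>_. Q)). 3 * card I * b \<le> 1 * (\<Sum>i\<in>I. indicator B (\<omega> i))}" by simp
  also have "emeasure (Pi\<^sub>M I (\<lambda>_. Q)) \<dots> \<le>
      ennreal (exp (- (3 * card I * b)) * exp (card I * ((exp 1 - 1) * measure Q B)))"
    by (rule exp_moment_count[OF Q B I])
  also have "\<dots> \<le> ennreal (exp (- (card I * b)))"
    unfolding exp_add[symmetric]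
    by (intro ennreal_leI iffD2[OF exp_le_cancel_iff]) (use * in \<open>simp add: algebra_simps\<close>)
  finally show ?thesis .
qed

lemma sum_indicator_card:
  "finite I \<Longrightarrow> (\<Sum>i\<in>I. indicator B (\<omega> i) :: real) = card {i \<in> I. \<omega> i \<in> B}"
  by (simp add: indicator_def sum.If_cases Int_def)

section \<open>Probability of balls and the sampling event\<close>

lemma base_model_support:
  assumes bm: "(M, P0) \<in> base_model D d k \<tau> L fmin fmax" and \<tau>: "0 < \<tau>"
  shows "mfd D d \<tau> M" "emeasure P0 (- M) = 0"
proof -
  obtain \<mu> \<phi> where vol: "volume_measure d M \<mu>" and \<phi>: "\<phi> \<in> borel_measurable borel"
      and P0: "P0 = density \<mu> (\<lambda>x. ennreal (\<phi> x))" and mc: "M \<in> manifold_class D d k \<tau> L"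
    using bm unfolding base_model_def by blast
  show m: "mfd D d \<tau> M" using mc \<tau> by (simp add: mfd_def manifold_class_def)
  have s\<mu>: "sets \<mu> = sets borel" and \<mu>M: "emeasure \<mu> (- M) = 0" using vol by (auto simp: volume_measure_def)
  have \<phi>\<mu>: "(\<lambda>x. ennreal (\<phi> x)) \<in> borel_measurable \<mu>" using \<phi> s\<mu> by (simp cong: measurable_cong_sets)
  have cM: "closed M" using mfd_sub(4)[OF m] by (rule compact_imp_closed)
  have "- M \<in> null_sets \<mu>" using s\<mu> \<mu>M cM by (intro null_setsI) (auto intro: borel_open open_Compl)
  then have "emeasure P0 (- M) = (\<integral>\<^sup>+x. ennreal (\<phi> x) * indicator (- M) x \<partial>\<mu>)"
    unfolding P0 by (intro emeasure_density \<phi>\<mu> null_setsD2)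
  also have "\<dots> = 0" using \<open>- M \<in> null_sets \<mu>\<close> by (rule nn_integral_null_set)
  finally show "emeasure P0 (- M) = 0" .
qed

lemma base_model_bounds:
  assumes vb: "\<And>D \<tau> M \<mu>. mfd D d \<tau> M \<Longrightarrow> volume_measure d M \<mu> \<Longrightarrow>
    (\<forall>y\<in>M. \<forall>r. 0 < r \<longrightarrow> r < \<tau> / 100 \<longrightarrow> ennreal (c * r ^ d) \<le> emeasure \<mu> (M \<inter> cball y r)) \<and>
    (\<forall>y\<in>M. \<forall>h. 0 < h \<longrightarrow> h \<le> \<tau> / 8 \<longrightarrow> emeasure \<mu> (M \<inter> cball y (2 * h)) \<le> ennreal (C * h ^ d))"
    and cC: "0 < c" "0 < C" and f: "0 < fmin" "fmin \<le> fmax"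
    and bm: "(M, P0) \<in> base_model D d k \<tau> L fmin fmax" and \<tau>: "0 < \<tau>"
  shows "\<And>y r. y \<in> M \<Longrightarrow> 0 < r \<Longrightarrow> r < \<tau> / 100 \<Longrightarrow> fmin * (c * r ^ d) \<le> measure P0 (cball y r)"
    "\<And>y h. y \<in> M \<Longrightarrow> 0 < h \<Longrightarrow> h \<le> \<tau> / 8 \<Longrightarrow> measure P0 (cball y (2 * h)) \<le> fmax * (C * h ^ d)"
proof -
  obtain \<mu> \<phi> where vol: "volume_measure d M \<mu>" and \<phi>: "\<phi> \<in> borel_measurable borel"
      "\<And>x. x \<in> M \<Longrightarrow> fmin \<le> \<phi> x \<and> \<phi> x \<le> fmax" and P0: "P0 = density \<mu> (\<lambda>x. ennreal (\<phi> x))"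
      and mc: "M \<in> manifold_class D d k \<tau> L" and pr: "prob_space P0" and sP: "sets P0 = sets borel"
    using bm unfolding base_model_def by blast
  note m = base_model_support(1)[OF bm \<tau>] and PM = base_model_support(2)[OF bm \<tau>]
  interpret prob_space P0 by (rule pr)
  have s\<mu>: "sets \<mu> = sets borel" and \<mu>M: "emeasure \<mu> (- M) = 0" using vol by (auto simp: volume_measure_def)
  have \<phi>\<mu>: "(\<lambda>x. ennreal (\<phi> x)) \<in> borel_measurable \<mu>" using \<phi>(1) s\<mu> by (simp cong: measurable_cong_sets)
  have cM: "closed M" using mfd_sub(4)[OF m] by (rule compact_imp_closed)
  \<comment> \<open>\<open>P0\<close> gives no mass to the complement of \<open>M\<close>, so balls
    may be cut down to \<open>M\<close>, where the density bounds hold.\<close>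
  have eP: "emeasure P0 (cball y r) = (\<integral>\<^sup>+x. ennreal (\<phi> x) * indicator (M \<inter> cball y r) x \<partial>\<mu>)" for y r
  proof -
    have b: "M \<inter> cball y r \<in> sets \<mu>" using volume_measure_sets[OF vol mfd_sub(4)[OF m]] .
    have "emeasure P0 (cball y r) = emeasure P0 (M \<inter> cball y r)"
    proof (rule emeasure_eq_AE)
      have "- M \<in> null_sets P0" using PM sP cM by (intro null_setsI) (auto intro: borel_open open_Compl)
      then show "AE x in P0. x \<in> cball y r \<longleftrightarrow> x \<in> M \<inter> cball y r" by (rule AE_I') auto
    qed (use b sP s\<mu> in auto)
    also have "\<dots> = (\<integral>\<^sup>+x. ennreal (\<phi> x) * indicator (M \<inter> cball y r) x \<partial>\<mu>)"
      unfolding P0 using b by (intro emeasure_density \<phi>\<mu>)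
    finally show ?thesis .
  qed
  show "fmin * (c * r ^ d) \<le> measure P0 (cball y r)" if "y \<in> M" "0 < r" "r < \<tau> / 100" for y r
  proof -
    have b: "M \<inter> cball y r \<in> sets \<mu>" using volume_measure_sets[OF vol mfd_sub(4)[OF m]] .
    have "ennreal (fmin * (c * r ^ d)) = ennreal fmin * ennreal (c * r ^ d)" using f cC that by (intro ennreal_mult) auto
    also have "\<dots> \<le> ennreal fmin * emeasure \<mu> (M \<inter> cball y r)" using vb[OF m vol] that by (intro mult_left_mono) auto
    also have "\<dots> = (\<integral>\<^sup>+x. ennreal fmin * indicator (M \<inter> cball y r) x \<partial>\<mu>)" using b by (rule nn_integral_cmult_indicator[symmetric])
    also have "\<dots> \<le> emeasure P0 (cball y r)"
      unfolding eP using \<phi>(2) by (intro nn_integral_mono) (auto simp: indicator_def intro: ennreal_leI)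
    finally show ?thesis by (simp add: emeasure_eq_measure)
  qed
  show "measure P0 (cball y (2 * h)) \<le> fmax * (C * h ^ d)" if "y \<in> M" "0 < h" "h \<le> \<tau> / 8" for y h
  proof -
    have b: "M \<inter> cball y (2 * h) \<in> sets \<mu>" using volume_measure_sets[OF vol mfd_sub(4)[OF m]] .
    have "emeasure P0 (cball y (2 * h)) \<le> (\<integral>\<^sup>+x. ennreal fmax * indicator (M \<inter> cball y (2 * h)) x \<partial>\<mu>)"
      unfolding eP using \<phi>(2) by (intro nn_integral_mono) (auto simp: indicator_def intro: ennreal_leI)
    also have "\<dots> = ennreal fmax * emeasure \<mu> (M \<inter> cball y (2 * h))" using b by (rule nn_integral_cmult_indicator)
    also have "\<dots> \<le> ennreal fmax * ennreal (C * h ^ d)" using vb[OF m vol] that by (intro mult_left_mono) auto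
    also have "\<dots> = ennreal (fmax * (C * h ^ d))" using f cC that by (intro ennreal_mult[symmetric]) auto
    finally show ?thesis using f cC that by (simp add: emeasure_eq_measure)
  qed
qed

text \<open>The almost sure support properties are turned into one measurable rectangle of full
  measure, on which both the deviation event and the majorant for the expectation are built.\<close>

lemma noisy_support_event:
  fixes n :: nat
  assumes nm: "(M, Q) \<in> noisy_model D d k \<tau> L fmin fmax \<sigma>" and \<tau>: "0 < \<tau>"
  defines "P \<equiv> Pi\<^sub>M {1..n} (\<lambda>_. Q)" and "A0 \<equiv> Pi\<^sub>E {1..n} (\<lambda>_. M \<times> (Rdim D \<inter> cball 0 \<sigma>))"
  shows "A0 \<in> sets P" "measure P A0 = 1"
proof -
  define P0 where "P0 = distr Q borel fst"
  have Q: "prob_space Q" and sQ: "sets Q = sets borel" and bm: "(M, P0) \<in> base_model D d k \<tau> L fmin fmax"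
    and AE1: "AE (y, z) in Q. z \<in> Rdim D \<and> (\<forall>v\<in>tangent_space M y. inner z v = 0) \<and> norm z \<le> \<sigma>"
    using nm unfolding noisy_model_def P0_def by blast+
  note m = base_model_support(1)[OF bm \<tau>]
  have cM: "closed M" using mfd_sub(4)[OF m] by (rule compact_imp_closed)
  interpret Q: prob_space Q by (rule Q)
  have fstm: "fst \<in> measurable Q borel"
    using sQ by (subst measurable_cong_sets[OF sQ refl]) (intro borel_measurable_continuous_onI continuous_intros)
  have sP0: "sets P0 = sets borel" by (simp add: P0_def)
  interpret PP: product_prob_space "\<lambda>_. Q" "{1..n}" by standard
  have PS: "prob_space P" unfolding P_def by (intro prob_space_PiM Q)
  interpret P: prob_space P by (rule PS)
  define S where "S = M \<times> (Rdim D \<inter> cball 0 \<sigma>)"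
  have S: "S \<in> sets Q" unfolding sQ S_def
    by (intro borel_closed closed_Times closed_Int cM closed_findim findim_Rdim closed_cball)
  have "AE x in Q. fst x \<in> M"
  proof -
    have "- M \<in> null_sets P0" using base_model_support(2)[OF bm \<tau>] sP0 cM by (intro null_setsI) (auto intro: borel_open open_Compl)
    then have "AE y in P0. y \<in> M" by (rule AE_I') auto
    then show ?thesis unfolding P0_def using fstm cM by (subst (asm) AE_distr_iff) auto
  qed
  with AE1 have "AE x in Q. x \<in> S" by eventually_elim (auto simp: S_def)
  then have S1: "emeasure Q S = 1" using S by (simp add: Q.emeasure_eq_measure Q.prob_eq_1)
  show "A0 \<in> sets P" unfolding A0_def P_def S_def[symmetric] by (intro sets_PiM_I_finite S) auto
  have "emeasure P A0 = (\<Prod>i\<in>{1..n}. emeasure Q S)" unfolding A0_def P_def S_def[symmetric]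
    by (rule PP.emeasure_PiM) (auto intro: S)
  then show "measure P A0 = 1" by (simp add: S1 P.emeasure_eq_measure)
qed

text \<open>Counting points in the balls around a finite net avoids conditioning on the centre: every ball
  around a sample point contains, and is contained in, balls around net points.\<close>

lemma good_event:
  fixes c C fmin fmax h \<eta> \<sigma> a b e :: real and n :: nat
  assumes vb: "\<And>D \<tau> M \<mu>. mfd D d \<tau> M \<Longrightarrow> volume_measure d M \<mu> \<Longrightarrow>
    (\<forall>y\<in>M. \<forall>r. 0 < r \<longrightarrow> r < \<tau> / 100 \<longrightarrow> ennreal (c * r ^ d) \<le> emeasure \<mu> (M \<inter> cball y r)) \<and>
    (\<forall>y\<in>M. \<forall>h. 0 < h \<longrightarrow> h \<le> \<tau> / 8 \<longrightarrow> emeasure \<mu> (M \<inter> cball y (2 * h)) \<le> ennreal (C * h ^ d))"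
    and cC: "0 < c" "0 < C" and f: "0 < fmin" "fmin \<le> fmax"
    and nm: "(M, Q) \<in> noisy_model D d k \<tau> L fmin fmax \<sigma>" and \<tau>: "0 < \<tau>"
    and h: "0 < h" "h \<le> \<tau> / 8" and \<eta>: "0 < \<eta>" "\<eta> \<le> 1 / 100"
  defines "P \<equiv> Pi\<^sub>M {1..n} (\<lambda>_. Q)"
    and "a \<equiv> fmin * (c * (\<eta> * h) ^ d)" and "b \<equiv> fmax * (C * h ^ d)" and "e \<equiv> fmin * (c * (\<eta> * h / 2) ^ d)"
  shows "\<exists>A\<in>sets P. 1 - (exp (- (n * a / 4)) + exp (- (n * b))) / e \<le> measure P A \<and>
    (\<forall>\<omega>\<in>A. (\<forall>j\<in>{1..n}. fst (\<omega> j) \<in> M \<and> snd (\<omega> j) \<in> Rdim D \<and> norm (snd (\<omega> j)) \<le> \<sigma>) \<and>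
      (\<forall>y\<in>M. n * a / 4 \<le> card {l \<in> {1..n}. fst (\<omega> l) \<in> cball y (2 * (\<eta> * h))}) \<and>
      (\<forall>y\<in>M. card {l \<in> {1..n}. fst (\<omega> l) \<in> cball y (3/2 * h)} \<le> 3 * n * b))"
proof -
  define P0 where "P0 = distr Q borel fst"
  have Q: "prob_space Q" and sQ: "sets Q = sets borel" and bm: "(M, P0) \<in> base_model D d k \<tau> L fmin fmax"
    using nm unfolding noisy_model_def P0_def by blast+
  note bmb = base_model_bounds[where d = d and c = c and C = C, OF _ cC f bm \<tau>]
  note m = base_model_support(1)[OF bm \<tau>]
  have BB3: "fmin * (c * r ^ d) \<le> measure P0 (cball y r)" if "y \<in> M" "0 < r" "r < \<tau> / 100" for y r
    by (rule bmb(1)[OF _ that]) (rule vb)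
  have BB4: "measure P0 (cball y (2 * h)) \<le> fmax * (C * h ^ d)" if "y \<in> M" "0 < h" "h \<le> \<tau> / 8" for y h
    by (rule bmb(2)[OF _ that]) (rule vb)
  have cM: "closed M" using mfd_sub(4)[OF m] by (rule compact_imp_closed)
  interpret Q: prob_space Q by (rule Q)
  have fstm: "fst \<in> measurable Q borel"
    using sQ by (subst measurable_cong_sets[OF sQ refl]) (intro borel_measurable_continuous_onI continuous_intros)
  interpret P0: prob_space P0 unfolding P0_def by (rule Q.prob_space_distr[OF fstm])
  have sP0: "sets P0 = sets borel" by (simp add: P0_def)
  have PS: "prob_space P" unfolding P_def by (intro prob_space_PiM Q)
  interpret P: prob_space P by (rule PS)
  have e0: "0 < e" using f cC h \<eta> by (simp add: e_def)
  have \<eta>h: "0 < \<eta> * h" "\<eta> * h < \<tau> / 100"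
  proof -
    show "0 < \<eta> * h" using \<eta> h by simp
    have "\<eta> * h \<le> 1 / 100 * (\<tau> / 8)" using \<eta> h by (intro mult_mono) auto
    then show "\<eta> * h < \<tau> / 100" using \<tau> by linarith
  qed
  \<comment> \<open>Balls of radius \<open>\<eta> * h / 2\<close> around separated points are
    disjoint and have mass at least \<open>e\<close>, so a net has at most \<open>1 / e\<close>
    points; this is the factor in the union bound.\<close>
  have net: "card F \<le> nat \<lfloor>1 / e\<rfloor>" if F: "finite F" "F \<subseteq> M" "separated (\<eta> * h) F" for F
  proof -
    have "ennreal (card F * e) \<le> emeasure P0 UNIV"
    proof (rule packing[OF F(1,3), where M = UNIV])
      fix x assume "x \<in> F"
      then have "e \<le> measure P0 (cball x (\<eta> * h / 2))"
        using BB3[of x "\<eta> * h / 2"] F(2) \<eta>h by (auto simp: e_def)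
      then show "ennreal e \<le> emeasure P0 (UNIV \<inter> cball x (\<eta> * h / 2))"
        by (simp add: P0.emeasure_eq_measure ennreal_leI)
    qed (use e0 sP0 in auto)
    also have "\<dots> \<le> 1" by (simp add: P0.emeasure_eq_measure)
    finally have "card F * e \<le> 1" using e0 by (simp flip: ennreal_1)
    then have "real (card F) \<le> 1 / e" using e0 by (simp add: field_simps)
    then show ?thesis by (simp add: le_nat_floor)
  qed
  obtain F where F: "finite F" "F \<subseteq> M" "card F \<le> nat \<lfloor>1 / e\<rfloor>" "M \<subseteq> (\<Union>f\<in>F. cball f (\<eta> * h))"
    using maximal_separated[of "\<eta> * h" M, OF _ net] \<eta>h by auto
  have cF: "real (card F) \<le> 1 / e"
  proof -
    have "0 \<le> 1 / e" using e0 by simp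
    then show ?thesis using F(3) by (metis le_nat_floor le_nat_iff of_int_floor_le of_int_of_nat_eq of_int_le_iff order_trans zero_le_floor nat_0_le of_nat_le_iff)
  qed
  define S where "S = M \<times> (Rdim D \<inter> cball 0 \<sigma>)"
  define A0 where "A0 = Pi\<^sub>E {1..n} (\<lambda>_. S)"
  note A0 = noisy_support_event(1)[OF nm \<tau>, where n = n, folded P_def S_def A0_def]
    and mA0 = noisy_support_event(2)[OF nm \<tau>, where n = n, folded P_def S_def A0_def]
  define B where "B y r = fst -` cball y r \<inter> space Q" for y :: evec and r :: real
  have B: "B y r \<in> sets Q" for y r unfolding B_def by (rule measurable_sets[OF fstm]) simp
  have mB: "measure Q (B y r) = measure P0 (cball y r)" for y r
    unfolding P0_def B_def using fstm by (simp add: measure_distr)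
  define N where "N y r \<omega> = (\<Sum>i\<in>{1..n}. indicator (B y r) (\<omega> i) :: real)" for y r and \<omega> :: "nat \<Rightarrow> evec \<times> evec"
  define E1 where "E1 y = {\<omega> \<in> space P. N y (\<eta> * h) \<omega> \<le> n * a / 4}" for y
  define E2 where "E2 y = {\<omega> \<in> space P. 3 * n * b \<le> N y (2 * h) \<omega>}" for y
  have Nm: "N y r \<in> borel_measurable P" for y r unfolding N_def P_def using B by measurable
  have E: "E1 y \<in> sets P" "E2 y \<in> sets P" for y unfolding E1_def E2_def using Nm by measurable
  have a0: "0 \<le> a" and b0: "0 \<le> b" using f cC h \<eta> by (auto simp: a_def b_def)
  have mE1: "measure P (E1 y) \<le> exp (- (n * a / 4))" if "y \<in> F" for y
  proof -
    have "a \<le> measure Q (B y (\<eta> * h))" unfolding mB a_def using BB3[of y "\<eta> * h"] that F(2) \<eta>h by auto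
    from count_lower_tail[OF Q B finite_atLeastAtMost a0 this, of 1 n, folded P_def]
    show ?thesis by (simp add: E1_def N_def P.emeasure_eq_measure)
  qed
  have mE2: "measure P (E2 y) \<le> exp (- (n * b))" if "y \<in> F" for y
  proof -
    have "measure Q (B y (2 * h)) \<le> b" unfolding mB b_def using BB4[of y h] that F(2) h by auto
    from count_upper_tail[OF Q B finite_atLeastAtMost this, of 1 n, folded P_def]
    show ?thesis by (simp add: E2_def N_def P.emeasure_eq_measure)
  qed
  define BAD where "BAD = (\<Union>y\<in>F. E1 y \<union> E2 y)"
  have BAD: "BAD \<in> sets P" unfolding BAD_def using F(1) E by (intro sets.finite_UN) auto
  have "measure P BAD \<le> (\<Sum>y\<in>F. measure P (E1 y \<union> E2 y))"
    unfolding BAD_def using F(1) E by (intro P.finite_measure_subadditive_finite) auto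
  also have "\<dots> \<le> (\<Sum>y\<in>F. exp (- (n * a / 4)) + exp (- (n * b)))"
  proof (rule sum_mono)
    fix y assume y: "y \<in> F"
    have "measure P (E1 y \<union> E2 y) \<le> measure P (E1 y) + measure P (E2 y)"
      by (rule measure_Un_le[OF E])
    then show "measure P (E1 y \<union> E2 y) \<le> exp (- (n * a / 4)) + exp (- (n * b))"
      using mE1[OF y] mE2[OF y] by linarith
  qed
  also have "\<dots> = card F * (exp (- (n * a / 4)) + exp (- (n * b)))" by simp
  also have "\<dots> \<le> 1 / e * (exp (- (n * a / 4)) + exp (- (n * b)))"
    using cF by (intro mult_right_mono) (auto intro: add_nonneg_nonneg)
  finally have mBAD: "measure P BAD \<le> (exp (- (n * a / 4)) + exp (- (n * b))) / e" by simp
  define A where "A = A0 - BAD"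
  have A: "A \<in> sets P" unfolding A_def using A0 BAD by simp
  have "measure P A0 \<le> measure P (A \<union> BAD)" unfolding A_def using A0 BAD by (intro P.finite_measure_mono) auto
  also have "\<dots> \<le> measure P A + measure P BAD" by (rule measure_Un_le[OF A BAD])
  finally have mA: "1 - (exp (- (n * a / 4)) + exp (- (n * b))) / e \<le> measure P A" using mA0 mBAD by linarith
  have sQ': "space Q = UNIV" using sets_eq_imp_space_eq[OF sQ] by simp
  have Ncard: "N y r \<omega> = card {l \<in> {1..n}. fst (\<omega> l) \<in> cball y r}" for y r \<omega>
    unfolding N_def by (subst sum_indicator_card) (auto simp: B_def sQ')
  show ?thesis
  proof (intro bexI[OF _ A] conjI ballI)
    fix \<omega> assume \<omega>: "\<omega> \<in> A"
    then have w: "\<omega> j \<in> S" if "j \<in> {1..n}" for j using that by (auto simp: A_def A0_def PiE_def)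
    show "fst (\<omega> j) \<in> M" "snd (\<omega> j) \<in> Rdim D" "norm (snd (\<omega> j)) \<le> \<sigma>" if "j \<in> {1..n}" for j
      using w[OF that] by (auto simp: S_def mem_Times_iff)
    have sp: "\<omega> \<in> space P" using \<omega> sets.sets_into_space[OF A] by blast
    fix y assume y: "y \<in> M"
    \<comment> \<open>The ball of radius \<open>\<eta> * h\<close> around \<open>g\<close> lies in
      the one of twice that radius around \<open>y\<close>, while the ball of radius
      \<open>2 * h\<close> around \<open>g\<close> contains the one of radius \<open>3/2 * h\<close>
      around \<open>y\<close>.\<close>
    then obtain g where g: "g \<in> F" "dist g y \<le> \<eta> * h" using F(4) by auto
    have nb: "\<omega> \<notin> E1 g" "\<omega> \<notin> E2 g" using \<omega> g(1) by (auto simp: A_def BAD_def)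
    have "n * a / 4 \<le> N g (\<eta> * h) \<omega>" using nb(1) sp by (simp add: E1_def)
    also have "\<dots> \<le> card {l \<in> {1..n}. fst (\<omega> l) \<in> cball y (2 * (\<eta> * h))}"
      unfolding Ncard of_nat_le_iff
    proof (rule card_mono)
      show "{l \<in> {1..n}. fst (\<omega> l) \<in> cball g (\<eta> * h)} \<subseteq> {l \<in> {1..n}. fst (\<omega> l) \<in> cball y (2 * (\<eta> * h))}"
      proof safe
        fix l assume "fst (\<omega> l) \<in> cball g (\<eta> * h)"
        then show "fst (\<omega> l) \<in> cball y (2 * (\<eta> * h))" using g(2) dist_triangle[of y "fst (\<omega> l)" g]
          by (simp add: dist_commute)
      qed
    qed simp
    finally show "n * a / 4 \<le> card {l \<in> {1..n}. fst (\<omega> l) \<in> cball y (2 * (\<eta> * h))}" .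
    have "\<eta> * h \<le> 1/100 * h" using \<eta> h by (intro mult_right_mono) auto
    have "real (card {l \<in> {1..n}. fst (\<omega> l) \<in> cball y (3/2 * h)}) \<le> N g (2 * h) \<omega>"
      unfolding Ncard of_nat_le_iff
    proof (rule card_mono)
      show "{l \<in> {1..n}. fst (\<omega> l) \<in> cball y (3/2 * h)} \<subseteq> {l \<in> {1..n}. fst (\<omega> l) \<in> cball g (2 * h)}"
      proof safe
        fix l assume "fst (\<omega> l) \<in> cball y (3/2 * h)"
        then have "dist g (fst (\<omega> l)) \<le> \<eta> * h + 3/2 * h" using g(2) dist_triangle[of g "fst (\<omega> l)" y] by simp
        then have "dist g (fst (\<omega> l)) \<le> 2 * h" using \<open>\<eta> * h \<le> 1/100 * h\<close> h(1) by linarith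
        then show "fst (\<omega> l) \<in> cball g (2 * h)" by simp
      qed
    qed simp
    also have "\<dots> \<le> 3 * n * b" using nb(2) sp by (simp add: E2_def)
    finally show "card {l \<in> {1..n}. fst (\<omega> l) \<in> cball y (3/2 * h)} \<le> 3 * n * b" .
  qed (rule mA)
qed

section \<open>Polynomial maps given by multilinear forms\<close>

text \<open>Terms of degree \<open>lo\<close> to \<open>hi\<close>, with one explicit bound
  \<open>C\<close> for all forms, because the constants must be uniform over manifolds.\<close>

definition polymap :: "evec set \<Rightarrow> evec set \<Rightarrow> nat \<Rightarrow> nat \<Rightarrow> real \<Rightarrow> (evec \<Rightarrow> evec) \<Rightarrow> bool" where
  "polymap T E lo hi C F \<longleftrightarrow> (\<exists>W. (\<forall>i\<in>{lo..hi}. multilinear_on T E i (W i) \<and> mbound T i (W i) C) \<and>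
     (\<forall>u\<in>T. F u = (\<Sum>i=lo..hi. W i (replicate i u))))"

lemma multilinear_on_zero: "subspace E \<Longrightarrow> multilinear_on T E i (\<lambda>_. 0)"
  by (simp add: multilinear_on_def subspace_0)

lemma multilinear_on_add:
  assumes "multilinear_on T E i A" "multilinear_on T E i A'" "subspace E"
  shows "multilinear_on T E i (\<lambda>ws. A ws + A' ws)"
  using assms by (simp add: multilinear_on_def subspace_add scaleR_add_right)

lemma multilinear_on_linear:
  assumes "multilinear_on T E i A" "linear f" "f ` E \<subseteq> E'"
  shows "multilinear_on T E' i (\<lambda>ws. f (A ws))"
  unfolding multilinear_on_def
proof (intro ballI impI)
  fix ws assume "ws \<in> lists T" "length ws = i"
  from assms(1)[unfolded multilinear_on_def, rule_format, OF this]
  have *: "A ws \<in> E" "\<forall>j<i. \<forall>x\<in>T. \<forall>y\<in>T. \<forall>c. A (ws[j := x + y]) = A (ws[j := x]) + A (ws[j := y]) \<and>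
      A (ws[j := c *\<^sub>R x]) = c *\<^sub>R A (ws[j := x])" by blast+
  then show "f (A ws) \<in> E' \<and> (\<forall>j<i. \<forall>x\<in>T. \<forall>y\<in>T. \<forall>c. f (A (ws[j := x + y])) = f (A (ws[j := x])) + f (A (ws[j := y])) \<and>
      f (A (ws[j := c *\<^sub>R x])) = c *\<^sub>R f (A (ws[j := x])))"
    using assms(2,3) by (simp add: linear_add[OF assms(2)] linear_cmul[OF assms(2)] image_subset_iff)
qed

lemma mbound_zero: "0 \<le> C \<Longrightarrow> mbound T i (\<lambda>_. 0) C"
  by (simp add: mbound_def prod_list_norm_nonneg)

lemma mbound_add: "mbound T i A C \<Longrightarrow> mbound T i A' C' \<Longrightarrow> mbound T i (\<lambda>ws. A ws + A' ws) (C + C')"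
  unfolding mbound_def by (simp add: distrib_right) (meson add_mono norm_triangle_ineq order_trans)

lemma polymap_extend:
  assumes "polymap T E lo hi C F" "lo' \<le> lo" "hi \<le> hi'" "C \<le> C'" "0 \<le> C'" "subspace E"
  shows "polymap T E lo' hi' C' F"
proof -
  obtain W where W: "\<And>i. i \<in> {lo..hi} \<Longrightarrow> multilinear_on T E i (W i) \<and> mbound T i (W i) C"
    "\<And>u. u \<in> T \<Longrightarrow> F u = (\<Sum>i=lo..hi. W i (replicate i u))"
    using assms(1) unfolding polymap_def by blast
  define W' where "W' i = (if i \<in> {lo..hi} then W i else (\<lambda>_. 0))" for i
  have "multilinear_on T E i (W' i) \<and> mbound T i (W' i) C'" for i
    using W(1)[of i] assms by (auto simp: W'_def multilinear_on_zero mbound_zero intro: mbound_mono)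
  moreover have "F u = (\<Sum>i=lo'..hi'. W' i (replicate i u))" if "u \<in> T" for u
    unfolding W(2)[OF that] using assms
    by (intro sum.mono_neutral_cong_left) (auto simp: W'_def)
  ultimately show ?thesis unfolding polymap_def by blast
qed

lemma polymap_add:
  assumes "polymap T E lo hi C F" "polymap T E lo hi C' F'" "subspace E"
  shows "polymap T E lo hi (C + C') (\<lambda>u. F u + F' u)"
proof -
  obtain W where W: "\<And>i. i \<in> {lo..hi} \<Longrightarrow> multilinear_on T E i (W i) \<and> mbound T i (W i) C"
    "\<And>u. u \<in> T \<Longrightarrow> F u = (\<Sum>i=lo..hi. W i (replicate i u))"
    using assms(1) unfolding polymap_def by blast
  obtain W' where W': "\<And>i. i \<in> {lo..hi} \<Longrightarrow> multilinear_on T E i (W' i) \<and> mbound T i (W' i) C'"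
    "\<And>u. u \<in> T \<Longrightarrow> F' u = (\<Sum>i=lo..hi. W' i (replicate i u))"
    using assms(2) unfolding polymap_def by blast
  show ?thesis unfolding polymap_def
    using W W' assms(3)
    by (intro exI[of _ "\<lambda>i ws. W i ws + W' i ws"])
      (simp add: multilinear_on_add mbound_add sum.distrib)
qed

lemma polymap_zero: "subspace E \<Longrightarrow> 0 \<le> C \<Longrightarrow> polymap T E lo hi C (\<lambda>_. 0)"
  unfolding polymap_def by (intro exI[of _ "\<lambda>_ _. 0"]) (simp add: multilinear_on_zero mbound_zero)

lemma polymap_sum:
  assumes "finite J" "\<And>j. j \<in> J \<Longrightarrow> polymap T E lo hi (C j) (F j)" "subspace E"
  shows "polymap T E lo hi (\<Sum>j\<in>J. C j) (\<lambda>u. \<Sum>j\<in>J. F j u)"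
  using assms(1,2)
proof (induction J rule: finite_induct)
  case (insert j J)
  then show ?case using polymap_add[OF _ _ assms(3), of T lo hi "C j" "F j" "\<Sum>j\<in>J. C j"] by simp
qed (simp add: polymap_zero assms(3))

lemma polymap_cong: "polymap T E lo hi C F \<Longrightarrow> (\<And>u. u \<in> T \<Longrightarrow> F u = G u) \<Longrightarrow> polymap T E lo hi C G"
  unfolding polymap_def by metis

lemma polymap_linear:
  assumes "polymap T E lo hi C F" "linear f" "f ` E \<subseteq> E'" "\<And>x. norm (f x) \<le> norm x"
  shows "polymap T E' lo hi C (\<lambda>u. f (F u))"
proof -
  obtain W where W: "\<And>i. i \<in> {lo..hi} \<Longrightarrow> multilinear_on T E i (W i) \<and> mbound T i (W i) C"
    "\<And>u. u \<in> T \<Longrightarrow> F u = (\<Sum>i=lo..hi. W i (replicate i u))"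
    using assms(1) unfolding polymap_def by blast
  have "mbound T i (\<lambda>ws. f (W i ws)) C" if "i \<in> {lo..hi}" for i
    using W(1)[OF that] assms(4) unfolding mbound_def by (meson order_trans)
  then show ?thesis unfolding polymap_def
    using W assms(2,3)
    by (intro exI[of _ "\<lambda>i ws. f (W i ws)"]) (simp add: multilinear_on_linear[OF _ assms(2,3)] linear_sum)
qed

lemma pow_le_pow:
  fixes x :: real
  assumes "0 \<le> x" "x \<le> \<rho>" "1 \<le> \<rho>" "b \<le> a"
  shows "x ^ a \<le> \<rho> ^ a * x ^ b"
proof -
  have "x ^ a = x ^ (a - b) * x ^ b" using assms by (simp flip: power_add)
  also have "\<dots> \<le> \<rho> ^ (a - b) * x ^ b" using assms by (intro mult_right_mono power_mono) auto
  also have "\<dots> \<le> \<rho> ^ a * x ^ b" using assms by (intro mult_right_mono power_increasing) auto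
  finally show ?thesis .
qed

text \<open>The dropped terms have degree above \<open>m\<close>; on the ball of radius
  \<open>\<rho>\<close> their surplus powers are absorbed into \<open>\<rho> ^ hi\<close>.\<close>

lemma polymap_truncate:
  fixes \<rho> C :: real
  assumes "polymap T E lo hi C F" "0 \<le> C" "1 \<le> \<rho>" "subspace E"
  shows "\<exists>G. polymap T E lo m C G \<and>
    (\<forall>u\<in>T. norm u \<le> \<rho> \<longrightarrow> norm (F u - G u) \<le> (Suc hi * C * \<rho> ^ hi) * norm u ^ Suc m)"
proof -
  obtain W where W: "\<And>i. i \<in> {lo..hi} \<Longrightarrow> multilinear_on T E i (W i) \<and> mbound T i (W i) C"
    "\<And>u. u \<in> T \<Longrightarrow> F u = (\<Sum>i=lo..hi. W i (replicate i u))"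
    using assms(1) unfolding polymap_def by blast
  define W' where "W' i = (if i \<in> {lo..hi} then W i else (\<lambda>_. 0))" for i
  have W'm: "multilinear_on T E i (W' i)" "mbound T i (W' i) C" for i
    using W(1)[of i] assms by (auto simp: W'_def multilinear_on_zero mbound_zero)
  define G where "G u = (\<Sum>i=lo..m. W' i (replicate i u))" for u
  have "polymap T E lo m C G" unfolding polymap_def using W'm by (intro exI[of _ W']) (simp add: G_def)
  moreover have "norm (F u - G u) \<le> (Suc hi * C * \<rho> ^ hi) * norm u ^ Suc m" if u: "u \<in> T" "norm u \<le> \<rho>" for u
  proof -
    let ?t = "\<lambda>i. W' i (replicate i u)"
    have F: "F u = sum ?t {lo..max hi m}"
      unfolding W(2)[OF u(1)] by (intro sum.mono_neutral_cong_left) (auto simp: W'_def)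
    have "F u - G u = sum ?t ({lo..max hi m} - {lo..m})"
      unfolding F G_def by (subst sum_diff) auto
    also have "\<dots> = sum ?t {max lo (Suc m)..hi}"
      by (intro sum.mono_neutral_cong_right) (auto simp: W'_def)
    also have "norm \<dots> \<le> (\<Sum>i\<in>{max lo (Suc m)..hi}. C * (\<rho> ^ hi * norm u ^ Suc m))"
    proof (rule sum_norm_le)
      fix i assume i: "i \<in> {max lo (Suc m)..hi}"
      have "norm (?t i) \<le> C * norm u ^ i" by (rule mbound_replicate[OF W'm(2) u(1)])
      also have "norm u ^ i \<le> \<rho> ^ i * norm u ^ Suc m" using u i assms by (intro pow_le_pow) auto
      also have "\<dots> \<le> \<rho> ^ hi * norm u ^ Suc m"
        using i assms by (intro mult_right_mono power_increasing) auto
      finally show "norm (?t i) \<le> C * (\<rho> ^ hi * norm u ^ Suc m)" using assms by (simp add: mult_left_mono)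
    qed
    also have "\<dots> = card {max lo (Suc m)..hi} * (C * (\<rho> ^ hi * norm u ^ Suc m))" by simp
    also have "\<dots> \<le> Suc hi * (C * (\<rho> ^ hi * norm u ^ Suc m))"
      using assms by (intro mult_right_mono) auto
    finally show ?thesis by (simp only: mult.assoc of_nat_Suc)
  qed
  ultimately show ?thesis by blast
qed

lemma multilinear_on_last:
  assumes "multilinear_on T E (Suc n) A" "ds \<in> lists T" "length ds = n" "x \<in> T" "y \<in> T"
  shows "A (ds @ [x + y]) = A (ds @ [x]) + A (ds @ [y])" "A (ds @ [c *\<^sub>R x]) = c *\<^sub>R A (ds @ [x])"
proof -
  have "ds @ [x] \<in> lists T" "length (ds @ [x]) = Suc n" using assms by auto
  from assms(1)[unfolded multilinear_on_def, rule_format, OF this, THEN conjunct2, rule_format, of n x y c]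
  show "A (ds @ [x + y]) = A (ds @ [x]) + A (ds @ [y])" "A (ds @ [c *\<^sub>R x]) = c *\<^sub>R A (ds @ [x])"
    using assms(3-5) by (auto simp: list_update_append)
qed

lemma multilinear_on_last_sum:
  assumes "multilinear_on T E (Suc n) A" "ds \<in> lists T" "length ds = n" "subspace T"
    and "finite J" "\<And>j. j \<in> J \<Longrightarrow> f j \<in> T"
  shows "A (ds @ [\<Sum>j\<in>J. f j]) = (\<Sum>j\<in>J. A (ds @ [f j]))"
  using assms(5,6)
proof (induction J rule: finite_induct)
  case empty
  then show ?case using multilinear_on_last(2)[OF assms(1-3), of 0 0 0] subspace_0[OF assms(4)] by simp
next
  case (insert a J)
  then show ?case
    using multilinear_on_last(1)[OF assms(1-3), of "f a" "\<Sum>j\<in>J. f j"] assms(4)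
    by (auto simp: subspace_sum)
qed

text \<open>The form \<open>W\<close> consumes the first \<open>j\<close> arguments and feeds the last argument of \<open>A\<close>, so that iterating
  the construction substitutes into every argument of \<open>A\<close>.\<close>

lemma multilinear_on_compose:
  assumes A: "multilinear_on T E (Suc n) A" and W: "multilinear_on T T j W"
  shows "multilinear_on T E (j + n) (\<lambda>ws. A (drop j ws @ [W (take j ws)]))"
  unfolding multilinear_on_def
proof (intro ballI impI)
  fix ws assume ws: "ws \<in> lists T" "length ws = j + n"
  define ts where "ts = take j ws"
  define ds where "ds = drop j ws"
  have tds: "ts \<in> lists T" "length ts = j" "ds \<in> lists T" "length ds = n"
    using ws by (auto simp: ts_def ds_def dest: in_set_takeD in_set_dropD)
  have WT: "W ts' \<in> T" if "ts' \<in> lists T" "length ts' = j" for ts' using multilinear_on_in[OF W that] .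
  have Al: "ds @ [W ts] \<in> lists T" "length (ds @ [W ts]) = Suc n" using tds WT by auto
  have "A (ds @ [W ts]) \<in> E" using multilinear_on_in[OF A Al] .
  moreover have
    "A (drop j (ws[l := x + y]) @ [W (take j (ws[l := x + y]))]) =
       A (drop j (ws[l := x]) @ [W (take j (ws[l := x]))]) + A (drop j (ws[l := y]) @ [W (take j (ws[l := y]))]) \<and>
     A (drop j (ws[l := c *\<^sub>R x]) @ [W (take j (ws[l := c *\<^sub>R x]))]) =
       c *\<^sub>R A (drop j (ws[l := x]) @ [W (take j (ws[l := x]))])"
    if l: "l < j + n" and xy: "x \<in> T" "y \<in> T" for l x y c
  proof (cases "l < j")
    case True
    have e: "drop j (ws[l := z]) = ds" "take j (ws[l := z]) = ts[l := z]" for z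
      using True by (auto simp: ds_def ts_def take_update_swap)
    have in': "ts[l := z] \<in> lists T" "length (ts[l := z]) = j" if "z \<in> T" for z
      using that tds set_update_subset_insert[of ts l z] by auto
    from W[unfolded multilinear_on_def, rule_format, OF tds(1,2), THEN conjunct2, rule_format, OF True xy, of c]
    have "W (ts[l := x + y]) = W (ts[l := x]) + W (ts[l := y])" "W (ts[l := c *\<^sub>R x]) = c *\<^sub>R W (ts[l := x])"
      by auto
    then show ?thesis unfolding e
      using multilinear_on_last[OF A tds(3,4) WT[OF in'[OF xy(1)]] WT[OF in'[OF xy(2)]]] by simp
  next
    case False
    have e: "drop j (ws[l := z]) @ [W (take j (ws[l := z]))] = (ds @ [W ts])[l - j := z]" for z
    proof -
      have "l - j < length ds" using False l tds by simp
      then show ?thesis using False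
        by (simp add: drop_update_swap list_update_append ds_def[symmetric] ts_def[symmetric])
    qed
    show ?thesis unfolding e
      using A[unfolded multilinear_on_def, rule_format, OF Al, THEN conjunct2, rule_format, of "l - j" x y c] False l xy
      by auto
  qed
  ultimately show "A (drop j ws @ [W (take j ws)]) \<in> E \<and>
    (\<forall>l<j + n. \<forall>x\<in>T. \<forall>y\<in>T. \<forall>c.
       A (drop j (ws[l := x + y]) @ [W (take j (ws[l := x + y]))]) =
       A (drop j (ws[l := x]) @ [W (take j (ws[l := x]))]) + A (drop j (ws[l := y]) @ [W (take j (ws[l := y]))]) \<and>
       A (drop j (ws[l := c *\<^sub>R x]) @ [W (take j (ws[l := c *\<^sub>R x]))]) =
       c *\<^sub>R A (drop j (ws[l := x]) @ [W (take j (ws[l := x]))]))"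
    by (simp add: ds_def ts_def)
qed

lemma mbound_compose:
  assumes A: "mbound T (Suc n) A B" and W: "mbound T j W C" and WT: "multilinear_on T T j W" and B: "0 \<le> B"
  shows "mbound T (j + n) (\<lambda>ws. A (drop j ws @ [W (take j ws)])) (B * C)"
  unfolding mbound_def
proof (intro ballI impI)
  fix ws assume ws: "ws \<in> lists T" "length ws = j + n"
  define ts where "ts = take j ws"
  define ds where "ds = drop j ws"
  have tds: "ts \<in> lists T" "length ts = j" "ds \<in> lists T" "length ds = n" "ws = ts @ ds"
    using ws by (auto simp: ts_def ds_def dest: in_set_takeD in_set_dropD)
  have "W ts \<in> T" using multilinear_on_in[OF WT tds(1,2)] .
  then have "ds @ [W ts] \<in> lists T" "length (ds @ [W ts]) = Suc n" using tds by auto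
  then have "norm (A (ds @ [W ts])) \<le> B * prod_list (map norm (ds @ [W ts]))" using A by (simp only: mbound_def)
  also have "\<dots> = B * prod_list (map norm ds) * norm (W ts)" by simp
  also have "B * prod_list (map norm ds) * norm (W ts) \<le> B * prod_list (map norm ds) * (C * prod_list (map norm ts))"
    using W tds B by (intro mult_left_mono) (auto simp: mbound_def prod_list_norm_nonneg)
  finally have "norm (A (ds @ [W ts])) \<le> B * prod_list (map norm ds) * (C * prod_list (map norm ts))" .
  moreover have "prod_list (map norm ws) = prod_list (map norm ts) * prod_list (map norm ds)" by (simp add: tds(5))
  ultimately show "norm (A (drop j ws @ [W (take j ws)])) \<le> B * C * prod_list (map norm ws)"
    unfolding ts_def[symmetric] ds_def[symmetric] by (simp add: algebra_simps)
qed

lemma polymap_compose: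
  assumes "polymap T T 1 K C P" "0 \<le> C" "subspace T" "subspace E"
    and "multilinear_on T E (a + b) A" "mbound T (a + b) A B" "0 \<le> B"
  shows "polymap T E (a + b) (a + b * K) (B * (K * C) ^ b) (\<lambda>u. A (replicate a u @ replicate b (P u)))"
  using assms(5-7)
proof (induction b arbitrary: a A B)
  case 0
  show ?case unfolding polymap_def
    by (intro exI[of _ "\<lambda>_. A"]) (use 0 in auto)
next
  case (Suc b)
  obtain W where W: "\<And>i. i \<in> {1..K} \<Longrightarrow> multilinear_on T T i (W i) \<and> mbound T i (W i) C"
    "\<And>u. u \<in> T \<Longrightarrow> P u = (\<Sum>i=1..K. W i (replicate i u))"
    using assms(1) unfolding polymap_def by blast
  let ?n = "a + b"
  have A: "multilinear_on T E (Suc ?n) A" "mbound T (Suc ?n) A B" using Suc.prems by simp_all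
  let ?A = "\<lambda>j ws. A (drop j ws @ [W j (take j ws)])"
  \<comment> \<open>In \<open>?A j\<close> the first \<open>j\<close> copies of \<open>u\<close>
    feed \<open>W j\<close>, whose value fills the last slot of \<open>A\<close>; one substitution
    fewer remains, and the induction hypothesis applies to \<open>?A j\<close> in place of
    \<open>A\<close>.\<close>
  have step: "polymap T E (a + Suc b) (a + Suc b * K) (B * C * (K * C) ^ b)
      (\<lambda>u. ?A j (replicate (j + a) u @ replicate b (P u)))" if j: "j \<in> {1..K}" for j
  proof -
    have "polymap T E (j + a + b) (j + a + b * K) (B * C * (K * C) ^ b)
      (\<lambda>u. ?A j (replicate (j + a) u @ replicate b (P u)))"
      using multilinear_on_compose[OF A(1), of j "W j"] mbound_compose[OF A(2), of j "W j" C] W(1)[OF j]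
        Suc.prems(3) assms(2)
      by (intro Suc.IH) (auto simp: add.assoc)
    then show ?thesis
      by (rule polymap_extend) (use j assms(2,4) Suc.prems(3) in auto)
  qed
  have "polymap T E (a + Suc b) (a + Suc b * K) (\<Sum>j=1..K. B * C * (K * C) ^ b)
      (\<lambda>u. \<Sum>j=1..K. ?A j (replicate (j + a) u @ replicate b (P u)))"
    by (rule polymap_sum[OF _ step assms(4)]) auto
  moreover have "(\<Sum>j=1..K. B * C * (K * C) ^ b) = B * (K * C) ^ Suc b" by (simp add: algebra_simps)
  ultimately have "polymap T E (a + Suc b) (a + Suc b * K) (B * (K * C) ^ Suc b)
      (\<lambda>u. \<Sum>j=1..K. ?A j (replicate (j + a) u @ replicate b (P u)))" by (simp only:)
  then show ?case
  proof (rule polymap_cong)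
    fix u assume u: "u \<in> T"
    have WT: "W j (replicate j u) \<in> T" if "j \<in> {1..K}" for j
      using multilinear_on_in[of T T j "W j" "replicate j u"] W(1)[OF that] u by (auto simp: in_lists_conv_set)
    have PT: "P u \<in> T" unfolding W(2)[OF u] using WT assms(3) by (intro subspace_sum) auto
    let ?ds = "replicate a u @ replicate b (P u)"
    have ds: "?ds \<in> lists T" "length ?ds = ?n" using u PT by auto
    have "A (replicate a u @ replicate (Suc b) (P u)) = A (?ds @ [P u])"
      by (simp add: replicate_append_same)
    also have "\<dots> = A (?ds @ [\<Sum>j=1..K. W j (replicate j u)])" using W(2)[OF u] by simp
    also have "\<dots> = (\<Sum>j=1..K. A (?ds @ [W j (replicate j u)]))"
      by (rule multilinear_on_last_sum[OF A(1) ds assms(3)]) (use WT in auto)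
    also have "\<dots> = (\<Sum>j=1..K. ?A j (replicate (j + a) u @ replicate b (P u)))"
      by (simp add: replicate_add)
    finally show "(\<Sum>j=1..K. ?A j (replicate (j + a) u @ replicate b (P u))) =
      A (replicate a u @ replicate (Suc b) (P u))" by simp
  qed
qed

section \<open>Inverting a graph expansion\<close>

text \<open>Abstract form of a point on a graph: \<open>v\<close> is the parameter, \<open>w\<close>
  the value of the graph map with Taylor forms \<open>A\<close>, and \<open>u\<close> the tangential
  coordinate. The factor 2 expresses that parameter and coordinate are comparable.\<close>

definition graph_data where
  "graph_data T A B k \<rho> u v w \<longleftrightarrow> u \<in> T \<and> v \<in> T \<and> norm u \<le> \<rho> \<and> norm v \<le> 2 * norm u \<and>
     norm (w - (\<Sum>i=2..k-1. A i (replicate i v))) \<le> B * norm v ^ k"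

text \<open>Gains one order: the forms in \<open>w\<close> have degree at least 2, so replacing
  \<open>v\<close> by a polynomial with error of order \<open>m + 1\<close> changes \<open>w\<close>
  only at order \<open>m + 2\<close>. The map \<open>f\<close> is general so as to serve for the
  tangential and for the normal part.\<close>

lemma graph_data_step:
  fixes \<rho> B C :: real
  assumes "1 \<le> \<rho>" "0 \<le> B" "0 \<le> C" "m + 2 \<le> k"
  shows "\<exists>C'\<ge>0. \<forall>T E f A P. findim T \<longrightarrow> subspace E \<longrightarrow> linear f \<longrightarrow> range f \<subseteq> E \<longrightarrow> (\<forall>x. norm (f x) \<le> norm x) \<longrightarrow>
    (\<forall>i\<in>{2..k-1}. multilinear_on T UNIV i (A i) \<and> mbound T i (A i) B) \<longrightarrow> polymap T T 1 m C P \<longrightarrow>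
    (\<exists>G. polymap T E 2 (m + 1) C' G \<and>
      (\<forall>u v w. graph_data T A B k \<rho> u v w \<longrightarrow> norm (v - P u) \<le> C * norm u ^ (m + 1) \<longrightarrow>
         norm (f w - G u) \<le> C' * norm u ^ (m + 2)))"
proof -
  define CQ where "CQ = (\<Sum>i=2..k-1. B * (m * C) ^ i)"
  \<comment> \<open>Bounds both \<open>norm v\<close> and \<open>norm (P u)\<close> by
    \<open>c' * norm u\<close>; \<open>K2\<close> is the resulting Lipschitz cost of exchanging the
    two in the forms.\<close>
  define c' where "c' = 2 + C * \<rho> ^ m"
  define K2 where "K2 = (\<Sum>i=2..k-1. real i * B * (c' ^ (i - 1) * \<rho> ^ k) * C)"
  define C' where "C' = CQ + (B * 2 ^ k * \<rho> ^ k + K2 + Suc (k * m) * CQ * \<rho> ^ (k * m))"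
  have CQ0: "0 \<le> CQ" using assms by (auto simp: CQ_def intro!: sum_nonneg)
  have c'0: "2 \<le> c'" using assms by (simp add: c'_def)
  have K20: "0 \<le> K2" using assms c'0 by (auto simp: K2_def intro!: sum_nonneg)
  have C'0: "0 \<le> C'" "CQ \<le> C'" using CQ0 K20 assms by (auto simp: C'_def)
  show ?thesis
  proof (rule exI[of _ C'], intro conjI allI impI)
    fix T E :: "evec set" and f :: "evec \<Rightarrow> evec" and A P
    assume fT: "findim T" and sE: "subspace E" and lf: "linear f" and fE: "range f \<subseteq> E"
      and nf: "\<forall>x. norm (f x) \<le> norm x"
      and A: "\<forall>i\<in>{2..k-1}. multilinear_on T UNIV i (A i) \<and> mbound T i (A i) B"
      and P: "polymap T T 1 m C P"
    note sT = findim_subspace[OF fT]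
    have PT: "P u \<in> T" if "u \<in> T" for u
    proof -
      obtain W where W: "\<forall>i\<in>{1..m}. multilinear_on T T i (W i)" "P u = (\<Sum>i=1..m. W i (replicate i u))"
        using P \<open>u \<in> T\<close> unfolding polymap_def by blast
      show ?thesis unfolding W(2)
      proof (rule subspace_sum[OF sT])
        fix i assume "i \<in> {1..m}"
        then have "multilinear_on T T i (W i)" using W(1) by blast
        then show "W i (replicate i u) \<in> T" by (rule multilinear_on_in) (use that in auto)
      qed
    qed
    define Q where "Q u = (\<Sum>i=2..k-1. A i (replicate i (P u)))" for u
    have "polymap T UNIV 2 (k * m) (\<Sum>i=2..k-1. B * (m * C) ^ i) Q"
      unfolding Q_def
    proof (rule polymap_sum)
      fix i assume i: "i \<in> {2..k-1}"
      have "polymap T UNIV (0 + i) (0 + i * m) (B * (m * C) ^ i) (\<lambda>u. A i (replicate 0 u @ replicate i (P u)))"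
        by (rule polymap_compose[OF P assms(3) sT]) (use A i assms in auto)
      then show "polymap T UNIV 2 (k * m) (B * (m * C) ^ i) (\<lambda>u. A i (replicate i (P u)))"
        by (elim polymap_extend[THEN polymap_cong]) (use i assms in auto)
    qed auto
    then have "polymap T E 2 (k * m) CQ (\<lambda>u. f (Q u))"
      using fE nf unfolding CQ_def by (intro polymap_linear[OF _ lf]) auto
    from polymap_truncate[OF this CQ0 assms(1) sE, of "m + 1"]
    obtain G where G: "polymap T E 2 (m + 1) CQ G"
      "\<And>u. u \<in> T \<Longrightarrow> norm u \<le> \<rho> \<Longrightarrow> norm (f (Q u) - G u) \<le> (Suc (k * m) * CQ * \<rho> ^ (k * m)) * norm u ^ (m + 2)"
      by auto
    show "\<exists>G. polymap T E 2 (m + 1) C' G \<and>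
      (\<forall>u v w. graph_data T A B k \<rho> u v w \<longrightarrow> norm (v - P u) \<le> C * norm u ^ (m + 1) \<longrightarrow>
         norm (f w - G u) \<le> C' * norm u ^ (m + 2))"
    proof (intro exI[of _ G] conjI allI impI)
      show "polymap T E 2 (m + 1) C' G" using polymap_extend[OF G(1) _ _ C'0(2,1) sE] by simp
      fix u v w assume gd: "graph_data T A B k \<rho> u v w" and vP: "norm (v - P u) \<le> C * norm u ^ (m + 1)"
      have u: "u \<in> T" "norm u \<le> \<rho>" and v: "v \<in> T" "norm v \<le> 2 * norm u"
        and w: "norm (w - (\<Sum>i=2..k-1. A i (replicate i v))) \<le> B * norm v ^ k"
        using gd by (auto simp: graph_data_def)
      let ?x = "norm u"
      have "B * norm v ^ k \<le> B * (2 * ?x) ^ k" using v assms by (intro mult_left_mono power_mono) auto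
      also have "\<dots> = B * 2 ^ k * ?x ^ k" by (simp add: power_mult_distrib)
      also have "\<dots> \<le> B * 2 ^ k * (\<rho> ^ k * ?x ^ (m + 2))"
        using u assms by (intro mult_left_mono pow_le_pow) auto
      finally have 1: "norm (w - (\<Sum>i=2..k-1. A i (replicate i v))) \<le> B * 2 ^ k * \<rho> ^ k * ?x ^ (m + 2)"
        using w by (simp add: mult.assoc)
      have nP: "norm (P u) \<le> c' * ?x"
      proof -
        have "C * ?x ^ (m + 1) = C * ?x ^ m * ?x" by simp
        also have "\<dots> \<le> C * \<rho> ^ m * ?x" using u assms by (intro mult_right_mono mult_left_mono power_mono) auto
        finally have "norm (v - P u) \<le> C * \<rho> ^ m * ?x" using vP by linarith
        then show ?thesis using norm_triangle_ineq2[of "P u" v] v norm_minus_commute[of v "P u"]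
          by (simp add: c'_def algebra_simps)
      qed
      have nv: "norm v \<le> c' * ?x" using v mult_right_mono[OF c'0 norm_ge_zero[of u]] by simp
      have "norm ((\<Sum>i=2..k-1. A i (replicate i v)) - Q u) =
          norm (\<Sum>i=2..k-1. A i (replicate i v) - A i (replicate i (P u)))"
        by (simp add: Q_def sum_subtractf)
      also have "\<dots> \<le> (\<Sum>i=2..k-1. (real i * B * (c' ^ (i - 1) * \<rho> ^ k) * C) * ?x ^ (m + 2))"
      proof (rule sum_norm_le)
        fix i assume i: "i \<in> {2..k-1}"
        have "norm (A i (replicate i v) - A i (replicate i (P u))) \<le> real i * B * (c' * ?x) ^ (i - 1) * norm (v - P u)"
          by (rule mbound_lipschitz[of T UNIV]) (use A i assms sT v(1) PT[OF u(1)] nv nP in auto)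
        also have "\<dots> \<le> real i * B * (c' ^ (i - 1) * (\<rho> ^ k * ?x)) * (C * ?x ^ (m + 1))"
        proof (intro mult_mono mult_left_mono vP)
          have "?x ^ (i - 1) \<le> \<rho> ^ (i - 1) * ?x ^ 1" using i u assms by (intro pow_le_pow) auto
          also have "\<dots> \<le> \<rho> ^ k * ?x" using i assms by (intro mult_mono power_increasing) auto
          finally show "(c' * ?x) ^ (i - 1) \<le> c' ^ (i - 1) * (\<rho> ^ k * ?x)"
            using c'0 by (simp add: power_mult_distrib mult_left_mono)
        qed (use assms c'0 in auto)
        finally show "norm (A i (replicate i v) - A i (replicate i (P u))) \<le>
            (real i * B * (c' ^ (i - 1) * \<rho> ^ k) * C) * ?x ^ (m + 2)"
          by (simp add: algebra_simps)
      qed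
      also have "\<dots> = K2 * ?x ^ (m + 2)" by (simp add: K2_def sum_distrib_right)
      finally have 2: "norm ((\<Sum>i=2..k-1. A i (replicate i v)) - Q u) \<le> K2 * ?x ^ (m + 2)" .
      have 3: "norm (f (Q u) - G u) \<le> (Suc (k * m) * CQ * \<rho> ^ (k * m)) * ?x ^ (m + 2)" by (rule G(2)[OF u])
      have "norm (f w - G u) \<le> norm (f (w - Q u)) + norm (f (Q u) - G u)"
        using norm_triangle_ineq[of "f (w - Q u)" "f (Q u) - G u"] by (simp add: linear_diff[OF lf])
      also have "norm (f (w - Q u)) \<le> norm (w - Q u)" using nf by blast
      also have "\<dots> \<le> norm (w - (\<Sum>i=2..k-1. A i (replicate i v))) + norm ((\<Sum>i=2..k-1. A i (replicate i v)) - Q u)"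
        using norm_triangle_ineq[of "w - (\<Sum>i=2..k-1. A i (replicate i v))" "(\<Sum>i=2..k-1. A i (replicate i v)) - Q u"] by simp
      finally have "norm (f w - G u) \<le> (B * 2 ^ k * \<rho> ^ k) * ?x ^ (m + 2) + K2 * ?x ^ (m + 2) +
          (Suc (k * m) * CQ * \<rho> ^ (k * m)) * ?x ^ (m + 2)" using 1 2 3 by linarith
      also have "\<dots> = (C' - CQ) * ?x ^ (m + 2)" by (simp add: C'_def algebra_simps)
      also have "\<dots> \<le> C' * ?x ^ (m + 2)" using CQ0 by (intro mult_right_mono) auto
      finally show "norm (f w - G u) \<le> C' * ?x ^ (m + 2)" .
    qed
  qed (rule C'0(1))
qed

lemma polymap_id: "polymap T T 1 1 1 (\<lambda>u. u)"
  unfolding polymap_def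
proof (intro exI[of _ "\<lambda>_ ws. hd ws"] conjI ballI)
  fix i :: nat assume "i \<in> {1..1}"
  then have i: "i = 1" by simp
  show "multilinear_on T T i hd"
    unfolding multilinear_on_def i by (auto simp: length_Suc_conv)
  show "mbound T i hd 1" unfolding mbound_def i by (auto simp: length_Suc_conv)
qed simp

text \<open>Iteration of \<open>v = u - \<pi> w\<close>, starting from \<open>v = u\<close> with a
  quadratic error; every round inserts the current polynomial into \<open>w\<close> and gains one
  order.\<close>

lemma graph_data_inverse:
  fixes \<rho> B :: real
  assumes "1 \<le> \<rho>" "0 \<le> B" "m + 2 \<le> k" "3 \<le> k" "1 \<le> m"
  shows "\<exists>C\<ge>0. \<forall>T \<pi> A. findim T \<longrightarrow> linear \<pi> \<longrightarrow> range \<pi> \<subseteq> T \<longrightarrow> (\<forall>x. norm (\<pi> x) \<le> norm x) \<longrightarrow>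
    (\<forall>i\<in>{2..k-1}. multilinear_on T UNIV i (A i) \<and> mbound T i (A i) B) \<longrightarrow>
    (\<exists>P. polymap T T 1 m C P \<and>
      (\<forall>u v w. graph_data T A B k \<rho> u v w \<longrightarrow> v = u - \<pi> w \<longrightarrow> norm (v - P u) \<le> C * norm u ^ (m + 1)))"
  using assms(5,3)
proof (induction m rule: dec_induct)
  case base
  let ?C = "Suc k * B * (2 * \<rho>) ^ k * 4 + 1"
  have C1: "1 \<le> ?C" using assms by simp
  show ?case
  proof (rule exI[of _ ?C], intro conjI allI impI)
    show "0 \<le> ?C" using C1 by linarith
    fix T :: "evec set" and \<pi> :: "evec \<Rightarrow> evec" and A
    assume fT: "findim T" and n\<pi>: "\<forall>x. norm (\<pi> x) \<le> norm x"
      and A: "\<forall>i\<in>{2..k-1}. multilinear_on T UNIV i (A i) \<and> mbound T i (A i) B"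
    show "\<exists>P. polymap T T 1 1 ?C P \<and>
      (\<forall>u v w. graph_data T A B k \<rho> u v w \<longrightarrow> v = u - \<pi> w \<longrightarrow> norm (v - P u) \<le> ?C * norm u ^ (1 + 1))"
    proof (intro exI[of _ "\<lambda>u. u"] conjI allI impI)
      show "polymap T T 1 1 ?C (\<lambda>u. u)"
        using polymap_extend[OF polymap_id _ _ C1] C1 findim_subspace[OF fT] by simp
      fix u v w assume gd: "graph_data T A B k \<rho> u v w" and vu: "v = u - \<pi> w"
      have u: "u \<in> T" "norm u \<le> \<rho>" and v: "v \<in> T" "norm v \<le> 2 * norm u"
        and w: "norm (w - (\<Sum>i=2..k-1. A i (replicate i v))) \<le> B * norm v ^ k"
        using gd by (auto simp: graph_data_def)
      have pw: "norm v ^ i \<le> (2 * \<rho>) ^ k * (norm v)\<^sup>2" if "2 \<le> i" "i \<le> k" for i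
      proof -
        have "norm v ^ i \<le> (2 * \<rho>) ^ i * norm v ^ 2" using v u assms that by (intro pow_le_pow) auto
        also have "\<dots> \<le> (2 * \<rho>) ^ k * (norm v)\<^sup>2" using assms that by (intro mult_right_mono power_increasing) auto
        finally show ?thesis .
      qed
      have "norm (\<Sum>i=2..k-1. A i (replicate i v)) \<le> (\<Sum>i=2..k-1. B * ((2 * \<rho>) ^ k * (norm v)\<^sup>2))"
      proof (rule sum_norm_le)
        fix i assume i: "i \<in> {2..k-1}"
        have "norm (A i (replicate i v)) \<le> B * norm v ^ i" using A i v by (intro mbound_replicate) auto
        also have "\<dots> \<le> B * ((2 * \<rho>) ^ k * (norm v)\<^sup>2)" using i assms by (intro mult_left_mono pw) auto
        finally show "norm (A i (replicate i v)) \<le> B * ((2 * \<rho>) ^ k * (norm v)\<^sup>2)" .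
      qed
      also have "\<dots> = card {2..k-1} * (B * ((2 * \<rho>) ^ k * (norm v)\<^sup>2))" by simp
      also have "\<dots> \<le> k * (B * ((2 * \<rho>) ^ k * (norm v)\<^sup>2))" using assms by (intro mult_right_mono) auto
      finally have 1: "norm (\<Sum>i=2..k-1. A i (replicate i v)) \<le> k * (B * ((2 * \<rho>) ^ k * (norm v)\<^sup>2))" .
      have 2: "B * norm v ^ k \<le> B * ((2 * \<rho>) ^ k * (norm v)\<^sup>2)" using assms by (intro mult_left_mono pw) auto
      have "norm (v - u) = norm (\<pi> w)" by (simp add: vu)
      also have "\<dots> \<le> norm w" using n\<pi> by blast
      also have "\<dots> \<le> norm (w - (\<Sum>i=2..k-1. A i (replicate i v))) + norm (\<Sum>i=2..k-1. A i (replicate i v))"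
        using norm_triangle_ineq[of "w - (\<Sum>i=2..k-1. A i (replicate i v))" "\<Sum>i=2..k-1. A i (replicate i v)"] by simp
      also have "\<dots> \<le> Suc k * (B * ((2 * \<rho>) ^ k * (norm v)\<^sup>2))" using w 1 2 by (simp add: algebra_simps)
      also have "\<dots> \<le> Suc k * (B * ((2 * \<rho>) ^ k * (2 * norm u)\<^sup>2))"
        using v assms by (intro mult_left_mono power_mono) auto
      also have "\<dots> = (?C - 1) * norm u ^ (1 + 1)" by (simp add: power2_eq_square algebra_simps)
      also have "\<dots> \<le> ?C * norm u ^ (1 + 1)" by (intro mult_right_mono) auto
      finally show "norm (v - u) \<le> ?C * norm u ^ (1 + 1)" .
    qed
  qed
next
  case (step m)
  have mk: "m + 2 \<le> k" using step.prems by simp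
  obtain C where C: "0 \<le> C" "\<And>T \<pi> A. findim T \<Longrightarrow> linear \<pi> \<Longrightarrow> range \<pi> \<subseteq> T \<Longrightarrow> (\<forall>x. norm (\<pi> x) \<le> norm x) \<Longrightarrow>
    (\<forall>i\<in>{2..k-1}. multilinear_on T UNIV i (A i) \<and> mbound T i (A i) B) \<Longrightarrow>
    (\<exists>P. polymap T T 1 m C P \<and>
      (\<forall>u v w. graph_data T A B k \<rho> u v w \<longrightarrow> v = u - \<pi> w \<longrightarrow> norm (v - P u) \<le> C * norm u ^ (m + 1)))"
    using step.IH[OF mk] by blast
  obtain C' where C': "0 \<le> C'" "\<And>T E f A P. findim T \<Longrightarrow> subspace E \<Longrightarrow> linear f \<Longrightarrow> range f \<subseteq> E \<Longrightarrow> (\<forall>x. norm (f x) \<le> norm x) \<Longrightarrow>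
    (\<forall>i\<in>{2..k-1}. multilinear_on T UNIV i (A i) \<and> mbound T i (A i) B) \<Longrightarrow> polymap T T 1 m C P \<Longrightarrow>
    (\<exists>G. polymap T E 2 (m + 1) C' G \<and>
      (\<forall>u v w. graph_data T A B k \<rho> u v w \<longrightarrow> norm (v - P u) \<le> C * norm u ^ (m + 1) \<longrightarrow>
         norm (f w - G u) \<le> C' * norm u ^ (m + 2)))"
    using graph_data_step[OF assms(1,2) C(1) mk] by blast
  show ?case
  proof (rule exI[of _ "1 + C'"], intro conjI allI impI)
    show "0 \<le> 1 + C'" using C'(1) by simp
    fix T :: "evec set" and \<pi> :: "evec \<Rightarrow> evec" and A
    assume h: "findim T" "linear \<pi>" "range \<pi> \<subseteq> T" "\<forall>x. norm (\<pi> x) \<le> norm x"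
      "\<forall>i\<in>{2..k-1}. multilinear_on T UNIV i (A i) \<and> mbound T i (A i) B"
    note sT = findim_subspace[OF h(1)]
    obtain P where P: "polymap T T 1 m C P"
      "\<And>u v w. graph_data T A B k \<rho> u v w \<Longrightarrow> v = u - \<pi> w \<Longrightarrow> norm (v - P u) \<le> C * norm u ^ (m + 1)"
      using C(2)[OF h] by blast
    obtain G where G: "polymap T T 2 (m + 1) C' G"
      "\<And>u v w. graph_data T A B k \<rho> u v w \<Longrightarrow> norm (v - P u) \<le> C * norm u ^ (m + 1) \<Longrightarrow>
         norm (\<pi> w - G u) \<le> C' * norm u ^ (m + 2)"
      using C'(2)[OF h(1) sT h(2-5) P(1)] by blast
    have "polymap T T 2 (m + 1) C' (\<lambda>u. - G u)"
      using polymap_linear[OF G(1), of uminus T] sT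
      by (simp add: linear_uminus subspace_neg image_subset_iff)
    then have p1: "polymap T T 1 (m + 1) C' (\<lambda>u. - G u)" by (rule polymap_extend) (use C'(1) sT in auto)
    have p2: "polymap T T 1 (m + 1) 1 (\<lambda>u. u)" by (rule polymap_extend[OF polymap_id]) (use sT in auto)
    have "polymap T T 1 (Suc m) (1 + C') (\<lambda>u. u + - G u)"
      using polymap_add[OF p2 p1 sT] by (simp only: Suc_eq_plus1)
    moreover have "norm (v - (u + - G u)) \<le> (1 + C') * norm u ^ (Suc m + 1)"
      if "graph_data T A B k \<rho> u v w" "v = u - \<pi> w" for u v w
    proof -
      have "v - (u + - G u) = - (\<pi> w - G u)" using that(2) by simp
      then have "norm (v - (u + - G u)) = norm (\<pi> w - G u)" by (simp only: norm_minus_cancel)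
      also have "\<dots> \<le> C' * norm u ^ (m + 2)" using G(2)[OF that(1) P(2)[OF that]] .
      also have "\<dots> \<le> (1 + C') * norm u ^ (m + 2)" by (intro mult_right_mono) auto
      finally show ?thesis by simp
    qed
    ultimately show "\<exists>P. polymap T T 1 (Suc m) (1 + C') P \<and>
      (\<forall>u v w. graph_data T A B k \<rho> u v w \<longrightarrow> v = u - \<pi> w \<longrightarrow> norm (v - P u) \<le> (1 + C') * norm u ^ (Suc m + 1))"
      by blast
  qed
qed

text \<open>The last gain is applied to \<open>f\<close> instead of the tangential projection: the
  parameter known with error of order \<open>k - 1\<close> gives \<open>f w\<close> with error of
  order \<open>k\<close>.\<close>

lemma graph_data_expansion:
  fixes \<rho> B :: real
  assumes "1 \<le> \<rho>" "0 \<le> B" "3 \<le> k"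
  shows "\<exists>C\<ge>0. \<forall>T E \<pi> f A. findim T \<longrightarrow> subspace E \<longrightarrow> linear \<pi> \<longrightarrow> range \<pi> \<subseteq> T \<longrightarrow> (\<forall>x. norm (\<pi> x) \<le> norm x) \<longrightarrow>
    linear f \<longrightarrow> range f \<subseteq> E \<longrightarrow> (\<forall>x. norm (f x) \<le> norm x) \<longrightarrow>
    (\<forall>i\<in>{2..k-1}. multilinear_on T UNIV i (A i) \<and> mbound T i (A i) B) \<longrightarrow>
    (\<exists>G. polymap T E 2 (k - 1) C G \<and>
      (\<forall>u v w. graph_data T A B k \<rho> u v w \<longrightarrow> v = u - \<pi> w \<longrightarrow> norm (f w - G u) \<le> C * norm u ^ k))"
proof -
  define m where "m = k - 2"
  have m: "k = m + 2" "1 \<le> m" using assms(3) by (simp_all add: m_def)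
  obtain C where C: "0 \<le> C" "\<And>T \<pi> A. findim T \<Longrightarrow> linear \<pi> \<Longrightarrow> range \<pi> \<subseteq> T \<Longrightarrow> (\<forall>x. norm (\<pi> x) \<le> norm x) \<Longrightarrow>
    (\<forall>i\<in>{2..k-1}. multilinear_on T UNIV i (A i) \<and> mbound T i (A i) B) \<Longrightarrow>
    (\<exists>P. polymap T T 1 m C P \<and>
      (\<forall>u v w. graph_data T A B k \<rho> u v w \<longrightarrow> v = u - \<pi> w \<longrightarrow> norm (v - P u) \<le> C * norm u ^ (m + 1)))"
    using graph_data_inverse[OF assms(1,2) _ assms(3) m(2)] m(1) by blast
  obtain C' where C': "0 \<le> C'" "\<And>T E f A P. findim T \<Longrightarrow> subspace E \<Longrightarrow> linear f \<Longrightarrow> range f \<subseteq> E \<Longrightarrow> (\<forall>x. norm (f x) \<le> norm x) \<Longrightarrow>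
    (\<forall>i\<in>{2..k-1}. multilinear_on T UNIV i (A i) \<and> mbound T i (A i) B) \<Longrightarrow> polymap T T 1 m C P \<Longrightarrow>
    (\<exists>G. polymap T E 2 (m + 1) C' G \<and>
      (\<forall>u v w. graph_data T A B k \<rho> u v w \<longrightarrow> norm (v - P u) \<le> C * norm u ^ (m + 1) \<longrightarrow>
         norm (f w - G u) \<le> C' * norm u ^ (m + 2)))"
    using graph_data_step[OF assms(1,2) C(1), of m k] m(1) by blast
  have km: "k - 1 = m + 1" using m by simp
  show ?thesis
  proof (rule exI[of _ C'], intro conjI allI impI)
    fix T E :: "evec set" and \<pi> f :: "evec \<Rightarrow> evec" and A assume h: "findim T" "subspace E" "linear \<pi>" "range \<pi> \<subseteq> T" "\<forall>x. norm (\<pi> x) \<le> norm x"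
      "linear f" "range f \<subseteq> E" "\<forall>x. norm (f x) \<le> norm x"
      "\<forall>i\<in>{2..k-1}. multilinear_on T UNIV i (A i) \<and> mbound T i (A i) B"
    obtain P where P: "polymap T T 1 m C P"
      "\<And>u v w. graph_data T A B k \<rho> u v w \<Longrightarrow> v = u - \<pi> w \<Longrightarrow> norm (v - P u) \<le> C * norm u ^ (m + 1)"
      using C(2)[OF h(1,3,4,5,9)] by blast
    obtain G where G: "polymap T E 2 (m + 1) C' G"
      "\<And>u v w. graph_data T A B k \<rho> u v w \<Longrightarrow> norm (v - P u) \<le> C * norm u ^ (m + 1) \<Longrightarrow>
         norm (f w - G u) \<le> C' * norm u ^ (m + 2)"
      using C'(2)[OF h(1,2,6-9) P(1)] by blast
    show "\<exists>G. polymap T E 2 (k - 1) C' G \<and>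
      (\<forall>u v w. graph_data T A B k \<rho> u v w \<longrightarrow> v = u - \<pi> w \<longrightarrow> norm (f w - G u) \<le> C' * norm u ^ k)"
      using G P(2) unfolding km by (intro exI[of _ G] conjI) (simp_all add: m(1))
  qed (rule C'(1))
qed

section \<open>Tensor expansion of the manifold over its tangent spaces\<close>

lemma iter_deriv_has_derivative:
  assumes "Ck_on k T B N" "ws \<in> lists T" "length ws < k" "v \<in> B"
  shows "(iter_deriv B N ws has_derivative frechet_derivative (iter_deriv B N ws) (at v within B)) (at v within B)"
  using assms unfolding Ck_on_def differentiable_on_def frechet_derivative_works by blast

lemma ball_in_cball_Int:
  assumes "v \<in> T" "norm (v::'a::real_normed_vector) < r"
  shows "ball v (r - norm v) \<inter> T \<subseteq> cball 0 r \<inter> T" "v \<in> cball 0 r \<inter> T" "0 < r - norm v"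
proof -
  have "norm x \<le> r" if "dist v x < r - norm v" for x
    using that norm_triangle_ineq[of v "x - v"] by (simp add: dist_norm norm_minus_commute)
  then show "ball v (r - norm v) \<inter> T \<subseteq> cball 0 r \<inter> T" by auto
qed (use assms in auto)

text \<open>Linearity in the first direction is that of a derivative. In the later directions it is,
  by induction, an identity of functions near \<open>v\<close>, and differentiating this identity
  uses uniqueness of derivatives along \<open>T\<close>; hence the interior condition on
  \<open>v\<close>.\<close>

lemma iter_deriv_multilinear:
  fixes N :: "'a::real_normed_vector \<Rightarrow> 'a"
  assumes sT: "subspace T" and Ck: "Ck_on k T B N" and B: "B = cball 0 r \<inter> T"
    and "i \<le> k" "v \<in> T" "norm v < r"
  shows "multilinear_on T UNIV i (\<lambda>ws. iter_deriv B N ws v)"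
  using assms(4-6)
proof (induction i arbitrary: v)
  case 0
  show ?case by (simp add: multilinear_on_def)
next
  case (Suc i)
  note bi = ball_in_cball_Int[OF Suc.prems(2,3), folded B]
  have D: "(iter_deriv B N us has_derivative frechet_derivative (iter_deriv B N us) (at v within B)) (at v within B)"
    if "us \<in> lists T" "length us = i" for us
    by (rule iter_deriv_has_derivative[OF Ck]) (use that Suc.prems bi in auto)
  have IH: "multilinear_on T UNIV i (\<lambda>ws. iter_deriv B N ws x)" if "x \<in> B" "dist x v < r - norm v" for x
    using Suc.IH[of x] Suc.prems that norm_triangle_ineq[of v "x - v"] by (auto simp: B dist_norm)
  show ?case
    unfolding multilinear_on_def
  proof (intro ballI impI conjI allI)
    fix ws' assume ws': "ws' \<in> lists T" "length ws' = Suc i"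
    then obtain w us where w: "ws' = w # us" "w \<in> T" "us \<in> lists T" "length us = i" by (cases ws') auto
    fix j x y c assume j: "j < Suc i" and xy: "x \<in> T" "y \<in> T"
    show "iter_deriv B N (ws'[j := x + y]) v = iter_deriv B N (ws'[j := x]) v + iter_deriv B N (ws'[j := y]) v"
      and "iter_deriv B N (ws'[j := c *\<^sub>R x]) v = c *\<^sub>R iter_deriv B N (ws'[j := x]) v"
    proof (atomize (full), cases j)
      case 0
      have "linear (frechet_derivative (iter_deriv B N us) (at v within B))"
        using D[OF w(3,4)] by (rule has_derivative_linear)
      then show "iter_deriv B N (ws'[j := x + y]) v = iter_deriv B N (ws'[j := x]) v + iter_deriv B N (ws'[j := y]) v
        \<and> iter_deriv B N (ws'[j := c *\<^sub>R x]) v = c *\<^sub>R iter_deriv B N (ws'[j := x]) v"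
        using 0 w(1) by (simp add: linear_add linear_cmul)
    next
      case (Suc l)
      have l: "l < i" using j Suc by simp
      have up: "us[l := z] \<in> lists T" "length (us[l := z]) = i" if "z \<in> T" for z
        using that w(3,4) set_update_subset_insert[of us l z] by auto
      have xyT: "x + y \<in> T" "c *\<^sub>R x \<in> T" using xy sT by (auto simp: subspace_add subspace_scale)
      let ?F = "\<lambda>z. frechet_derivative (iter_deriv B N (us[l := z])) (at v within B)"
      have "(iter_deriv B N (us[l := x + y]) has_derivative (\<lambda>h. ?F x h + ?F y h)) (at v within B)"
      proof (rule has_derivative_transform_within[OF has_derivative_add[OF D[OF up[OF xy(1)]] D[OF up[OF xy(2)]]] bi(3,2)])
        fix z assume "z \<in> B" "dist z v < r - norm v"
        from IH[OF this, unfolded multilinear_on_def, rule_format, OF w(3,4), THEN conjunct2, rule_format, OF l xy]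
        show "iter_deriv B N (us[l := x]) z + iter_deriv B N (us[l := y]) z = iter_deriv B N (us[l := x + y]) z"
          by simp
      qed
      from has_derivative_unique_subspace[OF D[OF up[OF xyT(1)]] this sT Suc.prems(2) bi(3,1) w(2)]
      have 1: "?F (x + y) w = ?F x w + ?F y w" .
      have "(iter_deriv B N (us[l := c *\<^sub>R x]) has_derivative (\<lambda>h. c *\<^sub>R ?F x h)) (at v within B)"
      proof (rule has_derivative_transform_within[OF has_derivative_scaleR_right[OF D[OF up[OF xy(1)]], of c] bi(3,2)])
        fix z assume "z \<in> B" "dist z v < r - norm v"
        from IH[OF this, unfolded multilinear_on_def, rule_format, OF w(3,4), THEN conjunct2, rule_format, OF l xy]
        show "c *\<^sub>R iter_deriv B N (us[l := x]) z = iter_deriv B N (us[l := c *\<^sub>R x]) z"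
          by simp
      qed
      from has_derivative_unique_subspace[OF D[OF up[OF xyT(2)]] this sT Suc.prems(2) bi(3,1) w(2)]
      have 2: "?F (c *\<^sub>R x) w = c *\<^sub>R ?F x w" .
      show "iter_deriv B N (ws'[j := x + y]) v = iter_deriv B N (ws'[j := x]) v + iter_deriv B N (ws'[j := y]) v
        \<and> iter_deriv B N (ws'[j := c *\<^sub>R x]) v = c *\<^sub>R iter_deriv B N (ws'[j := x]) v"
        using 1 2 Suc w(1) by simp
    qed
  qed auto
qed

lemma iter_deriv_line:
  fixes N :: "'a::real_normed_vector \<Rightarrow> 'a"
  assumes sT: "subspace T" and Ck: "Ck_on k T B N" and B: "B = cball 0 r \<inter> T"
    and ws: "ws \<in> lists T" "length ws < k" and v: "v \<in> T" "norm v < r" and t: "0 \<le> t" "t \<le> 1"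
  shows "((\<lambda>t. iter_deriv B N ws (t *\<^sub>R v)) has_vector_derivative iter_deriv B N (v # ws) (t *\<^sub>R v)) (at t)"
proof -
  define e where "e = (r - norm v) / (norm v + 1)"
  have nv: "0 < norm v + 1" by (simp add: add_nonneg_pos)
  have e: "0 < e" "e * (norm v + 1) = r - norm v" using v nv by (auto simp: e_def)
  have inB: "s *\<^sub>R v \<in> B" if "\<bar>s - t\<bar> < e" for s
  proof -
    have "\<bar>s\<bar> \<le> 1 + e" using that t by linarith
    then have "\<bar>s\<bar> * norm v \<le> (1 + e) * norm v" by (intro mult_right_mono) auto
    also have "\<dots> \<le> r" using e by (simp add: algebra_simps)
    finally show ?thesis using v sT by (auto simp: B subspace_scale)
  qed
  have tB: "t *\<^sub>R v \<in> B" using inB[of t] e by simp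
  have "((\<lambda>t. iter_deriv B N ws (0 + t *\<^sub>R v)) has_vector_derivative
      frechet_derivative (iter_deriv B N ws) (at (t *\<^sub>R v) within B) v) (at t)"
  proof (rule has_derivative_line[where S = B and x = 0 and w = v and s = t and f = "iter_deriv B N ws" and e = e
        and F = "frechet_derivative (iter_deriv B N ws) (at (t *\<^sub>R v) within B)"])
    show "(iter_deriv B N ws has_derivative frechet_derivative (iter_deriv B N ws) (at (t *\<^sub>R v) within B))
      (at (0 + t *\<^sub>R v) within B)" using iter_deriv_has_derivative[OF Ck ws tB] by simp
    show "0 + s *\<^sub>R v \<in> B" if "\<bar>s - t\<bar> < e" for s using inB[OF that] by simp
  qed (rule e(1))
  then show ?thesis by simp
qed

text \<open>The scalar Taylor formula for \<open>e \<bullet> N (t *\<^sub>R v)\<close>, with the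
  remainder \<open>e\<close> itself as test vector, gives
  \<open>norm e * norm e \<le> norm e * \<Lambda>\<close> and so replaces a vector-valued remainder
  formula.\<close>

lemma iter_deriv_taylor:
  fixes N :: "'a::real_inner \<Rightarrow> 'a"
  assumes sT: "subspace T" and Ck: "Ck_on k T B N" and B: "B = cball 0 r \<inter> T"
    and v: "v \<in> T" "norm v < r" and m: "0 < m" "m \<le> k"
    and bd: "\<And>t. 0 < t \<Longrightarrow> t < 1 \<Longrightarrow> norm (iter_deriv B N (replicate m v) (t *\<^sub>R v)) \<le> \<Lambda>"
  shows "norm (N v - (\<Sum>i<m. (1 / fact i) *\<^sub>R iter_deriv B N (replicate i v) 0)) \<le> \<Lambda>"
proof -
  define e where "e = N v - (\<Sum>i<m. (1 / fact i) *\<^sub>R iter_deriv B N (replicate i v) 0)"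
  define diff where "diff i t = e \<bullet> iter_deriv B N (replicate i v) (t *\<^sub>R v)" for i and t :: real
  have D: "\<forall>i t. i < m \<and> 0 \<le> t \<and> t \<le> 1 \<longrightarrow> DERIV (diff i) t :> diff (Suc i) t"
  proof (intro allI impI)
    fix i and t :: real assume it: "i < m \<and> 0 \<le> t \<and> t \<le> 1"
    have "((\<lambda>t. iter_deriv B N (replicate i v) (t *\<^sub>R v)) has_vector_derivative
        iter_deriv B N (v # replicate i v) (t *\<^sub>R v)) (at t)"
      by (rule iter_deriv_line[OF sT Ck B]) (use it m v in auto)
    from bounded_linear.has_vector_derivative[OF bounded_linear_inner_right[of e] this]
    show "DERIV (diff i) t :> diff (Suc i) t"
      by (simp add: diff_def[abs_def] has_real_derivative_iff_has_vector_derivative)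
  qed
  obtain t where t: "0 < t" "t < 1" "diff 0 1 = (\<Sum>i<m. diff i 0 / fact i * 1 ^ i) + diff m t / fact m * 1 ^ m"
    using Maclaurin[OF zero_less_one m(1) refl D] by blast
  have "e \<bullet> (\<Sum>i<m. (1 / fact i) *\<^sub>R iter_deriv B N (replicate i v) 0) = (\<Sum>i<m. diff i 0 / fact i)"
    by (simp add: inner_sum_right diff_def)
  then have "e \<bullet> e = diff 0 1 - (\<Sum>i<m. diff i 0 / fact i)"
    by (subst (2) e_def) (simp add: inner_diff_right diff_def)
  also have "\<dots> = diff m t / fact m" using t(3) by simp
  also have "\<dots> \<le> norm e * \<Lambda>"
  proof -
    have "diff m t \<le> norm e * norm (iter_deriv B N (replicate m v) (t *\<^sub>R v))"
      unfolding diff_def by (rule norm_cauchy_schwarz)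
    also have "\<dots> \<le> norm e * \<Lambda>" by (intro mult_left_mono bd t) auto
    finally have 1: "diff m t \<le> norm e * \<Lambda>" .
    have "0 \<le> \<Lambda>" using bd[OF t(1,2)] norm_ge_zero order_trans by blast
    then have "norm e * \<Lambda> / fact m \<le> norm e * \<Lambda> / 1" by (intro divide_left_mono) (auto simp: fact_ge_1)
    then show ?thesis using divide_right_mono[OF 1, of "fact m"] by simp
  qed
  finally have "norm e * norm e \<le> norm e * \<Lambda>" by (simp add: dot_square_norm power2_eq_square)
  moreover have "0 \<le> \<Lambda>" using order_trans[OF norm_ge_zero bd[of "1/2"]] by simp
  ultimately have "norm e \<le> \<Lambda>" by (cases "norm e = 0") (auto simp: mult_le_cancel_left)
  then show ?thesis by (simp add: e_def)
qed

text \<open>\<open>B0\<close> dominates the bounds of all orders at once. The estimates of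
  \<open>N\<close> and of its first derivative keep the sharper \<open>L 2\<close>, which makes
  \<open>N\<close> a small perturbation when \<open>norm v\<close> is at most
  \<open>1 / (8 * L 2)\<close>.\<close>

lemma graph_chart_estimates:
  assumes sm: "submanifold D d M" and p: "p \<in> M" and gc: "graph_chart k L M p r N"
    and k: "3 \<le> k" and L: "0 < L 2" "1 / (4 * L 2) \<le> r"
  defines "T \<equiv> tangent_space M p" and "B \<equiv> cball 0 r \<inter> tangent_space M p" and "B0 \<equiv> (\<Sum>i=2..k. \<bar>L i\<bar>)"
  assumes v: "v \<in> T" "norm v < 1 / (4 * L 2)"
  shows "p + v + N v \<in> M"
    and "i \<in> {2..k} \<Longrightarrow> multilinear_on T UNIV i (\<lambda>ws. iter_deriv B N ws v) \<and> mbound T i (\<lambda>ws. iter_deriv B N ws v) B0"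
    and "norm (N v - (\<Sum>i=2..k-1. (1 / fact i) *\<^sub>R iter_deriv B N (replicate i v) 0)) \<le> B0 * norm v ^ k"
    and "norm (N v) \<le> L 2 * (norm v)\<^sup>2"
    and "w \<in> T \<Longrightarrow> norm (iter_deriv B N [w] v) \<le> L 2 * norm v * norm w"
    and "(N has_derivative (\<lambda>w. iter_deriv B N [w] v)) (at v within B)"
proof -
  note fT = findim_tangent[OF sm p, folded T_def]
  note sT = findim_subspace[OF fT]
  have Beq: "B = cball 0 r \<inter> T" by (simp add: B_def T_def)
  have Ck: "Ck_on k T B N" and N0: "N 0 = 0" and dN0: "(N has_derivative (\<lambda>_. 0)) (at 0 within B)"
    and im: "(\<lambda>v. p + v + N v) ` B \<subseteq> M"
    and bd: "\<And>v i. v \<in> cball 0 (1 / (4 * L 2)) \<inter> T \<Longrightarrow> i \<in> {2..k} \<Longrightarrow> multi_onorm T i (\<lambda>ws. iter_deriv B N ws v) \<le> L i"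
    using gc unfolding graph_chart_def Let_def T_def[symmetric] Beq[symmetric] by blast+
  have rr: "norm x < r" if "norm x < 1 / (4 * L 2)" for x :: evec using that L by linarith
  have vB: "v \<in> B" using v rr[OF v(2)] by (simp add: Beq)
  show "p + v + N v \<in> M" using im vB by blast
  have ml: "multilinear_on T UNIV i (\<lambda>ws. iter_deriv B N ws x)" if "i \<le> k" "x \<in> T" "norm x < 1 / (4 * L 2)" for i x
    by (rule iter_deriv_multilinear[OF sT Ck Beq that(1,2) rr[OF that(3)]])
  have mb: "mbound T i (\<lambda>ws. iter_deriv B N ws x) (L i)" if "i \<in> {2..k}" "x \<in> T" "norm x < 1 / (4 * L 2)" for i x
    by (rule mbound_mono[OF mbound_multi_onorm[OF fT ml]]) (use that bd in auto)
  have LB: "L i \<le> B0" if "i \<in> {2..k}" for i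
  proof -
    have "\<bar>L i\<bar> \<le> B0" unfolding B0_def using that by (intro member_le_sum) auto
    then show ?thesis by linarith
  qed
  have mlv: "multilinear_on T UNIV i (\<lambda>ws. iter_deriv B N ws v) \<and> mbound T i (\<lambda>ws. iter_deriv B N ws v) B0"
    if "i \<in> {2..k}" for i
    using ml[of i v] mbound_mono[OF mb LB] that v by auto
  then show "i \<in> {2..k} \<Longrightarrow> multilinear_on T UNIV i (\<lambda>ws. iter_deriv B N ws v) \<and> mbound T i (\<lambda>ws. iter_deriv B N ws v) B0" .
  have tv: "t *\<^sub>R v \<in> T" "norm (t *\<^sub>R v) < 1 / (4 * L 2)" if "0 \<le> t" "t \<le> 1" for t
  proof -
    have "\<bar>t\<bar> * norm v \<le> 1 * norm v" using that by (intro mult_right_mono) auto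
    then show "t *\<^sub>R v \<in> T" "norm (t *\<^sub>R v) < 1 / (4 * L 2)" using v sT by (auto simp: subspace_scale)
  qed
  have zB: "0 \<in> T" "norm (0::evec) < r" using sT rr[of 0] L by (auto simp: subspace_0)
  note bi0 = ball_in_cball_Int[OF zB, folded Beq]
  have D0: "(N has_derivative frechet_derivative N (at 0 within B)) (at 0 within B)"
    using iter_deriv_has_derivative[OF Ck, of "[]" 0] bi0 k by simp
  have d1: "iter_deriv B N [w] 0 = 0" if "w \<in> T" for w
    using has_derivative_unique_subspace[OF D0 dN0 sT zB(1) bi0(3,1) that] by simp
  \<comment> \<open>The terms of order 0 and 1 vanish by the normalisation of \<open>N\<close> at
    the origin; for \<open>m = 2\<close> the right-hand sum is empty.\<close>
  have split: "(\<Sum>i<m. (1 / fact i) *\<^sub>R iter_deriv B N (replicate i v) 0) =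
      (\<Sum>i=2..m-1. (1 / fact i) *\<^sub>R iter_deriv B N (replicate i v) 0)" if "2 \<le> m" for m
  proof (rule sum.mono_neutral_right)
    show "\<forall>i\<in>{..<m} - {2..m - 1}. (1 / fact i) *\<^sub>R iter_deriv B N (replicate i v) 0 = 0"
    proof
      fix i assume "i \<in> {..<m} - {2..m - 1}"
      then have "i = 0 \<or> i = 1" by auto
      then show "(1 / fact i) *\<^sub>R iter_deriv B N (replicate i v) 0 = 0"
        using N0 d1[OF v(1)] by auto
    qed
  qed (use that in auto)
  have "norm (N v - (\<Sum>i<k. (1 / fact i) *\<^sub>R iter_deriv B N (replicate i v) 0)) \<le> B0 * norm v ^ k"
  proof (rule iter_deriv_taylor[OF sT Ck Beq v(1) rr[OF v(2)]])
    fix t :: real assume t: "0 < t" "t < 1"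
    have "mbound T k (\<lambda>ws. iter_deriv B N ws (t *\<^sub>R v)) B0"
      using mbound_mono[OF mb LB, of k "t *\<^sub>R v"] tv[of t] t k by auto
    from mbound_replicate[OF this v(1)]
    show "norm (iter_deriv B N (replicate k v) (t *\<^sub>R v)) \<le> B0 * norm v ^ k" .
  qed (use k in auto)
  then show "norm (N v - (\<Sum>i=2..k-1. (1 / fact i) *\<^sub>R iter_deriv B N (replicate i v) 0)) \<le> B0 * norm v ^ k"
    using split[of k] k by simp
  have "norm (N v - (\<Sum>i<2. (1 / fact i) *\<^sub>R iter_deriv B N (replicate i v) 0)) \<le> L 2 * norm v ^ 2"
  proof (rule iter_deriv_taylor[OF sT Ck Beq v(1) rr[OF v(2)]])
    fix t :: real assume t: "0 < t" "t < 1"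
    have "mbound T 2 (\<lambda>ws. iter_deriv B N ws (t *\<^sub>R v)) (L 2)"
      using mb[of 2 "t *\<^sub>R v"] tv[of t] t k by auto
    from mbound_replicate[OF this v(1)]
    show "norm (iter_deriv B N (replicate 2 v) (t *\<^sub>R v)) \<le> L 2 * norm v ^ 2" .
  qed (use k in auto)
  then show "norm (N v) \<le> L 2 * (norm v)\<^sup>2" using split[of 2] by simp
  show "norm (iter_deriv B N [w] v) \<le> L 2 * norm v * norm w" if w: "w \<in> T"
  proof -
    let ?f = "\<lambda>t. iter_deriv B N [w] (t *\<^sub>R v)"
    have der: "(?f has_vector_derivative iter_deriv B N [v, w] (t *\<^sub>R v)) (at t)" if "0 \<le> t" "t \<le> 1" for t
      by (rule iter_deriv_line[OF sT Ck Beq]) (use that w v rr k in auto)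
    have "continuous_on {0..1} ?f"
      using der has_vector_derivative_continuous by (intro continuous_at_imp_continuous_on) fastforce
    moreover have "(?f has_derivative (\<lambda>s. s *\<^sub>R iter_deriv B N [v, w] (t *\<^sub>R v))) (at t)" if "0 < t" "t < 1" for t
      using der[of t] that by (simp add: has_vector_derivative_def)
    ultimately obtain t where t: "t \<in> {0<..<1}"
      "norm (?f 1 - ?f 0) \<le> norm ((1 - 0) *\<^sub>R iter_deriv B N [v, w] (t *\<^sub>R v))"
      using mvt_general[of 0 1 ?f "\<lambda>t s. s *\<^sub>R iter_deriv B N [v, w] (t *\<^sub>R v)"] by auto
    have "mbound T 2 (\<lambda>ws. iter_deriv B N ws (t *\<^sub>R v)) (L 2)" using mb[of 2 "t *\<^sub>R v"] tv[of t] t k by auto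
    then have "norm (iter_deriv B N [v, w] (t *\<^sub>R v)) \<le> L 2 * prod_list (map norm [v, w])"
      using v w unfolding mbound_def by (metis Cons_in_lists_iff length_Cons list.size(3) lists.Nil numeral_2_eq_2)
    then show ?thesis using t(2) d1[OF w] by (simp add: mult.assoc)
  qed
  show "(N has_derivative (\<lambda>w. iter_deriv B N [w] v)) (at v within B)"
    using iter_deriv_has_derivative[OF Ck, of "[]" v] vB k by simp
qed

text \<open>A parameter whose image is closest to a given nearby point of \<open>M\<close> reaches it, again by the first
  order condition.\<close>

lemma graph_chart_cover:
  assumes m: "mfd D d \<tau> M" and p: "p \<in> M" and gc: "graph_chart k L M p r N"
    and k: "3 \<le> k" and L: "0 < L 2" "1 / (4 * L 2) \<le> r"
    and y: "y \<in> M" "norm (y - p) \<le> min \<tau> (1 / L 2) / 2000"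
  shows "\<exists>v\<in>tangent_space M p. norm v \<le> 3 * norm (y - p) \<and> y = p + v + N v"
proof -
  note sm = mfd_sub(1)[OF m] and \<tau> = mfd_sub(2)[OF m]
  let ?T = "tangent_space M p"
  let ?B = "cball 0 r \<inter> ?T"
  note fT = findim_tangent[OF sm p]
  note sT = findim_subspace[OF fT]
  note G = graph_chart_estimates[OF sm p gc k L]
  let ?\<pi> = "oproj ?T"
  \<comment> \<open>Half the radius on which the bounds hold: there \<open>N v\<close> is at most
    \<open>norm v / 8\<close> and the derivative of \<open>N\<close> at most 1/8.\<close>
  let ?K = "cball 0 (1 / (8 * L 2)) \<inter> ?T"
  have l8: "1 / (8 * L 2) < 1 / (4 * L 2)" using L by (simp add: field_simps)
  have inK: "v \<in> ?T" "norm v < 1 / (4 * L 2)" "norm v \<le> 1 / (8 * L 2)" if "v \<in> ?K" for v using that l8 by auto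
  have KB: "?K \<subseteq> ?B" using l8 L by auto
  have "continuous_on ?B (iter_deriv ?B N [])" using gc unfolding graph_chart_def Let_def Ck_on_def
    by (metis (no_types, lifting) le0 list.size(3) lists.Nil)
  then have cN: "continuous_on ?K N" using continuous_on_subset[OF _ KB] by simp
  define \<Psi> where "\<Psi> v = p + v + N v" for v
  have "continuous_on ?K (\<lambda>v. norm (y - \<Psi> v))" unfolding \<Psi>_def by (intro continuous_intros cN)
  moreover have K0: "0 \<in> ?K" using L sT by (simp add: subspace_0)
  ultimately obtain v where v: "v \<in> ?K" "\<forall>x\<in>?K. norm (y - \<Psi> v) \<le> norm (y - \<Psi> x)"
    using continuous_attains_inf[OF compact_findim[OF fT], of 0 "1 / (8 * L 2)" "\<lambda>v. norm (y - \<Psi> v)"] by blast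
  note vK = inK[OF v(1)]
  have N0: "N 0 = 0" using gc by (simp add: graph_chart_def Let_def)
  let ?s = "norm (y - p)"
  have "norm (y - \<Psi> v) \<le> ?s" using v(2)[rule_format, OF K0] by (simp add: \<Psi>_def N0)
  have Nv: "norm (N v) \<le> norm v / 8"
  proof -
    have "norm (N v) \<le> L 2 * (norm v)\<^sup>2" by (rule G(4)[OF vK(1,2)])
    also have "\<dots> = (L 2 * norm v) * norm v" by (simp add: power2_eq_square)
    also have "\<dots> \<le> (1/8) * norm v" using vK(3) L by (intro mult_right_mono) (auto simp: field_simps)
    finally show ?thesis by simp
  qed
  have \<Psi>p: "norm (\<Psi> v - p) \<le> 2 * ?s"
    using \<open>norm (y - \<Psi> v) \<le> ?s\<close> norm_triangle_ineq[of "\<Psi> v - y" "y - p"] by (simp add: norm_minus_commute)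
  have "norm v \<le> norm (\<Psi> v - p) + norm (N v)"
    using norm_triangle_ineq4[of "\<Psi> v - p" "N v"] by (simp add: \<Psi>_def)
  then have v3: "norm v \<le> 3 * ?s" using Nv \<Psi>p norm_ge_zero[of v] by linarith
  have sL: "?s \<le> \<tau> / 2000" "?s \<le> 1 / L 2 / 2000" using y(2) by auto
  have "1 / (8 * L 2) = 1 / L 2 / 8" by simp
  moreover have "0 < 1 / L 2" using L by simp
  moreover have "n < a / 8" if "s \<le> a / 2000" "0 < a" "n \<le> 3 * s" for a s n :: real
    using that by auto
  \<comment> \<open>The minimiser is interior to \<open>?K\<close>, so it may be varied in every
    tangent direction.\<close>
  ultimately have vlt: "norm v < 1 / (8 * L 2)" using v3 sL(2) by metis
  have \<Psi>M: "\<Psi> v \<in> M" unfolding \<Psi>_def by (rule G(1)[OF vK(1,2)])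
  define z where "z = y - \<Psi> v"
  \<comment> \<open>Both points lie on \<open>M\<close> close to \<open>p\<close>, so their
    difference is controlled by its tangential part.\<close>
  have z2: "norm z \<le> 2 * norm (?\<pi> z)" unfolding z_def
    by (rule tangent_expand[OF m p y(1) _ \<Psi>M]) (use sL \<Psi>p \<tau> in linarith)+
  let ?w = "?\<pi> z"
  have wT: "?w \<in> ?T" by (rule oproj_in[OF fT])
  let ?D = "\<lambda>w. iter_deriv ?B N [w] v"
  obtain \<delta> where d: "\<delta> > 0" "\<And>t. \<bar>t\<bar> < \<delta> \<Longrightarrow> v + t *\<^sub>R ?w \<in> ball v (1 / (8 * L 2) - norm v) \<inter> ?T"
    using line_in_ball[OF sT vK(1) wT, of "1 / (8 * L 2) - norm v"] vlt by auto
  have inK': "v + t *\<^sub>R ?w \<in> ?K" if "\<bar>t\<bar> < \<delta>" for t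
    using d(2)[OF that] ball_in_cball_Int(1)[OF vK(1) vlt] by blast
  have "((\<lambda>t. N (v + t *\<^sub>R ?w)) has_vector_derivative ?D ?w) (at 0)"
  proof (rule has_derivative_line[where S = ?B and e = \<delta>])
    show "(N has_derivative ?D) (at (v + 0 *\<^sub>R ?w) within ?B)" using G(6)[OF vK(1,2)] by (simp del: iter_deriv.simps)
    show "v + t *\<^sub>R ?w \<in> ?B" if "\<bar>t - 0\<bar> < \<delta>" for t
    proof -
      have "v + t *\<^sub>R ?w \<in> ?K" using inK'[of t] that by simp
      then show ?thesis using KB by blast
    qed
  qed (rule d(1))
  moreover have "((\<lambda>t. v + t *\<^sub>R ?w) has_vector_derivative ?w) (at 0)"
    unfolding has_vector_derivative_def by (auto intro!: derivative_eq_intros)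
  ultimately have "((\<lambda>t. (v + t *\<^sub>R ?w) + N (v + t *\<^sub>R ?w)) has_vector_derivative ?w + ?D ?w) (at 0)"
    by (intro has_vector_derivative_add)
  from has_vector_derivative_diff[OF has_vector_derivative_const[of "y - p"] this]
  have "((\<lambda>t. y - \<Psi> (v + t *\<^sub>R ?w)) has_vector_derivative - (?w + ?D ?w)) (at 0)"
    by (simp add: \<Psi>_def algebra_simps)
  then have df: "((\<lambda>t. y - \<Psi> (v + t *\<^sub>R ?w)) has_derivative (\<lambda>h. h *\<^sub>R - (?w + ?D ?w))) (at 0)"
    by (simp only: has_vector_derivative_def)
  let ?\<phi> = "\<lambda>t. (y - \<Psi> (v + t *\<^sub>R ?w)) \<bullet> (y - \<Psi> (v + t *\<^sub>R ?w))"
  have "(?\<phi> has_derivative (\<lambda>h. (y - \<Psi> (v + 0 *\<^sub>R ?w)) \<bullet> (h *\<^sub>R - (?w + ?D ?w)) +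
      (h *\<^sub>R - (?w + ?D ?w)) \<bullet> (y - \<Psi> (v + 0 *\<^sub>R ?w)))) (at 0)"
    by (rule has_derivative_inner[OF df df])
  moreover have "(\<lambda>h. (y - \<Psi> (v + 0 *\<^sub>R ?w)) \<bullet> (h *\<^sub>R - (?w + ?D ?w)) +
      (h *\<^sub>R - (?w + ?D ?w)) \<bullet> (y - \<Psi> (v + 0 *\<^sub>R ?w))) = times (- 2 * (z \<bullet> (?w + ?D ?w)))"
  proof
    fix h :: real
    have "z \<bullet> (h *\<^sub>R - d) + (h *\<^sub>R - d) \<bullet> z = - 2 * (z \<bullet> d) * h" for d
      by (simp add: inner_commute[of d z])
    then show "(y - \<Psi> (v + 0 *\<^sub>R ?w)) \<bullet> (h *\<^sub>R - (?w + ?D ?w)) +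
      (h *\<^sub>R - (?w + ?D ?w)) \<bullet> (y - \<Psi> (v + 0 *\<^sub>R ?w)) = - 2 * (z \<bullet> (?w + ?D ?w)) * h"
      by (simp only: scaleR_zero_left add_0_right z_def)
  qed
  ultimately have D: "DERIV ?\<phi> 0 :> - 2 * (z \<bullet> (?w + ?D ?w))" by (simp add: has_field_derivative_def)
  have "\<forall>t. \<bar>0 - t\<bar> < \<delta> \<longrightarrow> ?\<phi> 0 \<le> ?\<phi> t"
  proof (intro allI impI)
    fix t assume "\<bar>0 - t\<bar> < \<delta>"
    then have "norm (y - \<Psi> v) \<le> norm (y - \<Psi> (v + t *\<^sub>R ?w))" using v(2) inK'[of t] by simp
    then show "?\<phi> 0 \<le> ?\<phi> t" by (simp add: norm_eq_sqrt_inner)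
  qed
  then have "z \<bullet> (?w + ?D ?w) = 0" using DERIV_local_min[OF D d(1)] by simp
  then have 0: "z \<bullet> ?w + z \<bullet> ?D ?w = 0" by (simp add: inner_add_right)
  have zw: "z \<bullet> ?w = norm ?w * norm ?w"
    using inner_oproj_eq[OF fT wT, of z] by (simp add: dot_square_norm power2_eq_square)
  have "norm (?D ?w) \<le> L 2 * norm v * norm ?w" by (rule G(5)[OF vK(1,2) wT])
  also have "\<dots> \<le> 1/8 * norm ?w" using vK(3) L by (intro mult_right_mono) (auto simp: field_simps)
  finally have Dw: "norm (?D ?w) \<le> 1/8 * norm ?w" .
  have "- (z \<bullet> ?D ?w) \<le> norm z * norm (?D ?w)" using norm_cauchy_schwarz[of z "- ?D ?w"] by simp
  also have "\<dots> \<le> (2 * norm ?w) * (1/8 * norm ?w)" using z2 Dw by (intro mult_mono) auto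
  \<comment> \<open>Optimality in the direction \<open>?w\<close> itself bounds the square of its
    norm by a quarter of that square.\<close>
  finally have "norm ?w * norm ?w \<le> 1/4 * (norm ?w * norm ?w)" using 0 zw by simp
  then have "norm ?w * norm ?w = 0" using mult_nonneg_nonneg[OF norm_ge_zero[of ?w] norm_ge_zero[of ?w]] by linarith
  then have "z = 0" using z2 by simp
  then show ?thesis using vK(1) v3 by (auto simp: z_def \<Psi>_def)
qed

text \<open>For \<open>k = 2\<close> the sum is empty and the expansion is
  \<open>reach_tangent\<close>. For larger \<open>k\<close> the inverted graph expansion covers
  distances up to \<open>s0\<close>; beyond, up to the stated radius, the crude bound
  \<open>K\<close> is absorbed by \<open>CR * s0 ^ k\<close>.\<close>

lemma tensor_expansion_ex:
  assumes k: "2 \<le> k" and \<tau>: "0 < \<tau>" and L: "3 \<le> k \<longrightarrow> 0 < L 2"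
  shows "\<exists>Ct>0. \<exists>CR>0. \<forall>D d M y. M \<in> manifold_class D d k \<tau> L \<longrightarrow> y \<in> M \<longrightarrow>
    (\<exists>T. (\<forall>i\<in>{2..k-1}. multilinear_on (tangent_space M y) (Rdim D) i (T i) \<and> mbound (tangent_space M y) i (T i) Ct) \<and>
       tensor_expansion k (min \<tau> (1 / L_perp k \<tau> L) / 4) CR M y T)"
proof (cases "k = 2")
  case True
  show ?thesis
  proof (rule exI[of _ 1], intro conjI, simp, rule exI[of _ "1 / (2 * \<tau>)"], intro conjI allI impI)
    show "0 < 1 / (2 * \<tau>)" using \<tau> by simp
    fix D d M y assume M: "M \<in> manifold_class D d k \<tau> L" and y: "y \<in> M"
    have m: "mfd D d \<tau> M" using M \<tau> by (simp add: mfd_def manifold_class_def)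
    have "norm (x - y - oproj (tangent_space M y) (x - y)) \<le> 1 / (2 * \<tau>) * norm (x - y) ^ 2" if "x \<in> M" for x
      using reach_tangent[OF m y that] by simp
    then show "\<exists>T. (\<forall>i\<in>{2..k-1}. multilinear_on (tangent_space M y) (Rdim D) i (T i) \<and> mbound (tangent_space M y) i (T i) 1) \<and>
       tensor_expansion k (min \<tau> (1 / L_perp k \<tau> L) / 4) (1 / (2 * \<tau>)) M y T"
      using True by (intro exI[of _ undefined]) (auto simp: tensor_expansion_def Let_def)
  qed
next
  case False
  then have k3: "3 \<le> k" using k by simp
  then have L0: "0 < L 2" using L by simp
  define \<rho> where "\<rho> = max 1 (1 / L 2)"
  define B0 where "B0 = (\<Sum>i=2..k. \<bar>L i\<bar>)"
  have \<rho>1: "1 \<le> \<rho>" and B00: "0 \<le> B0" by (auto simp: \<rho>_def B0_def intro: sum_nonneg)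
  obtain C where C: "0 \<le> C" "\<And>T E \<pi> f A. findim T \<Longrightarrow> subspace E \<Longrightarrow> linear \<pi> \<Longrightarrow> range \<pi> \<subseteq> T \<Longrightarrow> (\<forall>x. norm (\<pi> x) \<le> norm x) \<Longrightarrow>
    linear f \<Longrightarrow> range f \<subseteq> E \<Longrightarrow> (\<forall>x. norm (f x) \<le> norm x) \<Longrightarrow>
    (\<forall>i\<in>{2..k-1}. multilinear_on T UNIV i (A i) \<and> mbound T i (A i) B0) \<Longrightarrow>
    (\<exists>G. polymap T E 2 (k - 1) C G \<and>
      (\<forall>u v w. graph_data T A B0 k \<rho> u v w \<longrightarrow> v = u - \<pi> w \<longrightarrow> norm (f w - G u) \<le> C * norm u ^ k))"
    using graph_data_expansion[OF \<rho>1 B00 k3] by blast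
  define m0 where "m0 = min \<tau> (1 / L 2)"
  have m0: "0 < m0" using \<tau> L0 by (simp add: m0_def)
  define s0 where "s0 = m0 / 2000"
  have s0: "0 < s0" using m0 by (simp add: s0_def)
  define Ct where "Ct = C + 1"
  define K where "K = m0 + (\<Sum>i=2..k-1. C * m0 ^ i)"
  have K0: "0 < K" using m0 C(1) by (auto simp: K_def intro!: add_pos_nonneg sum_nonneg)
  define CR where "CR = C + K / s0 ^ k"
  have CR: "0 < CR" "C \<le> CR" "K \<le> CR * s0 ^ k"
    using K0 C(1) s0 by (auto simp: CR_def distrib_right intro!: add_nonneg_pos)
  show ?thesis
  proof (rule exI[of _ Ct], intro conjI, use C in \<open>simp add: Ct_def\<close>, rule exI[of _ CR], intro conjI allI impI)
    show "0 < CR" by (rule CR)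
    fix D d M y assume M: "M \<in> manifold_class D d k \<tau> L" and y: "y \<in> M"
    have m: "mfd D d \<tau> M" using M \<tau> by (simp add: mfd_def manifold_class_def)
    note sm = mfd_sub(1)[OF m]
    obtain r N where gc: "1 / (4 * L 2) \<le> r" "graph_chart k L M y r N"
      using M k3 y by (auto simp: manifold_class_def)
    let ?T = "tangent_space M y"
    let ?B = "cball 0 r \<inter> ?T"
    note fT = findim_tangent[OF sm y]
    note sT = findim_subspace[OF fT]
    let ?\<pi> = "oproj ?T"
    note G = graph_chart_estimates[OF sm y gc(2) k3 L0 gc(1), folded B0_def]
    define A where "A i ws = (1 / fact i) *\<^sub>R iter_deriv ?B N ws 0" for i ws
    have A: "\<forall>i\<in>{2..k-1}. multilinear_on ?T UNIV i (A i) \<and> mbound ?T i (A i) B0"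
    proof
      fix i assume i: "i \<in> {2..k-1}"
      have g: "multilinear_on ?T UNIV i (\<lambda>ws. iter_deriv ?B N ws 0)" "mbound ?T i (\<lambda>ws. iter_deriv ?B N ws 0) B0"
        using G(2)[of 0 i] i L0 sT by (auto simp: subspace_0)
      have f1: "(1::real) / fact i \<le> 1" by (simp add: fact_ge_1)
      have "multilinear_on ?T UNIV i (A i)"
        unfolding A_def by (rule multilinear_on_linear[OF g(1)]) (auto intro: linear_scaleR)
      moreover have "mbound ?T i (A i) B0"
        unfolding mbound_def
      proof (intro ballI impI)
        fix ws assume ws: "ws \<in> lists ?T" "length ws = i"
        have "norm (A i ws) = 1 / fact i * norm (iter_deriv ?B N ws 0)" by (simp add: A_def)
        also have "\<dots> \<le> 1 * norm (iter_deriv ?B N ws 0)" using f1 by (intro mult_right_mono) auto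
        also have "\<dots> \<le> B0 * prod_list (map norm ws)" using g(2) ws by (simp add: mbound_def)
        finally show "norm (A i ws) \<le> B0 * prod_list (map norm ws)" .
      qed
      ultimately show "multilinear_on ?T UNIV i (A i) \<and> mbound ?T i (A i) B0" by blast
    qed
    \<comment> \<open>Removes the tangential component, and lands in \<open>Rdim D\<close>, since
      the derivatives of \<open>N\<close> have only been treated as having values in
      \<open>UNIV\<close>.\<close>
    define f where "f x = oproj (Rdim D) (x - ?\<pi> x)" for x
    have lf: "linear f" unfolding f_def
      using linear_compose[OF linear_compose_sub[OF linear_id linear_oproj[OF fT]] linear_oproj[OF findim_Rdim]]
      by (simp add: o_def)
    have nf: "norm (f x) \<le> norm x" for x unfolding f_def
      using norm_oproj_le[OF findim_Rdim] norm_oproj_diff_le[OF fT] order_trans by blast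
    obtain H where H: "polymap ?T (Rdim D) 2 (k - 1) C H"
      "\<And>u v w. graph_data ?T A B0 k \<rho> u v w \<Longrightarrow> v = u - ?\<pi> w \<Longrightarrow> norm (f w - H u) \<le> C * norm u ^ k"
      using C(2)[OF fT subspace_Rdim linear_oproj[OF fT] _ _ lf _ _ A] oproj_in[OF fT] norm_oproj_le[OF fT] nf
        oproj_in[OF findim_Rdim] unfolding f_def by (metis (no_types, lifting) image_subset_iff)
    obtain W where W: "\<And>i. i \<in> {2..k-1} \<Longrightarrow> multilinear_on ?T (Rdim D) i (W i) \<and> mbound ?T i (W i) C"
      "\<And>u. u \<in> ?T \<Longrightarrow> H u = (\<Sum>i=2..k-1. W i (replicate i u))"
      using H(1) unfolding polymap_def by blast
    have near: "norm (x - y - ?\<pi> (x - y) - H (?\<pi> (x - y))) \<le> C * norm (x - y) ^ k"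
      if x: "x \<in> M" "norm (x - y) \<le> s0" for x
    proof -
      obtain v where v: "v \<in> ?T" "norm v \<le> 3 * norm (x - y)" "x = y + v + N v"
        using graph_chart_cover[OF m y gc(2) k3 L0 gc(1) x(1)] x(2) by (auto simp: s0_def m0_def)
      let ?u = "?\<pi> (x - y)"
      have "norm (x - y) \<le> 1 / L 2 / 2000" using x(2) by (simp add: s0_def m0_def)
      moreover have "0 < 1 / L 2" using L0 by simp
      moreover have "n \<le> a / 8" "s \<le> a" if "s \<le> a / 2000" "0 < a" "n \<le> 3 * s" for a s n :: real
        using that by auto
      ultimately have v8: "norm v \<le> 1 / L 2 / 8" "norm (x - y) \<le> 1 / L 2" using v(2) by blast+
      have v4: "norm v < 1 / (4 * L 2)"
      proof -
        have "1 / (4 * L 2) = 1 / L 2 / 4" "0 < 1 / L 2" using L0 by simp_all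
        moreover have "n < a / 4" if "n \<le> a / 8" "0 < a" for a n :: real using that by auto
        ultimately show ?thesis using v8(1) by metis
      qed
      \<comment> \<open>The tangential coordinate differs from the parameter by the tangential part
        of \<open>N v\<close>; this is the relation that has to be inverted.\<close>
      have u: "?u = v + ?\<pi> (N v)" using v by (simp add: oproj_add[OF fT] oproj_id[OF sT] add.assoc)
      have "norm (N v) \<le> L 2 * (norm v)\<^sup>2" by (rule G(4)[OF v(1) v4])
      also have "\<dots> = (L 2 * norm v) * norm v" by (simp add: power2_eq_square)
      also have "\<dots> \<le> (1/8) * norm v" using v8(1) L0 by (intro mult_right_mono) (auto simp: field_simps)
      finally have "norm (?\<pi> (N v)) \<le> norm v / 8" using norm_oproj_le[OF fT, of "N v"] by simp
      moreover have "norm v \<le> norm ?u + norm (?\<pi> (N v))"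
        using norm_triangle_ineq4[of ?u "?\<pi> (N v)"] u by simp
      ultimately have vu: "norm v \<le> 2 * norm ?u" using norm_ge_zero[of v] by linarith
      have nu: "norm ?u \<le> norm (x - y)" by (rule norm_oproj_le[OF fT])
      have "graph_data ?T A B0 k \<rho> ?u v (N v)"
        unfolding graph_data_def A_def
        using G(3)[OF v(1) v4] v(1) vu nu v8(2) oproj_in[OF fT] by (auto simp: \<rho>_def)
      then have "norm (f (N v) - H ?u) \<le> C * norm ?u ^ k" using H(2) u by simp
      also have "\<dots> \<le> C * norm (x - y) ^ k" using nu C(1) by (intro mult_left_mono power_mono) auto
      also have "f (N v) = x - y - ?u"
      proof -
        have e: "N v - ?\<pi> (N v) = x - y - ?u" using u v(3) by simp
        have "x - y - ?u \<in> Rdim D"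
          using x(1) y mfd_sub(3)[OF m] oproj_in[OF fT] tangent_sub[OF sm y]
          by (blast intro: subspace_diff subspace_Rdim)
        then show ?thesis unfolding f_def e by (rule oproj_id[OF subspace_Rdim])
      qed
      finally show ?thesis .
    qed
    have "tensor_expansion k (min \<tau> (1 / L_perp k \<tau> L) / 4) CR M y W"
      unfolding tensor_expansion_def Let_def
    proof
      fix x assume x: "x \<in> M \<inter> cball y (min \<tau> (1 / L_perp k \<tau> L) / 4)"
      have "L_perp k \<tau> L = L 2" using k3 by (simp add: L_perp_def)
      then have "norm (x - y) \<le> m0 / 4" using x by (simp add: m0_def dist_norm norm_minus_commute)
      then have nx: "norm (x - y) \<le> m0" using m0 by simp
      let ?u = "?\<pi> (x - y)"
      have uT: "?u \<in> ?T" by (rule oproj_in[OF fT])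
      have "norm (x - y - ?u - H ?u) \<le> CR * norm (x - y) ^ k"
      proof (cases "norm (x - y) \<le> s0")
        case True
        have "norm (x - y - ?u - H ?u) \<le> C * norm (x - y) ^ k" using near x True by blast
        also have "\<dots> \<le> CR * norm (x - y) ^ k" using CR by (intro mult_right_mono) auto
        finally show ?thesis .
      next
        case False
        have nu: "norm ?u \<le> norm (x - y)" by (rule norm_oproj_le[OF fT])
        have "norm (H ?u) \<le> (\<Sum>i=2..k-1. C * m0 ^ i)"
          unfolding W(2)[OF uT]
        proof (rule sum_norm_le)
          fix i assume i: "i \<in> {2..k-1}"
          have "norm (W i (replicate i ?u)) \<le> C * norm ?u ^ i"
            using W(1)[OF i] uT by (intro mbound_replicate) auto
          also have "\<dots> \<le> C * m0 ^ i" using nu nx C(1) by (intro mult_left_mono power_mono) auto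
          finally show "norm (W i (replicate i ?u)) \<le> C * m0 ^ i" .
        qed
        moreover have "norm (x - y - ?u) \<le> m0" using norm_oproj_diff_le[OF fT, of "x - y"] nx by linarith
        ultimately have "norm (x - y - ?u - H ?u) \<le> K"
          using norm_triangle_ineq4[of "x - y - ?u" "H ?u"] by (simp add: K_def)
        also have "\<dots> \<le> CR * s0 ^ k" by (rule CR)
        also have "\<dots> \<le> CR * norm (x - y) ^ k" using False s0 CR by (intro mult_left_mono power_mono) auto
        finally show ?thesis .
      qed
      then show "norm (x - y - ?u - (\<Sum>i = 2..k - 1. W i (replicate i ?u))) \<le> CR * norm (x - y) ^ k"
        using W(2)[OF uT] by simp
    qed
    moreover have "\<forall>i\<in>{2..k-1}. multilinear_on ?T (Rdim D) i (W i) \<and> mbound ?T i (W i) Ct"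
      using W(1) mbound_mono[of ?T _ _ C Ct] by (auto simp: Ct_def)
    ultimately show "\<exists>T. (\<forall>i\<in>{2..k-1}. multilinear_on ?T (Rdim D) i (T i) \<and> mbound ?T i (T i) Ct) \<and>
       tensor_expansion k (min \<tau> (1 / L_perp k \<tau> L) / 4) CR M y T" by blast
  qed
qed

section \<open>Symmetrization\<close>

lemma multilinear_on_map:
  assumes A: "multilinear_on T E i A" and f: "linear f" "f ` U \<subseteq> T"
  shows "multilinear_on U E i (\<lambda>ws. A (map f ws))"
  unfolding multilinear_on_def
proof (intro ballI impI)
  fix ws assume ws: "ws \<in> lists U" "length ws = i"
  have "map f ws \<in> lists T" "length (map f ws) = i" using ws f(2) by (auto simp: in_lists_conv_set image_subset_iff)
  note * = A[unfolded multilinear_on_def, rule_format, OF this]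
  show "A (map f ws) \<in> E \<and> (\<forall>j<i. \<forall>x\<in>U. \<forall>y\<in>U. \<forall>c.
      A (map f (ws[j := x + y])) = A (map f (ws[j := x])) + A (map f (ws[j := y])) \<and>
      A (map f (ws[j := c *\<^sub>R x])) = c *\<^sub>R A (map f (ws[j := x])))"
  proof (intro conjI allI impI ballI)
    fix j x y c assume j: "j < i" and xy: "x \<in> U" "y \<in> U"
    have "f x \<in> T" "f y \<in> T" using xy f(2) by auto
    with * j show "A (map f (ws[j := x + y])) = A (map f (ws[j := x])) + A (map f (ws[j := y]))"
      "A (map f (ws[j := c *\<^sub>R x])) = c *\<^sub>R A (map f (ws[j := x]))"
      by (auto simp: map_update linear_add[OF f(1)] linear_cmul[OF f(1)])
  qed (use * in blast)
qed

lemma permute_list_update: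
  assumes "p permutes {..<length ws}" "j < length ws"
  shows "permute_list p (ws[j := x]) = (permute_list p ws)[inv p j := x]"
proof (rule nth_equalityI)
  fix i assume "i < length (permute_list p (ws[j := x]))"
  then have i: "i < length ws" by simp
  then have pi: "p i < length ws" using assms(1) permutes_in_image by fastforce
  have "inv p j = i \<longleftrightarrow> p i = j" using permutes_inverses[OF assms(1)] by metis
  moreover have "inv p j < length ws" using permutes_inv[OF assms(1)] assms(2) permutes_in_image by fastforce
  ultimately show "permute_list p (ws[j := x]) ! i = (permute_list p ws)[inv p j := x] ! i"
    using i pi assms by (simp add: permute_list_nth nth_list_update)
qed simp

lemma multilinear_on_permute:
  assumes A: "multilinear_on T E i A" and p: "p permutes {..<i}"
  shows "multilinear_on T E i (\<lambda>ws. A (permute_list p ws))"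
  unfolding multilinear_on_def
proof (intro ballI impI)
  fix ws assume ws: "ws \<in> lists T" "length ws = i"
  have p': "p permutes {..<length ws}" using p ws by simp
  have "permute_list p ws \<in> lists T" "length (permute_list p ws) = i"
    using ws set_permute_list[OF p'] by (auto simp: in_lists_conv_set)
  note * = A[unfolded multilinear_on_def, rule_format, OF this]
  have inv: "inv p j < i" if "j < i" for j using permutes_inv[OF p] that permutes_in_image by fastforce
  show "A (permute_list p ws) \<in> E \<and> (\<forall>j<i. \<forall>x\<in>T. \<forall>y\<in>T. \<forall>c.
      A (permute_list p (ws[j := x + y])) = A (permute_list p (ws[j := x])) + A (permute_list p (ws[j := y])) \<and>
      A (permute_list p (ws[j := c *\<^sub>R x])) = c *\<^sub>R A (permute_list p (ws[j := x])))"
    using * inv permute_list_update[OF p'] ws(2) by auto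
qed

lemma multilinear_on_sum:
  assumes "finite J" "\<And>j. j \<in> J \<Longrightarrow> multilinear_on T E i (A j)" "subspace E"
  shows "multilinear_on T E i (\<lambda>ws. \<Sum>j\<in>J. A j ws)"
  using assms(1,2)
  by (induction J rule: finite_induct) (auto intro: multilinear_on_add multilinear_on_zero simp: assms(3))

lemma prod_list_permute:
  assumes "p permutes {..<length ws}"
  shows "prod_list (map f (permute_list p ws)) = (prod_list (map f ws) :: real)"
proof -
  have "prod_list (map f (permute_list p ws)) = prod_mset (mset (map f (permute_list p ws)))" by (rule prod_mset_prod_list[symmetric])
  also have "mset (map f (permute_list p ws)) = mset (map f ws)" using assms by simp
  finally show ?thesis by (simp only: prod_mset_prod_list)
qed

definition symmetrize :: "nat \<Rightarrow> (evec list \<Rightarrow> evec) \<Rightarrow> evec list \<Rightarrow> evec" where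
  "symmetrize i A ws = (1 / fact i) *\<^sub>R (\<Sum>p | p permutes {..<i}. A (permute_list p ws))"

text \<open>The fit is over symmetric forms, but residuals evaluate them only on the diagonal, where
  averaging over permutations changes nothing. The bound survives because permuting the arguments
  keeps the product of their norms.\<close>

lemma symmetrize:
  assumes A: "multilinear_on T E i A" and B: "mbound T i A B" and E: "subspace E"
  shows "multilinear_on T E i (symmetrize i A)" "symmetric_on T i (symmetrize i A)"
    "mbound T i (symmetrize i A) B" "symmetrize i A (replicate i x) = A (replicate i x)"
proof -
  let ?P = "{p. p permutes {..<i}}"
  have fin: "finite ?P" by (rule finite_permutations) simp
  have card: "card ?P = fact i" using card_permutations[of "{..<i}" i] by simp
  have "multilinear_on T E i (\<lambda>ws. \<Sum>p\<in>?P. A (permute_list p ws))"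
    by (rule multilinear_on_sum[OF fin _ E]) (simp add: multilinear_on_permute[OF A])
  then show "multilinear_on T E i (symmetrize i A)"
    unfolding symmetrize_def[abs_def]
    by (rule multilinear_on_linear) (use E in \<open>auto intro: linear_scaleR subspace_scale\<close>)
  show "symmetric_on T i (symmetrize i A)"
    unfolding symmetric_on_def
  proof (intro ballI impI)
    fix ws ws' :: "evec list" assume ws: "length ws = i" "mset ws = mset ws'"
    then obtain q where q: "q permutes {..<length ws'}" "permute_list q ws' = ws" using mset_eq_permutation by metis
    have l: "length ws' = i" using ws mset_eq_length by metis
    have "(\<Sum>p\<in>?P. A (permute_list p ws)) = (\<Sum>p\<in>?P. A (permute_list (q \<circ> p) ws'))"
      using q l by (intro sum.cong) (auto simp: permute_list_compose)
    also have "\<dots> = (\<Sum>p\<in>?P. A (permute_list p ws'))"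
      using setum_permutations_compose_left[of q "{..<i}" "\<lambda>p. A (permute_list p ws')"] q(1) l by simp
    finally show "symmetrize i A ws = symmetrize i A ws'" by (simp add: symmetrize_def)
  qed
  show "mbound T i (symmetrize i A) B"
    unfolding mbound_def
  proof (intro ballI impI)
    fix ws assume ws: "ws \<in> lists T" "length ws = i"
    have "norm (\<Sum>p\<in>?P. A (permute_list p ws)) \<le> (\<Sum>p\<in>?P. B * prod_list (map norm ws))"
    proof (rule sum_norm_le)
      fix p assume "p \<in> ?P"
      then have p: "p permutes {..<length ws}" using ws by simp
      have "permute_list p ws \<in> lists T" using ws set_permute_list[OF p] by (auto simp: in_lists_conv_set)
      then have "norm (A (permute_list p ws)) \<le> B * prod_list (map norm (permute_list p ws))"
        using B ws by (simp add: mbound_def)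
      then show "norm (A (permute_list p ws)) \<le> B * prod_list (map norm ws)" by (simp only: prod_list_permute[OF p])
    qed
    also have "\<dots> = fact i * (B * prod_list (map norm ws))" using card by simp
    finally show "norm (symmetrize i A ws) \<le> B * prod_list (map norm ws)"
      by (simp add: symmetrize_def field_simps)
  qed
  have "permute_list p (replicate i x) = replicate i x" if "p permutes {..<i}" for p
    using that permutes_in_image[OF that] by (intro nth_equalityI) (auto simp: permute_list_nth)
  then have "(\<Sum>p\<in>?P. A (permute_list p (replicate i x))) = (\<Sum>p\<in>?P. A (replicate i x))"
    by (intro sum.cong) auto
  also have "\<dots> = fact i *\<^sub>R A (replicate i x)" using card by (simp add: scaleR_conv_of_real sum_constant_scaleR)
  finally show "symmetrize i A (replicate i x) = A (replicate i x)" by (simp add: symmetrize_def)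
qed

section \<open>Stability of the local polynomial fit\<close>

definition resid :: "nat \<Rightarrow> (evec \<Rightarrow> evec) \<Rightarrow> (nat \<Rightarrow> evec list \<Rightarrow> evec) \<Rightarrow> evec \<Rightarrow> evec" where
  "resid k \<pi> T x = x - \<pi> x - (\<Sum>i=2..k-1. T i (replicate i (\<pi> x)))"

lemma multilinear_on_replicate_0:
  assumes "multilinear_on T E i A" "subspace T" "2 \<le> i"
  shows "A (replicate i 0) = 0"
proof -
  obtain j where j: "i = Suc j" using assms(3) by (metis Suc_le_D numeral_2_eq_2)
  show ?thesis using multilinear_on_head_0[of T E j A "replicate j 0"] assms subspace_0[OF assms(2)] j by (auto simp: in_lists_conv_set)
qed

lemma resid_0:
  assumes "findim V" "\<And>i. i \<in> {2..k-1} \<Longrightarrow> multilinear_on (Rdim D) (Rdim D) i (T i)"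
  shows "resid k (oproj V) T 0 = 0"
proof -
  have "(\<Sum>i=2..k-1. T i (replicate i 0)) = 0"
    using multilinear_on_replicate_0[OF assms(2) subspace_Rdim] by (intro sum.neutral) auto
  then show ?thesis by (simp add: resid_def oproj_0[OF assms(1)])
qed

text \<open>Source of the factor \<open>1 + t * h\<close>: forms of degree at least 2 with bound
  \<open>t\<close> have Lipschitz constant of order \<open>t * h\<close> on balls of radius
  \<open>c * h\<close>; the other powers of \<open>h\<close> are absorbed into
  \<open>(c * \<rho>) ^ k\<close>.\<close>

lemma resid_lipschitz:
  fixes c \<rho> h t :: real
  assumes V: "findim V" "V \<subseteq> Rdim D"
    and T: "\<And>i. i \<in> {2..k-1} \<Longrightarrow> multilinear_on (Rdim D) (Rdim D) i (T i) \<and> mbound (Rdim D) i (T i) t"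
    and t: "0 \<le> t" and h: "0 \<le> h" "h \<le> \<rho>" "1 \<le> \<rho>" "1 \<le> c"
    and x: "norm x \<le> c * h" "norm y \<le> c * h"
  shows "norm (resid k (oproj V) T x - resid k (oproj V) T y) \<le>
    (1 + k * k * c * (c * \<rho>) ^ k) * (1 + t * h) * norm (x - y)"
proof -
  let ?\<pi> = "oproj V"
  have c\<rho>: "1 \<le> c * \<rho>" using mult_mono[of 1 c 1 \<rho>] h by simp
  have "resid k ?\<pi> T x - resid k ?\<pi> T y = ((x - y) - ?\<pi> (x - y)) -
      (\<Sum>i=2..k-1. T i (replicate i (?\<pi> x)) - T i (replicate i (?\<pi> y)))"
    by (simp add: resid_def oproj_diff[OF V(1)] sum_subtractf)
  then have "norm (resid k ?\<pi> T x - resid k ?\<pi> T y) \<le> norm ((x - y) - ?\<pi> (x - y)) +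
      norm (\<Sum>i=2..k-1. T i (replicate i (?\<pi> x)) - T i (replicate i (?\<pi> y)))"
    by (simp only: norm_triangle_ineq4)
  also have "norm ((x - y) - ?\<pi> (x - y)) \<le> norm (x - y)" by (rule norm_oproj_diff_le[OF V(1)])
  also have "norm (\<Sum>i=2..k-1. T i (replicate i (?\<pi> x)) - T i (replicate i (?\<pi> y))) \<le>
      (\<Sum>i=2..k-1. k * t * (c * h * (c * \<rho>) ^ k) * norm (x - y))"
  proof (rule sum_norm_le)
    fix i assume i: "i \<in> {2..k-1}"
    have "norm (T i (replicate i (?\<pi> x)) - T i (replicate i (?\<pi> y))) \<le> real i * t * (c * h) ^ (i - 1) * norm (?\<pi> x - ?\<pi> y)"
      using T[OF i] t V oproj_in[OF V(1)] x norm_oproj_le[OF V(1)] order_trans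
      by (intro mbound_lipschitz[of "Rdim D" "Rdim D"] subspace_Rdim) blast+
    also have "\<dots> \<le> k * t * (c * h * (c * \<rho>) ^ k) * norm (x - y)"
    proof (intro mult_mono)
      show "real i \<le> real k" using i by auto
      have "(c * h) ^ (i - 1) = c * h * (c * h) ^ (i - 2)"
        using i power_Suc[of "c * h" "i - 2"] by (simp add: Suc_diff_Suc numeral_2_eq_2)
      also have "\<dots> \<le> c * h * (c * \<rho>) ^ (i - 2)" using h by (intro mult_left_mono power_mono) auto
      also have "\<dots> \<le> c * h * (c * \<rho>) ^ k" using h i c\<rho> by (intro mult_left_mono power_increasing) auto
      finally show "(c * h) ^ (i - 1) \<le> c * h * (c * \<rho>) ^ k" .
      show "norm (?\<pi> x - ?\<pi> y) \<le> norm (x - y)"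
        using norm_oproj_le[OF V(1), of "x - y"] by (simp add: oproj_diff[OF V(1)])
    qed (use t h in auto)
    finally show "norm (T i (replicate i (?\<pi> x)) - T i (replicate i (?\<pi> y))) \<le>
        k * t * (c * h * (c * \<rho>) ^ k) * norm (x - y)" .
  qed
  also have "\<dots> = card {2..k-1} * (k * t * (c * h * (c * \<rho>) ^ k) * norm (x - y))" by simp
  also have "\<dots> \<le> k * (k * t * (c * h * (c * \<rho>) ^ k) * norm (x - y))"
    using t h by (intro mult_right_mono) auto
  also have "norm (x - y) + k * (k * t * (c * h * (c * \<rho>) ^ k) * norm (x - y)) =
      (1 + (k * k * c * (c * \<rho>) ^ k) * (t * h)) * norm (x - y)" by (simp add: algebra_simps)
  also have "\<dots> \<le> ((1 + k * k * c * (c * \<rho>) ^ k) * (1 + t * h)) * norm (x - y)"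
  proof (rule mult_right_mono)
    have "0 \<le> k * k * c * (c * \<rho>) ^ k" "0 \<le> t * h" using t h by auto
    then show "1 + (k * k * c * (c * \<rho>) ^ k) * (t * h) \<le> (1 + k * k * c * (c * \<rho>) ^ k) * (1 + t * h)"
      by (simp add: algebra_simps)
  qed simp
  finally show ?thesis by simp
qed

text \<open>On the image of the tangent space under the tensor expansion the residual is a polynomial whose
  linear part is the discrepancy between the two projections.\<close>

lemma resid_polynomial:
  assumes V: "findim V" "V \<subseteq> Rdim D" and W: "findim W" "W \<subseteq> Rdim D" and k: "2 \<le> k"
    and T: "\<And>i. i \<in> {2..k-1} \<Longrightarrow> multilinear_on (Rdim D) (Rdim D) i (T i)"
    and S: "\<And>i. i \<in> {2..k-1} \<Longrightarrow> multilinear_on W (Rdim D) i (S i)"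
  defines "\<Phi> \<equiv> \<lambda>u. u + (\<Sum>i=2..k-1. S i (replicate i u))"
  shows "linepoly W ((k - 1)\<^sup>2) (\<lambda>u. e \<bullet> resid k (oproj V) T (\<Phi> u))"
    and "\<exists>C\<ge>0. \<forall>u\<in>W. norm u \<le> s \<longrightarrow> norm (resid k (oproj V) T (\<Phi> u) - (u - oproj V u)) \<le> C * (norm u)\<^sup>2"
proof -
  let ?E = "Rdim D" and ?k = "k - 1" and ?\<pi> = "oproj V"
  note sE = subspace_Rdim[of D] and sW = findim_subspace[OF W(1)]
  have \<pi>E: "?\<pi> x \<in> ?E" for x using oproj_in[OF V(1)] V(2) by blast
  show "linepoly W ((k - 1)\<^sup>2) (\<lambda>u. e \<bullet> resid k ?\<pi> T (\<Phi> u))"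
    unfolding linepoly_def
  proof (intro ballI)
    fix u v assume uv: "u \<in> W" "v \<in> W"
    let ?f = "\<lambda>t. u + t *\<^sub>R v"
    have f1: "vpoly W 1 ?f"
      unfolding vpoly_def by (rule exI[of _ "\<lambda>i. if i = 0 then u else v"]) (use uv in auto)
    have rep: "map (\<lambda>f. f t) (replicate i g) = replicate i (g t)" for t i and g :: "real \<Rightarrow> evec" by simp
    have "vpoly ?E ?k (\<lambda>t. S i (replicate i (?f t)))" if i: "i \<in> {2..k-1}" for i
    proof -
      have "vpoly ?E (length (replicate i ?f) * 1) (\<lambda>t. S i (map (\<lambda>f. f t) (replicate i ?f)))"
        by (rule vpoly_multilinear[OF _ sW sE]) (use S[OF i] f1 in auto)
      then show ?thesis unfolding rep by (rule vpoly_mono) (use i sE in auto)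
    qed
    then have 1: "vpoly ?E ?k (\<lambda>t. \<Sum>i=2..k-1. S i (replicate i (?f t)))" by (rule vpoly_sum[OF _ sE])
    have "vpoly ?E 1 ?f" unfolding vpoly_def
      by (rule exI[of _ "\<lambda>i. if i = 0 then u else v"]) (use uv W(2) in auto)
    then have "vpoly ?E ?k ?f" by (rule vpoly_mono) (use k sE in auto)
    then have \<Phi>: "vpoly ?E ?k (\<lambda>t. \<Phi> (?f t))" unfolding \<Phi>_def by (rule vpoly_add[OF _ 1 sE])
    have \<pi>\<Phi>: "vpoly ?E ?k (\<lambda>t. ?\<pi> (\<Phi> (?f t)))"
      by (rule vpoly_linear[OF \<Phi> linear_oproj[OF V(1)]]) (use \<pi>E in auto)
    have kk: "?k \<le> ?k\<^sup>2" using k by (simp add: power2_eq_square)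
    have "vpoly ?E (?k\<^sup>2) (\<lambda>t. T i (replicate i (?\<pi> (\<Phi> (?f t)))))" if i: "i \<in> {2..k-1}" for i
    proof -
      let ?g = "\<lambda>t. ?\<pi> (\<Phi> (?f t))"
      have "vpoly ?E (length (replicate i ?g) * ?k) (\<lambda>t. T i (map (\<lambda>f. f t) (replicate i ?g)))"
        by (rule vpoly_multilinear[OF _ sE sE]) (use T[OF i] \<pi>\<Phi> in auto)
      then show ?thesis unfolding rep by (rule vpoly_mono) (use i sE in \<open>auto simp: power2_eq_square\<close>)
    qed
    then have 2: "vpoly ?E (?k\<^sup>2) (\<lambda>t. \<Sum>i=2..k-1. T i (replicate i (?\<pi> (\<Phi> (?f t)))))" by (rule vpoly_sum[OF _ sE])
    have neg: "vpoly ?E K (\<lambda>t. - g t)" if "vpoly ?E K g" for K and g :: "real \<Rightarrow> evec"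
      by (rule vpoly_linear[OF that linear_uminus]) (auto intro: subspace_neg[OF sE])
    have "vpoly ?E (?k\<^sup>2) (\<lambda>t. (\<Phi> (?f t) + - ?\<pi> (\<Phi> (?f t))) + - (\<Sum>i=2..k-1. T i (replicate i (?\<pi> (\<Phi> (?f t))))))"
      by (intro vpoly_add[OF _ _ sE] neg vpoly_mono[OF \<Phi> kk sE] vpoly_mono[OF \<pi>\<Phi> kk sE] 2)
    then have "vpoly ?E (?k\<^sup>2) (\<lambda>t. resid k ?\<pi> T (\<Phi> (?f t)))" by (simp add: resid_def)
    from vpoly_inner[OF this, of e]
    show "\<exists>P. degree P \<le> ?k\<^sup>2 \<and> (\<forall>t. e \<bullet> resid k ?\<pi> T (\<Phi> (?f t)) = poly P t)" .
  qed
  \<comment> \<open>These bounds are merely finite: the quadratic estimate serves to make a supremum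
    finite and to isolate the linear part in a limit, and reaches no final constant.\<close>
  have "\<exists>B\<ge>0. mbound W i (S i) B \<and> mbound ?E i (T i) B" if i: "i \<in> {2..k-1}" for i
  proof -
    obtain B1 B2 where "B1 \<ge> 0" "mbound W i (S i) B1" "B2 \<ge> 0" "mbound ?E i (T i) B2"
      using multilinear_on_bounded[OF W(1) S[OF i]] multilinear_on_bounded[OF findim_Rdim T[OF i]] by blast
    then show ?thesis by (intro exI[of _ "max B1 B2"]) (auto intro: mbound_mono)
  qed
  then obtain B where B: "\<And>i. i \<in> {2..k-1} \<Longrightarrow> B i \<ge> 0 \<and> mbound W i (S i) (B i) \<and> mbound ?E i (T i) (B i)" by metis
  define \<rho> where "\<rho> = max 1 s"
  define CS where "CS = (\<Sum>i=2..k-1. B i * \<rho> ^ i)"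
  define c where "c = 1 + CS * \<rho>"
  define CT where "CT = (\<Sum>i=2..k-1. B i * (c ^ i * \<rho> ^ i))"
  have \<rho>: "1 \<le> \<rho>" "s \<le> \<rho>" by (auto simp: \<rho>_def)
  have CS0: "0 \<le> CS" and CT0: "0 \<le> CT" and c1: "1 \<le> c"
  proof -
    show "0 \<le> CS" unfolding CS_def using B \<rho> by (auto intro!: sum_nonneg)
    then show "1 \<le> c" using \<rho> by (simp add: c_def)
    then show "0 \<le> CT" unfolding CT_def using B \<rho> by (auto intro!: sum_nonneg)
  qed
  show "\<exists>C\<ge>0. \<forall>u\<in>W. norm u \<le> s \<longrightarrow> norm (resid k ?\<pi> T (\<Phi> u) - (u - ?\<pi> u)) \<le> C * (norm u)\<^sup>2"
  proof (intro exI[of _ "CS + CT"] conjI ballI impI)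
    show "0 \<le> CS + CT" using CS0 CT0 by simp
    fix u assume u: "u \<in> W" "norm u \<le> s"
    have u\<rho>: "norm u \<le> \<rho>" using u \<rho> by simp
    have pw: "norm u ^ i \<le> \<rho> ^ i * (norm u)\<^sup>2" if "i \<in> {2..k-1}" for i
      using pow_le_pow[OF norm_ge_zero u\<rho> \<rho>(1), of 2 i] that by simp
    let ?\<psi> = "\<Sum>i=2..k-1. S i (replicate i u)"
    have "norm ?\<psi> \<le> (\<Sum>i=2..k-1. (B i * \<rho> ^ i) * (norm u)\<^sup>2)"
    proof (rule sum_norm_le)
      fix i assume i: "i \<in> {2..k-1}"
      have "norm (S i (replicate i u)) \<le> B i * norm u ^ i" using B[OF i] u by (intro mbound_replicate) auto
      also have "\<dots> \<le> B i * (\<rho> ^ i * (norm u)\<^sup>2)" using B[OF i] pw[OF i] by (intro mult_left_mono) auto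
      finally show "norm (S i (replicate i u)) \<le> (B i * \<rho> ^ i) * (norm u)\<^sup>2" by (simp add: mult.assoc)
    qed
    also have "\<dots> = CS * (norm u)\<^sup>2" by (simp add: CS_def sum_distrib_right)
    finally have \<psi>: "norm ?\<psi> \<le> CS * (norm u)\<^sup>2" .
    have "CS * (norm u)\<^sup>2 \<le> CS * (\<rho> * norm u)"
      unfolding power2_eq_square using u\<rho> CS0 by (intro mult_left_mono mult_right_mono) auto
    then have n\<Phi>: "norm (\<Phi> u) \<le> c * norm u"
      using norm_triangle_ineq[of u ?\<psi>] \<psi> by (simp add: \<Phi>_def c_def algebra_simps)
    have "norm (\<Sum>i=2..k-1. T i (replicate i (?\<pi> (\<Phi> u)))) \<le> (\<Sum>i=2..k-1. (B i * (c ^ i * \<rho> ^ i)) * (norm u)\<^sup>2)"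
    proof (rule sum_norm_le)
      fix i assume i: "i \<in> {2..k-1}"
      have "norm (T i (replicate i (?\<pi> (\<Phi> u)))) \<le> B i * norm (?\<pi> (\<Phi> u)) ^ i"
        using B[OF i] \<pi>E by (intro mbound_replicate) auto
      also have "\<dots> \<le> B i * (c * norm u) ^ i"
        using B[OF i] n\<Phi> norm_oproj_le[OF V(1), of "\<Phi> u"] by (intro mult_left_mono power_mono) auto
      also have "\<dots> = B i * c ^ i * norm u ^ i" by (simp add: power_mult_distrib)
      also have "\<dots> \<le> B i * c ^ i * (\<rho> ^ i * (norm u)\<^sup>2)" using B[OF i] pw[OF i] c1 by (intro mult_left_mono) auto
      finally show "norm (T i (replicate i (?\<pi> (\<Phi> u)))) \<le> (B i * (c ^ i * \<rho> ^ i)) * (norm u)\<^sup>2"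
        by (simp add: mult.assoc)
    qed
    also have "\<dots> = CT * (norm u)\<^sup>2" by (simp add: CT_def sum_distrib_right)
    finally have T2: "norm (\<Sum>i=2..k-1. T i (replicate i (?\<pi> (\<Phi> u)))) \<le> CT * (norm u)\<^sup>2" .
    have "resid k ?\<pi> T (\<Phi> u) - (u - ?\<pi> u) = (?\<psi> - ?\<pi> ?\<psi>) - (\<Sum>i=2..k-1. T i (replicate i (?\<pi> (\<Phi> u))))"
      by (simp add: resid_def \<Phi>_def oproj_add[OF V(1)])
    then have "norm (resid k ?\<pi> T (\<Phi> u) - (u - ?\<pi> u)) \<le> norm (?\<psi> - ?\<pi> ?\<psi>) + norm (\<Sum>i=2..k-1. T i (replicate i (?\<pi> (\<Phi> u))))"
      by (simp only: norm_triangle_ineq4)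
    also have "norm (?\<psi> - ?\<pi> ?\<psi>) \<le> norm ?\<psi>" by (rule norm_oproj_diff_le[OF V(1)])
    finally show "norm (resid k ?\<pi> T (\<Phi> u) - (u - ?\<pi> u)) \<le> (CS + CT) * (norm u)\<^sup>2"
      using \<psi> T2 by (simp add: algebra_simps)
  qed
qed

text \<open>The true tensors live on one tangent space. Precomposing with the projection and
  symmetrising lets them compete in the minimisation over \<open>Rdim D\<close>, with the same bound
  and the same diagonal values.\<close>

lemma symmetrized_pullback:
  assumes T: "findim T" and S: "multilinear_on T (Rdim D) i S" "mbound T i S C" and C: "0 \<le> C"
  defines "S' \<equiv> symmetrize i (\<lambda>ws. S (map (oproj T) ws))"
  shows "multilinear_on (Rdim D) (Rdim D) i S'" "symmetric_on (Rdim D) i S'" "mbound (Rdim D) i S' C"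
    "S' (replicate i (oproj T x)) = S (replicate i (oproj T x))"
proof -
  have A: "multilinear_on (Rdim D) (Rdim D) i (\<lambda>ws. S (map (oproj T) ws))"
    by (rule multilinear_on_map[OF S(1) linear_oproj[OF T]]) (use oproj_in[OF T] in auto)
  have p: "prod_list (map norm (map (oproj T) ws)) \<le> prod_list (map norm ws)" for ws
  proof (induction ws)
    case (Cons w ws)
    then show ?case using norm_oproj_le[OF T, of w] prod_list_norm_nonneg[of "map (oproj T) ws"]
      by (simp add: mult_mono del: map_map)
  qed simp
  have B: "mbound (Rdim D) i (\<lambda>ws. S (map (oproj T) ws)) C"
    unfolding mbound_def
  proof (intro ballI impI)
    fix ws assume "ws \<in> lists (Rdim D)" "length ws = i"
    then have w: "map (oproj T) ws \<in> lists T" "length (map (oproj T) ws) = i" using oproj_in[OF T] by auto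
    have "norm (S (map (oproj T) ws)) \<le> C * prod_list (map norm (map (oproj T) ws))" using S(2) w unfolding mbound_def by blast
    also have "\<dots> \<le> C * prod_list (map norm ws)" using p[of ws] C by (intro mult_left_mono)
    finally show "norm (S (map (oproj T) ws)) \<le> C * prod_list (map norm ws)" .
  qed
  show "multilinear_on (Rdim D) (Rdim D) i S'" "symmetric_on (Rdim D) i S'" "mbound (Rdim D) i S' C"
    unfolding S'_def using symmetrize[OF A B subspace_Rdim] by blast+
  show "S' (replicate i (oproj T x)) = S (replicate i (oproj T x))"
    unfolding S'_def symmetrize(4)[OF A B subspace_Rdim]
    by (simp add: oproj_id[OF findim_subspace[OF T] oproj_in[OF T]])
qed

text \<open>Deterministic core: all randomness has been reduced to the counts \<open>mm\<close> and
  \<open>b\<close>. Squared residuals summed over the large ball dominate those over a single cell,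
  which produces \<open>sqrt (b / mm)\<close>.\<close>

lemma angle_bound:
  fixes X Y :: "nat \<Rightarrow> evec" and \<rho>0 \<tau> h t \<sigma> CR Ct \<Lambda> mm b :: real and \<pi> :: "evec \<Rightarrow> evec"
  assumes norming: "\<And>V (q::evec \<Rightarrow> real) s B. subspace V \<Longrightarrow> linepoly V ((k - 1)\<^sup>2) q \<Longrightarrow> 0 < s \<Longrightarrow>
      (\<forall>u\<in>V \<inter> cball 0 s. \<bar>q u\<bar> \<le> B) \<Longrightarrow>
      \<exists>M\<ge>0. \<exists>u0\<in>V \<inter> cball 0 s. (\<forall>u\<in>V. norm (u - u0) \<le> s / (4 * \<Lambda>\<^sup>2) \<longrightarrow> M / 2 \<le> \<bar>q u\<bar>) \<and>
        (\<forall>v\<in>V \<inter> cball 0 s. \<forall>t. \<bar>t\<bar> \<le> 1 \<longrightarrow> \<bar>q (t *\<^sub>R v) - q 0\<bar> \<le> \<Lambda> * M * \<bar>t\<bar>)"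
    and \<Lambda>: "1 \<le> \<Lambda>" and k: "2 \<le> k" and m: "mfd D d \<tau> M"
    and Y: "\<And>l. l \<in> {1..n} \<Longrightarrow> Y l \<in> M" and X: "\<And>l. l \<in> {1..n} \<Longrightarrow> norm (X l - Y l) \<le> \<sigma>"
    and j: "j \<in> {1..n}" and n: "2 \<le> n"
    and \<sigma>: "0 \<le> \<sigma>" "\<sigma> \<le> h / 4" and h: "0 < h" "h \<le> \<rho>0 / 8" "\<rho>0 \<le> \<tau>"
    and S: "\<And>i. i \<in> {2..k-1} \<Longrightarrow> multilinear_on (tangent_space M (Y j)) (Rdim D) i (S i) \<and>
        mbound (tangent_space M (Y j)) i (S i) Ct"
    and te: "tensor_expansion k (\<rho>0 / 4) CR M (Y j) S"
    and cst: "0 \<le> CR" "0 \<le> Ct" "Ct \<le> t"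
    and arg: "is_arg_min (local_risk k n h X j) (admissible D d k t) (\<pi>, T)"
    and mm: "0 < mm" "\<And>z. z \<in> M \<Longrightarrow> mm \<le> card {l \<in> {1..n}. Y l \<in> cball z (2 * (1 / (800 * \<Lambda>\<^sup>2) * h))}"
    and b: "card {l \<in> {1..n}. Y l \<in> cball (Y j) (3/2 * h)} \<le> b"
  defines "\<rho> \<equiv> max 1 \<rho>0" and "c \<equiv> 2 + CR * max 1 \<rho>0 ^ k"
  defines "K1 \<equiv> 1 + k * k * c * (c * \<rho>) ^ k"
  defines "K2 \<equiv> CR * 2 ^ k + 2 * K1" and "K3 \<equiv> 2 * K1 + K1 * CR"
  shows "angle (tangent_space M (Y j)) (range \<pi>) \<le>
    1200 * \<Lambda> * (K2 + K3) * sqrt (b / mm) * max (h ^ (k - 1)) (\<sigma> / h) * (1 + t * h)"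
proof -
  note sm = mfd_sub(1)[OF m] and \<tau> = mfd_sub(2)[OF m] and MD = mfd_sub(3)[OF m]
  define y where "y = Y j"
  define TT where "TT = tangent_space M y"
  have yM: "y \<in> M" using Y[OF j] by (simp add: y_def)
  note fT = findim_tangent[OF sm yM, folded TT_def] and sTD = tangent_sub[OF sm yM, folded TT_def]
    and dT = dim_tangent[OF sm yM, folded TT_def]
  note sT = findim_subspace[OF fT]
  let ?p = "oproj TT"
  have adm: "admissible D d k t (\<pi>, T)"
    and min: "\<And>z. admissible D d k t z \<Longrightarrow> \<not> local_risk k n h X j z < local_risk k n h X j (\<pi>, T)"
    using arg by (auto simp: is_arg_min_def)
  obtain V where V: "\<pi> = oproj V" "subspace V" "V \<subseteq> Rdim D" "dim V = d"
    using adm by (auto simp: admissible_def orth_projectors_def)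
  have fV: "findim V" by (rule findim_subset[OF findim_Rdim V(2,3)])
  have t0: "0 \<le> t" using cst by linarith
  have Tm: "multilinear_on (Rdim D) (Rdim D) i (T i) \<and> mbound (Rdim D) i (T i) t" if "i \<in> {2..k-1}" for i
  proof -
    have "multilinear_on (Rdim D) (Rdim D) i (T i)" "multi_onorm (Rdim D) i (T i) \<le> t"
      using adm that by (auto simp: admissible_def)
    then show ?thesis using mbound_mono[OF mbound_multi_onorm[OF findim_Rdim]] by blast
  qed
  note S0 = S[folded y_def, folded TT_def]
  define S' where "S' i = symmetrize i (\<lambda>ws. S i (map ?p ws))" for i
  have S': "multilinear_on (Rdim D) (Rdim D) i (S' i)" "symmetric_on (Rdim D) i (S' i)" "mbound (Rdim D) i (S' i) Ct"
    "S' i (replicate i (?p x)) = S i (replicate i (?p x))" if "i \<in> {2..k-1}" for i x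
    unfolding S'_def using symmetrized_pullback[OF fT _ _ cst(2)] S0[OF that] by blast+
  have S't: "multilinear_on (Rdim D) (Rdim D) i (S' i) \<and> mbound (Rdim D) i (S' i) t" if "i \<in> {2..k-1}" for i
    using S'[OF that] mbound_mono cst(3) by blast
  have admS: "admissible D d k t (?p, S')"
    unfolding admissible_def
    using S' S't multi_onorm_le[OF subspace_Rdim _ t0] fT sT sTD dT
    by (auto simp: orth_projectors_def)
  define R where "R l = resid k \<pi> T (X l - X j)" for l
  define R' where "R' l = resid k ?p S' (X l - X j)" for l
  let ?I = "\<lambda>l. indicat_real (cball 0 h) (X l - X j)"
  \<comment> \<open>Error per sample point: the remainder of the expansion against the noise.
    \<open>W\<close> adds the Lipschitz factor of the residual.\<close>
  define \<Delta> where "\<Delta> = max (h ^ k) \<sigma>"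
  define W where "W = (1 + t * h) * \<Delta>"
  have th: "1 \<le> 1 + t * h" using t0 h by simp
  have \<Delta>: "0 < \<Delta>" "h ^ k \<le> \<Delta>" "\<sigma> \<le> \<Delta>" using h by (auto simp: \<Delta>_def less_max_iff_disj)
  have W: "\<Delta> \<le> W" "0 < W" using mult_right_mono[OF th, of \<Delta>] \<Delta> by (auto simp: W_def)
  have risk: "local_risk k n h X j (\<pi>', T') =
      1 / (real n - 1) * (\<Sum>l\<in>{1..n} - {j}. (norm (resid k \<pi>' T' (X l - X j)))\<^sup>2 * ?I l)" for \<pi>' T'
    by (simp add: local_risk_def Let_def resid_def)
  have rn: "1 < real n" using n by simp
  have I1: "(\<Sum>l\<in>{1..n} - {j}. (norm (R l))\<^sup>2 * ?I l) \<le> (\<Sum>l\<in>{1..n} - {j}. (norm (R' l))\<^sup>2 * ?I l)"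
  proof (rule ccontr)
    assume "\<not> ?thesis"
    then have less: "(\<Sum>l\<in>{1..n} - {j}. (norm (R' l))\<^sup>2 * ?I l) < (\<Sum>l\<in>{1..n} - {j}. (norm (R l))\<^sup>2 * ?I l)"
      by (simp only: not_le)
    have "0 < 1 / (real n - 1)" using rn by simp
    from mult_strict_left_mono[OF less this] have "local_risk k n h X j (?p, S') < local_risk k n h X j (\<pi>, T)"
      by (simp only: risk R_def R'_def)
    then show False using min[OF admS] by blast
  qed
  have \<rho>: "1 \<le> \<rho>" "\<rho>0 \<le> \<rho>" "h \<le> \<rho>" using h by (auto simp: \<rho>_def)
  have c: "c = 2 + CR * \<rho> ^ k" "2 \<le> c" using mult_nonneg_nonneg[OF cst(1), of "max 1 \<rho>0 ^ k"] unfolding c_def \<rho>_def by simp_all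
  have K1: "1 \<le> K1" using c \<rho> by (simp add: K1_def)
  have K2: "0 < K2" and K3: "0 < K3" 
  proof -
    have "0 \<le> CR * 2 ^ k" "0 \<le> K1 * CR" using K1 cst by auto
    then show "0 < K2" "0 < K3" using K1 unfolding K2_def K3_def by linarith+
  qed
  have lip: "norm (resid k (oproj U) A x - resid k (oproj U) A z) \<le> K1 * (1 + t * h) * norm (x - z)"
    if "findim U" "U \<subseteq> Rdim D"
      "\<And>i. i \<in> {2..k-1} \<Longrightarrow> multilinear_on (Rdim D) (Rdim D) i (A i) \<and> mbound (Rdim D) i (A i) t"
      "norm x \<le> c * h" "norm z \<le> c * h" for U A x z
    
    using resid_lipschitz[OF that(1,2) that(3) t0, where h=h and \<rho>=\<rho> and c=c and x=x and y=z and k=k] h \<rho> c that(4,5) by (simp add: K1_def)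
  have xy: "norm ((X l - X j) - (Y l - y)) \<le> 2 * \<sigma>" if "l \<in> {1..n}" for l
    using norm_triangle_ineq4[of "X l - Y l" "X j - Y j"] X[OF that] X[OF j] by (simp add: y_def algebra_simps)
  have h2: "2 * h \<le> c * h" using c h by simp
  have ex: "norm (x - y - ?p (x - y) - (\<Sum>i=2..k-1. S i (replicate i (?p (x - y))))) \<le> CR * norm (x - y) ^ k"
    if "x \<in> M" "norm (x - y) \<le> 3/2 * h" for x
  proof -
    have "x \<in> M \<inter> cball y (\<rho>0 / 4)" using that h by (simp add: dist_norm norm_minus_commute)
    then show ?thesis using te unfolding tensor_expansion_def Let_def y_def[symmetric] TT_def[symmetric] by blast
  qed
  \<comment> \<open>Expansion error at the noiseless difference, plus the Lipschitz effect of the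
    displacement by at most \<open>2 * \<sigma>\<close>.\<close>
  have R'b: "norm (R' l) \<le> K2 * W" if l: "l \<in> {1..n}" "norm (Y l - y) \<le> 3/2 * h" "norm (X l - X j) \<le> h" for l
  proof -
    let ?y = "Y l - y"
    have "resid k ?p S' ?y = ?y - ?p ?y - (\<Sum>i=2..k-1. S i (replicate i (?p ?y)))"
      unfolding resid_def using S'(4) by (intro arg_cong2[of _ _ _ _ "(-)"] sum.cong) auto
    then have "norm (resid k ?p S' ?y) \<le> CR * norm ?y ^ k" using ex[OF Y[OF l(1)] l(2)] by simp
    also have "\<dots> \<le> CR * (2 * h) ^ k" using l(2) cst h by (intro mult_left_mono power_mono) auto
    also have "\<dots> = CR * 2 ^ k * h ^ k" by (simp add: power_mult_distrib)
    also have "\<dots> \<le> CR * 2 ^ k * W" using cst \<Delta> W by (intro mult_left_mono) auto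
    finally have 1: "norm (resid k ?p S' ?y) \<le> CR * 2 ^ k * W" .
    have "norm (R' l - resid k ?p S' ?y) \<le> K1 * (1 + t * h) * norm ((X l - X j) - ?y)"
    proof -
      have "norm (X l - X j) \<le> c * h" "norm ?y \<le> c * h" using l h h2 by linarith+
      then show ?thesis unfolding R'_def using S't by (intro lip[OF fT sTD]) blast+
    qed
    also have "\<dots> \<le> K1 * (1 + t * h) * (2 * \<Delta>)"
      using xy[OF l(1)] \<Delta> K1 th by (intro mult_left_mono) auto
    finally have "norm (R' l - resid k ?p S' ?y) \<le> 2 * K1 * W" by (simp add: W_def algebra_simps)
    then show ?thesis using 1 norm_triangle_sub[of "R' l" "resid k ?p S' ?y"] by (simp add: K2_def algebra_simps)
  qed
  have KW: "0 \<le> (K2 * W)\<^sup>2" by simp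
  have "(\<Sum>l\<in>{1..n} - {j}. (norm (R' l))\<^sup>2 * ?I l) \<le> (\<Sum>l\<in>{1..n} - {j}. if Y l \<in> cball (Y j) (3/2 * h) then (K2 * W)\<^sup>2 else 0)"
  proof (rule sum_mono)
    fix l assume "l \<in> {1..n} - {j}"
    then have l: "l \<in> {1..n}" by simp
    show "(norm (R' l))\<^sup>2 * ?I l \<le> (if Y l \<in> cball (Y j) (3/2 * h) then (K2 * W)\<^sup>2 else 0)"
    proof (cases "norm (X l - X j) \<le> h")
      case True
      have "norm (Y l - y) \<le> norm (X l - X j) + norm ((X l - X j) - (Y l - y))"
        using norm_triangle_ineq4[of "X l - X j" "(X l - X j) - (Y l - y)"] by simp
      \<comment> \<open>Since \<open>2 * \<sigma> \<le> h / 2\<close>, observations within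
        \<open>h\<close> of \<open>X j\<close> come from points within \<open>3/2 * h\<close> of
        \<open>Y j\<close>.\<close>
      then have y3: "norm (Y l - y) \<le> 3/2 * h" using True xy[OF l] \<sigma> by linarith
      then have "(norm (R' l))\<^sup>2 \<le> (K2 * W)\<^sup>2" using R'b[OF l y3 True] by (intro power_mono) auto
      then show ?thesis using True y3 by (simp add: y_def dist_norm norm_minus_commute indicator_def)
    qed (auto simp: indicator_def)
  qed
  also have "\<dots> \<le> (\<Sum>l\<in>{1..n}. if Y l \<in> cball (Y j) (3/2 * h) then (K2 * W)\<^sup>2 else 0)"
    by (intro sum_mono2) auto
  also have "\<dots> = card {l \<in> {1..n}. Y l \<in> cball (Y j) (3/2 * h)} * (K2 * W)\<^sup>2"
    by (simp add: sum.If_cases Int_def)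
  also have "\<dots> \<le> b * (K2 * W)\<^sup>2" using b by (intro mult_right_mono) auto
  finally have I2: "(\<Sum>l\<in>{1..n} - {j}. (norm (R l))\<^sup>2 * ?I l) \<le> b * (K2 * W)\<^sup>2" using I1 by linarith
  \<comment> \<open>The residual vanishes at 0, so the excluded index \<open>j\<close> can be added
    to the sum at no cost; a cell below may contain it.\<close>
  have Rj: "R j = 0" unfolding R_def V(1) using resid_0[OF fV, of k D T] Tm by simp
  have I3: "(\<Sum>l\<in>{1..n}. (norm (R l))\<^sup>2 * ?I l) \<le> b * (K2 * W)\<^sup>2"
    using I2 j Rj by (subst sum.remove[of _ j]) auto
  \<comment> \<open>Small enough to lift tangent vectors of norm up to \<open>s\<close> to
    \<open>M\<close>, and to keep whole cells within \<open>h / 2\<close> of \<open>y\<close>. The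
    norming radius \<open>s / (4 * \<Lambda>\<^sup>2)\<close> then equals the cell radius in the
    counts.\<close>
  define s where "s = h / 100"
  have s: "0 < s" using h by (simp add: s_def)
  define \<Phi> where "\<Phi> u = u + (\<Sum>i=2..k-1. S i (replicate i u))" for u
  define MX where "MX = 3 * sqrt (b / mm) * ((K2 + K3) * W)"
  have \<eta>: "2 * (1 / (800 * \<Lambda>\<^sup>2) * h) = s / (4 * \<Lambda>\<^sup>2)" using \<Lambda> by (simp add: s_def field_simps)
  have \<Lambda>2: "1 \<le> \<Lambda>\<^sup>2" using \<Lambda> by (rule one_le_power)
  have \<eta>2: "s / (4 * \<Lambda>\<^sup>2) \<le> s"
  proof -
    have "s / (4 * \<Lambda>\<^sup>2) \<le> s / 1" using s \<Lambda>2 by (intro divide_left_mono) auto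
    then show ?thesis by simp
  qed
  have cells: "mm \<le> card {l \<in> {1..n}. Y l \<in> cball z (s / (4 * \<Lambda>\<^sup>2))}" if "z \<in> M" for z
    using mm(2)[OF that] unfolding \<eta> .
  have main: "norm (v0 - \<pi> v0) \<le> \<Lambda> * MX / s" if v0: "v0 \<in> TT" "norm v0 = 1" for v0
  proof (cases "v0 - \<pi> v0 = 0")
    case True
    have "0 \<le> b" using b by linarith
    then have "0 \<le> MX" using mm(1) K2 K3 W(2) by (simp add: MX_def)
    then show ?thesis using True \<Lambda> s by simp
  next
    case False
    define N where "N = norm (v0 - \<pi> v0)"
    have N: "0 < N" using False by (simp add: N_def)
    \<comment> \<open>Testing the residual against this unit vector gives a scalar polynomial whose
      linear part at \<open>v0\<close> is \<open>N\<close>.\<close>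
    define e where "e = (1 / N) *\<^sub>R (v0 - \<pi> v0)"
    have e: "norm e = 1" "e \<bullet> (v0 - \<pi> v0) = N"
      using N by (auto simp: e_def N_def dot_square_norm power2_eq_square)
    define q where "q u = e \<bullet> resid k \<pi> T (\<Phi> u)" for u
    have RP: "linepoly TT ((k - 1)\<^sup>2) q"
      "\<exists>C\<ge>0. \<forall>u\<in>TT. norm u \<le> s \<longrightarrow> norm (resid k \<pi> T (\<Phi> u) - (u - \<pi> u)) \<le> C * (norm u)\<^sup>2"
      unfolding q_def \<Phi>_def V(1)
      using resid_polynomial[OF fV V(3) fT sTD k, of T S] Tm S0 by blast+
    obtain C where C: "0 \<le> C" "\<And>u. u \<in> TT \<Longrightarrow> norm u \<le> s \<Longrightarrow> norm (resid k \<pi> T (\<Phi> u) - (u - \<pi> u)) \<le> C * (norm u)\<^sup>2"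
      using RP(2) by blast
    have qabs: "\<bar>q u\<bar> \<le> norm (resid k \<pi> T (\<Phi> u))" for u
      using Cauchy_Schwarz_ineq2[of e "resid k \<pi> T (\<Phi> u)"] e by (simp add: q_def)
    \<comment> \<open>Only finiteness matters here, so that the norming inequality applies.\<close>
    have "\<forall>u\<in>TT \<inter> cball 0 s. \<bar>q u\<bar> \<le> s + C * s\<^sup>2"
    proof
      fix u assume u: "u \<in> TT \<inter> cball 0 s"
      have "norm (resid k \<pi> T (\<Phi> u)) \<le> norm (u - \<pi> u) + C * (norm u)\<^sup>2"
        using C(2)[of u] u norm_triangle_sub[of "resid k \<pi> T (\<Phi> u)" "u - \<pi> u"] by simp
      moreover have "norm (u - \<pi> u) \<le> norm u" unfolding V(1) by (rule norm_oproj_diff_le[OF fV])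
      moreover have "norm u \<le> s" using u by simp
      moreover have "C * (norm u)\<^sup>2 \<le> C * s\<^sup>2" using u C(1) by (intro mult_left_mono power_mono) auto
      ultimately show "\<bar>q u\<bar> \<le> s + C * s\<^sup>2" using qabs[of u] by linarith
    qed
    from norming[OF sT RP(1) s this] obtain MM u0 where MM: "0 \<le> MM" "u0 \<in> TT \<inter> cball 0 s"
      "\<And>u. u \<in> TT \<Longrightarrow> norm (u - u0) \<le> s / (4 * \<Lambda>\<^sup>2) \<Longrightarrow> MM / 2 \<le> \<bar>q u\<bar>"
      "\<And>v t. v \<in> TT \<inter> cball 0 s \<Longrightarrow> \<bar>t\<bar> \<le> 1 \<Longrightarrow> \<bar>q (t *\<^sub>R v) - q 0\<bar> \<le> \<Lambda> * MM * \<bar>t\<bar>" by blast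
    have nu0: "norm u0 \<le> s" using MM(2) by simp
    have "norm u0 < \<tau> / 400" using nu0 h \<tau> by (simp add: s_def)
    \<comment> \<open>\<open>u0\<close> is the tangential coordinate of a point of \<open>M\<close>;
      the cell around that point is where many samples are guaranteed.\<close>
    then obtain p where p: "p \<in> M" "norm (p - y) \<le> 2 * norm u0" "?p (p - y) = u0"
      using tangent_cover'[OF m yM, of u0] MM(2) by (auto simp: TT_def)
    define Cl where "Cl = {l \<in> {1..n}. Y l \<in> cball p (s / (4 * \<Lambda>\<^sup>2))}"
    have mC: "mm \<le> card Cl" using cells[OF p(1)] by (simp add: Cl_def)
    have finC: "finite Cl" by (simp add: Cl_def)
    have near: "norm (Y l - y) \<le> h / 2" "norm (Y l - p) \<le> s / (4 * \<Lambda>\<^sup>2)" "l \<in> {1..n}" if "l \<in> Cl" for l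
    proof -
      show l: "l \<in> {1..n}" and 1: "norm (Y l - p) \<le> s / (4 * \<Lambda>\<^sup>2)" using that by (auto simp: Cl_def dist_norm norm_minus_commute)
      have "norm (Y l - y) \<le> norm (Y l - p) + norm (p - y)" using norm_triangle_ineq[of "Y l - p" "p - y"] by simp
      then have "norm (Y l - y) \<le> 3 * s" using 1 p(2) nu0 \<eta>2 by linarith
      then show "norm (Y l - y) \<le> h / 2" using h by (simp add: s_def)
    qed
    \<comment> \<open>Passage from the polynomial graph over \<open>?u\<close> to the true
      difference \<open>Y l - y\<close> and on to the observed \<open>X l - X j\<close>; both errors
      go through the Lipschitz bound and make up \<open>K3 * W\<close>.\<close>
    have each: "MM / 2 \<le> norm (R l) + K3 * W" "?I l = 1" if l: "l \<in> Cl" for l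
    proof -
      note nr = near[OF l]
      let ?y = "Y l - y" let ?u = "?p (Y l - y)"
      have uT: "?u \<in> TT" by (rule oproj_in[OF fT])
      have "norm (?u - u0) \<le> s / (4 * \<Lambda>\<^sup>2)"
      proof -
        have "?u - u0 = ?p (Y l - p)" using p(3) oproj_diff[OF fT, of ?y "p - y"] by simp
        then show ?thesis using norm_oproj_le[OF fT, of "Y l - p"] nr(2) by simp
      qed
      then have "MM / 2 \<le> \<bar>q ?u\<bar>" by (rule MM(3)[OF uT])
      also have "\<dots> \<le> norm (resid k \<pi> T (\<Phi> ?u))" by (rule qabs)
      finally have 0: "MM / 2 \<le> norm (resid k \<pi> T (\<Phi> ?u))" .
      have "norm (X l - X j) \<le> norm ?y + norm ((X l - X j) - ?y)"
        using norm_triangle_ineq[of ?y "(X l - X j) - ?y"] by simp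
      then have nx: "norm (X l - X j) \<le> h" using nr(1) xy[OF nr(3)] \<sigma> by linarith
      then show "?I l = 1" by (simp add: indicator_def)
      have "norm (?y - \<Phi> ?u) \<le> CR * norm ?y ^ k"
        using ex[OF Y[OF nr(3)]] nr(1) h by (simp add: \<Phi>_def diff_diff_eq add.assoc)
      also have "\<dots> \<le> CR * h ^ k" using nr(1) h cst by (intro mult_left_mono power_mono) auto
      finally have y\<Phi>: "norm (?y - \<Phi> ?u) \<le> CR * h ^ k" .
      have "h ^ k \<le> \<rho> ^ k * h ^ 1" using h \<rho> k by (intro pow_le_pow) auto
      then have "CR * h ^ k \<le> CR * \<rho> ^ k * h" using cst mult_left_mono by fastforce
      then have n\<Phi>: "norm (\<Phi> ?u) \<le> c * h"
        using y\<Phi> nr(1) norm_triangle_ineq2[of "\<Phi> ?u" ?y] h norm_minus_commute[of ?y "\<Phi> ?u"]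
        by (simp add: c(1) algebra_simps)
      have ny: "norm ?y \<le> c * h" using nr(1) h h2 by linarith
      have nxc: "norm (X l - X j) \<le> c * h" using nx h h2 by linarith
      have "norm (resid k \<pi> T (\<Phi> ?u) - resid k \<pi> T ?y) \<le> K1 * (1 + t * h) * norm (\<Phi> ?u - ?y)"
        unfolding V(1) by (rule lip[OF fV V(3) _ n\<Phi> ny]) (use Tm in blast)
      also have "\<dots> \<le> K1 * (1 + t * h) * (CR * \<Delta>)"
      proof (rule mult_left_mono)
        have "CR * h ^ k \<le> CR * \<Delta>" using cst \<Delta> by (intro mult_left_mono) auto
        then show "norm (\<Phi> ?u - ?y) \<le> CR * \<Delta>" using y\<Phi> by (simp add: norm_minus_commute)
      qed (use K1 th in auto)
      finally have 1: "norm (resid k \<pi> T (\<Phi> ?u) - resid k \<pi> T ?y) \<le> K1 * CR * W" by (simp add: W_def algebra_simps)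
      have "norm (resid k \<pi> T ?y - R l) \<le> K1 * (1 + t * h) * norm (?y - (X l - X j))"
        unfolding R_def V(1) by (rule lip[OF fV V(3) _ ny nxc]) (use Tm in blast)
      also have "\<dots> \<le> K1 * (1 + t * h) * (2 * \<Delta>)"
        using xy[OF nr(3)] \<Delta> K1 th by (intro mult_left_mono) (auto simp: norm_minus_commute)
      finally have 2: "norm (resid k \<pi> T ?y - R l) \<le> 2 * K1 * W" by (simp add: W_def algebra_simps)
      have "norm (resid k \<pi> T (\<Phi> ?u)) \<le> norm (resid k \<pi> T (\<Phi> ?u) - resid k \<pi> T ?y) + (norm (resid k \<pi> T ?y - R l) + norm (R l))"
        using norm_triangle_sub[of "resid k \<pi> T (\<Phi> ?u)" "resid k \<pi> T ?y"] norm_triangle_sub[of "resid k \<pi> T ?y" "R l"] by linarith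
      then show "MM / 2 \<le> norm (R l) + K3 * W" using 0 1 2 by (simp add: K3_def algebra_simps)
    qed
    have sq: "(MM / 2)\<^sup>2 \<le> 2 * ((norm (R l))\<^sup>2 * ?I l) + 2 * (K3 * W)\<^sup>2" if "l \<in> Cl" for l
    proof -
      have "(MM / 2)\<^sup>2 \<le> (norm (R l) + K3 * W)\<^sup>2" using each(1)[OF that] MM(1) by (intro power_mono) auto
      also have "\<dots> \<le> 2 * (norm (R l))\<^sup>2 + 2 * (K3 * W)\<^sup>2"
        using sum_squares_bound[of "norm (R l)" "K3 * W"] by (simp add: power2_sum)
      finally show ?thesis using each(2)[OF that] by simp
    qed
    have "card Cl * (MM / 2)\<^sup>2 = (\<Sum>l\<in>Cl. (MM / 2)\<^sup>2)" by simp
    also have "\<dots> \<le> (\<Sum>l\<in>Cl. 2 * ((norm (R l))\<^sup>2 * ?I l) + 2 * (K3 * W)\<^sup>2)" by (intro sum_mono sq)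
    also have "\<dots> = 2 * (\<Sum>l\<in>Cl. (norm (R l))\<^sup>2 * ?I l) + card Cl * (2 * (K3 * W)\<^sup>2)"
      by (simp add: sum.distrib sum_distrib_left)
    also have "(\<Sum>l\<in>Cl. (norm (R l))\<^sup>2 * ?I l) \<le> (\<Sum>l\<in>{1..n}. (norm (R l))\<^sup>2 * ?I l)"
      by (intro sum_mono2) (auto simp: Cl_def)
    finally have main1: "card Cl * (MM / 2)\<^sup>2 \<le> 2 * (b * (K2 * W)\<^sup>2) + card Cl * (2 * (K3 * W)\<^sup>2)" using I3 by linarith
    have cC: "0 < real (card Cl)" using mC mm(1) by linarith
    have "card Cl \<le> card {l \<in> {1..n}. Y l \<in> cball (Y j) (3/2 * h)}"
    proof (rule card_mono)
      show "Cl \<subseteq> {l \<in> {1..n}. Y l \<in> cball (Y j) (3/2 * h)}"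
      proof
        fix l assume "l \<in> Cl"
        from near(1,3)[OF this] show "l \<in> {l \<in> {1..n}. Y l \<in> cball (Y j) (3/2 * h)}"
          using h by (simp add: y_def dist_norm norm_minus_commute)
      qed
    qed simp
    \<comment> \<open>The cell is part of the large ball, so the ratio \<open>b / mm\<close> is at
      least 1; this absorbs the \<open>K3\<close> term, which comes without that ratio.\<close>
    then have bC: "card Cl \<le> b" using b by linarith
    define r where "r = b / mm"
    have r: "1 \<le> r" "b \<le> r * card Cl" "1 * real (card Cl) \<le> r * card Cl"
    proof -
      show "1 \<le> r" using bC mC mm(1) by (simp add: r_def)
      then show "1 * real (card Cl) \<le> r * card Cl" using cC by (intro mult_right_mono) auto
      have "r * mm \<le> r * card Cl" using mC \<open>1 \<le> r\<close> by (intro mult_left_mono) auto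
      then show "b \<le> r * card Cl" using mm(1) by (simp add: r_def)
    qed
    have "card Cl * (MM / 2)\<^sup>2 \<le> 2 * ((r * card Cl) * (K2 * W)\<^sup>2) + (r * card Cl) * (2 * (K3 * W)\<^sup>2)"
      using main1 mult_right_mono[OF r(2) KW] mult_right_mono[OF r(3), of "2 * (K3 * W)\<^sup>2"] by simp
    also have "\<dots> = card Cl * (2 * r * ((K2 * W)\<^sup>2 + (K3 * W)\<^sup>2))" by (simp add: algebra_simps)
    finally have "(MM / 2)\<^sup>2 \<le> 2 * r * ((K2 * W)\<^sup>2 + (K3 * W)\<^sup>2)" using mult_le_cancel_left_pos[OF cC] by blast
    also have "\<dots> \<le> 2 * r * ((K2 + K3) * W)\<^sup>2"
    proof (rule mult_left_mono)
      have "0 \<le> 2 * (K2 * W) * (K3 * W)" using K2 K3 W by simp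
      then show "(K2 * W)\<^sup>2 + (K3 * W)\<^sup>2 \<le> ((K2 + K3) * W)\<^sup>2" by (simp add: distrib_right power2_sum)
    qed (use r in auto)
    finally have "MM\<^sup>2 \<le> 8 * (r * ((K2 + K3) * W)\<^sup>2)" by (simp add: power_divide)
    also have "\<dots> \<le> 9 * (r * ((K2 + K3) * W)\<^sup>2)" using r by (intro mult_right_mono) auto
    also have "\<dots> = MX\<^sup>2" using r by (simp add: MX_def r_def[symmetric] power_mult_distrib)
    finally have "MM\<^sup>2 \<le> MX\<^sup>2" .
    moreover have "0 \<le> MX" using r K2 K3 W by (simp add: MX_def r_def[symmetric])
    ultimately have MMX: "MM \<le> MX" by (rule power2_le_imp_le)
    have q0: "q 0 = 0"
      using C(2)[of 0] sT s by (simp add: q_def subspace_0 V(1) oproj_0[OF fV])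
    \<comment> \<open>Along \<open>t' *\<^sub>R (s *\<^sub>R v0)\<close> the polynomial is
      \<open>t' * s * N\<close> up to an error quadratic in \<open>t'\<close>, and the norming
      inequality bounds it by \<open>\<Lambda> * MM * t'\<close>. Dividing by \<open>t'\<close> and
      letting it tend to 0 removes the uncontrolled constant \<open>C\<close>.\<close>
    have "s * N \<le> \<Lambda> * MM"
    proof (rule field_le_epsilon)
      fix \<epsilon> :: real assume \<epsilon>: "0 < \<epsilon>"
      define t' where "t' = min 1 (\<epsilon> / (C * s\<^sup>2 + 1))"
      have Cs: "0 < C * s\<^sup>2 + 1" using C(1) by (simp add: add_nonneg_pos)
      have t': "0 < t'" "t' \<le> 1" "C * s\<^sup>2 * t' \<le> \<epsilon>"
      proof -
        show "0 < t'" "t' \<le> 1" using \<epsilon> Cs by (auto simp: t'_def)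
        have "t' \<le> \<epsilon> / (C * s\<^sup>2 + 1)" by (simp add: t'_def)
        then have "t' * (C * s\<^sup>2 + 1) \<le> \<epsilon>" using Cs by (simp add: pos_le_divide_eq)
        then show "C * s\<^sup>2 * t' \<le> \<epsilon>" using \<open>0 < t'\<close> by (simp add: algebra_simps)
      qed
      let ?v = "s *\<^sub>R v0" let ?u = "t' *\<^sub>R ?v"
      have v: "?v \<in> TT \<inter> cball 0 s" using v0 s sT by (simp add: subspace_scale)
      have u: "?u \<in> TT" "norm ?u = t' * s" using v0 s t' sT by (auto simp: subspace_scale)
      have us: "norm ?u \<le> s" using u(2) t' s mult_right_mono[of t' 1 s] by simp
      have "q ?u \<le> \<Lambda> * MM * t'" using MM(4)[OF v, of t'] q0 t' by simp
      moreover have "t' * s * N - C * (t' * s)\<^sup>2 \<le> q ?u"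
      proof -
        have "e \<bullet> (?u - \<pi> ?u) = t' * s * N"
          using e(2) by (simp add: V(1) oproj_scale[OF fV] inner_diff_right algebra_simps flip: e(2))
        moreover have "\<bar>e \<bullet> (resid k \<pi> T (\<Phi> ?u) - (?u - \<pi> ?u))\<bar> \<le> C * (t' * s)\<^sup>2"
          using Cauchy_Schwarz_ineq2[of e "resid k \<pi> T (\<Phi> ?u) - (?u - \<pi> ?u)"] e(1) C(2)[OF u(1) us] u(2) by simp
        ultimately show ?thesis unfolding q_def inner_diff_right[of e "resid k \<pi> T (\<Phi> ?u)"] by linarith
      qed
      ultimately have "t' * (s * N) \<le> t' * (\<Lambda> * MM + C * s\<^sup>2 * t')"
        by (simp add: power2_eq_square algebra_simps)
      then have "s * N \<le> \<Lambda> * MM + C * s\<^sup>2 * t'" using mult_le_cancel_left_pos[OF t'(1)] by blast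
      then show "s * N \<le> \<Lambda> * MM + \<epsilon>" using t'(3) by linarith
    qed
    also have "\<dots> \<le> \<Lambda> * MX" using MMX \<Lambda> by (intro mult_left_mono) auto
    finally show ?thesis using s by (simp add: N_def[symmetric] field_simps)
  qed
  have b0: "0 \<le> b" using b by linarith
  have MX0: "0 \<le> MX" using b0 mm(1) K2 K3 W(2) by (simp add: MX_def)
  have \<theta>0: "0 \<le> \<Lambda> * MX / s" using MX0 \<Lambda> s by simp
  have "norm (u - oproj V u) \<le> \<Lambda> * MX / s * norm u" if u: "u \<in> TT" for u
  proof (cases "u = 0")
    case False
    let ?u = "(1 / norm u) *\<^sub>R u"
    have "norm (?u - \<pi> ?u) \<le> \<Lambda> * MX / s" by (rule main) (use False u sT in \<open>auto simp: subspace_scale\<close>)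
    moreover have "?u - \<pi> ?u = (1 / norm u) *\<^sub>R (u - \<pi> u)" by (simp add: V(1) oproj_scale[OF fV] scaleR_diff_right)
    ultimately have "norm (u - \<pi> u) / norm u \<le> \<Lambda> * MX / s" by simp
    then show ?thesis using False V(1) by (simp only: pos_divide_le_eq[of "norm u"] zero_less_norm_iff simp_thms)
  qed (simp add: oproj_0[OF fV])
  \<comment> \<open>The factor 4, the 3 in \<open>MX\<close> and the 100 in \<open>s\<close>
    multiply to 1200.\<close>
  then have "angle TT V \<le> 4 * (\<Lambda> * MX / s)" using angle_le[OF fT fV _ \<theta>0] dT V(4) by simp
  also have "\<dots> = 1200 * \<Lambda> * (K2 + K3) * sqrt (b / mm) * (\<Delta> / h) * (1 + t * h)"
    by (simp add: MX_def s_def W_def)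
  also have "\<Delta> / h = max (h ^ (k - 1)) (\<sigma> / h)"
  proof -
    have "h ^ k = h * h ^ (k - 1)" using k by (cases k) auto
    then have "h ^ k / h = h ^ (k - 1)" using h by simp
    then show ?thesis using h by (simp add: \<Delta>_def max_divide_distrib_right)
  qed
  finally show ?thesis unfolding TT_def y_def V(1) range_oproj[OF fV] .
qed

section \<open>Bandwidth and tail probabilities\<close>

lemma ln_ratio_bounds:
  fixes n :: nat assumes "2 \<le> n"
  shows "0 < ln (real n)" "0 < ln (real n) / (real n - 1)" "1 / real n \<le> 1 / ln 2 * (ln (real n) / (real n - 1))"
proof -
  have n: "2 \<le> real n" using assms by simp
  show l: "0 < ln (real n)" using n by simp
  then show "0 < ln (real n) / (real n - 1)" using n by simp
  have l2: "ln 2 \<le> ln (real n)" "0 < ln (2::real)" using n by auto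
  then have "1 \<le> 1 / ln 2 * ln (real n)" by (simp add: field_simps)
  then have "1 / real n \<le> (1 / ln 2 * ln (real n)) / (real n - 1)" using n by (intro frac_le) auto
  then show "1 / real n \<le> 1 / ln 2 * (ln (real n) / (real n - 1))" by simp
qed

lemma bandwidth_eq:
  assumes "0 < G" "0 < fmin" "0 < fmax" "2 \<le> n"
  shows "bandwidth d G fmin fmax n = (G * fmax\<^sup>2 / fmin ^ 3) powr (1 / d) * (ln (real n) / (real n - 1)) powr (1 / d)"
proof -
  have "G * (fmax\<^sup>2 * ln (real n)) / (fmin ^ 3 * (real n - 1)) = (G * fmax\<^sup>2 / fmin ^ 3) * (ln (real n) / (real n - 1))"
    by simp
  then show ?thesis unfolding bandwidth_def using assms ln_ratio_bounds(2)[OF assms(4)] by (simp only: powr_mult)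
qed

text \<open>The powers of the density bounds in the bandwidth give
  \<open>G * ln n \<le> n * fmin * h ^ d\<close> whenever \<open>fmin \<le> fmax\<close>, so both
  exponents are at least a multiple of \<open>G * ln n\<close> with a factor free of the
  densities.\<close>

lemma bandwidth_tail:
  fixes c C \<eta> :: real
  assumes d: "1 \<le> d" and pos: "0 < c" "0 < C" "0 < \<eta>"
  shows "\<exists>C0>0. \<forall>G\<ge>C0. \<forall>fmin fmax n h. 0 < fmin \<longrightarrow> fmin \<le> fmax \<longrightarrow> 2 \<le> n \<longrightarrow> h = bandwidth d G fmin fmax n \<longrightarrow>
    0 < h \<and> (exp (- (n * (fmin * (c * (\<eta> * h) ^ d)) / 4)) + exp (- (n * (fmax * (C * h ^ d))))) / (fmin * (c * (\<eta> * h / 2) ^ d))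
      \<le> (1 / real n) powr (k / d)"
proof -
  define \<alpha> where "\<alpha> = c * \<eta> ^ d / 4"
  define \<beta> where "\<beta> = c * (\<eta> / 2) ^ d"
  define \<gamma> where "\<gamma> = min \<alpha> C"
  have p: "0 < \<alpha>" "0 < \<beta>" "0 < \<gamma>" "\<gamma> \<le> \<alpha>" "\<gamma> \<le> C" using pos by (auto simp: \<alpha>_def \<beta>_def \<gamma>_def)
  \<comment> \<open>The first entry bounds the net by \<open>n\<close> points. The second makes each
    exponential at most \<open>n\<close> to the power \<open>-(2 + k / d)\<close>: one power pays
    for the net and one for adding the two tails.\<close>
  define C0 where "C0 = max (1 / (\<beta> * ln 2)) ((2 + k / d) / \<gamma>)"
  have l2: "0 < ln (2::real)" by simp
  have C0: "0 < C0" using p l2 by (simp add: C0_def less_max_iff_disj)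
  show ?thesis
  proof (intro exI[of _ C0] conjI C0 allI impI)
    fix G fmin fmax h :: real and n :: nat
    assume G: "C0 \<le> G" and f: "0 < fmin" "fmin \<le> fmax" and n: "2 \<le> n" and h: "h = bandwidth d G fmin fmax n"
    have G0: "0 < G" using G C0 by linarith
    have f0: "0 < fmax" using f by linarith
    note ln = ln_ratio_bounds[OF n]
    have n2: "2 \<le> real n" using n by simp
    define H where "H = G * (fmax\<^sup>2 * ln (real n)) / (fmin ^ 3 * (real n - 1))"
    have H0: "0 < H" unfolding H_def using G0 f f0 ln n2 by (intro divide_pos_pos mult_pos_pos) auto
    have h0: "0 < h" unfolding h bandwidth_def H_def[symmetric] using H0 by simp
    have hd: "h ^ d = H"
    proof -
      have "h ^ d = h powr d" using h0 by (simp add: powr_realpow)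
      also have "\<dots> = H powr (1 / d * d)" unfolding h bandwidth_def H_def by (simp only: powr_powr)
      also have "\<dots> = H" using d H0 by simp
      finally show ?thesis .
    qed
    have Hl: "G * ln (real n) \<le> n * (fmin * H)"
    proof -
      have "fmin\<^sup>2 * (real n - 1) \<le> fmax\<^sup>2 * real n" using f n2 by (intro mult_mono power_mono) auto
      then have "G * ln (real n) * (fmin\<^sup>2 * (real n - 1)) \<le> G * ln (real n) * (fmax\<^sup>2 * real n)"
        using G0 ln by (intro mult_left_mono) auto
      moreover have "n * (fmin * H) = G * ln (real n) * (fmax\<^sup>2 * real n) / (fmin\<^sup>2 * (real n - 1))"
        using f n2 by (simp add: H_def power2_eq_square power3_eq_cube mult_ac)
      moreover have "0 < fmin\<^sup>2 * (real n - 1)" using f n2 by simp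
      ultimately show ?thesis by (simp only: pos_le_divide_eq)
    qed
    have 1: "\<gamma> * (G * ln (real n)) \<le> n * (fmin * (c * (\<eta> * h) ^ d)) / 4"
    proof -
      have "\<gamma> * (G * ln (real n)) \<le> \<alpha> * (n * (fmin * H))" using p G0 ln by (intro mult_mono[OF p(4) Hl]) auto
      then show ?thesis by (simp add: \<alpha>_def power_mult_distrib hd algebra_simps)
    qed
    have 2: "\<gamma> * (G * ln (real n)) \<le> n * (fmax * (C * h ^ d))"
    proof -
      have "\<gamma> * (G * ln (real n)) \<le> C * (n * (fmin * H))" using pos G0 ln by (intro mult_mono[OF p(5) Hl]) auto
      also have "\<dots> \<le> C * (n * (fmax * H))" using pos f H0 by (intro mult_left_mono mult_right_mono) auto
      finally show ?thesis by (simp add: hd algebra_simps)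
    qed
    define E where "E = fmin * (c * (\<eta> * h / 2) ^ d)"
    have E: "1 / n \<le> E"
    proof -
      have "1 / (\<beta> * ln 2) \<le> G" using G by (simp add: C0_def)
      then have "1 \<le> \<beta> * (G * ln 2)" using p l2 by (simp add: field_simps)
      also have "\<dots> \<le> \<beta> * (G * ln (real n))" using p G0 n2 by (intro mult_left_mono) auto
      also have "\<dots> \<le> \<beta> * (n * (fmin * H))" using p Hl by (intro mult_left_mono) auto
      also have "\<dots> = n * E" by (simp add: E_def \<beta>_def power_mult_distrib power_divide hd)
      finally show ?thesis using n2 by (simp add: field_simps)
    qed
    have "(2 + k / d) / \<gamma> \<le> G" using G by (simp add: C0_def)
    then have \<gamma>G: "2 + k / d \<le> \<gamma> * G" using p by (simp add: pos_divide_le_eq mult.commute)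
    let ?s = "exp (- (n * (fmin * (c * (\<eta> * h) ^ d)) / 4)) + exp (- (n * (fmax * (C * h ^ d))))"
    have "?s \<le> exp (- (\<gamma> * (G * ln (real n)))) + exp (- (\<gamma> * (G * ln (real n))))" using 1 2 by (intro add_mono) auto
    also have "\<dots> = 2 * real n powr (- (\<gamma> * G))" using n2 by (simp add: powr_def)
    also have "\<dots> \<le> real n * real n powr (- (2 + k / d))" using n2 \<gamma>G by (intro mult_mono powr_mono) auto
    also have "\<dots> = real n powr (- (1 + k / d))" using n2 powr_add[of "real n" 1 "- (2 + k / d)"] by simp
    finally have s: "?s \<le> real n powr (- (1 + k / d))" .
    have "?s / E \<le> real n powr (- (1 + k / d)) / (1 / n)"
      using s E n2 by (intro frac_le) auto
    also have "\<dots> = real n powr (- (k / d))" using n2 powr_add[of "real n" 1 "- (1 + k / d)"] by (simp add: mult.commute)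
    also have "\<dots> = (1 / real n) powr (k / d)" using n2 by (simp add: powr_minus powr_divide inverse_eq_divide)
    finally show "?s / (fmin * (c * (\<eta> * h / 2) ^ d)) \<le> (1 / real n) powr (k / d)" unfolding E_def .
    show "0 < h" by (rule h0)
  qed
qed

lemma max_angle_le:
  assumes "1 \<le> n" "\<And>j. j \<in> {1..n} \<Longrightarrow>
    angle (tangent_space M (fst (\<omega> j))) (range (fst (est (\<lambda>l. fst (\<omega> l) + snd (\<omega> l)) j))) \<le> B"
  shows "max_angle M n est \<omega> \<le> B"
  unfolding max_angle_def using assms by (subst Max_le_iff) auto

section \<open>High probability bound\<close>

text \<open>This and \<open>deviation_bound\<close> are literal pieces of the final statement, which
  is recovered by unfolding them.\<close>

definition expansion_constant :: "nat \<Rightarrow> nat \<Rightarrow> real \<Rightarrow> (nat \<Rightarrow> real) \<Rightarrow> real \<Rightarrow> bool" where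
  "expansion_constant d k \<tau> L Ct \<longleftrightarrow>
     (\<exists>CR>0. \<forall>D>d. \<forall>M\<in>manifold_class D d k \<tau> L. \<forall>y\<in>M. \<exists>T.
         (\<forall>i\<in>{2..k-1}. multilinear_on (tangent_space M y) (Rdim D) i (T i) \<and>
            multi_onorm (tangent_space M y) i (T i) \<le> Ct) \<and>
         tensor_expansion k (min \<tau> (1 / L_perp k \<tau> L) / 4) CR M y T)"

definition deviation_bound ::
    "nat \<Rightarrow> nat \<Rightarrow> real \<Rightarrow> (nat \<Rightarrow> real) \<Rightarrow> real \<Rightarrow> real \<Rightarrow> real \<Rightarrow> real \<Rightarrow> real \<Rightarrow> bool" where
  "deviation_bound d k \<tau> L Ct C1 G fmin fmax \<longleftrightarrow>
     (\<forall>D>d. \<forall>n\<ge>2. \<forall>\<sigma>\<ge>0. \<forall>t\<ge>Ct. \<forall>h est M Q.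
            h = bandwidth d G fmin fmax n \<longrightarrow> \<sigma> \<le> h / 4 \<longrightarrow> h \<le> min \<tau> (1 / L_perp k \<tau> L) / 8 \<longrightarrow>
            local_poly_estimator D d k n h t est \<longrightarrow> (M, Q) \<in> noisy_model D d k \<tau> L fmin fmax \<sigma> \<longrightarrow>
            (\<exists>A \<in> sets (Pi\<^sub>M {1..n} (\<lambda>_. Q)).
               1 - (1 / real n) powr (real k / real d) \<le> measure (Pi\<^sub>M {1..n} (\<lambda>_. Q)) A \<and>
               (\<forall>\<omega>\<in>A. max_angle M n est \<omega> \<le>
                  C1 * sqrt (fmax / fmin) * max (h ^ (k - 1)) (\<sigma> / h) * (1 + t * h))))"

text \<open>The order of the choices carries the dependence of the constants: the norming constant,
  the volume constants and \<open>C0\<close> are fixed before \<open>\<tau>\<close> and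
  \<open>L\<close> appear, while \<open>Ct\<close> and \<open>C1\<close> may depend on these but not
  on the densities.\<close>

lemma high_probability_bound:
  assumes d: "1 \<le> d" and k: "2 \<le> k"
  shows "\<exists>C0>0. \<forall>(\<tau>::real) (L::nat \<Rightarrow> real). 0 < \<tau> \<longrightarrow> (3 \<le> k \<longrightarrow> 0 < L 2) \<longrightarrow>
    (\<exists>Ct>0. \<exists>C1>0. expansion_constant d k \<tau> L Ct \<and>
      (\<forall>G\<ge>C0. \<forall>fmin fmax. 0 < fmin \<longrightarrow> fmin \<le> fmax \<longrightarrow> deviation_bound d k \<tau> L Ct C1 G fmin fmax))"
proof -
  obtain \<Lambda> where \<Lambda>: "1 \<le> \<Lambda>" and norming: "\<And>V (q::evec \<Rightarrow> real) s B. subspace V \<Longrightarrow> linepoly V ((k - 1)\<^sup>2) q \<Longrightarrow> 0 < s \<Longrightarrow>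
      (\<forall>u\<in>V \<inter> cball 0 s. \<bar>q u\<bar> \<le> B) \<Longrightarrow>
      \<exists>M\<ge>0. \<exists>u0\<in>V \<inter> cball 0 s. (\<forall>u\<in>V. norm (u - u0) \<le> s / (4 * \<Lambda>\<^sup>2) \<longrightarrow> M / 2 \<le> \<bar>q u\<bar>) \<and>
        (\<forall>v\<in>V \<inter> cball 0 s. \<forall>t. \<bar>t\<bar> \<le> 1 \<longrightarrow> \<bar>q (t *\<^sub>R v) - q 0\<bar> \<le> \<Lambda> * M * \<bar>t\<bar>)"
    using linepoly_norming[where K = "(k - 1)\<^sup>2" and ?'v = evec] by blast
  obtain c C where cC: "0 < c" "0 < C" and vb: "\<And>D \<tau> M \<mu>. mfd D d \<tau> M \<Longrightarrow> volume_measure d M \<mu> \<Longrightarrow>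
    (\<forall>y\<in>M. \<forall>r. 0 < r \<longrightarrow> r < \<tau> / 100 \<longrightarrow> ennreal (c * r ^ d) \<le> emeasure \<mu> (M \<inter> cball y r)) \<and>
    (\<forall>y\<in>M. \<forall>h. 0 < h \<longrightarrow> h \<le> \<tau> / 8 \<longrightarrow> emeasure \<mu> (M \<inter> cball y (2 * h)) \<le> ennreal (C * h ^ d))"
    using volume_bounds[OF d] by blast
  \<comment> \<open>Half the cell radius of the deterministic bound, relative to \<open>h\<close>,
    because passing from net points to arbitrary centres doubles the radius.\<close>
  define \<eta> where "\<eta> = 1 / (800 * \<Lambda>\<^sup>2)"
  have \<Lambda>2: "1 \<le> \<Lambda>\<^sup>2" using \<Lambda> by (rule one_le_power)
  have "1 / (800 * \<Lambda>\<^sup>2) \<le> 1 / 100" using \<Lambda>2 by (intro divide_left_mono) auto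
  then have \<eta>: "0 < \<eta>" "\<eta> \<le> 1 / 100" using \<Lambda>2 by (auto simp: \<eta>_def)
  obtain C0 where C0: "0 < C0" and tail: "\<forall>G\<ge>C0. \<forall>fmin fmax n h. 0 < fmin \<longrightarrow> fmin \<le> fmax \<longrightarrow> 2 \<le> n \<longrightarrow>
      h = bandwidth d G fmin fmax n \<longrightarrow>
    0 < h \<and> (exp (- (n * (fmin * (c * (\<eta> * h) ^ d)) / 4)) + exp (- (n * (fmax * (C * h ^ d))))) / (fmin * (c * (\<eta> * h / 2) ^ d))
      \<le> (1 / real n) powr (k / d)"
    using bandwidth_tail[OF d cC \<eta>(1), of k] by blast
  show ?thesis
  proof (rule exI[of _ C0], intro conjI C0 allI impI)
    fix \<tau> :: real and L :: "nat \<Rightarrow> real"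
    assume \<tau>: "0 < \<tau>" and L: "3 \<le> k \<longrightarrow> 0 < L 2"
    define \<rho>0 where "\<rho>0 = min \<tau> (1 / L_perp k \<tau> L)"
    obtain Ct CR where Ct: "0 < Ct" and CR: "0 < CR" and te: "\<And>D d M y. M \<in> manifold_class D d k \<tau> L \<Longrightarrow> y \<in> M \<Longrightarrow>
       \<exists>T. (\<forall>i\<in>{2..k-1}. multilinear_on (tangent_space M y) (Rdim D) i (T i) \<and> mbound (tangent_space M y) i (T i) Ct) \<and>
         tensor_expansion k (\<rho>0 / 4) CR M y T"
      using tensor_expansion_ex[where L = L, OF k \<tau> L] unfolding \<rho>0_def by metis
    define \<rho> where "\<rho> = max 1 \<rho>0"
    define c' where "c' = 2 + CR * max 1 \<rho>0 ^ k"
    define K1 where "K1 = 1 + k * k * c' * (c' * \<rho>) ^ k"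
    define K2 where "K2 = CR * 2 ^ k + 2 * K1"
    define K3 where "K3 = 2 * K1 + K1 * CR"
    define C1 where "C1 = 1200 * \<Lambda> * (K2 + K3) * sqrt (12 * C / (c * \<eta> ^ d))"
    have c'0: "0 \<le> c'" using CR by (simp add: c'_def)
    have K1: "1 \<le> K1" using c'0 by (simp add: K1_def \<rho>_def)
    have K23: "0 < K2 + K3"
    proof -
      have "0 \<le> CR * 2 ^ k" "0 \<le> K1 * CR" using K1 CR by auto
      then show ?thesis using K1 unfolding K2_def K3_def by linarith
    qed
    have C1: "0 < C1" using \<Lambda> K23 cC \<eta> by (simp add: C1_def)
    show "\<exists>Ct>0. \<exists>C1>0. expansion_constant d k \<tau> L Ct \<and>
      (\<forall>G\<ge>C0. \<forall>fmin fmax. 0 < fmin \<longrightarrow> fmin \<le> fmax \<longrightarrow> deviation_bound d k \<tau> L Ct C1 G fmin fmax)"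
    proof (rule exI[of _ Ct], intro conjI Ct, rule exI[of _ C1], intro conjI C1)
      show "expansion_constant d k \<tau> L Ct"
        unfolding expansion_constant_def \<rho>0_def[symmetric]
      proof (intro exI[of _ CR] conjI CR allI impI ballI)
        fix D M y assume M: "M \<in> manifold_class D d k \<tau> L" and y: "y \<in> M"
        have "submanifold D d M" using M by (simp add: manifold_class_def)
        then have "subspace (tangent_space M y)" using findim_subspace[OF findim_tangent] y by blast
        then show "\<exists>T. (\<forall>i\<in>{2..k-1}. multilinear_on (tangent_space M y) (Rdim D) i (T i) \<and>
            multi_onorm (tangent_space M y) i (T i) \<le> Ct) \<and> tensor_expansion k (\<rho>0 / 4) CR M y T"
          using te[OF M y] multi_onorm_le Ct by (meson less_imp_le)
      qed
    next
      show "\<forall>G\<ge>C0. \<forall>fmin fmax. 0 < fmin \<longrightarrow> fmin \<le> fmax \<longrightarrow> deviation_bound d k \<tau> L Ct C1 G fmin fmax"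
        unfolding deviation_bound_def \<rho>0_def[symmetric]
      proof (intro allI impI)
        fix G fmin fmax \<sigma> t h :: real and D n :: nat and est and M :: "evec set" and Q
        assume G: "C0 \<le> G" and f: "0 < fmin" "fmin \<le> fmax" and D: "d < D" and n: "2 \<le> n" and \<sigma>: "0 \<le> \<sigma>" "\<sigma> \<le> h / 4"
          and t: "Ct \<le> t" and h: "h = bandwidth d G fmin fmax n" and h\<rho>: "h \<le> \<rho>0 / 8"
          and est: "local_poly_estimator D d k n h t est" and nm: "(M, Q) \<in> noisy_model D d k \<tau> L fmin fmax \<sigma>"
        have h0: "0 < h" and tl: "(exp (- (n * (fmin * (c * (\<eta> * h) ^ d)) / 4)) + exp (- (n * (fmax * (C * h ^ d))))) /
            (fmin * (c * (\<eta> * h / 2) ^ d)) \<le> (1 / real n) powr (k / d)"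
          using tail[rule_format, OF G f n h] by blast+
        have \<rho>\<tau>: "\<rho>0 \<le> \<tau>" by (simp add: \<rho>0_def)
        have h\<tau>: "h \<le> \<tau> / 8" using h\<rho> \<rho>\<tau> by linarith
        define a where "a = fmin * (c * (\<eta> * h) ^ d)"
        define b where "b = fmax * (C * h ^ d)"
        have mc: "M \<in> manifold_class D d k \<tau> L" using nm by (auto simp: noisy_model_def base_model_def)
        have m: "mfd D d \<tau> M" using mc \<tau> by (simp add: mfd_def manifold_class_def)
        have a0: "0 < n * a / 4" using f cC \<eta> h0 n by (simp add: a_def)
        \<comment> \<open>Sample size and bandwidth cancel in the ratio of the counts, leaving the
          ratio of the density bounds.\<close>
        have ba: "3 * n * b / (n * a / 4) = (12 * C / (c * \<eta> ^ d)) * (fmax / fmin)"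
          using f cC \<eta> h0 n by (simp add: a_def b_def power_mult_distrib field_simps)
        have "\<exists>A\<in>sets (Pi\<^sub>M {1..n} (\<lambda>_. Q)).
          1 - (exp (- (n * a / 4)) + exp (- (n * b))) / (fmin * (c * (\<eta> * h / 2) ^ d)) \<le> measure (Pi\<^sub>M {1..n} (\<lambda>_. Q)) A \<and>
          (\<forall>\<omega>\<in>A. (\<forall>j\<in>{1..n}. fst (\<omega> j) \<in> M \<and> snd (\<omega> j) \<in> Rdim D \<and> norm (snd (\<omega> j)) \<le> \<sigma>) \<and>
            (\<forall>y\<in>M. n * a / 4 \<le> card {l \<in> {1..n}. fst (\<omega> l) \<in> cball y (2 * (\<eta> * h))}) \<and>
            (\<forall>y\<in>M. card {l \<in> {1..n}. fst (\<omega> l) \<in> cball y (3/2 * h)} \<le> 3 * n * b))"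
          unfolding a_def b_def by (rule good_event[OF vb cC f nm \<tau> h0 h\<tau> \<eta>])
        then obtain A where A: "A \<in> sets (Pi\<^sub>M {1..n} (\<lambda>_. Q))"
          "1 - (exp (- (n * a / 4)) + exp (- (n * b))) / (fmin * (c * (\<eta> * h / 2) ^ d)) \<le> measure (Pi\<^sub>M {1..n} (\<lambda>_. Q)) A"
          and good: "\<forall>\<omega>\<in>A. (\<forall>j\<in>{1..n}. fst (\<omega> j) \<in> M \<and> snd (\<omega> j) \<in> Rdim D \<and> norm (snd (\<omega> j)) \<le> \<sigma>) \<and>
            (\<forall>y\<in>M. n * a / 4 \<le> card {l \<in> {1..n}. fst (\<omega> l) \<in> cball y (2 * (\<eta> * h))}) \<and>
            (\<forall>y\<in>M. card {l \<in> {1..n}. fst (\<omega> l) \<in> cball y (3/2 * h)} \<le> 3 * n * b)"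
          by blast
        show "\<exists>A \<in> sets (Pi\<^sub>M {1..n} (\<lambda>_. Q)).
               1 - (1 / real n) powr (real k / real d) \<le> measure (Pi\<^sub>M {1..n} (\<lambda>_. Q)) A \<and>
               (\<forall>\<omega>\<in>A. max_angle M n est \<omega> \<le> C1 * sqrt (fmax / fmin) * max (h ^ (k - 1)) (\<sigma> / h) * (1 + t * h))"
        proof (intro bexI[OF _ A(1)] conjI ballI)
          show "1 - (1 / real n) powr (real k / real d) \<le> measure (Pi\<^sub>M {1..n} (\<lambda>_. Q)) A"
            using A(2) tl unfolding a_def b_def by linarith
          fix \<omega> assume \<omega>: "\<omega> \<in> A"
          note g = good[rule_format, OF \<omega>]
          let ?X = "\<lambda>l. fst (\<omega> l) + snd (\<omega> l)"
          show "max_angle M n est \<omega> \<le> C1 * sqrt (fmax / fmin) * max (h ^ (k - 1)) (\<sigma> / h) * (1 + t * h)"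
          proof (rule max_angle_le)
            show "1 \<le> n" using n by simp
            fix j assume j: "j \<in> {1..n}"
            have yM: "fst (\<omega> j) \<in> M" using g j by blast
            obtain S where S: "\<forall>i\<in>{2..k-1}. multilinear_on (tangent_space M (fst (\<omega> j))) (Rdim D) i (S i) \<and>
                mbound (tangent_space M (fst (\<omega> j))) i (S i) Ct" "tensor_expansion k (\<rho>0 / 4) CR M (fst (\<omega> j)) S"
              using te[OF mc yM] by blast
            obtain \<pi> T where \<pi>T: "est ?X j = (\<pi>, T)" by (metis surj_pair)
            have X: "?X l \<in> Rdim D" if "l \<in> {1..n}" for l
              using g that mfd_sub(3)[OF m] by (intro subspace_add[OF subspace_Rdim]) blast+
            have arg: "is_arg_min (local_risk k n h ?X j) (admissible D d k t) (\<pi>, T)"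
              unfolding \<pi>T[symmetric] by (rule est[unfolded local_poly_estimator_def, rule_format, OF X j])
            have "angle (tangent_space M (fst (\<omega> j))) (range \<pi>) \<le>
              1200 * \<Lambda> * (K2 + K3) * sqrt (3 * n * b / (n * a / 4)) * max (h ^ (k - 1)) (\<sigma> / h) * (1 + t * h)"
              unfolding K2_def K3_def K1_def c'_def \<rho>_def
            proof (rule angle_bound[where Y = "\<lambda>l. fst (\<omega> l)" and X = ?X and j = j and n = n, OF norming \<Lambda> k m])
              show "is_arg_min (local_risk k n h ?X j) (admissible D d k t) (\<pi>, T)" by (rule arg)
              show "tensor_expansion k (\<rho>0 / 4) CR M (fst (\<omega> j)) S" by (rule S(2))
              show "real (card {l \<in> {1..n}. fst (\<omega> l) \<in> cball (fst (\<omega> j)) (3 / 2 * h)}) \<le> 3 * n * b" using g yM by blast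
              show "n * a / 4 \<le> card {l \<in> {1..n}. fst (\<omega> l) \<in> cball z (2 * (1 / (800 * \<Lambda>\<^sup>2) * h))}" if "z \<in> M" for z
                using g that unfolding \<eta>_def by blast
            qed (use g S j n \<sigma> h0 h\<rho> \<rho>\<tau> CR Ct t a0 in auto)
            also have "sqrt (3 * n * b / (n * a / 4)) = sqrt (12 * C / (c * \<eta> ^ d)) * sqrt (fmax / fmin)"
              unfolding ba by (rule real_sqrt_mult)
            finally show "angle (tangent_space M (fst (\<omega> j))) (range (fst (est ?X j))) \<le>
                C1 * sqrt (fmax / fmin) * max (h ^ (k - 1)) (\<sigma> / h) * (1 + t * h)"
              by (simp add: \<pi>T C1_def mult.assoc)
          qed
        qed
      qed
    qed
  qed
qed

section \<open>Expectation\<close>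

text \<open>A measurable majorant is built from the two events alone: \<open>v\<close> plus 2 off
  \<open>A\<close> plus infinity off \<open>B\<close>, the last at no cost since \<open>B\<close>
  has full measure. Thus \<open>f\<close> may be non-measurable.\<close>

lemma upper_expectation_le:
  assumes P: "prob_space P" and A: "A \<in> sets P" "1 - p \<le> measure P A" and B: "B \<in> sets P" "measure P B = 1"
    and f: "\<And>x. x \<in> A \<Longrightarrow> f x \<le> v" "\<And>x. x \<in> B \<Longrightarrow> f x \<le> 2" and vp: "0 \<le> v" "0 \<le> p"
  shows "upper_expectation P (\<lambda>x. ennreal (f x)) \<le> ennreal (v + 2 * p)"
proof -
  interpret prob_space P by (rule P)
  define g where "g x = ennreal v + 2 * indicator (space P - A) x + \<top> * indicator (space P - B) x" for x
  have gm: "g \<in> borel_measurable P" unfolding g_def using A(1) B(1) by measurable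
  have fg: "ennreal (f x) \<le> g x" if x: "x \<in> space P" for x
  proof (cases "x \<in> A")
    case True
    then have "ennreal (f x) \<le> ennreal v" using f(1) by (intro ennreal_leI)
    also have "\<dots> \<le> g x" unfolding g_def by (simp add: add.assoc)
    finally show ?thesis .
  next
    case False
    show ?thesis
    proof (cases "x \<in> B")
      case True
      then have "ennreal (f x) \<le> ennreal 2" using f(2) by (intro ennreal_leI)
      then show ?thesis using False x True by (auto simp: g_def intro: order_trans add_increasing)
    next
      case False
      then show ?thesis using x by (simp add: g_def)
    qed
  qed
  have "upper_expectation P (\<lambda>x. ennreal (f x)) \<le> (\<integral>\<^sup>+x. g x \<partial>P)"
    unfolding upper_expectation_def using gm fg by (intro INF_lower) auto
  also have "\<dots> = ennreal v + 2 * emeasure P (space P - A) + \<top> * emeasure P (space P - B)"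
    unfolding g_def using A(1) B(1) by (simp add: nn_integral_add nn_integral_cmult_indicator emeasure_space_1)
  also have "emeasure P (space P - B) = 0" using B by (simp add: emeasure_eq_measure prob_compl)
  also have "emeasure P (space P - A) \<le> ennreal p"
    using A by (simp add: emeasure_eq_measure prob_compl ennreal_leI)
  also have "ennreal v + 2 * ennreal p + \<top> * 0 = ennreal (v + 2 * p)"
    using vp by (simp add: ennreal_plus ennreal_mult flip: ennreal_numeral)
  finally show ?thesis by (simp add: add_left_mono add_right_mono mult_left_mono)
qed

lemma max_angle_le_2:
  assumes m: "mfd D d \<tau> M" and n: "1 \<le> n" and est: "local_poly_estimator D d k n h t est"
    and \<omega>: "\<And>j. j \<in> {1..n} \<Longrightarrow> fst (\<omega> j) \<in> M \<and> snd (\<omega> j) \<in> Rdim D"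
  shows "max_angle M n est \<omega> \<le> 2"
proof (rule max_angle_le[OF n])
  fix j assume j: "j \<in> {1..n}"
  let ?X = "\<lambda>l. fst (\<omega> l) + snd (\<omega> l)"
  obtain \<pi> T where \<pi>T: "est ?X j = (\<pi>, T)" by (metis surj_pair)
  have X: "?X l \<in> Rdim D" if "l \<in> {1..n}" for l
    using \<omega>[OF that] mfd_sub(3)[OF m] by (intro subspace_add[OF subspace_Rdim]) blast+
  have "is_arg_min (local_risk k n h ?X j) (admissible D d k t) (\<pi>, T)"
    unfolding \<pi>T[symmetric] by (rule est[unfolded local_poly_estimator_def, rule_format, OF X j])
  then obtain V where V: "\<pi> = oproj V" "subspace V" "V \<subseteq> Rdim D"
    by (auto simp: is_arg_min_def admissible_def orth_projectors_def)
  have fV: "findim V" by (rule findim_subset[OF findim_Rdim V(2,3)])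
  show "angle (tangent_space M (fst (\<omega> j))) (range (fst (est ?X j))) \<le> 2"
    using angle_le_2[OF findim_tangent[OF mfd_sub(1)[OF m]] fV] \<omega>[OF j] by (simp add: \<pi>T V(1) range_oproj[OF fV])
qed

text \<open>For \<open>\<sigma> \<le> h / 4\<close> the deviation bound applies with
  \<open>t * h = 1\<close>. For larger noise the rate is itself bounded below, since
  \<open>\<sigma> / h\<close> exceeds 1/4, and the trivial bound 2 on angles suffices.\<close>

lemma expectation_bound:
  fixes \<tau> G fmin fmax C1 Ct :: real and L :: "nat \<Rightarrow> real"
  assumes d: "1 \<le> d" and k: "2 \<le> k" and \<tau>: "0 < \<tau>" and L: "3 \<le> k \<longrightarrow> 0 < L 2" and G: "0 < G" and f: "0 < fmin" "fmin \<le> fmax"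
    and C1: "0 < C1" and Ct: "0 < Ct"
    and dev: "deviation_bound d k \<tau> L Ct C1 G fmin fmax"
  shows "\<exists>C2>0. \<exists>n0\<ge>2. \<forall>D>d. \<forall>n\<ge>n0. \<forall>\<sigma>. 0 \<le> \<sigma> \<longrightarrow> \<sigma> < \<tau> \<longrightarrow> (\<forall>h est.
            h = bandwidth d G fmin fmax n \<longrightarrow> local_poly_estimator D d k n h (1 / h) est \<longrightarrow>
            (SUP (M, Q) \<in> noisy_model D d k \<tau> L fmin fmax \<sigma>.
               upper_expectation (Pi\<^sub>M {1..n} (\<lambda>_. Q)) (\<lambda>\<omega>. ennreal (max_angle M n est \<omega>)))
            \<le> ennreal (C2 * (ln (real n) / (real n - 1)) powr (real (k - 1) / real d) *
                 max 1 (\<sigma> * (ln (real n) / (real n - 1)) powr (- (real k / real d)))))"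
proof -
  define \<rho>0 where "\<rho>0 = min \<tau> (1 / L_perp k \<tau> L)"
  have \<rho>0: "0 < \<rho>0" using \<tau> L k by (cases "k = 2") (auto simp: \<rho>0_def L_perp_def)
  define g where "g = (G * fmax\<^sup>2 / fmin ^ 3) powr (1 / d)"
  have g: "0 < g" using G f by (simp add: g_def)
  define R where "R = C1 * sqrt (fmax / fmin)"
  have R: "0 < R" using C1 f by (simp add: R_def)
  \<comment> \<open>The three summands pay for the deviation bound, for the exceptional event and
    for the regime of large noise.\<close>
  define C2 where "C2 = 2 * R * (g ^ (k - 1) + 1 / g) + 2 * (1 / ln 2) powr ((k - 1) / d) + 8 / g"
  have C2p: "0 < 2 * R * (g ^ (k - 1) + 1 / g)" "0 < 2 * (1 / ln 2) powr (real (k - 1) / d)" "0 < 8 / g"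
    using R g by (auto intro!: mult_pos_pos add_pos_pos)
  then have C2: "0 < C2" "8 / g \<le> C2" unfolding C2_def by linarith+
  have "((\<lambda>n::nat. g * (ln (real n) / (real n - 1)) powr (1 / d)) \<longlongrightarrow> 0) at_top"
  proof -
    have "((\<lambda>n::nat. ln (real n) / (real n - 1)) \<longlongrightarrow> 0) at_top" by real_asymp
    then have "((\<lambda>n::nat. g * (ln (real n) / (real n - 1)) powr (1 / d)) \<longlongrightarrow> g * 0 powr (1 / d)) at_top"
      using d by (intro tendsto_mult tendsto_const tendsto_powr') (auto intro!: eventually_sequentiallyI[of 2])
    then show ?thesis by simp
  qed
  moreover have "0 < min (\<rho>0 / 8) (1 / Ct)" using \<rho>0 Ct by simp
  ultimately have "\<forall>\<^sub>F n in at_top. g * (ln (real n) / (real n - 1)) powr (1 / d) < min (\<rho>0 / 8) (1 / Ct)"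
    by (rule order_tendstoD(2))
  \<comment> \<open>Large \<open>n\<close> makes \<open>h\<close> admissible and at the same time
    \<open>t = 1 / h\<close> at least \<open>Ct\<close>.\<close>
  then obtain n1 where n1: "\<And>n::nat. n1 \<le> n \<Longrightarrow> g * (ln (real n) / (real n - 1)) powr (1 / d) < min (\<rho>0 / 8) (1 / Ct)"
    by (auto simp: eventually_sequentially)
  show ?thesis
  proof (intro exI[of _ C2] exI[of _ "max 2 n1"] conjI allI impI)
    fix D n :: nat and \<sigma> h :: real and est
    assume D: "d < D" and nn: "max 2 n1 \<le> n" and \<sigma>: "0 \<le> \<sigma>" and h: "h = bandwidth d G fmin fmax n"
      and est: "local_poly_estimator D d k n h (1 / h) est"
    have n: "2 \<le> n" "n1 \<le> n" using nn by auto
    note ln = ln_ratio_bounds[OF n(1)]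
    define \<epsilon> where "\<epsilon> = ln (real n) / (real n - 1)"
    have \<epsilon>: "0 < \<epsilon>" unfolding \<epsilon>_def by (rule ln(2))
    have hg: "h = g * \<epsilon> powr (1 / d)"
      unfolding h g_def \<epsilon>_def by (rule bandwidth_eq) (use G f n in auto)
    have h0: "0 < h" using g \<epsilon> by (simp add: hg)
    have hs: "h < \<rho>0 / 8" "h < 1 / Ct" using n1[OF n(2)] by (auto simp: hg \<epsilon>_def)
    have Cth: "Ct \<le> 1 / h" using hs(2) h0 Ct by (simp add: field_simps)
    define r where "r = C2 * \<epsilon> powr ((k - 1) / d) * max 1 (\<sigma> * \<epsilon> powr (- (k / d)))"
    \<comment> \<open>\<open>h\<close> scales like \<open>\<epsilon>\<close> to the power
      \<open>1 / d\<close>; the exponents are split as \<open>(k - 1) / d - k / d\<close> to match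
      the second term of the maximum.\<close>
    have lk: "\<epsilon> powr (real (k - 1) / d) * \<epsilon> powr (- (k / d)) = \<epsilon> powr (- (1 / d))"
    proof -
      have "real (k - 1) / d + - (k / d) = - (1 / d)" using k d by (simp add: of_nat_diff field_simps)
      then show ?thesis by (simp only: powr_add[symmetric])
    qed
    have \<sigma>h: "\<sigma> / h = (1 / g) * (\<epsilon> powr (real (k - 1) / d) * (\<sigma> * \<epsilon> powr (- (k / d))))"
    proof -
      have "\<sigma> / h = (1 / g) * (\<sigma> * \<epsilon> powr (- (1 / d)))" by (simp add: hg powr_minus divide_inverse)
      then show ?thesis unfolding lk[symmetric] by (simp add: mult_ac)
    qed
    have hk: "h ^ (k - 1) = g ^ (k - 1) * \<epsilon> powr (real (k - 1) / d)"
      using \<epsilon> by (simp add: hg power_mult_distrib powr_power)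
    let ?m = "max 1 (\<sigma> * \<epsilon> powr (- (k / d)))"
    let ?l = "\<epsilon> powr (real (k - 1) / d)"
    have bias: "max (h ^ (k - 1)) (\<sigma> / h) \<le> (g ^ (k - 1) + 1 / g) * (?l * ?m)"
    proof (rule max.boundedI)
      have "?l * 1 \<le> ?l * ?m" "?l * (\<sigma> * \<epsilon> powr (- (k / d))) \<le> ?l * ?m" by (intro mult_left_mono; simp)+
      then have "g ^ (k - 1) * (?l * 1) \<le> g ^ (k - 1) * (?l * ?m)"
        "1 / g * (?l * (\<sigma> * \<epsilon> powr (- (k / d)))) \<le> 1 / g * (?l * ?m)" using g by (intro mult_left_mono; simp)+
      moreover have "0 \<le> g ^ (k - 1) * (?l * ?m)" "0 \<le> 1 / g * (?l * ?m)" using g by auto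
      ultimately show "h ^ (k - 1) \<le> (g ^ (k - 1) + 1 / g) * (?l * ?m)" "\<sigma> / h \<le> (g ^ (k - 1) + 1 / g) * (?l * ?m)"
        unfolding hk \<sigma>h distrib_right by linarith+
    qed
    \<comment> \<open>Lowering the exponent to \<open>(k - 1) / d\<close> and bounding
      \<open>1 / n\<close> by a multiple of \<open>\<epsilon>\<close> puts the exceptional
      probability below the rate.\<close>
    have prob: "(1 / real n) powr (k / d) \<le> (1 / ln 2) powr (real (k - 1) / d) * (?l * ?m)"
    proof -
      have "(1 / real n) powr (k / d) \<le> (1 / real n) powr (real (k - 1) / d)"
        using n d by (intro powr_mono') (auto intro!: divide_right_mono)
      also have "\<dots> \<le> (1 / ln 2 * \<epsilon>) powr (real (k - 1) / d)" using ln(3) by (intro powr_mono2) (auto simp: \<epsilon>_def)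
      also have "\<dots> = (1 / ln 2) powr (real (k - 1) / d) * (?l * 1)" by (simp only: powr_mult mult_1_right)
      also have "\<dots> \<le> (1 / ln 2) powr (real (k - 1) / d) * (?l * ?m)" by (intro mult_left_mono) auto
      finally show ?thesis .
    qed
    have "(SUP (M, Q) \<in> noisy_model D d k \<tau> L fmin fmax \<sigma>.
        upper_expectation (Pi\<^sub>M {1..n} (\<lambda>_. Q)) (\<lambda>\<omega>. ennreal (max_angle M n est \<omega>))) \<le> ennreal r"
    proof (rule SUP_least, clarify)
      fix M Q assume nm: "(M, Q) \<in> noisy_model D d k \<tau> L fmin fmax \<sigma>"
      let ?P = "Pi\<^sub>M {1..n} (\<lambda>_. Q)"
      have Q: "prob_space Q" and bm: "(M, distr Q borel fst) \<in> base_model D d k \<tau> L fmin fmax"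
        using nm by (auto simp: noisy_model_def)
      have m: "mfd D d \<tau> M" by (rule base_model_support(1)[OF bm \<tau>])
      have P: "prob_space ?P" by (intro prob_space_PiM Q)
      note B = noisy_support_event[OF nm \<tau>, of n]
      have two: "max_angle M n est \<omega> \<le> 2" if "\<omega> \<in> Pi\<^sub>E {1..n} (\<lambda>_. M \<times> (Rdim D \<inter> cball 0 \<sigma>))" for \<omega>
        using that n by (intro max_angle_le_2[OF m _ est]) (auto simp: PiE_iff mem_Times_iff)
      show "upper_expectation ?P (\<lambda>\<omega>. ennreal (max_angle M n est \<omega>)) \<le> ennreal r"
      proof (cases "\<sigma> \<le> h / 4")
        case True
        have "h \<le> \<rho>0 / 8" using hs by simp
        from dev[unfolded deviation_bound_def \<rho>0_def[symmetric], rule_format, OF D n(1) \<sigma> Cth h True this est nm] obtain A where A: "A \<in> sets ?P"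
            "1 - (1 / real n) powr (k / d) \<le> measure ?P A"
            "\<And>\<omega>. \<omega> \<in> A \<Longrightarrow> max_angle M n est \<omega> \<le> R * max (h ^ (k - 1)) (\<sigma> / h) * 2"
          using h0 unfolding R_def by auto
        have v: "0 \<le> R * max (h ^ (k - 1)) (\<sigma> / h) * 2" using R h0 by (simp add: le_max_iff_disj)
        have "upper_expectation ?P (\<lambda>\<omega>. ennreal (max_angle M n est \<omega>)) \<le>
            ennreal (R * max (h ^ (k - 1)) (\<sigma> / h) * 2 + 2 * (1 / real n) powr (k / d))"
          by (rule upper_expectation_le[OF P A(1,2) B A(3) two v]) auto
        also have "\<dots> \<le> ennreal r"
        proof (rule ennreal_leI)
          have "R * max (h ^ (k - 1)) (\<sigma> / h) * 2 \<le> R * ((g ^ (k - 1) + 1 / g) * (?l * ?m)) * 2"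
            using bias R by (intro mult_right_mono mult_left_mono) auto
          moreover have "0 \<le> 8 / g * (?l * ?m)" using g by auto
          moreover have "r = R * ((g ^ (k - 1) + 1 / g) * (?l * ?m)) * 2 +
              2 * ((1 / ln 2) powr (real (k - 1) / d) * (?l * ?m)) + 8 / g * (?l * ?m)"
            unfolding r_def C2_def by (simp only: algebra_simps)
          ultimately show "R * max (h ^ (k - 1)) (\<sigma> / h) * 2 + 2 * (1 / real n) powr (k / d) \<le> r"
            using prob by linarith
        qed
        finally show ?thesis .
      next
        case False
        have "upper_expectation ?P (\<lambda>\<omega>. ennreal (max_angle M n est \<omega>)) \<le> ennreal (2 + 2 * 0)"
          by (rule upper_expectation_le[OF P B(1) _ B two two]) (use B(2) in auto)
        also have "\<dots> \<le> ennreal r"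
        proof (rule ennreal_leI)
          have "1 / 4 \<le> \<sigma> / h" using False h0 by (simp add: field_simps)
          then have "8 * (1 / 4) \<le> 8 * (\<sigma> / h)" by linarith
          also have "\<dots> = 8 / g * (?l * (\<sigma> * \<epsilon> powr (- (k / d))))" unfolding \<sigma>h by simp
          also have "\<dots> \<le> C2 * (?l * ?m)" using C2 \<sigma> by (intro mult_mono mult_left_mono) auto
          finally show "2 + 2 * 0 \<le> r" by (simp add: r_def mult.assoc)
        qed
        finally show ?thesis .
      qed
    qed
    then show "(SUP (M, Q) \<in> noisy_model D d k \<tau> L fmin fmax \<sigma>.
        upper_expectation (Pi\<^sub>M {1..n} (\<lambda>_. Q)) (\<lambda>\<omega>. ennreal (max_angle M n est \<omega>)))
      \<le> ennreal (C2 * (ln (real n) / (real n - 1)) powr (real (k - 1) / real d) *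
          max 1 (\<sigma> * (ln (real n) / (real n - 1)) powr (- (real k / real d))))"
      unfolding r_def \<epsilon>_def .
  qed (use C2 in auto)
qed

text \<open>Uniformity is expressed by the order of quantifiers: the threshold for the bandwidth
  constant sees only \<open>d\<close> and \<open>k\<close>, the tensor and deviation constants also
  \<open>\<tau>\<close> and \<open>L\<close>, and the constants of the expectation bound also
  \<open>C\<^sub>h\<close> and the density bounds. The ambient dimension, the manifold and the law
  come last.\<close>

theorem theorem2:
  fixes d k :: nat
  assumes "1 \<le> d" and "2 \<le> k"
  shows "\<exists>C\<^sub>0>0. \<forall>(\<tau>::real) (L::nat \<Rightarrow> real). 0 < \<tau> \<longrightarrow> (3 \<le> k \<longrightarrow> 0 < L 2) \<longrightarrow>
    (\<exists>C\<^sub>t>0. \<exists>C\<^sub>1>0.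
      (\<exists>C\<^sub>R>0. \<forall>D>d. \<forall>M\<in>manifold_class D d k \<tau> L. \<forall>y\<in>M. \<exists>T.
         (\<forall>i\<in>{2..k-1}. multilinear_on (tangent_space M y) (Rdim D) i (T i) \<and>
            multi_onorm (tangent_space M y) i (T i) \<le> C\<^sub>t) \<and>
         tensor_expansion k (min \<tau> (1 / L_perp k \<tau> L) / 4) C\<^sub>R M y T) \<and>
      (\<forall>C\<^sub>h\<ge>C\<^sub>0. \<forall>fmin fmax. 0 < fmin \<longrightarrow> fmin \<le> fmax \<longrightarrow>
         (\<forall>D>d. \<forall>n\<ge>2. \<forall>\<sigma>\<ge>0. \<forall>t\<ge>C\<^sub>t. \<forall>h est M Q.
            h = bandwidth d C\<^sub>h fmin fmax n \<longrightarrow>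
            \<sigma> \<le> h / 4 \<longrightarrow>
            h \<le> min \<tau> (1 / L_perp k \<tau> L) / 8 \<longrightarrow>
            local_poly_estimator D d k n h t est \<longrightarrow>
            (M, Q) \<in> noisy_model D d k \<tau> L fmin fmax \<sigma> \<longrightarrow>
            (\<exists>A \<in> sets (Pi\<^sub>M {1..n} (\<lambda>_. Q)).
               1 - (1 / real n) powr (real k / real d) \<le> measure (Pi\<^sub>M {1..n} (\<lambda>_. Q)) A \<and>
               (\<forall>\<omega>\<in>A. max_angle M n est \<omega> \<le>
                  C\<^sub>1 * sqrt (fmax / fmin) * max (h ^ (k - 1)) (\<sigma> / h) * (1 + t * h)))) \<and>
         (\<exists>C\<^sub>2>0. \<exists>n\<^sub>0\<ge>2. \<forall>D>d. \<forall>n\<ge>n\<^sub>0. \<forall>\<sigma>. 0 \<le> \<sigma> \<longrightarrow> \<sigma> < \<tau> \<longrightarrow> (\<forall>h est.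
            h = bandwidth d C\<^sub>h fmin fmax n \<longrightarrow>
            local_poly_estimator D d k n h (1 / h) est \<longrightarrow>
            (SUP (M, Q) \<in> noisy_model D d k \<tau> L fmin fmax \<sigma>.
               upper_expectation (Pi\<^sub>M {1..n} (\<lambda>_. Q)) (\<lambda>\<omega>. ennreal (max_angle M n est \<omega>)))
            \<le> ennreal (C\<^sub>2 * (ln (real n) / (real n - 1)) powr (real (k - 1) / real d) *
                 max 1 (\<sigma> * (ln (real n) / (real n - 1)) powr (- (real k / real d))))))))"
proof -
  obtain C0 where C0: "0 < C0" and hp: "\<forall>(\<tau>::real) (L::nat \<Rightarrow> real). 0 < \<tau> \<longrightarrow> (3 \<le> k \<longrightarrow> 0 < L 2) \<longrightarrow>
    (\<exists>Ct>0. \<exists>C1>0. expansion_constant d k \<tau> L Ct \<and>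
      (\<forall>G\<ge>C0. \<forall>fmin fmax. 0 < fmin \<longrightarrow> fmin \<le> fmax \<longrightarrow> deviation_bound d k \<tau> L Ct C1 G fmin fmax))"
    using high_probability_bound[OF assms] by blast
  show ?thesis
  proof (rule exI[of _ C0], intro conjI C0 allI impI, goal_cases)
    case \<tau>L: (1 \<tau> L)
    obtain Ct C1 where Ct: "0 < Ct" and C1: "0 < C1" and exp: "expansion_constant d k \<tau> L Ct"
      and dev: "\<forall>G\<ge>C0. \<forall>fmin fmax. 0 < fmin \<longrightarrow> fmin \<le> fmax \<longrightarrow> deviation_bound d k \<tau> L Ct C1 G fmin fmax"
      using hp \<tau>L by blast
    show ?case
    proof (rule exI[of _ Ct], rule conjI[OF Ct], rule exI[of _ C1], rule conjI[OF C1],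
        rule conjI[OF exp[unfolded expansion_constant_def]], intro allI impI, rule conjI, goal_cases)
      case (1 G fmin fmax)
      show ?case by (rule dev[rule_format, OF 1, unfolded deviation_bound_def])
    next
      case (2 G fmin fmax)
      have "0 < G" using 2(1) C0 by linarith
      then show ?case
        by (rule expectation_bound[OF assms \<tau>L _ 2(2,3) C1 Ct dev[rule_format, OF 2]])
    qed
  qed
qed

end
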